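(* Let $\mathrm{ord}(q)\in\mathbb Z_{\ge3}\cup\{\infty\}$, and let $\mathbb k=\mathbb C[q]/(q^{\mathrm{ord}(q)}-1)$ if $\mathrm{ord}(q)<\infty$ and $\mathbb k=\overline{\mathbb C(q)}$ if $\mathrm{ord}(q)=\infty$. Let $p_0,p_1,\xi\in\mathbb k^\times$ with $p_0,p_1\neq\pm1$. Put $J=\{\xi^{\pm1}q^{2k}\mid k\in\mathbb Z\}$, $\theta(i)=i^{-1}$, $a_{ij}=\delta_{j=q^2i}$, $\boldsymbol\lambda(i)=\delta_{i=p_1}+\delta_{i=-p_0}$, and let $X(i)=i$ for $i\in J$. Let $\beta\in\mathbb N[J]^\theta$ be a self-dual dimension vector with $\|\beta\|_\theta=n$, and let ${}^\theta\mathcal R(\beta;\boldsymbol\lambda)$ be the associated orientifold KLR algebra. The isomorphism $${}^\theta\widehat{\mathbb P}_\beta\to{}^\theta\widehat{\mathcal O}_\beta,\qquad e(\nu)\mapsto e(\nu),\quad x_ke(\nu)\mapsto\Big(\frac{X(\nu_k)}{X_k}-\frac{X_k}{X(\nu_k)}\Big)e(\nu)$$ extends to an algebra isomorphism $${}^\theta\mathcal R(\beta;\boldsymbol\lambda)\otimes_{{}^\theta\mathbb P_\beta}{}^\theta\widehat{\mathbb P}_\beta\ \xrightarrow{\ \sim\ }\ \mathcal H_{\mathsf C_n}(p_0,p_1)\otimes_{\mathcal O}{}^\theta\widehat{\mathcal O}_\beta$$ given, for $\nu\in{}^\theta J^\beta$ and $1\le k\le n-1$, by $$\tau_ke(\nu)\mapsto\begin{cases}\Big(\frac{X_k}{X(\nu_{k+1})}+\frac{X(\nu_k)}{X_{k+1}}\Big)^{-1}\Big(\frac{X_{k+1}}{X_k}-1\Big)^{-1}(\Phi_k-1)e(\nu)&\text{if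 }\nu_k=\nu_{k+1},\\[4pt]\Big(\frac{X_k}{X(\nu_{k+1})}+\frac{X(\nu_k)}{X_{k+1}}\Big)\Big(\frac{X(\nu_{k+1})}{X(\nu_k)}-\frac{X_{k+1}}{X_k}\Big)\Phi_ke(\nu)&\text{if }\nu_{k+1}=q^2\nu_k,\\[4pt]\Phi_ke(\nu)&\text{otherwise,}\end{cases}$$ $$\tau_0e(\nu)\mapsto\begin{cases}X(\nu_1)(X_1^{-1}-X_1)^{-1}(\Phi_0-1)e(\nu)&\text{if }\nu_1=\theta(\nu_1),\\[4pt]\Big(\frac{X_1}{X(\nu_1)}-\frac{X(\nu_1)}{X_1}\Big)^{\boldsymbol\lambda(\nu_1)}\Phi_0e(\nu)&\text{otherwise.}\end{cases}$$
   Context: **Quiver.** The quiver $\Gamma$ has vertex set $J$ and $a_{ij}$ arrows from $i$ to $j$. Depending on $\xi$ and the order of $q$ it can be of the following types: for $\mathrm{ord}(q)=\infty$: $A_\infty$ with $J^\theta=\{1\}$ ($\xi=1$), $A_\infty$ with $J^\theta=\varnothing$ ($\xi=q$), $A_\infty\times A_\infty$ with $J^\theta=\varnothing$ ($\xi\notin\pm q^{\mathbb Z}$); for $\mathrm{ord}(q)=2m$: $A^{(1)}_m$ with $J^\theta=\{\pm1\}$ ($\xi=1$), $A^{(1)}_m$ with $J^\theta=\varnothing$ ($\xi=q$), $A^{(1)}_m\times A^{(1)}_m$ with $J^\theta=\varnothing$ ($\xi\notin q^{\mathbb Z}$); for $\mathrm{ord}(q)=m$ odd: $A^{(1)}_m$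 with $J^\theta=\{1\}$ ($\xi=1$), $A^{(1)}_m\times A^{(1)}_m$ with $J^\theta=\varnothing$ ($\xi\notin\pm q^{\mathbb Z}$). Here $J^\theta$ is the set of $\theta$-fixed vertices. **Combinatorics.** $\mathfrak W_n=\langle s_0,\dots,s_{n-1}\rangle=(\mathbb Z/2)^n\rtimes\mathfrak S_n$. For $\beta\in\mathbb N[J]$ with $\theta(\beta)=\beta$ (it is always assumed that $\beta(i)$ is even whenever $\theta(i)=i$), $\|\beta\|_\theta=\frac12\sum_i\beta(i)$ and ${}^\theta J^\beta$ is the set of $\nu=\nu_1\cdots\nu_n\in J^n$ with $\sum_k(\nu_k+\theta(\nu_k))=\beta$ in $\mathbb N[J]$. $\mathfrak W_n$ acts on $J^n$: $s_k$ swaps $\nu_k$ and $\nu_{k+1}$ for $k\ge1$; $s_0$ replaces $\nu_1$ by $\theta(\nu_1)$. **Orientifold KLR algebra.** $P_{ij}(u,v)=\delta_{i\ne j}(v-u)^{a_{ij}}$, $P_i(u)=\delta_{i\neq\theta(i)}(-u)^{\boldsymbol\lambda(i)}$, $Q_{ij}(u,v)=P_{ij}(u,v)P_{ji}(v,u)$, $Q'_i(u)=P_i(u)P_{\theta(i)}(-u)$. ${}^\theta\mathcal R(\beta;\boldsymbol\lambda)$ is the $\mathbb k$-algebra generated by $e(\nu)$ ($\nu\in{}^\theta J^\beta$), $x_1,\dots,x_n$, $\tau_0,\dots,\tau_{n-1}$ with relations: the $e(\nu)$ are orthogonal idempotents with sum $1$; $x_le(\nu)=e(\nu)x_l$; $\tau_ke(\nu)=e(s_k\nu)\tau_k$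 ($0\le k<n$); $x_lx_{l'}=x_{l'}x_l$; $\tau_k^2e(\nu)=Q_{\nu_k,\nu_{k+1}}(x_{k+1},x_k)e(\nu)$ ($k\ge1$); $\tau_0^2e(\nu)=Q'_{\nu_1}(-x_1)e(\nu)$; $\tau_k\tau_{k'}=\tau_{k'}\tau_k$ if $|k-k'|>1$; $(\tau_{k+1}\tau_k\tau_{k+1}-\tau_k\tau_{k+1}\tau_k)e(\nu)=\delta_{\nu_k,\nu_{k+2}}\frac{Q_{\nu_k,\nu_{k+1}}(x_{k+1},x_k)-Q_{\nu_k,\nu_{k+1}}(x_{k+1},x_{k+2})}{x_k-x_{k+2}}e(\nu)$ ($k\ge1$); $((\tau_1\tau_0)^2-(\tau_0\tau_1)^2)e(\nu)$ equals $\frac{Q'_{\nu_2}(x_2)-Q'_{\nu_1}(x_1)}{x_1+x_2}\tau_1e(\nu)$ if $\nu_1\ne\nu_2=\theta(\nu_1)$; $\frac{Q_{\nu_1,\nu_2}(x_2,-x_1)-Q_{\nu_1,\nu_2}(-x_2,-x_1)}{x_2}\tau_0e(\nu)$ if $\nu_1\neq\theta(\nu_1)$, $\nu_2=\theta(\nu_2)$; $\frac{Q_{\nu_1,\nu_2}(x_2,-x_1)-Q_{\nu_1,\nu_2}(x_2,x_1)}{x_1x_2}(x_1\tau_0+1)e(\nu)$ if $\theta(\nu_1)=\nu_1\ne\nu_2=\theta(\nu_2)$; $0$ otherwise; for $k\ge1$, $(\tau_kx_l-x_{s_k(l)}\tau_k)e(\nu)$ equals $-e(\nu)$ if $l=k,\nu_k=\nu_{k+1}$,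 $e(\nu)$ if $l=k+1,\nu_k=\nu_{k+1}$, $0$ otherwise; $(\tau_0x_1+x_1\tau_0)e(\nu)$ equals $-2e(\nu)$ if $\nu_1=\theta(\nu_1)$, $0$ otherwise; $\tau_0x_l=x_l\tau_0$ for $l\ne1$. **Its completion.** ${}^\theta\mathbb P_\beta=\bigoplus_\nu\mathbb k[x_1,\dots,x_n]e(\nu)$, ${}^\theta\widehat{\mathbb P}_\beta=\bigoplus_\nu\mathbb k[[x_1,\dots,x_n]]e(\nu)$ ($\nu\in{}^\theta J^\beta$). ${}^\theta\mathcal R(\beta;\boldsymbol\lambda)\otimes_{{}^\theta\mathbb P_\beta}{}^\theta\widehat{\mathbb P}_\beta$ carries the natural algebra structure extending those of the two factors; it acts faithfully on ${}^\theta\widehat{\mathbb P}_\beta$, with $\tau_k\cdot fe(\nu)=\frac{s_k(f)-f}{x_k-x_{k+1}}e(\nu)$ if $\nu_k=\nu_{k+1}$ and $P_{\nu_k,\nu_{k+1}}(x_k,x_{k+1})s_k(f)e(s_k\nu)$ otherwise ($k\ge1$), and $\tau_0\cdot fe(\nu)=\frac{s_0(f)-f}{x_1}e(\nu)$ if $\theta(\nu_1)=\nu_1$ and $P_{\nu_1}(x_1)s_0(f)e(s_0\nu)$ otherwise, where $s_k$ swaps $x_k,x_{k+1}$ and $s_0(x_1)=-x_1$. **Affine Hecke algebra.** $\mathcal H_{\mathsf C_n}(p_0,p_1)$ is the $\mathbb k$-algebra generated by $T_0,\dots,T_{n-1}$, $X_1^{\pm1},\dots,X_n^{\pm1}$ with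 relations $(T_k-q)(T_k+q^{-1})=0$ ($1\le k\le n-1$), $(T_0-p_0)(T_0+p_1^{-1})=0$, the braid relations $T_kT_{k+1}T_k=T_{k+1}T_kT_{k+1}$ ($k\ge1$), $(T_0T_1)^2=(T_1T_0)^2$, $T_kT_{k'}=T_{k'}T_k$ for $|k-k'|>1$, $X_lX_{l'}=X_{l'}X_l$, $X_lX_l^{-1}=X_l^{-1}X_l=1$, $T_kX_kT_k=X_{k+1}$ ($1\le k\le n-1$), $T_0X_1^{-1}T_0=p_0p_1^{-1}X_1+(p_0p_1^{-1}-1)T_0$, and $T_kX_l=X_lT_k$ for $l\ne k,k+1$. $\mathcal O=\mathbb k[X_1^{\pm1},\dots,X_n^{\pm1}]$, $\mathcal K=\mathbb k(X_1,\dots,X_n)$, on which $\mathfrak W_n$ acts by permuting and inverting variables ($s_0(X_1)=X_1^{-1}$). The intertwiners in $\mathcal H_{\mathsf C_n}(p_0,p_1)\otimes_{\mathcal O}\mathcal K$ are $\Phi_k=1+\frac{X_k-X_{k+1}}{qX_k-q^{-1}X_{k+1}}(T_k-q)$ ($1\le k\le n-1$), $\Phi_0=1+p_1\frac{X_1^2-1}{(X_1+p_0)(X_1-p_1)}(T_0-p_0)$; $s_k\mapsto\Phi_k$ defines an isomorphism of the skew group ring $\mathbb k[\mathfrak W_n]\ltimes\mathcal K$ with $\mathcal H_{\mathsf C_n}(p_0,p_1)\otimes_{\mathcal O}\mathcal K$. **Its completion.** $\widehat{\mathcal O}_\nu=\mathbb k[[X_1-X(\nu_1),\dots,X_n-X(\nu_n)]]$,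 ${}^\theta\widehat{\mathcal O}_\beta=\bigoplus_{\nu\in{}^\theta J^\beta}\widehat{\mathcal O}_\nu e(\nu)$, with $w(fe(\nu))=w(f)e(w\nu)$ for $w\in\mathfrak W_n$. $\mathcal H_{\mathsf C_n}(p_0,p_1)\otimes_{\mathcal O}{}^\theta\widehat{\mathcal O}_\beta$ carries the natural algebra structure for which it acts faithfully on ${}^\theta\widehat{\mathcal O}_\beta$, extending the polynomial representation $(T_k-q)f=\frac{qX_k-q^{-1}X_{k+1}}{X_k-X_{k+1}}(s_k(f)-f)$ ($k\ge1$), $(T_0-p_0)f=p_1^{-1}\frac{(X_1+p_0)(X_1-p_1)}{X_1^2-1}(s_0(f)-f)$; here $\Phi_k$ corresponds to $s_k$, so that $\Phi_ke(\nu)=e(s_k\nu)\Phi_k$.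
   Formalization: For ord(q)=m finite, k is taken to be C with q a primitive m-th root of unity; the images are stated for e(ν)τ_k, with e(ν) on the left, instead of τ_k e(ν), and the signs of the coefficient for ν_{k+1}=q²ν_k and of the base of the λ(ν_1)-power are reversed. *)

theory Defs
  imports
    "HOL-Library.Poly_Mapping"
    "HOL-Library.FuncSet"
    "HOL-Library.Extended_Nat"
    "HOL-Combinatorics.Transposition"
    "HOL-Computational_Algebra.Computational_Algebra"
    "HOL-Algebra.QuotRing"
    "HOL-Algebra.Free_Abelian_Groups"
begin

section \<open>The ground field\<close>

definition mult_order :: "'k::field \<Rightarrow> enat" where
  "mult_order q = (if \<exists>m>0. q ^ m = 1 then enat (LEAST m. 0 < m \<and> q ^ m = 1) else \<infinity>)"

text \<open>
  If \<open>q\<close> has finite order \<open>m\<close>, then \<open>q ^ m - 1\<close> is not irreducible over the complex numbers, and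
  the ground ring \<open>C[q]/(q ^ m - 1)\<close> is read as its residue field in which \<open>q\<close> still has order
  \<open>m\<close>, i.e. the complex numbers with \<open>q\<close> a primitive \<open>m\<close>-th root of unity. If \<open>q\<close> has infinite
  order, the ground field is an algebraic closure of \<open>C(q)\<close>.
\<close>

definition ground_field :: "'k::field \<Rightarrow> bool" where
  "ground_field q \<longleftrightarrow>
     (\<exists>h :: complex poly \<Rightarrow> 'k.
        h 1 = 1 \<and> (\<forall>a b. h (a + b) = h a + h b) \<and> (\<forall>a b. h (a * b) = h a * h b) \<and>
        h [:0, 1:] = q \<and>
        (if mult_order q \<noteq> \<infinity> then surj h
         else inj h \<and>
           (\<forall>p :: 'k poly. 0 < degree p \<longrightarrow> (\<exists>z. poly p z = 0)) \<and>
           (\<forall>z. \<exists>p :: complex poly poly. p \<noteq> 0 \<and> poly (map_poly h p) z = 0)))"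


section \<open>Algebras given by generators and relations\<close>

datatype 'g fword = Word (letters: "'g list")

instantiation fword :: (type) monoid_add
begin
definition "0 = Word []"
definition "u + v = Word (letters u @ letters v)"
instance by standard (simp_all add: zero_fword_def plus_fword_def)
end

text \<open>Since words form a monoid under concatenation, \<open>'g fword \<Rightarrow>\<^sub>0 'k\<close> with the
  convolution product is the free associative algebra on \<open>'g\<close>.\<close>

definition scal :: "'k::zero \<Rightarrow> 'g fword \<Rightarrow>\<^sub>0 'k" where
  "scal c = Poly_Mapping.single 0 c"

definition gen :: "'g \<Rightarrow> 'g fword \<Rightarrow>\<^sub>0 'k::zero_neq_one" where
  "gen g = Poly_Mapping.single (Word [g]) 1"

definition free_algebra :: "'g set \<Rightarrow> ('g fword \<Rightarrow>\<^sub>0 'k::field) ring" where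
  "free_algebra S =
     \<lparr>carrier = {p. \<forall>w \<in> Poly_Mapping.keys p. set (letters w) \<subseteq> S},
      monoid.mult = (*), monoid.one = 1, ring.zero = 0, ring.add = (+)\<rparr>"

definition presented :: "'g set \<Rightarrow> ('g fword \<Rightarrow>\<^sub>0 'k::field) set \<Rightarrow> ('g fword \<Rightarrow>\<^sub>0 'k) set ring" where
  "presented S rels = free_algebra S Quot (genideal (free_algebra S) rels)"

definition pcls :: "'g set \<Rightarrow> ('g fword \<Rightarrow>\<^sub>0 'k::field) set \<Rightarrow> ('g fword \<Rightarrow>\<^sub>0 'k) \<Rightarrow> ('g fword \<Rightarrow>\<^sub>0 'k) set" where
  "pcls S rels a = genideal (free_algebra S) rels +>\<^bsub>free_algebra S\<^esub> a"

text \<open>The action of a presented algebra on functions, given the action \<open>\<rho>\<close> of the generators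
  and the embedding \<open>sc\<close> of the scalars into the values. It does not depend on the chosen
  representative whenever \<open>\<rho>\<close> satisfies the relations.\<close>

definition free_act ::
  "('k::zero \<Rightarrow> 'c::comm_ring_1) \<Rightarrow> ('g \<Rightarrow> ('a \<Rightarrow> 'c) \<Rightarrow> 'a \<Rightarrow> 'c) \<Rightarrow>
   ('g fword \<Rightarrow>\<^sub>0 'k) \<Rightarrow> ('a \<Rightarrow> 'c) \<Rightarrow> 'a \<Rightarrow> 'c" where
  "free_act sc \<rho> a F =
     (\<lambda>\<mu>. \<Sum>w \<in> Poly_Mapping.keys a. sc (Poly_Mapping.lookup a w) * foldr \<rho> (letters w) F \<mu>)"

definition presented_act ::
  "('k::zero \<Rightarrow> 'c::comm_ring_1) \<Rightarrow> ('g \<Rightarrow> ('a \<Rightarrow> 'c) \<Rightarrow> 'a \<Rightarrow> 'c) \<Rightarrow>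
   ('g fword \<Rightarrow>\<^sub>0 'k) set \<Rightarrow> ('a \<Rightarrow> 'c) \<Rightarrow> 'a \<Rightarrow> 'c" where
  "presented_act sc \<rho> C = free_act sc \<rho> (SOME a. a \<in> C)"


section \<open>Tensor products with an extension of a commutative subalgebra\<close>

text \<open>
  For ring maps \<open>\<alpha>: P \<rightarrow> R\<close> and \<open>\<gamma>: P \<rightarrow> M\<close>, the tensor product of \<open>R\<close> (as a right
  \<open>P\<close>-module) and \<open>M\<close> (as a left \<open>P\<close>-module) as the quotient of the free abelian group on pairs.
\<close>

definition tensor_rels ::
  "'r ring \<Rightarrow> 'm ring \<Rightarrow> 'p set \<Rightarrow> ('p \<Rightarrow> 'r) \<Rightarrow> ('p \<Rightarrow> 'm) \<Rightarrow> ('r \<times> 'm \<Rightarrow>\<^sub>0 int) set" where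
  "tensor_rels R M P \<alpha> \<gamma> =
     {frag_of (r \<oplus>\<^bsub>R\<^esub> r', m) - frag_of (r, m) - frag_of (r', m) | r r' m.
        r \<in> carrier R \<and> r' \<in> carrier R \<and> m \<in> carrier M} \<union>
     {frag_of (r, m \<oplus>\<^bsub>M\<^esub> m') - frag_of (r, m) - frag_of (r, m') | r m m'.
        r \<in> carrier R \<and> m \<in> carrier M \<and> m' \<in> carrier M} \<union>
     {frag_of (r \<otimes>\<^bsub>R\<^esub> \<alpha> p, m) - frag_of (r, \<gamma> p \<otimes>\<^bsub>M\<^esub> m) | r p m.
        r \<in> carrier R \<and> p \<in> P \<and> m \<in> carrier M}"

definition tensor_null ::
  "'r ring \<Rightarrow> 'm ring \<Rightarrow> 'p set \<Rightarrow> ('p \<Rightarrow> 'r) \<Rightarrow> ('p \<Rightarrow> 'm) \<Rightarrow> ('r \<times> 'm \<Rightarrow>\<^sub>0 int) set" where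
  "tensor_null R M P \<alpha> \<gamma> =
     generate (free_Abelian_group (carrier R \<times> carrier M)) (tensor_rels R M P \<alpha> \<gamma>)"

definition tensor_group ::
  "'r ring \<Rightarrow> 'm ring \<Rightarrow> 'p set \<Rightarrow> ('p \<Rightarrow> 'r) \<Rightarrow> ('p \<Rightarrow> 'm) \<Rightarrow> ('r \<times> 'm \<Rightarrow>\<^sub>0 int) set monoid" where
  "tensor_group R M P \<alpha> \<gamma> =
     free_Abelian_group (carrier R \<times> carrier M) Mod tensor_null R M P \<alpha> \<gamma>"

definition tensor_cls ::
  "'r ring \<Rightarrow> 'm ring \<Rightarrow> 'p set \<Rightarrow> ('p \<Rightarrow> 'r) \<Rightarrow> ('p \<Rightarrow> 'm) \<Rightarrow>
   ('r \<times> 'm \<Rightarrow>\<^sub>0 int) \<Rightarrow> ('r \<times> 'm \<Rightarrow>\<^sub>0 int) set" where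
  "tensor_cls R M P \<alpha> \<gamma> z =
     tensor_null R M P \<alpha> \<gamma> #>\<^bsub>free_Abelian_group (carrier R \<times> carrier M)\<^esub> z"

text \<open>If \<open>M\<close> consists of functions and \<open>R\<close> acts on \<open>M\<close>, then \<open>r \<otimes> m\<close> acts by
  \<open>g \<mapsto> r \<cdot> (m g)\<close>; the product on the tensor product is the one for which
  this (faithful) action is multiplicative.\<close>

definition tensor_act ::
  "('r \<Rightarrow> ('a \<Rightarrow> 'c::comm_ring_1) \<Rightarrow> 'a \<Rightarrow> 'c) \<Rightarrow>
   ('r \<times> ('a \<Rightarrow> 'c) \<Rightarrow>\<^sub>0 int) set \<Rightarrow> ('a \<Rightarrow> 'c) \<Rightarrow> 'a \<Rightarrow> 'c" where
  "tensor_act act C g =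
     (let z = (SOME z. z \<in> C)
      in (\<lambda>\<mu>. \<Sum>(r, m) \<in> Poly_Mapping.keys z.
            of_int (Poly_Mapping.lookup z (r, m)) * act r (\<lambda>\<mu>. m \<mu> * g \<mu>) \<mu>))"

definition tensor_ring ::
  "('r \<Rightarrow> ('a \<Rightarrow> 'c::comm_ring_1) \<Rightarrow> 'a \<Rightarrow> 'c) \<Rightarrow> 'r ring \<Rightarrow> ('a \<Rightarrow> 'c) ring \<Rightarrow>
   'p set \<Rightarrow> ('p \<Rightarrow> 'r) \<Rightarrow> ('p \<Rightarrow> 'a \<Rightarrow> 'c) \<Rightarrow> ('r \<times> ('a \<Rightarrow> 'c) \<Rightarrow>\<^sub>0 int) set ring" where
  "tensor_ring act R M P \<alpha> \<gamma> =
     (let T = tensor_group R M P \<alpha> \<gamma>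
      in \<lparr>carrier = carrier T,
          monoid.mult = (\<lambda>a b. THE c. c \<in> carrier T \<and>
             (\<forall>g \<in> carrier M. tensor_act act c g = tensor_act act a (tensor_act act b g))),
          monoid.one = tensor_cls R M P \<alpha> \<gamma> (frag_of (\<one>\<^bsub>R\<^esub>, \<one>\<^bsub>M\<^esub>)),
          ring.zero = \<one>\<^bsub>T\<^esub>,
          ring.add = (\<otimes>\<^bsub>T\<^esub>)\<rparr>)"

definition alg_iso :: "('k \<Rightarrow> 'r) \<Rightarrow> 'r ring \<Rightarrow> ('k \<Rightarrow> 's) \<Rightarrow> 's ring \<Rightarrow> ('r \<Rightarrow> 's) \<Rightarrow> bool" where
  "alg_iso sR R sS S h \<longleftrightarrow> h \<in> ring_iso R S \<and> (\<forall>c. h (sR c) = sS c)"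


section \<open>Polynomials and power series in the variables indexed by positive integers\<close>

type_synonym 'k mpoly = "(nat \<Rightarrow>\<^sub>0 nat) \<Rightarrow>\<^sub>0 'k"

definition mpoly_var :: "nat \<Rightarrow> 'k::zero_neq_one mpoly" where
  "mpoly_var l = Poly_Mapping.single (Poly_Mapping.single l 1) 1"

definition exact_div :: "'r::idom \<Rightarrow> 'r \<Rightarrow> 'r" where
  "exact_div a b = (THE c. c * b = a)"

typedef 'a mps = "UNIV :: ((nat \<Rightarrow>\<^sub>0 nat) \<Rightarrow> 'a) set"
  morphisms mps_coeff Abs_mps by simp

lemma mps_coeff_Abs [simp]: "mps_coeff (Abs_mps f) = f"
  by (simp add: Abs_mps_inverse)

lemma mps_eqI: "(\<And>m. mps_coeff f m = mps_coeff g m) \<Longrightarrow> f = g"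
  by (metis mps_coeff_inject ext)

definition msplits :: "(nat \<Rightarrow>\<^sub>0 nat) \<Rightarrow> ((nat \<Rightarrow>\<^sub>0 nat) \<times> (nat \<Rightarrow>\<^sub>0 nat)) set" where
  "msplits m = {(a, b). a + b = m}"

lemma finite_msplits [simp, intro]: "finite (msplits m)"
proof -
  define A where "A = {a :: nat \<Rightarrow>\<^sub>0 nat. \<forall>x. Poly_Mapping.lookup a x \<le> Poly_Mapping.lookup m x}"
  let ?K = "Poly_Mapping.keys m"
  let ?M = "Max (insert 0 (Poly_Mapping.lookup m ` ?K))"
  let ?F = "{f. \<forall>x. (x \<in> ?K \<longrightarrow> f x \<in> {..?M}) \<and> (x \<notin> ?K \<longrightarrow> f x = 0)}"
  have "Poly_Mapping.lookup a \<in> ?F" if "a \<in> A" for a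
  proof -
    have le: "Poly_Mapping.lookup a x \<le> Poly_Mapping.lookup m x" for x
      using that unfolding A_def by blast
    have "Poly_Mapping.lookup a x \<in> {..?M}" if "x \<in> ?K" for x
      unfolding atMost_iff by (rule le_trans[OF le Max_ge]) (use that in auto)
    moreover have "Poly_Mapping.lookup a x = 0" if "x \<notin> ?K" for x
      using le[of x] that by (simp add: in_keys_iff)
    ultimately show ?thesis by blast
  qed
  then have "Poly_Mapping.lookup ` A \<subseteq> ?F" by (rule image_subsetI)
  then have "finite (Poly_Mapping.lookup ` A)"
    by (rule finite_subset) (rule finite_set_of_finite_funs; simp)
  then have "finite A"
    by (rule finite_imageD[where f = Poly_Mapping.lookup])
      (rule inj_onI, erule iffD1[OF poly_mapping.lookup_inject])
  then have "finite (A \<times> A)" by (simp only: finite_cartesian_product)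
  moreover have "msplits m \<subseteq> A \<times> A"
    by (auto simp: msplits_def A_def lookup_add)
  ultimately show ?thesis by (rule finite_subset[rotated])
qed

instantiation mps :: (comm_ring_1) comm_ring_1
begin

definition "0 = Abs_mps (\<lambda>_. 0)"
definition "1 = Abs_mps (\<lambda>m. if m = 0 then 1 else 0)"
definition "f + g = Abs_mps (\<lambda>m. mps_coeff f m + mps_coeff g m)"
definition "f - g = Abs_mps (\<lambda>m. mps_coeff f m - mps_coeff g m)"
definition "- f = Abs_mps (\<lambda>m. - mps_coeff f m)"
definition "f * g = Abs_mps (\<lambda>m. \<Sum>(a, b) \<in> msplits m. mps_coeff f a * mps_coeff g b)"

instance
proof
  fix f g h :: "'a mps"
  show "f + g + h = f + (g + h)" "f + g = g + f" "0 + f = f" "- f + f = 0" "f - g = f + - g"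
    by (auto intro!: mps_eqI simp: plus_mps_def zero_mps_def minus_mps_def uminus_mps_def)
  show "(f + g) * h = f * h + g * h"
    by (rule mps_eqI)
      (simp add: plus_mps_def times_mps_def case_prod_unfold distrib_right sum.distrib)
  show "f * g = g * f"
  proof (rule mps_eqI)
    fix m
    have "(\<Sum>p \<in> msplits m. mps_coeff f (fst p) * mps_coeff g (snd p)) =
        (\<Sum>p \<in> msplits m. mps_coeff g (fst p) * mps_coeff f (snd p))"
      by (rule sum.reindex_bij_witness[where i = prod.swap and j = prod.swap])
        (simp_all add: msplits_def case_prod_unfold add.commute mult.commute)
    then show "mps_coeff (f * g) m = mps_coeff (g * f) m"
      by (simp add: times_mps_def case_prod_unfold)
  qed
  show "1 * f = f"
  proof (rule mps_eqI)
    fix m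
    have "mps_coeff (1 * f) m =
        (\<Sum>p \<in> msplits m. mps_coeff 1 (fst p) * mps_coeff f (snd p))"
      by (simp add: times_mps_def case_prod_unfold)
    also have "\<dots> = (\<Sum>p \<in> {(0, m)}. mps_coeff 1 (fst p) * mps_coeff f (snd p))"
    proof (rule sum.mono_neutral_right)
      show "{(0, m)} \<subseteq> msplits m" by (simp add: msplits_def)
      show "\<forall>p \<in> msplits m - {(0, m)}. mps_coeff 1 (fst p) * mps_coeff f (snd p) = 0"
      proof
        fix p assume p: "p \<in> msplits m - {(0, m)}"
        have "fst p \<noteq> 0"
        proof
          assume "fst p = 0"
          with p have "p = (0, m)" by (cases p) (simp add: msplits_def)
          with p show False by blast
        qed
        then show "mps_coeff 1 (fst p) * mps_coeff f (snd p) = 0"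
          by (simp add: one_mps_def)
      qed
    qed simp
    finally show "mps_coeff (1 * f) m = mps_coeff f m" by (simp add: one_mps_def)
  qed
  show "f * g * h = f * (g * h)"
  proof (rule mps_eqI)
    fix m
    let ?F = "mps_coeff f" and ?G = "mps_coeff g" and ?H = "mps_coeff h"
    have "mps_coeff (f * g * h) m =
        (\<Sum>p \<in> msplits m. \<Sum>r \<in> msplits (fst p). ?F (fst r) * ?G (snd r) * ?H (snd p))"
      by (simp add: times_mps_def case_prod_unfold sum_distrib_right)
    also have "\<dots> = (\<Sum>(p, r) \<in> Sigma (msplits m) (\<lambda>p. msplits (fst p)).
        ?F (fst r) * ?G (snd r) * ?H (snd p))"
      by (rule sum.Sigma) auto
    also have "\<dots> = (\<Sum>(p, r) \<in> Sigma (msplits m) (\<lambda>p. msplits (snd p)).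
        ?F (fst p) * (?G (fst r) * ?H (snd r)))"
      by (rule sum.reindex_bij_witness[where
            i = "\<lambda>(p, r). ((fst p + fst r, snd r), (fst p, fst r))" and
            j = "\<lambda>(p, r). ((fst r, snd r + snd p), (snd r, snd p))"])
        (auto simp add: msplits_def add.assoc mult.assoc)
    also have "\<dots> = (\<Sum>p \<in> msplits m. \<Sum>r \<in> msplits (snd p). ?F (fst p) * (?G (fst r) * ?H (snd r)))"
      by (rule sum.Sigma[symmetric]) auto
    also have "\<dots> = mps_coeff (f * (g * h)) m"
      by (simp add: times_mps_def case_prod_unfold sum_distrib_left)
    finally show "mps_coeff (f * g * h) m = mps_coeff (f * (g * h)) m" .
  qed
  show "(0 :: 'a mps) \<noteq> 1"
  proof
    assume "(0 :: 'a mps) = 1"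
    then have "mps_coeff (0 :: 'a mps) 0 = mps_coeff (1 :: 'a mps) 0" by simp
    then show False by (simp add: zero_mps_def one_mps_def)
  qed
qed

end

definition mdeg :: "(nat \<Rightarrow>\<^sub>0 nat) \<Rightarrow> nat" where
  "mdeg m = (\<Sum>l \<in> Poly_Mapping.keys m. Poly_Mapping.lookup m l)"

lemma mdeg_superset:
  assumes "finite A" "Poly_Mapping.keys m \<subseteq> A"
  shows "mdeg m = (\<Sum>l \<in> A. Poly_Mapping.lookup m l)"
  unfolding mdeg_def by (rule sum.mono_neutral_left) (use assms in \<open>auto simp: in_keys_iff\<close>)

lemma keys_add_nat: "Poly_Mapping.keys (a + b) = Poly_Mapping.keys a \<union> Poly_Mapping.keys (b :: nat \<Rightarrow>\<^sub>0 nat)"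
  by (auto simp: in_keys_iff lookup_add)

lemma mdeg_add: "mdeg (a + b) = mdeg a + mdeg b"
  by (simp add: mdeg_superset[of "Poly_Mapping.keys a \<union> Poly_Mapping.keys b"] keys_add_nat
      lookup_add sum.distrib)

lemma finite_mdeg:
  assumes "finite A"
  shows "finite {m. Poly_Mapping.keys m \<subseteq> A \<and> mdeg m = d}" (is "finite ?S")
proof -
  let ?F = "{f. \<forall>x. (x \<in> A \<longrightarrow> f x \<in> {..d}) \<and> (x \<notin> A \<longrightarrow> f x = 0)}"
  have "Poly_Mapping.lookup m \<in> ?F" if "m \<in> ?S" for m
  proof -
    have m: "Poly_Mapping.keys m \<subseteq> A" "mdeg m = d" using that by auto
    have "Poly_Mapping.lookup m x \<in> {..d}" if "x \<in> A" for x
    proof -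
      have "Poly_Mapping.lookup m x \<le> (\<Sum>l \<in> A. Poly_Mapping.lookup m l)"
        by (rule member_le_sum) (use assms that in auto)
      then show ?thesis using mdeg_superset[OF assms m(1)] m(2) by (metis atMost_iff)
    qed
    moreover have "Poly_Mapping.lookup m x = 0" if "x \<notin> A" for x
      using m(1) that by (auto simp: in_keys_iff)
    ultimately show ?thesis by blast
  qed
  then have "Poly_Mapping.lookup ` ?S \<subseteq> ?F" by (rule image_subsetI)
  then have "finite (Poly_Mapping.lookup ` ?S)"
    by (rule finite_subset) (rule finite_set_of_finite_funs; use assms in simp)
  then show ?thesis
    by (rule finite_imageD[where f = Poly_Mapping.lookup])
      (rule inj_onI, erule iffD1[OF poly_mapping.lookup_inject])
qed

text \<open>Among the exponents of lowest degree involving only variables from a finite set, the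
  lexicographically least one is a leading exponent.\<close>

lemma mps_leading:
  fixes f :: "'a::zero mps"
  assumes "mps_coeff f m \<noteq> 0" "Poly_Mapping.keys m \<subseteq> A" "finite A"
  obtains a where "mps_coeff f a \<noteq> 0" "Poly_Mapping.keys a \<subseteq> A"
    "\<And>b. mps_coeff f b \<noteq> 0 \<Longrightarrow> Poly_Mapping.keys b \<subseteq> A \<Longrightarrow> mdeg a \<le> mdeg b"
    "\<And>b. mps_coeff f b \<noteq> 0 \<Longrightarrow> Poly_Mapping.keys b \<subseteq> A \<Longrightarrow> mdeg a = mdeg b \<Longrightarrow> a \<le> b"
proof -
  let ?P = "\<lambda>b. mps_coeff f b \<noteq> 0 \<and> Poly_Mapping.keys b \<subseteq> A"
  define d where "d = (LEAST d. \<exists>b. ?P b \<and> mdeg b = d)"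
  have ex: "\<exists>b. ?P b \<and> mdeg b = d"
    unfolding d_def by (rule LeastI_ex) (use assms in blast)
  have least: "d \<le> mdeg b" if "?P b" for b
    unfolding d_def by (rule Least_le) (use that in blast)
  let ?S = "{b. ?P b \<and> mdeg b = d}"
  have fin: "finite ?S" by (rule finite_subset[OF _ finite_mdeg[OF assms(3), of d]]) auto
  have ne: "?S \<noteq> {}" using ex by blast
  obtain a where a: "a \<in> ?S" "\<And>b. b \<in> ?S \<Longrightarrow> a \<le> b"
    using Min_in[OF fin ne] Min_le[OF fin] by blast
  have P: "?P a" and d: "mdeg a = d" using a(1) by blast+
  show ?thesis
  proof (rule that[of a])
    show "mps_coeff f a \<noteq> 0" "Poly_Mapping.keys a \<subseteq> A" using P by blast+
    fix b assume b: "mps_coeff f b \<noteq> 0" "Poly_Mapping.keys b \<subseteq> A"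
    show "mdeg a \<le> mdeg b" unfolding d by (rule least) (use b in blast)
    assume "mdeg a = mdeg b"
    with b d show "a \<le> b" by (intro a(2)) simp
  qed
qed

instance mps :: (idom) idom
proof
  fix f g :: "'a mps"
  assume "f \<noteq> 0" "g \<noteq> 0"
  then obtain m m' where m: "mps_coeff f m \<noteq> 0" "mps_coeff g m' \<noteq> 0"
    by (metis mps_eqI zero_mps_def mps_coeff_Abs)
  define A where "A = Poly_Mapping.keys m \<union> Poly_Mapping.keys m'"
  obtain a where a: "mps_coeff f a \<noteq> 0" "Poly_Mapping.keys a \<subseteq> A"
    "\<And>b. mps_coeff f b \<noteq> 0 \<Longrightarrow> Poly_Mapping.keys b \<subseteq> A \<Longrightarrow> mdeg a \<le> mdeg b"
    "\<And>b. mps_coeff f b \<noteq> 0 \<Longrightarrow> Poly_Mapping.keys b \<subseteq> A \<Longrightarrow> mdeg a = mdeg b \<Longrightarrow> a \<le> b"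
    using mps_leading[OF m(1), of A] by (auto simp: A_def)
  obtain b where b: "mps_coeff g b \<noteq> 0" "Poly_Mapping.keys b \<subseteq> A"
    "\<And>c. mps_coeff g c \<noteq> 0 \<Longrightarrow> Poly_Mapping.keys c \<subseteq> A \<Longrightarrow> mdeg b \<le> mdeg c"
    "\<And>c. mps_coeff g c \<noteq> 0 \<Longrightarrow> Poly_Mapping.keys c \<subseteq> A \<Longrightarrow> mdeg b = mdeg c \<Longrightarrow> b \<le> c"
    using mps_leading[OF m(2), of A] by (auto simp: A_def)
  have "mps_coeff (f * g) (a + b) =
      (\<Sum>p \<in> msplits (a + b). if p = (a, b) then mps_coeff f a * mps_coeff g b else 0)"
    unfolding times_mps_def mps_coeff_Abs
  proof (rule sum.cong[OF refl], clarify)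
    fix c d assume "(c, d) \<in> msplits (a + b)"
    then have cd: "c + d = a + b" by (simp add: msplits_def)
    then have k: "Poly_Mapping.keys c \<subseteq> A" "Poly_Mapping.keys d \<subseteq> A"
      using a(2) b(2) keys_add_nat[of c d] keys_add_nat[of a b] by auto
    have "c = a \<and> d = b" if nz: "mps_coeff f c \<noteq> 0" "mps_coeff g d \<noteq> 0"
    proof -
      have "mdeg c + mdeg d = mdeg a + mdeg b" using cd by (metis mdeg_add)
      with a(3)[OF nz(1) k(1)] b(3)[OF nz(2) k(2)]
      have "mdeg a = mdeg c" "mdeg b = mdeg d" by auto
      then have le: "a \<le> c" "b \<le> d" using a(4)[OF nz(1) k(1)] b(4)[OF nz(2) k(2)] by auto
      have "a = c"
      proof (rule ccontr)
        assume "a \<noteq> c"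
        with le have "a + b < c + d" by (meson add_less_le_mono order_le_imp_less_or_eq)
        with cd show False by simp
      qed
      with cd show ?thesis by simp
    qed
    then show "mps_coeff f c * mps_coeff g d =
        (if (c, d) = (a, b) then mps_coeff f a * mps_coeff g b else 0)"
      by auto
  qed
  also have "\<dots> = mps_coeff f a * mps_coeff g b"
    by (subst sum.delta[OF finite_msplits]) (auto simp: msplits_def)
  finally show "f * g \<noteq> 0" using a(1) b(1) by (auto simp: zero_mps_def)
qed

definition mps_const :: "'k::zero \<Rightarrow> 'k mps" where
  "mps_const c = Abs_mps (\<lambda>m. if m = 0 then c else 0)"

definition mps_var :: "nat \<Rightarrow> 'k::zero_neq_one mps" where
  "mps_var l = Abs_mps (\<lambda>m. if m = Poly_Mapping.single l 1 then 1 else 0)"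

definition mps_inverse :: "'k::comm_ring_1 mps \<Rightarrow> 'k mps" where
  "mps_inverse f = (THE g. f * g = 1)"

text \<open>Substitution of \<open>\<sigma> l\<close> for the variable \<open>l\<close>. It is only used when every \<open>\<sigma> l\<close> is a series
  without constant term and every monomial occurs in \<open>mps_monom \<sigma> m\<close> for finitely many \<open>m\<close>
  only, so that the sum is finite.\<close>

definition mps_monom :: "(nat \<Rightarrow> 'k::comm_ring_1 mps) \<Rightarrow> (nat \<Rightarrow>\<^sub>0 nat) \<Rightarrow> 'k mps" where
  "mps_monom \<sigma> m = (\<Prod>l \<in> Poly_Mapping.keys m. \<sigma> l ^ Poly_Mapping.lookup m l)"

definition mps_subst :: "(nat \<Rightarrow> 'k::comm_ring_1 mps) \<Rightarrow> 'k mps \<Rightarrow> 'k mps" where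
  "mps_subst \<sigma> f =
     Abs_mps (\<lambda>t. \<Sum>m | mps_coeff f m * mps_coeff (mps_monom \<sigma> m) t \<noteq> 0.
                    mps_coeff f m * mps_coeff (mps_monom \<sigma> m) t)"

text \<open>The extension to fractions of an injective ring endomorphism.\<close>

definition fract_map :: "('r::idom \<Rightarrow> 'r) \<Rightarrow> 'r fract \<Rightarrow> 'r fract" where
  "fract_map h z =
     (let (a, b) = (SOME (a, b). b \<noteq> 0 \<and> z = Fract a b) in Fract (h a) (h b))"

definition fconst :: "'k::field \<Rightarrow> 'k mps fract" where
  "fconst c = to_fract (mps_const c)"

definition fvar :: "nat \<Rightarrow> 'k::field mps fract" where
  "fvar l = to_fract (mps_var l)"

definition mps_in :: "nat \<Rightarrow> 'k::zero mps set" where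
  "mps_in n = {f. \<forall>m. mps_coeff f m \<noteq> 0 \<longrightarrow> Poly_Mapping.keys m \<subseteq> {1..n}}"

text \<open>The power series ring in the variables \<open>1, \<dots>, n\<close>, and its field of fractions.\<close>

definition pseries :: "nat \<Rightarrow> 'k::field mps fract set" where
  "pseries n = to_fract ` mps_in n"

definition pfrac :: "nat \<Rightarrow> 'k::field mps fract set" where
  "pfrac n = {Fract f g | f g. f \<in> mps_in n \<and> g \<in> mps_in n \<and> g \<noteq> 0}"


section \<open>Direct sums indexed by sequences of vertices\<close>

text \<open>An element \<open>\<Sum>\<nu>\<in>V. f \<nu> e(\<nu>)\<close> is represented by the function \<open>f\<close>, extended by \<open>0\<close>.\<close>

definition vec :: "'v set \<Rightarrow> ('v \<Rightarrow> 'c::zero) \<Rightarrow> 'v \<Rightarrow> 'c" where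
  "vec V g = (\<lambda>\<mu>. if \<mu> \<in> V then g \<mu> else 0)"

definition at_idem :: "'v \<Rightarrow> 'c::zero \<Rightarrow> 'v \<Rightarrow> 'c" where
  "at_idem \<nu> f = (\<lambda>\<mu>. if \<mu> = \<nu> then f else 0)"

definition coef_ring :: "'v set \<Rightarrow> 'c::comm_ring_1 set \<Rightarrow> ('v \<Rightarrow> 'c) ring" where
  "coef_ring V S =
     \<lparr>carrier = {F. (\<forall>\<nu> \<in> V. F \<nu> \<in> S) \<and> (\<forall>\<nu>. \<nu> \<notin> V \<longrightarrow> F \<nu> = 0)},
      monoid.mult = (\<lambda>F G \<mu>. F \<mu> * G \<mu>), monoid.one = vec V (\<lambda>_. 1),
      ring.zero = (\<lambda>_. 0), ring.add = (\<lambda>F G \<mu>. F \<mu> + G \<mu>)\<rparr>"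

text \<open>A sequence is a function on \<open>{1..n}\<close>; \<open>seq_swap \<theta> k\<close> is the action of the \<open>k\<close>-th simple
  reflection on sequences, and \<open>index_swap k\<close> its action on the indices of the variables.\<close>

definition theta_seqs :: "('i \<Rightarrow> 'i) \<Rightarrow> 'i set \<Rightarrow> nat \<Rightarrow> ('i \<Rightarrow>\<^sub>0 nat) \<Rightarrow> (nat \<Rightarrow> 'i) set" where
  "theta_seqs \<theta> J n \<beta> =
     {\<nu> \<in> {1..n} \<rightarrow>\<^sub>E J.
        (\<Sum>k \<in> {1..n}. Poly_Mapping.single (\<nu> k) 1 + Poly_Mapping.single (\<theta> (\<nu> k)) 1) = \<beta>}"

definition theta_norm :: "('i \<Rightarrow>\<^sub>0 nat) \<Rightarrow> nat" where
  "theta_norm \<beta> = (\<Sum>i \<in> Poly_Mapping.keys \<beta>. Poly_Mapping.lookup \<beta> i) div 2"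

definition seq_swap :: "('i \<Rightarrow> 'i) \<Rightarrow> nat \<Rightarrow> (nat \<Rightarrow> 'i) \<Rightarrow> nat \<Rightarrow> 'i" where
  "seq_swap \<theta> k \<nu> = (if k = 0 then \<nu>(1 := \<theta> (\<nu> 1)) else \<nu>(k := \<nu> (k + 1), k + 1 := \<nu> k))"

definition index_swap :: "nat \<Rightarrow> nat \<Rightarrow> nat" where
  "index_swap k l = (if k = 0 then l else transpose k (k + 1) l)"


section \<open>Orientifold KLR algebras\<close>

datatype 'i klr_gen = KIdem "nat \<Rightarrow> 'i" | KX nat | KTau nat

abbreviation ke :: "(nat \<Rightarrow> 'i) \<Rightarrow> 'i klr_gen fword \<Rightarrow>\<^sub>0 'k::field" where "ke \<nu> \<equiv> gen (KIdem \<nu>)"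
abbreviation kx :: "nat \<Rightarrow> 'i klr_gen fword \<Rightarrow>\<^sub>0 'k::field" where "kx l \<equiv> gen (KX l)"
abbreviation kt :: "nat \<Rightarrow> 'i klr_gen fword \<Rightarrow>\<^sub>0 'k::field" where "kt k \<equiv> gen (KTau k)"

definition klr_P :: "('i \<Rightarrow> 'i \<Rightarrow> nat) \<Rightarrow> 'i \<Rightarrow> 'i \<Rightarrow> 'r \<Rightarrow> 'r \<Rightarrow> 'r::comm_ring_1" where
  "klr_P a i j u v = (if i \<noteq> j then (v - u) ^ a i j else 0)"

definition klr_P0 :: "('i \<Rightarrow> 'i) \<Rightarrow> ('i \<Rightarrow> nat) \<Rightarrow> 'i \<Rightarrow> 'r \<Rightarrow> 'r::comm_ring_1" where
  "klr_P0 \<theta> lam i u = (if i \<noteq> \<theta> i then (- u) ^ lam i else 0)"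

definition klr_Q :: "('i \<Rightarrow> 'i \<Rightarrow> nat) \<Rightarrow> 'i \<Rightarrow> 'i \<Rightarrow> 'r \<Rightarrow> 'r \<Rightarrow> 'r::comm_ring_1" where
  "klr_Q a i j u v = klr_P a i j u v * klr_P a j i v u"

definition klr_Q0 :: "('i \<Rightarrow> 'i) \<Rightarrow> ('i \<Rightarrow> nat) \<Rightarrow> 'i \<Rightarrow> 'r \<Rightarrow> 'r::comm_ring_1" where
  "klr_Q0 \<theta> lam i u = klr_P0 \<theta> lam i u * klr_P0 \<theta> lam (\<theta> i) (- u)"

text \<open>A polynomial evaluated at the generators \<open>x\<^sub>l\<close> (with the factors of each monomial in
  increasing order of their indices).\<close>

definition kpoly :: "'k::field mpoly \<Rightarrow> 'i klr_gen fword \<Rightarrow>\<^sub>0 'k" where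
  "kpoly p =
     (\<Sum>m \<in> Poly_Mapping.keys p.
        Poly_Mapping.single
          (Word (concat (map (\<lambda>l. replicate (Poly_Mapping.lookup m l) (KX l))
                   (sorted_list_of_set (Poly_Mapping.keys m)))))
          (Poly_Mapping.lookup p m))"

definition klr_mixed ::
  "('i \<Rightarrow> 'i) \<Rightarrow> ('i \<Rightarrow> 'i \<Rightarrow> nat) \<Rightarrow> ('i \<Rightarrow> nat) \<Rightarrow> (nat \<Rightarrow> 'i) \<Rightarrow> 'i klr_gen fword \<Rightarrow>\<^sub>0 'k::field" where
  "klr_mixed \<theta> a lam \<nu> =
     (let i = \<nu> 1; j = \<nu> 2; x1 = mpoly_var 1; x2 = mpoly_var 2
      in if i \<noteq> j \<and> j = \<theta> i then
           kpoly (exact_div (klr_Q0 \<theta> lam j x2 - klr_Q0 \<theta> lam i x1) (x1 + x2)) * kt 1 * ke \<nu>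
         else if i \<noteq> \<theta> i \<and> j = \<theta> j then
           kpoly (exact_div (klr_Q a i j x2 (- x1) - klr_Q a i j (- x2) (- x1)) x2) * kt 0 * ke \<nu>
         else if \<theta> i = i \<and> i \<noteq> j \<and> j = \<theta> j then
           kpoly (exact_div (klr_Q a i j x2 (- x1) - klr_Q a i j x2 x1) (x1 * x2)) *
             (kx 1 * kt 0 + 1) * ke \<nu>
         else 0)"

inductive_set klr_rels ::
  "('i \<Rightarrow> 'i) \<Rightarrow> ('i \<Rightarrow> 'i \<Rightarrow> nat) \<Rightarrow> ('i \<Rightarrow> nat) \<Rightarrow> nat \<Rightarrow> (nat \<Rightarrow> 'i) set \<Rightarrow>
   ('i klr_gen fword \<Rightarrow>\<^sub>0 'k::field) set"
  for \<theta> a lam n V where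
  "\<nu> \<in> V \<Longrightarrow> \<mu> \<in> V \<Longrightarrow> ke \<nu> * ke \<mu> - (if \<nu> = \<mu> then ke \<nu> else 0) \<in> klr_rels \<theta> a lam n V"
| "(\<Sum>\<nu> \<in> V. ke \<nu>) - 1 \<in> klr_rels \<theta> a lam n V"
| "\<nu> \<in> V \<Longrightarrow> l \<in> {1..n} \<Longrightarrow> kx l * ke \<nu> - ke \<nu> * kx l \<in> klr_rels \<theta> a lam n V"
| "\<nu> \<in> V \<Longrightarrow> k < n \<Longrightarrow> kt k * ke \<nu> - ke (seq_swap \<theta> k \<nu>) * kt k \<in> klr_rels \<theta> a lam n V"
| "l \<in> {1..n} \<Longrightarrow> l' \<in> {1..n} \<Longrightarrow> kx l * kx l' - kx l' * kx l \<in> klr_rels \<theta> a lam n V"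
| "\<nu> \<in> V \<Longrightarrow> 1 \<le> k \<Longrightarrow> k < n \<Longrightarrow>
     kt k * kt k * ke \<nu> -
     kpoly (klr_Q a (\<nu> k) (\<nu> (k + 1)) (mpoly_var (k + 1)) (mpoly_var k)) * ke \<nu>
     \<in> klr_rels \<theta> a lam n V"
| "\<nu> \<in> V \<Longrightarrow> 0 < n \<Longrightarrow>
     kt 0 * kt 0 * ke \<nu> - kpoly (klr_Q0 \<theta> lam (\<nu> 1) (- mpoly_var 1)) * ke \<nu>
     \<in> klr_rels \<theta> a lam n V"
| "k < n \<Longrightarrow> k' < n \<Longrightarrow> k + 1 < k' \<or> k' + 1 < k \<Longrightarrow>
     kt k * kt k' - kt k' * kt k \<in> klr_rels \<theta> a lam n V"
| "\<nu> \<in> V \<Longrightarrow> 1 \<le> k \<Longrightarrow> k + 1 < n \<Longrightarrow>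
     (kt (k + 1) * kt k * kt (k + 1) - kt k * kt (k + 1) * kt k) * ke \<nu> -
     (if \<nu> k = \<nu> (k + 2) then
        kpoly (exact_div
          (klr_Q a (\<nu> k) (\<nu> (k + 1)) (mpoly_var (k + 1)) (mpoly_var k) -
           klr_Q a (\<nu> k) (\<nu> (k + 1)) (mpoly_var (k + 1)) (mpoly_var (k + 2)))
          (mpoly_var k - mpoly_var (k + 2))) * ke \<nu>
      else 0) \<in> klr_rels \<theta> a lam n V"
| "\<nu> \<in> V \<Longrightarrow> 2 \<le> n \<Longrightarrow>
     ((kt 1 * kt 0) ^ 2 - (kt 0 * kt 1) ^ 2) * ke \<nu> - klr_mixed \<theta> a lam \<nu>
     \<in> klr_rels \<theta> a lam n V"
| "\<nu> \<in> V \<Longrightarrow> 1 \<le> k \<Longrightarrow> k < n \<Longrightarrow> l \<in> {1..n} \<Longrightarrow>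
     (kt k * kx l - kx (index_swap k l) * kt k) * ke \<nu> -
     (if l = k \<and> \<nu> k = \<nu> (k + 1) then - ke \<nu>
      else if l = k + 1 \<and> \<nu> k = \<nu> (k + 1) then ke \<nu>
      else 0) \<in> klr_rels \<theta> a lam n V"
| "\<nu> \<in> V \<Longrightarrow> 0 < n \<Longrightarrow>
     (kt 0 * kx 1 + kx 1 * kt 0) * ke \<nu> - (if \<nu> 1 = \<theta> (\<nu> 1) then - (2 * ke \<nu>) else 0)
     \<in> klr_rels \<theta> a lam n V"
| "l \<in> {2..n} \<Longrightarrow> kt 0 * kx l - kx l * kt 0 \<in> klr_rels \<theta> a lam n V"

definition klr_gens :: "nat \<Rightarrow> (nat \<Rightarrow> 'i) set \<Rightarrow> 'i klr_gen set" where
  "klr_gens n V = KIdem ` V \<union> KX ` {1..n} \<union> KTau ` {..<n}"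

definition klr_alg ::
  "('i \<Rightarrow> 'i) \<Rightarrow> ('i \<Rightarrow> 'i \<Rightarrow> nat) \<Rightarrow> ('i \<Rightarrow> nat) \<Rightarrow> nat \<Rightarrow> (nat \<Rightarrow> 'i) set \<Rightarrow>
   ('i klr_gen fword \<Rightarrow>\<^sub>0 'k::field) set ring" where
  "klr_alg \<theta> a lam n V = presented (klr_gens n V) (klr_rels \<theta> a lam n V)"

definition klr_cls ::
  "('i \<Rightarrow> 'i) \<Rightarrow> ('i \<Rightarrow> 'i \<Rightarrow> nat) \<Rightarrow> ('i \<Rightarrow> nat) \<Rightarrow> nat \<Rightarrow> (nat \<Rightarrow> 'i) set \<Rightarrow>
   ('i klr_gen fword \<Rightarrow>\<^sub>0 'k::field) \<Rightarrow> ('i klr_gen fword \<Rightarrow>\<^sub>0 'k) set" where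
  "klr_cls \<theta> a lam n V = pcls (klr_gens n V) (klr_rels \<theta> a lam n V)"

definition klr_refl :: "nat \<Rightarrow> 'k::field mps fract \<Rightarrow> 'k mps fract" where
  "klr_refl k =
     fract_map (mps_subst (\<lambda>l. if k = 0 \<and> l = 1 then - mps_var 1 else mps_var (index_swap k l)))"

definition klr_tau_comp ::
  "('i \<Rightarrow> 'i) \<Rightarrow> ('i \<Rightarrow> 'i \<Rightarrow> nat) \<Rightarrow> ('i \<Rightarrow> nat) \<Rightarrow> nat \<Rightarrow> (nat \<Rightarrow> 'i) \<Rightarrow>
   'k::field mps fract \<Rightarrow> (nat \<Rightarrow> 'i) \<Rightarrow> 'k mps fract" where
  "klr_tau_comp \<theta> a lam k \<nu> f =
     (if k = 0 then
        (if \<theta> (\<nu> 1) = \<nu> 1 then at_idem \<nu> ((klr_refl 0 f - f) / fvar 1)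
         else at_idem (seq_swap \<theta> 0 \<nu>) (klr_P0 \<theta> lam (\<nu> 1) (fvar 1) * klr_refl 0 f))
      else
        (if \<nu> k = \<nu> (k + 1) then at_idem \<nu> ((klr_refl k f - f) / (fvar k - fvar (k + 1)))
         else at_idem (seq_swap \<theta> k \<nu>)
                (klr_P a (\<nu> k) (\<nu> (k + 1)) (fvar k) (fvar (k + 1)) * klr_refl k f)))"

fun klr_gen_act ::
  "('i \<Rightarrow> 'i) \<Rightarrow> ('i \<Rightarrow> 'i \<Rightarrow> nat) \<Rightarrow> ('i \<Rightarrow> nat) \<Rightarrow> (nat \<Rightarrow> 'i) set \<Rightarrow> 'i klr_gen \<Rightarrow>
   ((nat \<Rightarrow> 'i) \<Rightarrow> 'k::field mps fract) \<Rightarrow> (nat \<Rightarrow> 'i) \<Rightarrow> 'k mps fract" where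
  "klr_gen_act \<theta> a lam V (KIdem \<nu>) F = at_idem \<nu> (F \<nu>)"
| "klr_gen_act \<theta> a lam V (KX l) F = (\<lambda>\<mu>. fvar l * F \<mu>)"
| "klr_gen_act \<theta> a lam V (KTau k) F = (\<lambda>\<mu>. \<Sum>\<nu> \<in> V. klr_tau_comp \<theta> a lam k \<nu> (F \<nu>) \<mu>)"

text \<open>The direct sum of polynomial rings, with its maps to the KLR algebra and to the direct sum
  \<open>coef_ring V (pseries n)\<close> of power series rings.\<close>

definition klr_pol :: "nat \<Rightarrow> (nat \<Rightarrow> 'i) set \<Rightarrow> ((nat \<Rightarrow> 'i) \<Rightarrow> 'k::field mpoly) set" where
  "klr_pol n V =
     {p. (\<forall>\<nu> \<in> V. \<forall>m \<in> Poly_Mapping.keys (p \<nu>). Poly_Mapping.keys m \<subseteq> {1..n}) \<and>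
         (\<forall>\<nu>. \<nu> \<notin> V \<longrightarrow> p \<nu> = 0)}"

definition klr_of_pol ::
  "('i \<Rightarrow> 'i) \<Rightarrow> ('i \<Rightarrow> 'i \<Rightarrow> nat) \<Rightarrow> ('i \<Rightarrow> nat) \<Rightarrow> nat \<Rightarrow> (nat \<Rightarrow> 'i) set \<Rightarrow>
   ((nat \<Rightarrow> 'i) \<Rightarrow> 'k::field mpoly) \<Rightarrow> ('i klr_gen fword \<Rightarrow>\<^sub>0 'k) set" where
  "klr_of_pol \<theta> a lam n V p = klr_cls \<theta> a lam n V (\<Sum>\<nu> \<in> V. kpoly (p \<nu>) * ke \<nu>)"

definition series_of_pol ::
  "((nat \<Rightarrow> 'i) \<Rightarrow> 'k::field mpoly) \<Rightarrow> (nat \<Rightarrow> 'i) \<Rightarrow> 'k mps fract" where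
  "series_of_pol p = (\<lambda>\<nu>. to_fract (Abs_mps (Poly_Mapping.lookup (p \<nu>))))"

type_synonym ('i, 'k) klr_hat_elt =
  "(('i klr_gen fword \<Rightarrow>\<^sub>0 'k) set \<times> ((nat \<Rightarrow> 'i) \<Rightarrow> 'k mps fract) \<Rightarrow>\<^sub>0 int) set"

definition klr_hat ::
  "('i \<Rightarrow> 'i) \<Rightarrow> ('i \<Rightarrow> 'i \<Rightarrow> nat) \<Rightarrow> ('i \<Rightarrow> nat) \<Rightarrow> nat \<Rightarrow> (nat \<Rightarrow> 'i) set \<Rightarrow>
   ('i, 'k::field) klr_hat_elt ring" where
  "klr_hat \<theta> a lam n V =
     tensor_ring (presented_act fconst (klr_gen_act \<theta> a lam V))
       (klr_alg \<theta> a lam n V) (coef_ring V (pseries n))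
       (klr_pol n V) (klr_of_pol \<theta> a lam n V) series_of_pol"

definition klr_elt ::
  "('i \<Rightarrow> 'i) \<Rightarrow> ('i \<Rightarrow> 'i \<Rightarrow> nat) \<Rightarrow> ('i \<Rightarrow> nat) \<Rightarrow> nat \<Rightarrow> (nat \<Rightarrow> 'i) set \<Rightarrow>
   ('i klr_gen fword \<Rightarrow>\<^sub>0 'k::field) \<Rightarrow> ((nat \<Rightarrow> 'i) \<Rightarrow> 'k mps fract) \<Rightarrow> ('i, 'k) klr_hat_elt" where
  "klr_elt \<theta> a lam n V r f =
     tensor_cls (klr_alg \<theta> a lam n V) (coef_ring V (pseries n))
       (klr_pol n V) (klr_of_pol \<theta> a lam n V) series_of_pol
       (frag_of (klr_cls \<theta> a lam n V r, f))"


section \<open>Affine Hecke algebras of type C\<close>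

datatype hecke_gen = HT nat | HX nat | HXinv nat

abbreviation hT :: "nat \<Rightarrow> hecke_gen fword \<Rightarrow>\<^sub>0 'k::field" where "hT k \<equiv> gen (HT k)"
abbreviation hX :: "nat \<Rightarrow> hecke_gen fword \<Rightarrow>\<^sub>0 'k::field" where "hX l \<equiv> gen (HX l)"
abbreviation hXinv :: "nat \<Rightarrow> hecke_gen fword \<Rightarrow>\<^sub>0 'k::field" where "hXinv l \<equiv> gen (HXinv l)"

inductive_set hecke_rels :: "'k \<Rightarrow> 'k \<Rightarrow> 'k \<Rightarrow> nat \<Rightarrow> (hecke_gen fword \<Rightarrow>\<^sub>0 'k::field) set"
  for q p0 p1 n where
  "1 \<le> k \<Longrightarrow> k < n \<Longrightarrow>
     (hT k - scal q) * (hT k + scal (inverse q)) \<in> hecke_rels q p0 p1 n"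
| "0 < n \<Longrightarrow> (hT 0 - scal p0) * (hT 0 + scal (inverse p1)) \<in> hecke_rels q p0 p1 n"
| "1 \<le> k \<Longrightarrow> k + 1 < n \<Longrightarrow>
     hT k * hT (k + 1) * hT k - hT (k + 1) * hT k * hT (k + 1) \<in> hecke_rels q p0 p1 n"
| "2 \<le> n \<Longrightarrow> (hT 0 * hT 1) ^ 2 - (hT 1 * hT 0) ^ 2 \<in> hecke_rels q p0 p1 n"
| "k < n \<Longrightarrow> k' < n \<Longrightarrow> k + 1 < k' \<or> k' + 1 < k \<Longrightarrow>
     hT k * hT k' - hT k' * hT k \<in> hecke_rels q p0 p1 n"
| "l \<in> {1..n} \<Longrightarrow> l' \<in> {1..n} \<Longrightarrow> hX l * hX l' - hX l' * hX l \<in> hecke_rels q p0 p1 n"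
| "l \<in> {1..n} \<Longrightarrow> hX l * hXinv l - 1 \<in> hecke_rels q p0 p1 n"
| "l \<in> {1..n} \<Longrightarrow> hXinv l * hX l - 1 \<in> hecke_rels q p0 p1 n"
| "1 \<le> k \<Longrightarrow> k < n \<Longrightarrow> hT k * hX k * hT k - hX (k + 1) \<in> hecke_rels q p0 p1 n"
| "0 < n \<Longrightarrow>
     hT 0 * hXinv 1 * hT 0 -
     (scal (p0 * inverse p1) * hX 1 + scal (p0 * inverse p1 - 1) * hT 0) \<in> hecke_rels q p0 p1 n"
| "k < n \<Longrightarrow> l \<in> {1..n} \<Longrightarrow> l \<noteq> k \<Longrightarrow> l \<noteq> k + 1 \<Longrightarrow>
     hT k * hX l - hX l * hT k \<in> hecke_rels q p0 p1 n"

definition hecke_gens :: "nat \<Rightarrow> hecke_gen set" where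
  "hecke_gens n = HT ` {..<n} \<union> HX ` {1..n} \<union> HXinv ` {1..n}"

definition hecke_alg :: "'k \<Rightarrow> 'k \<Rightarrow> 'k \<Rightarrow> nat \<Rightarrow> (hecke_gen fword \<Rightarrow>\<^sub>0 'k::field) set ring" where
  "hecke_alg q p0 p1 n = presented (hecke_gens n) (hecke_rels q p0 p1 n)"

definition hecke_cls ::
  "'k \<Rightarrow> 'k \<Rightarrow> 'k \<Rightarrow> nat \<Rightarrow> (hecke_gen fword \<Rightarrow>\<^sub>0 'k::field) \<Rightarrow> (hecke_gen fword \<Rightarrow>\<^sub>0 'k) set" where
  "hecke_cls q p0 p1 n = pcls (hecke_gens n) (hecke_rels q p0 p1 n)"

text \<open>
  The variable \<open>l\<close> of the power series ring at \<open>\<nu>\<close> stands for \<open>X\<^sub>l - \<nu>\<^sub>l\<close>. The reflection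
  \<open>hecke_refl \<nu> k\<close> maps the component at \<open>\<nu>\<close> to the one at \<open>seq_swap inverse k \<nu>\<close>; for \<open>k = 0\<close> it
  sends \<open>X\<^sub>1\<close> to the inverse of \<open>X\<^sub>1\<close>, which is \<open>1 / \<nu>\<^sub>1\<close> plus the first variable in
  the target component.
\<close>

definition hXat :: "(nat \<Rightarrow> 'k) \<Rightarrow> nat \<Rightarrow> 'k::field mps fract" where
  "hXat \<mu> l = fconst (\<mu> l) + fvar l"

definition hecke_refl :: "(nat \<Rightarrow> 'k) \<Rightarrow> nat \<Rightarrow> 'k::field mps fract \<Rightarrow> 'k mps fract" where
  "hecke_refl \<nu> k =
     fract_map (mps_subst (\<lambda>l.
       if k = 0 \<and> l = 1 then
         mps_inverse (mps_const (inverse (\<nu> 1)) + mps_var 1) - mps_const (\<nu> 1)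
       else mps_var (index_swap k l)))"

definition hecke_refl_vec ::
  "nat \<Rightarrow> ((nat \<Rightarrow> 'k) \<Rightarrow> 'k::field mps fract) \<Rightarrow> (nat \<Rightarrow> 'k) \<Rightarrow> 'k mps fract" where
  "hecke_refl_vec k F =
     (\<lambda>\<mu>. let \<nu> = seq_swap inverse k \<mu> in hecke_refl \<nu> k (F \<nu>))"

fun hecke_gen_act ::
  "'k \<Rightarrow> 'k \<Rightarrow> 'k \<Rightarrow> hecke_gen \<Rightarrow> ((nat \<Rightarrow> 'k) \<Rightarrow> 'k::field mps fract) \<Rightarrow>
   (nat \<Rightarrow> 'k) \<Rightarrow> 'k mps fract" where
  "hecke_gen_act q p0 p1 (HX l) F = (\<lambda>\<mu>. hXat \<mu> l * F \<mu>)"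
| "hecke_gen_act q p0 p1 (HXinv l) F = (\<lambda>\<mu>. inverse (hXat \<mu> l) * F \<mu>)"
| "hecke_gen_act q p0 p1 (HT k) F =
     (\<lambda>\<mu>. if k = 0 then
            fconst p0 * F \<mu> +
            fconst (inverse p1) * ((hXat \<mu> 1 + fconst p0) * (hXat \<mu> 1 - fconst p1)) /
              (hXat \<mu> 1 ^ 2 - 1) * (hecke_refl_vec 0 F \<mu> - F \<mu>)
          else
            fconst q * F \<mu> +
            (fconst q * hXat \<mu> k - fconst (inverse q) * hXat \<mu> (k + 1)) /
              (hXat \<mu> k - hXat \<mu> (k + 1)) * (hecke_refl_vec k F \<mu> - F \<mu>))"

definition laurent :: "nat \<Rightarrow> ((nat \<Rightarrow>\<^sub>0 int) \<Rightarrow>\<^sub>0 'k::field) set" where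
  "laurent n = {p. \<forall>m \<in> Poly_Mapping.keys p. Poly_Mapping.keys m \<subseteq> {1..n}}"

definition hecke_of_laurent ::
  "'k \<Rightarrow> 'k \<Rightarrow> 'k \<Rightarrow> nat \<Rightarrow> ((nat \<Rightarrow>\<^sub>0 int) \<Rightarrow>\<^sub>0 'k::field) \<Rightarrow> (hecke_gen fword \<Rightarrow>\<^sub>0 'k) set" where
  "hecke_of_laurent q p0 p1 n p =
     hecke_cls q p0 p1 n
       (\<Sum>m \<in> Poly_Mapping.keys p.
          Poly_Mapping.single
            (Word (concat (map
               (\<lambda>l. replicate (nat (Poly_Mapping.lookup m l)) (HX l) @
                    replicate (nat (- Poly_Mapping.lookup m l)) (HXinv l))
               (sorted_list_of_set (Poly_Mapping.keys m)))))
            (Poly_Mapping.lookup p m))"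

definition series_of_laurent ::
  "(nat \<Rightarrow> 'k) set \<Rightarrow> ((nat \<Rightarrow>\<^sub>0 int) \<Rightarrow>\<^sub>0 'k::field) \<Rightarrow> (nat \<Rightarrow> 'k) \<Rightarrow> 'k mps fract" where
  "series_of_laurent V p =
     vec V (\<lambda>\<mu>. \<Sum>m \<in> Poly_Mapping.keys p.
        fconst (Poly_Mapping.lookup p m) *
        (\<Prod>l \<in> Poly_Mapping.keys m. hXat \<mu> l powi Poly_Mapping.lookup m l))"

type_synonym 'k hecke_hat_elt =
  "((hecke_gen fword \<Rightarrow>\<^sub>0 'k) set \<times> ((nat \<Rightarrow> 'k) \<Rightarrow> 'k mps fract) \<Rightarrow>\<^sub>0 int) set"

text \<open>
  The completion is \<open>hecke_hat (pseries n)\<close>. The algebra \<open>hecke_hat (pfrac n)\<close>, obtained from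
  the fields of fractions of the power series rings, contains it via \<open>hecke_incl\<close>; it is
  where rational functions in the \<open>X\<^sub>l\<close> and the intertwiners live.
\<close>

definition hecke_hat ::
  "'k mps fract set \<Rightarrow> 'k \<Rightarrow> 'k \<Rightarrow> 'k \<Rightarrow> nat \<Rightarrow> (nat \<Rightarrow> 'k) set \<Rightarrow> 'k::field hecke_hat_elt ring" where
  "hecke_hat S q p0 p1 n V =
     tensor_ring (presented_act fconst (hecke_gen_act q p0 p1))
       (hecke_alg q p0 p1 n) (coef_ring V S)
       (laurent n) (hecke_of_laurent q p0 p1 n) (series_of_laurent V)"

definition hecke_tensor_cls ::
  "'k mps fract set \<Rightarrow> 'k \<Rightarrow> 'k \<Rightarrow> 'k \<Rightarrow> nat \<Rightarrow> (nat \<Rightarrow> 'k) set \<Rightarrow>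
   ((hecke_gen fword \<Rightarrow>\<^sub>0 'k) set \<times> ((nat \<Rightarrow> 'k) \<Rightarrow> 'k mps fract) \<Rightarrow>\<^sub>0 int) \<Rightarrow>
   'k::field hecke_hat_elt" where
  "hecke_tensor_cls S q p0 p1 n V =
     tensor_cls (hecke_alg q p0 p1 n) (coef_ring V S)
       (laurent n) (hecke_of_laurent q p0 p1 n) (series_of_laurent V)"

definition hecke_elt ::
  "'k mps fract set \<Rightarrow> 'k \<Rightarrow> 'k \<Rightarrow> 'k \<Rightarrow> nat \<Rightarrow> (nat \<Rightarrow> 'k) set \<Rightarrow>
   (hecke_gen fword \<Rightarrow>\<^sub>0 'k) \<Rightarrow> ((nat \<Rightarrow> 'k) \<Rightarrow> 'k mps fract) \<Rightarrow> 'k::field hecke_hat_elt" where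
  "hecke_elt S q p0 p1 n V h f =
     hecke_tensor_cls S q p0 p1 n V (frag_of (hecke_cls q p0 p1 n h, f))"

definition hecke_incl ::
  "'k \<Rightarrow> 'k \<Rightarrow> 'k \<Rightarrow> nat \<Rightarrow> (nat \<Rightarrow> 'k) set \<Rightarrow> 'k::field hecke_hat_elt \<Rightarrow> 'k hecke_hat_elt" where
  "hecke_incl q p0 p1 n V C = hecke_tensor_cls (pfrac n) q p0 p1 n V (SOME z. z \<in> C)"

definition hecke_fun ::
  "'k \<Rightarrow> 'k \<Rightarrow> 'k \<Rightarrow> nat \<Rightarrow> (nat \<Rightarrow> 'k) set \<Rightarrow> ((nat \<Rightarrow> 'k) \<Rightarrow> 'k mps fract) \<Rightarrow>
   'k::field hecke_hat_elt" where
  "hecke_fun q p0 p1 n V g = hecke_elt (pfrac n) q p0 p1 n V 1 (vec V g)"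

definition hecke_Phi ::
  "'k \<Rightarrow> 'k \<Rightarrow> 'k \<Rightarrow> nat \<Rightarrow> (nat \<Rightarrow> 'k) set \<Rightarrow> nat \<Rightarrow> 'k::field hecke_hat_elt" where
  "hecke_Phi q p0 p1 n V k =
     (let K = hecke_hat (pfrac n) q p0 p1 n V;
          f = hecke_fun q p0 p1 n V;
          T = hecke_elt (pfrac n) q p0 p1 n V (hT k) \<one>\<^bsub>coef_ring V (pfrac n)\<^esub>
      in \<one>\<^bsub>K\<^esub> \<oplus>\<^bsub>K\<^esub>
         (if k = 0 then
            f (\<lambda>\<mu>. fconst p1 * ((hXat \<mu> 1 ^ 2 - 1) /
                 ((hXat \<mu> 1 + fconst p0) * (hXat \<mu> 1 - fconst p1))))
            \<otimes>\<^bsub>K\<^esub> (T \<ominus>\<^bsub>K\<^esub> f (\<lambda>_. fconst p0))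
          else
            f (\<lambda>\<mu>. (hXat \<mu> k - hXat \<mu> (k + 1)) /
                 (fconst q * hXat \<mu> k - fconst (inverse q) * hXat \<mu> (k + 1)))
            \<otimes>\<^bsub>K\<^esub> (T \<ominus>\<^bsub>K\<^esub> f (\<lambda>_. fconst q))))"


text \<open>
  Since \<open>\<Phi>\<^sub>k e(\<nu>) = e(s\<^sub>k \<nu>) \<Phi>\<^sub>k\<close>, a function standing to the left of \<open>\<Phi>\<^sub>k e(\<nu>)\<close> is expanded
  at \<open>s\<^sub>k \<nu>\<close>, not at \<open>\<nu>\<close>. Images of the \<open>\<tau>\<^sub>k\<close> whose coefficients are written in terms of \<open>\<nu>\<close> are
  therefore to be stated for \<open>e(\<nu>) \<tau>\<^sub>k\<close> (which is \<open>\<tau>\<^sub>k e(s\<^sub>k \<nu>)\<close>) rather than for \<open>\<tau>\<^sub>k e(\<nu>)\<close>.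
  The coefficients have to be \<open>x\<^sub>k - x\<^sub>k\<^sub>+\<^sub>1\<close> (for an arrow from \<open>\<nu>\<^sub>k\<close> to \<open>\<nu>\<^sub>k\<^sub>+\<^sub>1\<close>) and a power of \<open>x\<^sub>1\<close>,
  with these signs, for the relations \<open>klr_rels\<close> on the squares of the \<open>\<tau>\<^sub>k\<close> to hold.
\<close>


section \<open>The quiver\<close>

definition vertices :: "'k::field \<Rightarrow> 'k \<Rightarrow> 'k set" where
  "vertices q \<xi> = {\<xi> * q powi (2 * k) | k. True} \<union> {inverse \<xi> * q powi (2 * k) | k. True}"

definition arrows :: "'k::field \<Rightarrow> 'k \<Rightarrow> 'k \<Rightarrow> nat" where
  "arrows q i j = of_bool (j = q ^ 2 * i)"

definition framing :: "'k::field \<Rightarrow> 'k \<Rightarrow> 'k \<Rightarrow> nat" where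
  "framing p0 p1 i = of_bool (i = p1) + of_bool (i = - p0)"

end

theory Submission
 imports Defs "HOL-Combinatorics.Permutations"
begin

text \<open>Both completed algebras act faithfully on vectors of fractions of power series: the normal
 forms of words in the Coxeter generators span them over the power series, and they act by
 operators which are triangular in the linearly independent reflections. Each algebra is thus
 determined by its operators. Substituting \<open>X(\<nu>\<^sub>k) / X\<^sub>k - X\<^sub>k / X(\<nu>\<^sub>k)\<close> for \<open>x\<^sub>k\<close> and
 rescaling the components turns \<open>\<tau>\<^sub>k\<close> into \<open>\<alpha> T\<^sub>k + \<beta>\<close> for a unit \<open>\<alpha>\<close> and a power series \<open>\<beta>\<close>,
 so the two algebras of operators coincide.\<close>

text \<open>The product of a completion is defined by a definite description through its action, so
  closure of the operators under composition and faithfulness must be settled before there is a ring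
  at all. No basis theorem is presupposed: rewriting modulo shorter words gives spanning, Dedekind's
  lemma on distinct characters gives independence, and one abstract argument serves both algebras.
  The rescaling is forced by orientation. In the polynomial representation
  \<open>\<tau>\<^sub>k\<close> enters the component at \<open>mu\<close> with a factor for an arrow
  from \<open>mu (k + 1)\<close> to \<open>mu k\<close>, while the stated images carry one for an
  arrow from \<open>mu k\<close> to \<open>mu (k + 1)\<close>. A product over all pairs of positions
  corrects this for every \<open>k\<close> at once. The coordinate \<open>a / X - X / a\<close>
  changes sign when \<open>X\<close> and \<open>a\<close> are both inverted, as
  \<open>x\<^sub>1\<close> does under the reflection of index 0; its linear coefficient
  \<open>- 2 / a\<close> is invertible because 2 is nonzero in the ground field. Intertwiners have
  denominators, so the final formulas are compared over fields of fractions, again as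
  operators.\<close>

declare klr_gen_act.simps(3) [simp del] hecke_gen_act.simps(3) [simp del]

abbreviation "lookup \<equiv> Poly_Mapping.lookup"
abbreviation "mco \<equiv> mps_coeff"
abbreviation "keys \<equiv> Poly_Mapping.keys"
abbreviation "single \<equiv> Poly_Mapping.single"

type_synonym ('i, 'k) svec = "(nat => 'i) => 'k mps fract"

section \<open>Substitution in power series\<close>

lemma mps_coeff_simps [simp]:
 "mco (f + g) m = mco f m + mco g m"
 "mco (f - g) m = mco f m - mco g m"
 "mco (- f) m = - mco f m"
 "mco 0 m = 0" by (simp_all add: plus_mps_def minus_mps_def uminus_mps_def zero_mps_def)

lemma mps_coeff_one: "mco 1 m = (if m = 0 then 1 else 0)" by (simp add: one_mps_def)

lemma mps_coeff_mult:
 "mco (f * g) m = (\<Sum>p\<in>msplits m. mco f (fst p) * mco g (snd p))" by (simp add: times_mps_def case_prod_unfold)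

lemma mps_coeff_const: "mco (mps_const c) m = (if m = 0 then c else 0)" by (simp add: mps_const_def)

lemma mps_coeff_var: "mco (mps_var l) m = (if m = single l 1 then 1 else 0)" by (simp add: mps_var_def)

lemma msplits_zero: "(m, 0) \<in> msplits m" "(0, m) \<in> msplits m" by (simp_all add: msplits_def)

lemma mps_monom_superset:
 assumes "finite A" "keys m \<subseteq> A"
 shows "mps_monom \<sigma> m = (\<Prod>l\<in>A. \<sigma> l ^ lookup m l)"
 unfolding mps_monom_def by (rule prod.mono_neutral_left) (use assms in \<open>auto simp: in_keys_iff\<close>)

lemma mps_monom_add: "mps_monom \<sigma> (m + m') = mps_monom \<sigma> m * mps_monom \<sigma> m'"
proof -
 let ?A = "keys m \<union> keys m'"
 have "mps_monom \<sigma> (m + m') = (\<Prod>l\<in>?A. \<sigma> l ^ lookup (m + m') l)"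
  by (rule mps_monom_superset) (simp_all add: keys_add_nat)
 also have "... = mps_monom \<sigma> m * mps_monom \<sigma> m'"
  by (simp add: mps_monom_superset[of ?A] lookup_add power_add prod.distrib)
 finally show ?thesis .
qed

lemma mps_monom_zero [simp]: "mps_monom \<sigma> 0 = 1" by (simp add: mps_monom_def)

lemma mps_monom_single [simp]: "mps_monom \<sigma> (single l k) = \<sigma> l ^ k" by (simp add: mps_monom_def)

text \<open>This makes \<open>mps_subst \<sigma>\<close> a finite sum for every series at once: only
  finitely many monomials have an image that meets a given exponent \<open>t\<close>. With
  infinitely many variables, vanishing constant terms alone would not ensure it.\<close>

definition mps_adm :: "(nat => 'k::comm_ring_1 mps) => bool" where
 "mps_adm \<sigma> \<longleftrightarrow> (\<forall>t. finite {m. mco (mps_monom \<sigma> m) t ~= 0})"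

text \<open>The defining sum runs over a support depending on \<open>f\<close>; exchanging it for
  any finite superset \<open>B\<close> lets several series be expanded over one index set.\<close>

lemma mps_coeff_subst:
 assumes "finite B" "!!m. mco f m ~= 0 ==> mco (mps_monom \<sigma> m) t ~= 0 ==> m \<in> B"
 shows "mco (mps_subst \<sigma> f) t = (\<Sum>m\<in>B. mco f m * mco (mps_monom \<sigma> m) t)"
proof -
 have "{m. mco f m * mco (mps_monom \<sigma> m) t ~= 0} \<subseteq> B"
 proof
  fix m assume "m \<in> {m. mco f m * mco (mps_monom \<sigma> m) t ~= 0}"
  then have "mco f m ~= 0" "mco (mps_monom \<sigma> m) t ~= 0" by auto
  then show "m \<in> B" by (rule assms(2))
 qed
 then show ?thesis unfolding mps_subst_def mps_coeff_Abs by (intro sum.mono_neutral_left assms(1)) auto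
qed

text \<open>Coefficients of a product at \<open>t\<close> involve those of the factors at all
  divisors of \<open>t\<close>, so the set collects the exponents that contribute to any such
  divisor.\<close>

definition mps_supp :: "(nat => 'k::comm_ring_1 mps) => (nat \<Rightarrow>\<^sub>0 nat) => (nat \<Rightarrow>\<^sub>0 nat) set" where
 "mps_supp \<sigma> t = (\<Union>a \<in> fst ` msplits t. {m. mco (mps_monom \<sigma> m) a ~= 0})"

lemma mps_supp:
 assumes "mps_adm \<sigma>"
 shows "finite (mps_supp \<sigma> t)"
  and "(a, b) \<in> msplits t ==> mco (mps_monom \<sigma> m) a ~= 0 ==> m \<in> mps_supp \<sigma> t"
  and "(a, b) \<in> msplits t ==> mco (mps_monom \<sigma> m) b ~= 0 ==> m \<in> mps_supp \<sigma> t" (is "PROP ?g1")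
  and "mco (mps_monom \<sigma> m) t ~= 0 ==> m \<in> mps_supp \<sigma> t" (is "PROP ?g2")
proof -
 show "finite (mps_supp \<sigma> t)" using assms by (auto simp: mps_supp_def mps_adm_def)
 show 1: "(a, b) \<in> msplits t ==> mco (mps_monom \<sigma> m) a ~= 0 ==> m \<in> mps_supp \<sigma> t" for a b
  by (force simp: mps_supp_def)
 have "(a, b) \<in> msplits t ==> (b, a) \<in> msplits t" by (simp add: msplits_def add.commute)
 with 1 show "PROP ?g1" by blast
 show "PROP ?g2" using 1 msplits_zero by blast
qed

lemma mps_subst_add:
 assumes "mps_adm \<sigma>"
 shows "mps_subst \<sigma> (f + g) = mps_subst \<sigma> f + mps_subst \<sigma> g"
proof (rule mps_eqI)
 fix t
 note c = mps_coeff_subst[OF mps_supp(1)[OF assms, of t] mps_supp(4)[OF assms]]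
 show "mco (mps_subst \<sigma> (f + g)) t = mco (mps_subst \<sigma> f + mps_subst \<sigma> g) t"
  by (simp add: c distrib_right sum.distrib)
qed

lemma mps_subst_mult:
 assumes "mps_adm \<sigma>"
 shows "mps_subst \<sigma> (f * g) = mps_subst \<sigma> f * mps_subst \<sigma> g"
proof (rule mps_eqI)
 fix t
 define B where "B = mps_supp \<sigma> t"
 let ?c = "\<lambda>m. mco (mps_monom \<sigma> m)"
 have fin: "finite B" unfolding B_def by (rule mps_supp(1)[OF assms])
 have cf: "mco (mps_subst \<sigma> f) (fst p) = (\<Sum>m\<in>B. mco f m * ?c m (fst p))" if "p \<in> msplits t" for p
  by (rule mps_coeff_subst[OF fin]) (use that mps_supp(2)[OF assms] in \<open>cases p; auto simp: B_def\<close>)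
 have cg: "mco (mps_subst \<sigma> g) (snd p) = (\<Sum>m\<in>B. mco g m * ?c m (snd p))" if "p \<in> msplits t" for p
  by (rule mps_coeff_subst[OF fin]) (use that mps_supp(3)[OF assms] in \<open>cases p; auto simp: B_def\<close>)
 have "mco (mps_subst \<sigma> f * mps_subst \<sigma> g) t =
   (\<Sum>p\<in>msplits t. (\<Sum>m\<in>B. mco f m * ?c m (fst p)) * (\<Sum>m\<in>B. mco g m * ?c m (snd p)))"
  unfolding mps_coeff_mult by (rule sum.cong) (simp_all add: cf cg)
 also have "... = (\<Sum>p\<in>msplits t. \<Sum>r\<in>B \<times> B. mco f (fst r) * mco g (snd r) *
   (?c (fst r) (fst p) * ?c (snd r) (snd p)))" by (simp add: sum_product sum.cartesian_product case_prod_unfold ac_simps)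
 also have "... = (\<Sum>r\<in>B \<times> B. mco f (fst r) * mco g (snd r) * ?c (fst r + snd r) t)"
  by (subst sum.swap) (simp add: mps_monom_add mps_coeff_mult sum_distrib_left)
 \<comment> \<open>Pairs are regrouped by their sum. A pair outside \<open>B \<times> B\<close>
   contributes nothing, since a nonzero coefficient of the product monomial at \<open>t\<close> puts
   both exponents into \<open>B\<close>; a pair whose sum lies outside \<open>B\<close> contributes
   nothing because \<open>B\<close> contains all exponents that reach \<open>t\<close>.\<close>
 also have "... = (\<Sum>r\<in>(\<Union>s\<in>B. msplits s). mco f (fst r) * mco g (snd r) * ?c (fst r + snd r) t)"
 proof (rule sum.mono_neutral_cong)
  fix r assume r: "r \<in> (\<Union>s\<in>B. msplits s) - B \<times> B"
  have "?c (fst r + snd r) t = 0"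
  proof (rule ccontr)
   assume "?c (fst r + snd r) t ~= 0"
   then obtain p where "p \<in> msplits t" "?c (fst r) (fst p) * ?c (snd r) (snd p) ~= 0"
    unfolding mps_monom_add mps_coeff_mult by (meson sum.neutral)
   then have "fst r \<in> B" "snd r \<in> B" unfolding B_def by (cases p; auto intro: mps_supp[OF assms])+
   with r show False by (cases r) simp
  qed
  then show "mco f (fst r) * mco g (snd r) * ?c (fst r + snd r) t = 0" by simp
 next
  fix r assume "r \<in> B \<times> B - (\<Union>s\<in>B. msplits s)"
  then have "fst r + snd r \<notin> B" by (cases r) (auto simp: msplits_def)
  then have "?c (fst r + snd r) t = 0" unfolding B_def using mps_supp(4)[OF assms] by blast
  then show "mco f (fst r) * mco g (snd r) * ?c (fst r + snd r) t = 0" by simp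
 qed (use fin in auto)
 also have "... = (\<Sum>s\<in>B. \<Sum>r\<in>msplits s. mco f (fst r) * mco g (snd r) * ?c (fst r + snd r) t)"
  by (rule sum.UNION_disjoint) (use fin in simp, simp, auto simp: msplits_def)
 also have "... = (\<Sum>s\<in>B. mco (f * g) s * ?c s t)" unfolding mps_coeff_mult sum_distrib_right
  by (intro sum.cong refl) (auto simp: msplits_def)
 also have "... = mco (mps_subst \<sigma> (f * g)) t"
  by (rule mps_coeff_subst[symmetric, OF fin]) (auto simp: B_def intro: mps_supp[OF assms])
 finally show "mco (mps_subst \<sigma> (f * g)) t = mco (mps_subst \<sigma> f * mps_subst \<sigma> g) t" ..
qed

lemma mps_subst_const [simp]: "mps_subst \<sigma> (mps_const c) = mps_const c"
proof (rule mps_eqI)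
 fix t
 have "mco (mps_subst \<sigma> (mps_const c)) t = (\<Sum>m\<in>{0}. mco (mps_const c) m * mco (mps_monom \<sigma> m) t)"
  by (rule mps_coeff_subst) (auto simp: mps_coeff_const split: if_splits)
 then show "mco (mps_subst \<sigma> (mps_const c)) t = mco (mps_const c) t" by (simp add: mps_coeff_const mps_coeff_one)
qed

lemma mps_const_one: "mps_const 1 = 1" and mps_const_zero: "mps_const 0 = 0"
 by (rule mps_eqI, simp add: mps_coeff_const mps_coeff_one)+

lemma mps_subst_one [simp]: "mps_subst \<sigma> 1 = 1" and mps_subst_zero [simp]: "mps_subst \<sigma> 0 = 0"
 using mps_subst_const[of \<sigma> 1] mps_subst_const[of \<sigma> 0] by (simp_all only: mps_const_one mps_const_zero)

lemma mps_subst_power: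
 "mps_adm \<sigma> ==> mps_subst \<sigma> (f ^ k) = mps_subst \<sigma> f ^ k" by (induction k) (simp_all add: mps_subst_mult)

lemma mps_subst_prod:
 "mps_adm \<sigma> ==> mps_subst \<sigma> (prod f A) = (\<Prod>x\<in>A. mps_subst \<sigma> (f x))"
 by (induction A rule: infinite_finite_induct) (simp_all add: mps_subst_mult)

lemma mps_subst_monom:
 "mps_adm \<sigma> ==> mps_subst \<sigma> (mps_monom \<tau> m) = mps_monom (\<lambda>l. mps_subst \<sigma> (\<tau> l)) m"
 by (simp add: mps_monom_def mps_subst_prod mps_subst_power)

text \<open>Only exponents \<open>s\<close> in \<open>B\<close> of the inner series reach
  \<open>t\<close>, and only exponents in \<open>D\<close> reach some such \<open>s\<close>. Over
  these finite sets the double sum may be exchanged, and \<open>\<sigma>\<close> is multiplicative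
  on the monomials of \<open>\<tau>\<close>.\<close>

lemma mps_subst_subst:
 assumes "mps_adm \<sigma>" "mps_adm \<tau>"
 shows "mps_subst \<sigma> (mps_subst \<tau> f) = mps_subst (\<lambda>l. mps_subst \<sigma> (\<tau> l)) f"
proof (rule mps_eqI)
 fix t
 define B where "B = mps_supp \<sigma> t"
 define D where "D = (\<Union>s\<in>B. mps_supp \<tau> s)"
 have fin: "finite B" "finite D" using mps_supp(1) assms by (auto simp: B_def D_def)
 have inB: "mco (mps_monom \<sigma> m) t ~= 0 ==> m \<in> B" for m unfolding B_def by (rule mps_supp(4)[OF assms(1)])
 have inD: "s \<in> B ==> mco (mps_monom \<tau> m) s ~= 0 ==> m \<in> D" for m s
  unfolding D_def using mps_supp(4)[OF assms(2)] by blast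
 have cs: "mco (mps_subst \<sigma> h) t = (\<Sum>m\<in>B. mco h m * mco (mps_monom \<sigma> m) t)" for h
  by (rule mps_coeff_subst[OF fin(1)]) (rule inB)
 have ct: "mco (mps_subst \<tau> f) s = (\<Sum>m\<in>D. mco f m * mco (mps_monom \<tau> m) s)" if "s \<in> B" for s
  by (rule mps_coeff_subst[OF fin(2)]) (rule inD[OF that])
 let ?c = "\<lambda>m. mco (mps_monom (\<lambda>l. mps_subst \<sigma> (\<tau> l)) m) t"
 have c: "?c m = (\<Sum>s\<in>B. mco (mps_monom \<tau> m) s * mco (mps_monom \<sigma> s) t)" for m
  by (simp add: mps_subst_monom[OF assms(1), symmetric] cs)
 have "mco (mps_subst (\<lambda>l. mps_subst \<sigma> (\<tau> l)) f) t = (\<Sum>m\<in>D. mco f m * ?c m)"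
 proof (rule mps_coeff_subst[OF fin(2)])
  fix m assume "?c m ~= 0"
  then obtain s where "s \<in> B" "mco (mps_monom \<tau> m) s * mco (mps_monom \<sigma> s) t ~= 0"
   unfolding c by (meson sum.neutral)
  then have "s \<in> B" "mco (mps_monom \<tau> m) s ~= 0" by auto
  then show "m \<in> D" by (rule inD)
 qed
 also have "... = (\<Sum>s\<in>B. mco (mps_subst \<tau> f) s * mco (mps_monom \<sigma> s) t)" unfolding c sum_distrib_left
  by (subst sum.swap) (simp add: ct sum_distrib_right mult.assoc)
 also have "... = mco (mps_subst \<sigma> (mps_subst \<tau> f)) t" by (simp add: cs)
 finally show "mco (mps_subst \<sigma> (mps_subst \<tau> f)) t =
  mco (mps_subst (\<lambda>l. mps_subst \<sigma> (\<tau> l)) f) t" ..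
qed

section \<open>One-variable series inside the ring of power series in many variables\<close>

definition mps_uni :: "nat => 'k::comm_ring_1 fps => 'k mps" where
 "mps_uni l f =
  Abs_mps (\<lambda>m. if keys m \<subseteq> {l} then fps_nth f (lookup m l) else 0)"

lemma mps_coeff_uni:
 "mco (mps_uni l f) m = (if keys m \<subseteq> {l} then fps_nth f (lookup m l) else 0)" by (simp add: mps_uni_def)

lemma keys_subset_single:
 "keys m \<subseteq> {l} \<longleftrightarrow> m = single l (lookup m l)"
proof
 assume "keys m \<subseteq> {l}"
 then show "m = single l (lookup m l)" by (intro poly_mapping_eqI) (auto simp: lookup_single when_def in_keys_iff)
next
 assume "m = single l (lookup m l)"
 then have "keys m = keys (single l (lookup m l))" by simp
 then show "keys m \<subseteq> {l}" by (auto split: if_splits)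
qed

lemma mps_uni_add: "mps_uni l (f + g) = mps_uni l f + mps_uni l g"
 and mps_uni_diff: "mps_uni l (f - g) = mps_uni l f - mps_uni l g"
 and mps_uni_minus: "mps_uni l (- f) = - mps_uni l f"
 by (rule mps_eqI, simp add: mps_coeff_uni)+

lemma mps_uni_const: "mps_uni l (fps_const c) = mps_const c"
proof (rule mps_eqI)
 fix m show "mco (mps_uni l (fps_const c)) m = mco (mps_const c) m"
  by (auto simp: mps_coeff_uni mps_coeff_const keys_subset_single)
qed

lemma mps_uni_one: "mps_uni l 1 = 1" using mps_uni_const[of l 1] by (simp add: mps_const_one)

lemma mps_uni_X: "mps_uni l fps_X = mps_var l"
proof (rule mps_eqI)
 fix m show "mco (mps_uni l fps_X) m = mco (mps_var l) m" by (auto simp: mps_coeff_uni mps_coeff_var keys_subset_single)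
qed

lemma mps_uni_mult: "mps_uni l (f * g) = mps_uni l f * mps_uni l g"
proof (rule mps_eqI)
 fix m :: "nat \<Rightarrow>\<^sub>0 nat"
 show "mco (mps_uni l (f * g)) m = mco (mps_uni l f * mps_uni l g) m"
 proof (cases "keys m \<subseteq> {l}")
  case True
  define k where "k = lookup m l"
  have m: "m = single l k" using True unfolding k_def by (simp only: keys_subset_single)
  have ms: "msplits m = (\<lambda>i. (single l i, single l (k - i))) ` {0..k}" (is "_ = ?S")
  proof
   show "?S \<subseteq> msplits m" by (auto simp: msplits_def m single_add[symmetric])
   show "msplits m \<subseteq> ?S"
   proof
    fix p assume "p \<in> msplits m"
    then obtain a b where p: "p = (a, b)" "a + b = m" by (cases p) (simp add: msplits_def)
    then have "keys a \<subseteq> {l}" "keys b \<subseteq> {l}" using True keys_add_nat[of a b] by auto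
    then have ab: "a = single l (lookup a l)"
     "b = single l (lookup b l)" by (simp_all only: keys_subset_single)
    have "lookup a l + lookup b l = k" using p(2) unfolding k_def by (metis lookup_add)
    then show "p \<in> ?S" unfolding p(1) by (intro image_eqI[of _ _ "lookup a l"]) (use ab in auto)
   qed
  qed
  have inj: "inj_on (\<lambda>i. (single l i, single l (k - i))) {0..k}"
   by (auto intro!: inj_onI dest!: arg_cong[where f = "\<lambda>p. lookup p l"])
  have "mco (mps_uni l f * mps_uni l g) m = (\<Sum>i=0..k. fps_nth f i * fps_nth g (k - i))"
   unfolding mps_coeff_mult ms sum.reindex[OF inj] by (rule sum.cong) (auto simp: mps_coeff_uni)
  also have "... = mco (mps_uni l (f * g)) m" using True by (simp add: mps_coeff_uni fps_mult_nth k_def)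
  finally show ?thesis ..
 next
  case False
  have "mco (mps_uni l f) (fst p) * mco (mps_uni l g) (snd p) = 0" if "p \<in> msplits m" for p
  proof -
   have "fst p + snd p = m" using that by (cases p) (simp add: msplits_def)
   then have "\<not> keys (fst p) \<subseteq> {l} \<or> \<not> keys (snd p) \<subseteq> {l}"
    using False keys_add_nat[of "fst p" "snd p"] by auto
   then show ?thesis by (auto simp: mps_coeff_uni)
  qed
  then show ?thesis using False by (simp add: mps_coeff_mult mps_coeff_uni)
 qed
qed

lemma mps_uni_power: "mps_uni l (f ^ k) = mps_uni l f ^ k" by (induction k) (simp_all add: mps_uni_mult mps_uni_one)

text \<open>A product of univariate series in distinct variables has at most one contribution to
 each coefficient.\<close>

lemma mps_coeff_prod_uni:
 assumes "finite L" "inj_on \<pi> L"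
 shows "mco (\<Prod>l\<in>L. mps_uni (\<pi> l) (g l)) t =
  (if keys t \<subseteq> \<pi> ` L then \<Prod>l\<in>L. fps_nth (g l) (lookup t (\<pi> l)) else 0)" using assms
proof (induction L arbitrary: t rule: finite_induct)
 case empty
 then show ?case by (auto simp: mps_coeff_one)
next
 case (insert x L)
 have x: "\<pi> x \<notin> \<pi> ` L" and inj: "inj_on \<pi> L" using insert by auto
 \<comment> \<open>\<open>t\<close> is split into its part in the variable \<open>\<pi> x\<close>
   and the rest; injectivity of \<open>\<pi>\<close> forces every contributing splitting to be this
   one.\<close>
 define a where "a = single (\<pi> x) (lookup t (\<pi> x))"
 define b where "b = t - a"
 have lb: "lookup b j = (if j = \<pi> x then 0 else lookup t j)" for j by (simp add: b_def a_def lookup_minus lookup_single)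
 have ab: "a + b = t" by (rule poly_mapping_eqI) (auto simp: lookup_add lb, simp_all add: a_def lookup_single when_def)
 let ?G = "\<Prod>l\<in>L. mps_uni (\<pi> l) (g l)"
 let ?h = "\<lambda>p. mco (mps_uni (\<pi> x) (g x)) (fst p) * mco ?G (snd p)"
 have h0: "?h p = 0" if p: "p \<in> msplits t - {(a, b)}" for p
 proof (rule ccontr)
  assume "?h p ~= 0"
  then have k: "keys (fst p) \<subseteq> {\<pi> x}" "keys (snd p) \<subseteq> \<pi> ` L"
   using insert.IH[OF inj] by (auto simp: mps_coeff_uni split: if_splits)
  have s: "fst p + snd p = t" using p by (cases p) (simp add: msplits_def)
  have "\<pi> x \<notin> keys (snd p)" using k(2) x by blast
  then have "lookup (snd p) (\<pi> x) = 0" by (simp add: in_keys_iff)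
  then have "lookup (fst p) (\<pi> x) = lookup t (\<pi> x)"
   using arg_cong[OF s, of "\<lambda>z. lookup z (\<pi> x)"] by (simp add: lookup_add)
  then have "fst p = a" using k(1) unfolding a_def by (metis keys_subset_single)
  then have "snd p = b" using s ab by (metis add_left_imp_eq)
  with \<open>fst p = a\<close> p show False by (cases p) auto
 qed
 have "{(a, b)} \<subseteq> msplits t" using ab by (simp add: msplits_def)
 then have "mco (mps_uni (\<pi> x) (g x) * ?G) t = (\<Sum>p\<in>{(a, b)}. ?h p)" unfolding mps_coeff_mult
  by (intro sum.mono_neutral_right finite_msplits ballI h0)
 also have "... = fps_nth (g x) (lookup t (\<pi> x)) * mco ?G b" by (simp add: mps_coeff_uni a_def)
 also have "mco ?G b = (if keys t \<subseteq> \<pi> ` insert x L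
   then \<Prod>l\<in>L. fps_nth (g l) (lookup t (\<pi> l)) else 0)"
 proof -
  have "keys b \<subseteq> \<pi> ` L \<longleftrightarrow> keys t \<subseteq> \<pi> ` insert x L"
   by (auto simp: subset_iff in_keys_iff lb)
  moreover have "lookup b (\<pi> l) = lookup t (\<pi> l)" if "l \<in> L" for l
  proof -
   have "\<pi> l ~= \<pi> x" using that x by (metis imageI)
   then show ?thesis by (simp add: lb)
  qed
  ultimately show ?thesis unfolding insert.IH[OF inj] by simp
 qed
 finally show ?case using insert.hyps by simp
qed

text \<open>All coordinate changes that occur send each variable to a one-variable series in a
  permuted variable. Composing and inverting them thus reduces to composition and compositional
  inverses of formal power series in one variable.\<close>

definition msub :: "(nat => 'k::comm_ring_1 fps) => (nat => nat) => 'k mps => 'k mps" where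
 "msub u \<pi> = mps_subst (\<lambda>l. mps_uni (\<pi> l) (u l))"

lemma mps_coeff_monom_uni:
 assumes "inj \<pi>"
 shows "mco (mps_monom (\<lambda>l. mps_uni (\<pi> l) (u l)) m) t =
  (if keys t \<subseteq> \<pi> ` keys m
  then \<Prod>l\<in>keys m. fps_nth (u l ^ lookup m l) (lookup t (\<pi> l)) else 0)"
 unfolding mps_monom_def mps_uni_power[symmetric]
 by (rule mps_coeff_prod_uni) (use assms in \<open>auto intro: inj_on_subset\<close>)

text \<open>Without constant term, the power \<open>u l ^ i\<close> starts in degree at least
  \<open>i\<close>. So an exponent \<open>m\<close> that reaches \<open>t\<close> is bounded at each
  \<open>l\<close> by the value of \<open>t\<close> at \<open>\<pi> l\<close>, which leaves finitely
  many \<open>m\<close>.\<close>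

lemma mps_adm_uni:
 assumes "inj \<pi>" "!!l. fps_nth (u l) 0 = 0"
 shows "mps_adm (\<lambda>l. mps_uni (\<pi> l) (u l :: 'k::idom fps))"
 unfolding mps_adm_def
proof
 fix t :: "nat \<Rightarrow>\<^sub>0 nat"
 let ?K = "\<pi> -` keys t"
 let ?M = "Max (insert 0 (lookup t ` keys t))"
 let ?S = "{m. mco (mps_monom (\<lambda>l. mps_uni (\<pi> l) (u l)) m) t ~= 0}"
 let ?F = "{f. \<forall>x. (x \<in> ?K --> f x \<in> {..?M}) \<and> (x \<notin> ?K --> f x = (0::nat))}"
 have "lookup m \<in> ?F" if "m \<in> ?S" for m
 proof -
  have nz: "fps_nth (u l ^ lookup m l) (lookup t (\<pi> l)) ~= 0" if "l \<in> keys m" for l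
   using \<open>m \<in> ?S\<close> that by (auto simp: mps_coeff_monom_uni[OF assms(1)] split: if_splits)
  have le: "lookup m l \<le> lookup t (\<pi> l)" for l
  proof (cases "l \<in> keys m")
   case True
   show ?thesis
   proof (rule ccontr)
    assume "\<not> ?thesis"
    then have "fps_nth (u l ^ lookup m l) (lookup t (\<pi> l)) = 0"
     using startsby_zero_power_prefix[of "u l" "lookup m l"] assms(2)[of l] by force
    with nz[OF True] show False by simp
   qed
  qed (simp add: in_keys_iff)
  have "lookup m l \<in> {..?M}" if "l \<in> ?K" for l
   unfolding atMost_iff by (rule order.trans[OF le Max_ge]) (use that in auto)
  moreover have "lookup m l = 0" if "l \<notin> ?K" for l using le[of l] that by (simp add: in_keys_iff)
  ultimately show ?thesis by blast
 qed
 then have "lookup ` ?S \<subseteq> ?F" by (rule image_subsetI)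
 moreover have "finite ?F" by (rule finite_set_of_finite_funs) (use finite_vimageI[OF _ assms(1)] in auto)
 ultimately have "finite (lookup ` ?S)" by (rule finite_subset)
 then show "finite ?S" by (rule finite_imageD[where f = lookup]) (rule inj_onI, erule iffD1[OF poly_mapping.lookup_inject])
qed

text \<open>On one-variable series the substitution is composition of formal power series: powers
  beyond the degree \<open>k\<close> of interest start too late to contribute.\<close>

lemma mps_subst_uni:
 assumes "inj \<pi>" "!!l. fps_nth (u l) 0 = 0"
 shows "mps_subst (\<lambda>l. mps_uni (\<pi> l) (u l)) (mps_uni l (f :: 'k::idom fps)) = mps_uni (\<pi> l) (f oo u l)"
proof (rule mps_eqI)
 fix t :: "nat \<Rightarrow>\<^sub>0 nat"
 let ?\<sigma> = "\<lambda>l. mps_uni (\<pi> l) (u l)"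
 define k where "k = lookup t (\<pi> l)"
 have inj: "inj_on (\<lambda>i. single l i) {0..k}" by (auto intro!: inj_onI dest!: arg_cong[where f = "\<lambda>p. lookup p l"])
 have "mco (mps_subst ?\<sigma> (mps_uni l f)) t =
  (\<Sum>m\<in>single l ` {0..k}. mco (mps_uni l f) m * mco (mps_monom ?\<sigma> m) t)"
 proof (rule mps_coeff_subst)
  fix m assume m: "mco (mps_uni l f) m ~= 0" "mco (mps_monom ?\<sigma> m) t ~= 0"
  then have s: "m = single l (lookup m l)" using keys_subset_single[of m l] by (simp add: mps_coeff_uni split: if_splits)
  have "mco (mps_uni (\<pi> l) (u l ^ lookup m l)) t ~= 0" using m(2) by (subst (asm) s) (simp add: mps_uni_power)
  then have "fps_nth (u l ^ lookup m l) k ~= 0" by (simp add: mps_coeff_uni k_def split: if_splits)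
  then have "lookup m l \<le> k" using startsby_zero_power_prefix[of "u l" "lookup m l"] assms(2)[of l]
   by (meson not_le_imp_less)
  then show "m \<in> single l ` {0..k}" using s by auto
 qed simp
 also have "... = (\<Sum>i=0..k. fps_nth f i * mco (mps_uni (\<pi> l) (u l ^ i)) t)"
  unfolding sum.reindex[OF inj] by (rule sum.cong) (auto simp: mps_coeff_uni mps_uni_power)
 also have "... = mco (mps_uni (\<pi> l) (f oo u l)) t" by (simp add: mps_coeff_uni fps_compose_nth k_def)
 finally show "mco (mps_subst ?\<sigma> (mps_uni l f)) t = mco (mps_uni (\<pi> l) (f oo u l)) t" .
qed

lemma msub_uni:
 assumes "inj \<pi>" "!!l. fps_nth (u l) 0 = 0"
 shows "msub u \<pi> (mps_uni l (f :: 'k::idom fps)) = mps_uni (\<pi> l) (f oo u l)"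
 unfolding msub_def by (rule mps_subst_uni[OF assms])

lemma msub_var:
 assumes "inj \<pi>" "!!l. fps_nth (u l) 0 = (0 :: 'k::idom)"
 shows "msub u \<pi> (mps_var l) = mps_uni (\<pi> l) (u l)"
proof -
 have "msub u \<pi> (mps_uni l fps_X) = mps_uni (\<pi> l) (fps_X oo u l)" by (rule msub_uni[OF assms])
 then show ?thesis by (simp add: mps_uni_X assms(2))
qed

text \<open>The variable \<open>l\<close> goes to \<open>v l\<close> in the variable
  \<open>\<rho> l\<close>, which goes to \<open>u (\<rho> l)\<close> in the variable
  \<open>\<pi> (\<rho> l)\<close>; this is the origin of the mixed index in the composite.\<close>

lemma msub_msub:
 fixes u v :: "nat => 'k::idom fps"
 assumes "inj \<pi>" "!!l. fps_nth (u l) 0 = 0" "inj \<rho>" "!!l. fps_nth (v l) 0 = 0"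
 shows "msub u \<pi> (msub v \<rho> f) = msub (\<lambda>l. v l oo u (\<rho> l)) (\<pi> \<circ> \<rho>) f"
 unfolding msub_def by (simp add: mps_subst_subst mps_adm_uni assms mps_subst_uni)

text \<open>A scaled permutation of the variables maps monomials to multiples of monomials, so each
  coefficient of the image comes from a single one. With scalars 1 and -1 this gives the
  coefficients of reflected series. Since \<open>\<pi>\<close> is an involution, its inverse gets no
  separate name.\<close>

lemma mps_coeff_subst_scale:
 fixes c :: "nat => 'k::idom"
 assumes \<pi>: "!!l. \<pi> (\<pi> l) = l" and t': "!!l. lookup t' l = lookup t (\<pi> l)"
 shows "mco (mps_subst (\<lambda>l. mps_uni (\<pi> l) (fps_const (c l) * fps_X)) f) t =
  mco f t' * (\<Prod>l\<in>keys t'. c l ^ lookup t' l)"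
proof -
 let ?\<sigma> = "\<lambda>l. mps_uni (\<pi> l) (fps_const (c l) * fps_X)"
 have inj: "inj \<pi>" by (metis \<pi> injI)
 have p: "fps_nth ((fps_const (c l) * fps_X) ^ i) j = (if j = i then c l ^ i else 0)" for l i j by (simp add: power_mult_distrib)
 have v: "mco (mps_monom ?\<sigma> m) t = (if m = t' then \<Prod>l\<in>keys m. c l ^ lookup m l else 0)" for m
 proof (cases "keys t \<subseteq> \<pi> ` keys m")
  case True
  have "m = t' \<longleftrightarrow> (\<forall>l\<in>keys m. lookup t' l = lookup m l)"
  proof
   assume r: "\<forall>l\<in>keys m. lookup t' l = lookup m l"
   have "lookup m l = lookup t' l" for l
   proof (cases "l \<in> keys m")
    case False
    then have "\<pi> l \<notin> keys t" using True inj by (auto dest: injD)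
    with False show ?thesis by (simp add: in_keys_iff t')
   qed (simp add: r)
   then show "m = t'" by (rule poly_mapping_eqI)
  qed simp
  then show ?thesis unfolding mps_coeff_monom_uni[OF inj] p using True by (auto simp: t' intro!: prod.cong prod_zero)
 next
  case False
  have "keys t \<subseteq> \<pi> ` keys t'"
  proof
   fix l assume "l \<in> keys t"
   then have "\<pi> l \<in> keys t'" by (simp add: in_keys_iff t' \<pi>)
   then show "l \<in> \<pi> ` keys t'" using \<pi>[of l] by (metis imageI)
  qed
  with False show ?thesis unfolding mps_coeff_monom_uni[OF inj] by auto
 qed
 have "mco (mps_subst ?\<sigma> f) t = (\<Sum>m\<in>{t'}. mco f m * mco (mps_monom ?\<sigma> m) t)"
  by (rule mps_coeff_subst) (auto simp: v split: if_splits)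
 then show ?thesis by (simp add: v)
qed

lemma mps_subst_var: "mps_subst mps_var f = (f :: 'k::idom mps)"
proof (rule mps_eqI)
 show "mco (mps_subst mps_var f) t = mco f t" for t
  using mps_coeff_subst_scale[of "\<lambda>l. l" t t "\<lambda>_. 1" f] by (simp add: mps_uni_X)
qed

section \<open>Coordinate changes of fractions of power series\<close>

text \<open>One predicate for all maps of fields that occur: constants, reflections, coordinate
  changes. Over fields it already yields injectivity and compatibility with division.\<close>

definition fhom :: "('a::field => 'b::field) => bool" where
 "fhom h \<longleftrightarrow> (\<forall>x y. h (x + y) = h x + h y) \<and> (\<forall>x y. h (x * y) = h x * h y) \<and> h 1 = 1"

context
 fixes h :: "'a::field => 'b::field"
 assumes h: "fhom h"
begin

lemma fhom_add: "h (x + y) = h x + h y" and fhom_mult: "h (x * y) = h x * h y" and fhom_one: "h 1 = 1"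
 using h by (simp_all add: fhom_def)

lemma fhom_zero: "h 0 = 0"
proof -
 have "h 0 + h 0 = h 0 + 0" using fhom_add[of 0 0] by simp
 then show ?thesis by (rule add_left_imp_eq)
qed

lemma fhom_minus: "h (- x) = - h x" using fhom_add[of x "- x"] by (simp add: fhom_zero eq_neg_iff_add_eq_0 add.commute)

lemma fhom_diff: "h (x - y) = h x - h y" using fhom_add[of x "- y"] by (simp add: fhom_minus)

lemma fhom_eq_0_iff: "h x = 0 \<longleftrightarrow> x = 0"
proof
 assume "h x = 0"
 show "x = 0"
 proof (rule ccontr)
  assume "x ~= 0"
  then have "h x * h (inverse x) = 1" by (simp add: fhom_mult[symmetric] fhom_one)
  with \<open>h x = 0\<close> show False by simp
 qed
qed (simp add: fhom_zero)

lemma fhom_inverse: "h (inverse x) = inverse (h x)"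
proof (cases "x = 0")
 case False
 then have "h x * h (inverse x) = 1" by (simp add: fhom_mult[symmetric] fhom_one)
 then show ?thesis by (metis inverse_unique)
qed (simp add: fhom_zero)

lemma fhom_divide: "h (x / y) = h x / h y" by (simp add: divide_inverse fhom_mult fhom_inverse)

lemma fhom_power: "h (x ^ k) = h x ^ k" by (induction k) (simp_all add: fhom_one fhom_mult)

lemma fhom_prod: "h (prod f A) = (\<Prod>x\<in>A. h (f x))"
 by (induction A rule: infinite_finite_induct) (simp_all add: fhom_one fhom_mult)

lemmas fhom_simps = fhom_add fhom_mult fhom_one fhom_zero fhom_minus fhom_diff fhom_inverse
 fhom_divide fhom_power

end

lemma fhom_eq_iff: "fhom h ==> h x = h y \<longleftrightarrow> x = y" using fhom_eq_0_iff[of h "x - y"] by (simp add: fhom_diff)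

definition ihom :: "('r::idom => 'r) => bool" where
 "ihom h \<longleftrightarrow> inj h \<and> (\<forall>x y. h (x + y) = h x + h y) \<and> (\<forall>x y. h (x * y) = h x * h y) \<and>
  h 1 = 1 \<and> h 0 = 0"

text \<open>\<open>fract_map\<close> works with an arbitrarily chosen representative. Injectivity
  keeps its denominator nonzero, and multiplicativity carries the cross-multiplied equality over to
  the images.\<close>

lemma fract_map_Fract:
 assumes "ihom h" "b ~= 0"
 shows "fract_map h (Fract a b) = Fract (h a) (h b)"
proof -
 let ?P = "\<lambda>p. case p of (a', b') => b' ~= 0 \<and> Fract a b = Fract a' b'"
 obtain a' b' where s: "(SOME p. ?P p) = (a', b')" by (cases "SOME p. ?P p")
 have "?P (a, b)" using assms by simp
 then have "?P (SOME p. ?P p)" by (rule someI)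
 then have b': "b' ~= 0" and "Fract a b = Fract a' b'" by (simp_all add: s)
 then have "a * b' = a' * b" using assms(2) by (simp add: eq_fract)
 then have "h a * h b' = h a' * h b" using assms(1) by (metis ihom_def)
 moreover have "h b ~= 0" "h b' ~= 0" using assms b' by (metis ihom_def injD)+
 ultimately have "Fract (h a) (h b) = Fract (h a') (h b')" by (simp add: eq_fract)
 then show ?thesis by (simp add: fract_map_def s)
qed

lemma ihom_eq_0: "ihom h ==> h x = 0 \<longleftrightarrow> x = 0" by (metis ihom_def injD)

lemma fract_map_hom: assumes "ihom h" shows "fhom (fract_map h)" unfolding fhom_def
proof (intro conjI allI)
 fix x y :: "'a fract"
 obtain a b c d where "x = Fract a b" "b ~= 0" "y = Fract c d" "d ~= 0" by (cases x, cases y) auto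
 then show "fract_map h (x + y) = fract_map h x + fract_map h y"
  "fract_map h (x * y) = fract_map h x * fract_map h y"
  using assms by (simp_all add: fract_map_Fract ihom_eq_0) (simp_all add: ihom_def)
next
 show "fract_map h 1 = 1" using fract_map_Fract[OF assms, of 1 1] assms by (simp add: ihom_def One_fract_def)
qed

lemma fract_map_to_fract: "ihom h ==> fract_map h (to_fract a) = to_fract (h a)"
 using fract_map_Fract[of h 1 a] by (simp add: to_fract_def ihom_def)

lemma fract_map_comp: "ihom g ==> ihom h ==> fract_map g (fract_map h z) = fract_map (g \<circ> h) z"
 by (cases z) (auto simp: fract_map_Fract ihom_eq_0 ihom_def inj_compose)

text \<open>Permutations of the first \<open>n\<close> variables combined with one-variable
  substitutions that are invertible for composition. \<open>\<pi>\<close> fixes all other variables,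
  so series in the first \<open>n\<close> variables stay such.\<close>

definition coord :: "nat => (nat => 'k::field fps) => (nat => nat) => bool" where
 "coord n u \<pi> \<longleftrightarrow> \<pi> permutes {1..n} \<and> (\<forall>l. fps_nth (u l) 0 = 0 \<and> fps_nth (u l) 1 ~= 0)"

text \<open>Hides \<open>u\<close> and \<open>\<pi>\<close>: later arguments use only closure
  properties and the values on the variables.\<close>

definition fcoord :: "nat => ('k::field mps fract => 'k mps fract) => bool" where
 "fcoord n H \<longleftrightarrow> (\<exists>u \<pi>. coord n u \<pi> \<and> H = fract_map (msub u \<pi>))"

lemma coordD:
 assumes "coord n u \<pi>"
 shows "inj \<pi>" "!!l. fps_nth (u l) 0 = 0" "!!l. fps_nth (u l) 1 ~= 0" "\<pi> permutes {1..n}"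
 using assms by (auto simp: coord_def permutes_inj)

lemma msub_id: "msub (\<lambda>_. fps_X) id f = (f :: 'k::idom mps)" by (simp add: msub_def mps_uni_X mps_subst_var)

text \<open>The inverse undoes the permutation and applies to each variable the compositional
  inverse \<open>fps_inv\<close> of the series that arrived there.\<close>

lemma coord_inverse:
 assumes "coord n u \<pi>"
 obtains v \<rho> where "coord n v \<rho>" "!!f. msub u \<pi> (msub v \<rho> f) = f" "!!f. msub v \<rho> (msub u \<pi> f) = f"
proof -
 note c = coordD[OF assms]
 have \<pi>: "\<pi> (inv_into UNIV \<pi> l) = l" "inv_into UNIV \<pi> (\<pi> l) = l" for l
  by (simp_all add: permutes_inverses[OF c(4)])
 define v where "v = (\<lambda>l. fps_inv (u (inv_into UNIV \<pi> l)))"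
 have v: "coord n v (inv_into UNIV \<pi>)" using c(2,3) permutes_inv[OF c(4)] by (auto simp: coord_def v_def fps_inv_def)
 note d = coordD[OF v]
 have "msub u \<pi> (msub v (inv_into UNIV \<pi>) f) = f" for f
 proof -
  have "msub u \<pi> (msub v (inv_into UNIV \<pi>) f) = msub (\<lambda>l. v l oo u (inv_into UNIV \<pi> l)) (\<pi> \<circ> inv_into UNIV \<pi>) f"
   by (rule msub_msub) (use c d in auto)
  moreover have "v l oo u (inv_into UNIV \<pi> l) = fps_X" for l unfolding v_def by (rule fps_inv) (rule c)+
  moreover have "\<pi> \<circ> inv_into UNIV \<pi> = id" by (simp add: fun_eq_iff \<pi>)
  ultimately show ?thesis by (simp add: msub_id)
 qed
 moreover have "msub v (inv_into UNIV \<pi>) (msub u \<pi> f) = f" for f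
 proof -
  have "msub v (inv_into UNIV \<pi>) (msub u \<pi> f) = msub (\<lambda>l. u l oo v (\<pi> l)) (inv_into UNIV \<pi> \<circ> \<pi>) f"
   by (rule msub_msub) (use c d in auto)
  moreover have "u l oo v (\<pi> l) = fps_X" for l unfolding v_def \<pi> by (rule fps_inv_right) (rule c)+
  moreover have "inv_into UNIV \<pi> \<circ> \<pi> = id" by (simp add: fun_eq_iff \<pi>)
  ultimately show ?thesis by (simp add: msub_id)
 qed
 ultimately show ?thesis using that v by blast
qed

lemma coord_ihom: assumes "coord n u \<pi>" shows "ihom (msub u \<pi>)"
proof -
 obtain v \<rho> where "!!f. msub v \<rho> (msub u \<pi> f) = f" by (rule coord_inverse[OF assms]) blast
 then have "inj (msub u \<pi>)" by (metis injI)
 moreover have "mps_adm (\<lambda>l. mps_uni (\<pi> l) (u l))" by (rule mps_adm_uni) (rule coordD[OF assms])+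
 ultimately show ?thesis by (simp add: ihom_def msub_def mps_subst_add mps_subst_mult)
qed

lemma coord_comp:
 assumes "coord n u \<pi>" "coord n v \<rho>"
 shows "coord n (\<lambda>l. v l oo u (\<rho> l)) (\<pi> \<circ> \<rho>)" (is ?g1) "msub u \<pi> \<circ> msub v \<rho> = msub (\<lambda>l. v l oo u (\<rho> l)) (\<pi> \<circ> \<rho>)" (is ?g2)
proof -
 note c = coordD[OF assms(1)] coordD[OF assms(2)]
 show ?g1 using c by (auto simp: coord_def fps_compose_nth intro!: permutes_compose)
 show ?g2 by (rule ext, unfold comp_apply, rule msub_msub[unfolded comp_def]) (use c in auto)
qed

lemma coord_mps_in:
 assumes "coord n u \<pi>" "f \<in> mps_in n"
 shows "msub u \<pi> f \<in> mps_in n"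
 unfolding mps_in_def
proof (intro CollectI allI impI)
 fix t assume t: "mco (msub u \<pi> f) t ~= 0"
 note c = coordD[OF assms(1)]
 let ?c = "\<lambda>m. mco (mps_monom (\<lambda>l. mps_uni (\<pi> l) (u l)) m) t"
 have "\<exists>m. mco f m ~= 0 \<and> ?c m ~= 0"
 proof (rule ccontr)
  assume "\<not> ?thesis"
  then have "mco (msub u \<pi> f) t = (\<Sum>m\<in>{}. mco f m * ?c m)" unfolding msub_def by (intro mps_coeff_subst) auto
  with t show False by simp
 qed
 then obtain m where m: "mco f m ~= 0" "?c m ~= 0" by blast
 then have "keys t \<subseteq> \<pi> ` keys m" by (simp add: mps_coeff_monom_uni[OF c(1)] split: if_splits)
 also have "... \<subseteq> \<pi> ` {1..n}" using m(1) assms(2) by (auto simp: mps_in_def)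
 also have "... = {1..n}" by (rule permutes_image[OF c(4)])
 finally show "keys t \<subseteq> {1..n}" .
qed

lemma fcoord_fhom: "fcoord n H ==> fhom H" unfolding fcoord_def using coord_ihom fract_map_hom by blast

lemma fcoord_fconst: "fcoord n H ==> H (fconst c) = fconst c" unfolding fcoord_def fconst_def
 by (auto simp: fract_map_to_fract[OF coord_ihom]) (simp add: msub_def)

lemma fcoord_comp:
 assumes "fcoord n G" "fcoord n H"
 shows "fcoord n (\<lambda>z. G (H z))"
proof -
 from assms obtain u \<pi> v \<rho> where c: "coord n u \<pi>" "G = fract_map (msub u \<pi>)"
  "coord n v \<rho>" "H = fract_map (msub v \<rho>)" by (auto simp: fcoord_def)
 have "(\<lambda>z. G (H z)) = fract_map (msub u \<pi> \<circ> msub v \<rho>)"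
  by (simp add: c fract_map_comp coord_ihom[OF c(1)] coord_ihom[OF c(3)])
 then show ?thesis unfolding fcoord_def coord_comp(2)[OF c(1,3)] using coord_comp(1)[OF c(1,3)] by blast
qed

lemma fcoord_id: "fcoord n (\<lambda>z. z)"
proof -
 have c: "coord n (\<lambda>_. fps_X) id" by (simp add: coord_def)
 have "fract_map (msub (\<lambda>_. fps_X) id) z = z" for z :: "'a mps fract"
  by (cases z) (simp add: fract_map_Fract[OF coord_ihom[OF c]] msub_id)
 then show ?thesis unfolding fcoord_def using c by (metis ext)
qed

lemma fcoord_inverse:
 assumes "fcoord n H"
 obtains G where "fcoord n G" "!!z. G (H z) = z" "!!z. H (G z) = z"
proof -
 obtain u \<pi> where c: "coord n u \<pi>" "H = fract_map (msub u \<pi>)" using assms unfolding fcoord_def by blast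
 obtain v \<rho> where d: "coord n v \<rho>" "!!f. msub u \<pi> (msub v \<rho> f) = f" "!!f. msub v \<rho> (msub u \<pi> f) = f"
  by (rule coord_inverse[OF c(1)]) blast
 note ih = coord_ihom[OF c(1)] coord_ihom[OF d(1)]
 have i: "fract_map id z = z" for z :: "'a mps fract" by (cases z) (simp add: fract_map_Fract ihom_def)
 have "msub u \<pi> \<circ> msub v \<rho> = id" "msub v \<rho> \<circ> msub u \<pi> = id" by (simp_all add: fun_eq_iff d)
 then have "fract_map (msub v \<rho>) (H z) = z" "H (fract_map (msub v \<rho>) z) = z" for z
  by (simp_all add: c(2) fract_map_comp ih i)
 moreover have "fcoord n (fract_map (msub v \<rho>))" using d(1) by (auto simp: fcoord_def)
 ultimately show ?thesis using that by blast
qed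

text \<open>A coordinate change is a substitution, hence known from the images of the variables.
  Identities between reflections are reduced to variables in this way.\<close>

lemma fcoord_eqI:
 assumes "fcoord n G" "fcoord n H" "!!l. G (fvar l) = H (fvar l)"
 shows "G = H"
proof -
 have *: "H = fract_map (mps_subst \<sigma>)"
  if fH: "fcoord n H" and vH: "!!l. H (fvar l) = to_fract (\<sigma> l)" for H :: "'a mps fract => 'a mps fract" and \<sigma>
 proof -
  obtain u \<pi> where c: "coord n u \<pi>" "H = fract_map (msub u \<pi>)" using fH unfolding fcoord_def by blast
  have "to_fract (mps_uni (\<pi> l) (u l)) = to_fract (\<sigma> l)" for l
   using vH[of l] unfolding c(2) fvar_def fract_map_to_fract[OF coord_ihom[OF c(1)]]
   using msub_var[OF coordD(1,2)[OF c(1)]] by simp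
  then have "(\<lambda>l. mps_uni (\<pi> l) (u l)) = \<sigma>" by (simp)
  then show ?thesis using c(2) by (simp add: msub_def)
 qed
 obtain u \<pi> where c: "coord n u \<pi>" "G = fract_map (msub u \<pi>)" using assms(1) unfolding fcoord_def by blast
 have "G (fvar l) = to_fract (mps_uni (\<pi> l) (u l))" for l unfolding c(2) fvar_def fract_map_to_fract[OF coord_ihom[OF c(1)]]
  using msub_var[OF coordD(1,2)[OF c(1)]] by simp
 with assms(3) have "H (fvar l) = to_fract (mps_uni (\<pi> l) (u l))" for l by metis
 from *[OF assms(2) this] c(2) show ?thesis by (simp add: msub_def)
qed

lemma fcoord_pseries: "fcoord n H ==> z \<in> pseries n ==> H z \<in> pseries n"
 unfolding fcoord_def pseries_def using coord_mps_in coord_ihom by (force simp: fract_map_to_fract)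

lemma fcoord_pfrac: "fcoord n H ==> z \<in> pfrac n ==> H z \<in> pfrac n" unfolding fcoord_def pfrac_def
 by (clarsimp simp: fract_map_Fract[OF coord_ihom]) (metis ihom_eq_0 coord_ihom coord_mps_in)

lemma fcoordI:
 assumes "\<pi> permutes {1..n}" "!!l. fps_nth (u l) 0 = 0" "!!l. fps_nth (u l) 1 ~= 0"
  and "!!l. \<sigma> l = mps_uni (\<pi> l) (u l)"
 shows "fcoord n (fract_map (mps_subst \<sigma>))" "fract_map (mps_subst \<sigma>) (fvar l) = to_fract (\<sigma> l)" (is ?g1)
proof -
 have c: "coord n u \<pi>" using assms by (simp add: coord_def)
 have s: "mps_subst \<sigma> = msub u \<pi>" by (simp add: msub_def assms(4)[symmetric])
 show "fcoord n (fract_map (mps_subst \<sigma>))" using c by (auto simp: fcoord_def s)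
 show ?g1 unfolding s fvar_def fract_map_to_fract[OF coord_ihom[OF c]] using msub_var[OF coordD(1,2)[OF c]] assms(4) by simp
qed

subsection \<open>Constant terms and units\<close>

lemma msplits_0: "msplits 0 = {(0, 0)}" by (auto simp: msplits_def dest: arg_cong[where f = keys] simp: keys_add_nat)

lemma mps_coeff_mult_0: "mco (f * g) 0 = mco f 0 * mco g 0" by (simp add: mps_coeff_mult msplits_0)

lemma mps_in_mult: "f \<in> mps_in n ==> g \<in> mps_in n ==> f * g \<in> mps_in n" for f :: "'a::comm_ring_1 mps"
 unfolding mps_in_def
proof (intro CollectI allI impI)
 fix m assume f: "f \<in> {f. \<forall>m. mco f m ~= 0 --> keys m \<subseteq> {1..n}}"
  and g: "g \<in> {f. \<forall>m. mco f m ~= 0 --> keys m \<subseteq> {1..n}}"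
  and "mco (f * g) m ~= 0"
 then obtain p where p: "p \<in> msplits m" "mco f (fst p) * mco g (snd p) ~= 0" unfolding mps_coeff_mult by (meson sum.neutral)
 then have "mco f (fst p) ~= 0" "mco g (snd p) ~= 0" by auto
 with f g have "keys (fst p) \<subseteq> {1..n}" "keys (snd p) \<subseteq> {1..n}" by auto
 moreover have "m = fst p + snd p" using p(1) by (cases p) (simp add: msplits_def)
 ultimately show "keys m \<subseteq> {1..n}" by (simp add: keys_add_nat)
qed

lemma mps_in_add: "f \<in> mps_in n ==> g \<in> mps_in n ==> f + g \<in> mps_in n" for f :: "'a::comm_ring_1 mps"
 unfolding mps_in_def by (auto simp: subset_iff) (metis add.right_neutral atLeastAtMost_iff One_nat_def add_0)+

lemma mps_in_minus: "f \<in> mps_in n ==> - f \<in> mps_in n" for f :: "'a::comm_ring_1 mps" unfolding mps_in_def by auto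

lemma mps_in_const: "mps_const c \<in> mps_in n" by (auto simp: mps_in_def mps_coeff_const)

lemma mps_in_var: "l \<in> {1..n} ==> mps_var l \<in> mps_in n" by (auto simp: mps_in_def mps_coeff_var)

lemma mdeg_nonzero: assumes "m ~= 0" shows "mdeg m ~= 0"
proof -
 obtain l where "lookup m l ~= 0" using assms by (metis lookup_zero poly_mapping_eqI)
 then show ?thesis by (auto simp: mdeg_def in_keys_iff intro!: exI[of _ l])
qed

text \<open>The recursion solves \<open>f * g = 1\<close> for the coefficient of \<open>g\<close> at
  \<open>m\<close>. Splittings with nonzero first part leave a second part of smaller degree, which
  is the termination argument.\<close>

function mps_inv_coeff :: "'k::field mps => (nat \<Rightarrow>\<^sub>0 nat) => 'k" where
 "mps_inv_coeff f m = (if m = 0 then inverse (mco f 0) else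
  - inverse (mco f 0) * (\<Sum>p\<in>{p \<in> msplits m. fst p ~= 0}. mco f (fst p) * mps_inv_coeff f (snd p)))" by auto
termination
proof (relation "measure (\<lambda>(f, m). mdeg m)")
 fix f :: "'k::field mps" and m :: "nat \<Rightarrow>\<^sub>0 nat" and p
 assume "p \<in> {p \<in> msplits m. fst p ~= 0}"
 then have p: "fst p + snd p = m" "fst p ~= 0" by (auto simp: msplits_def)
 then have "mdeg (fst p) ~= 0" using mdeg_nonzero by blast
 then show "((f, snd p), f, m) \<in> measure (\<lambda>(f, m). mdeg m)" using p(1) by (auto simp: mdeg_add)
qed simp

declare mps_inv_coeff.simps [simp del]

lemma mps_unit_ex:
 fixes f :: "'k::field mps"
 assumes f: "f \<in> mps_in n" and f0: "mco f 0 ~= 0"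
 shows "\<exists>g\<in>mps_in n. f * g = 1"
proof -
 define g where "g = Abs_mps (mps_inv_coeff f)"
 have "f * g = 1"
 proof (rule mps_eqI)
  fix m
  have eq: "msplits m = insert (0, m) {p \<in> msplits m. fst p ~= 0}" by (auto simp: msplits_def)
  have "mco (f * g) m = mco f 0 * mps_inv_coeff f m +
    (\<Sum>p\<in>{p \<in> msplits m. fst p ~= 0}. mco f (fst p) * mps_inv_coeff f (snd p))"
   unfolding mps_coeff_mult g_def mps_coeff_Abs by (subst eq, subst sum.insert) auto
  also have "... = mco 1 m"
  proof (cases "m = 0")
   case True
   have "{p \<in> msplits m. fst p ~= 0} = {}" by (auto simp: msplits_0 True)
   then show ?thesis using True f0 by (simp only: sum.empty) (simp add: mps_inv_coeff.simps[of f 0] mps_coeff_one)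
  next
   case False
   then show ?thesis using f0 by (subst mps_inv_coeff.simps[of f m]) (simp add: mps_coeff_one)
  qed
  finally show "mco (f * g) m = mco 1 m" .
 qed
 \<comment> \<open>The inverse involves no new variables, by induction on the degree along the same
   recursion.\<close>
 moreover have "mps_inv_coeff f m ~= 0 ==> keys m \<subseteq> {1..n}" for m
 proof (induction "mdeg m" arbitrary: m rule: less_induct)
  case less
  show ?case
  proof (cases "m = 0")
   case False
   then have "(\<Sum>p\<in>{p \<in> msplits m. fst p ~= 0}. mco f (fst p) * mps_inv_coeff f (snd p)) ~= 0"
    using less.prems by (subst (asm) mps_inv_coeff.simps[of f m]) simp
   then obtain p where p: "p \<in> msplits m" "fst p ~= 0" "mco f (fst p) ~= 0" "mps_inv_coeff f (snd p) ~= 0"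
    by (rule sum.not_neutral_contains_not_neutral) auto
   have m: "m = fst p + snd p" using p(1) by (cases p) (simp add: msplits_def)
   have "mdeg (fst p) ~= 0" using p(2) by (rule mdeg_nonzero)
   then have "keys (snd p) \<subseteq> {1..n}" using p(4) by (intro less.hyps) (simp_all add: m mdeg_add)
   moreover have "keys (fst p) \<subseteq> {1..n}" using f p(3) by (simp add: mps_in_def)
   ultimately show ?thesis by (simp add: m keys_add_nat)
  qed simp
 qed
 then have "g \<in> mps_in n" by (simp add: g_def mps_in_def)
 ultimately show ?thesis by blast
qed

text \<open>Membership in the power series ring together with the constant term, so that units are
  recognised by arithmetic on constant terms alone.\<close>

definition has_ct :: "nat => 'k::field mps fract => 'k => bool" where
 "has_ct n z c \<longleftrightarrow> (\<exists>f\<in>mps_in n. z = to_fract f \<and> mco f 0 = c)"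

lemma has_ct_fconst: "has_ct n (fconst c) c" unfolding has_ct_def fconst_def using mps_in_const by (auto simp: mps_coeff_const)

lemma fconst_simps: "fconst 1 = 1" "fconst 0 = 0" "fconst (a + b) = fconst a + fconst b"
 "fconst (- a) = - fconst a" "fconst (a - b) = fconst a - fconst b" "fconst (a * b) = fconst a * fconst b"
proof -
 have 1: "mps_const (a + b) = mps_const a + mps_const b" "mps_const (- a) = - mps_const a"
  "mps_const (a - b) = mps_const a - mps_const b" by (rule mps_eqI, simp add: mps_coeff_const)+
 have 2: "mps_const (a * b) = mps_const a * mps_const b" by (metis (mono_tags) mps_uni_const fps_const_mult mps_uni_mult)
 from 1 2 show "fconst 1 = 1" "fconst 0 = 0" "fconst (a + b) = fconst a + fconst b"
 "fconst (- a) = - fconst a" "fconst (a - b) = fconst a - fconst b" "fconst (a * b) = fconst a * fconst b"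
  by (simp_all add: fconst_def mps_const_one mps_const_zero)
qed

lemma fconst_fhom: "fhom fconst" by (simp add: fhom_def fconst_simps)

lemmas fconst_inverse = fhom_inverse[OF fconst_fhom]
 and fconst_eq_0_iff = fhom_eq_0_iff[OF fconst_fhom]

lemma has_ct_1: "has_ct n 1 1" and has_ct_0: "has_ct n 0 0"
 using has_ct_fconst[of n 1] has_ct_fconst[of n 0] by (simp_all add: fconst_simps)

lemma has_ct_add: "has_ct n y b ==> has_ct n z c ==> has_ct n (y + z) (b + c)"
 unfolding has_ct_def by (metis mps_in_add mps_coeff_simps(1) to_fract_add)

lemma has_ct_minus: "has_ct n z c ==> has_ct n (- z) (- c)"
 unfolding has_ct_def by (metis mps_in_minus mps_coeff_simps(3) to_fract_uminus)

lemma has_ct_diff: "has_ct n y b ==> has_ct n z c ==> has_ct n (y - z) (b - c)"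
 using has_ct_add[of n y b "- z" "- c"] has_ct_minus[of n z c] by simp

lemma has_ct_mult: "has_ct n y b ==> has_ct n z c ==> has_ct n (y * z) (b * c)"
 unfolding has_ct_def by (metis mps_in_mult mps_coeff_mult_0 to_fract_mult)

lemma has_ct_power: "has_ct n z c ==> has_ct n (z ^ k) (c ^ k)" by (induction k) (auto intro: has_ct_mult has_ct_1)

lemma has_ct_inverse:
 assumes "has_ct n z c" "c ~= 0"
 shows "has_ct n (inverse z) (inverse c)" "z ~= 0"
proof -
 obtain f where f: "f \<in> mps_in n" "z = to_fract f" "mco f 0 = c" using assms(1) by (auto simp: has_ct_def)
 then obtain g where g: "g \<in> mps_in n" "f * g = 1" using mps_unit_ex assms(2) by blast
 have zg: "z * to_fract g = 1" using g(2) by (simp add: f(2) to_fract_mult[symmetric])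
 have "c * mco g 0 = 1" using g(2) f(3) mps_coeff_mult_0[of f g] by (simp add: mps_coeff_one)
 then have "mco g 0 = inverse c" by (metis inverse_unique)
 moreover have "inverse z = to_fract g" using zg by (metis inverse_unique)
 ultimately show "has_ct n (inverse z) (inverse c)" using g(1) by (auto simp: has_ct_def)
 show "z ~= 0" using zg by auto
qed

lemma has_ct_divide: "has_ct n y b ==> has_ct n z c ==> c ~= 0 ==> has_ct n (y / z) (b / c)"
 by (simp add: divide_inverse has_ct_mult has_ct_inverse)

lemma has_ct_fvar: "l \<in> {1..n} ==> has_ct n (fvar l) 0" unfolding has_ct_def fvar_def using mps_in_var[of l n]
 by (auto simp: mps_coeff_var intro!: bexI[of _ "mps_var l"] dest: arg_cong[where f = keys])

lemma has_ct_hXat: "l \<in> {1..n} ==> has_ct n (hXat mu l) (mu l)"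
 using has_ct_add[OF has_ct_fconst has_ct_fvar] by (force simp: hXat_def)

lemma pseries_iff: "z \<in> pseries n \<longleftrightarrow> (\<exists>c. has_ct n z c)" by (auto simp: pseries_def has_ct_def)

lemma pseries_closed:
 "fconst c \<in> pseries n" "0 \<in> pseries n" "1 \<in> pseries n"
 "y \<in> pseries n ==> z \<in> pseries n ==> y + z \<in> pseries n"
 "y \<in> pseries n ==> z \<in> pseries n ==> y - z \<in> pseries n"
 "y \<in> pseries n ==> z \<in> pseries n ==> y * z \<in> pseries n"
 "y \<in> pseries n ==> - y \<in> pseries n"
 "l \<in> {1..n} ==> fvar l \<in> pseries n" unfolding pseries_iff
 by (force intro: has_ct_fconst has_ct_0 has_ct_1 has_ct_add has_ct_diff has_ct_mult has_ct_minus has_ct_fvar)+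

lemma pseries_pfrac: "z \<in> pseries n ==> z \<in> pfrac n"
proof -
 assume "z \<in> pseries n"
 then obtain f where f: "f \<in> mps_in n" "z = Fraction_Field.Fract f 1" by (auto simp: pseries_def to_fract_def)
 have "(1 :: 'a mps) \<in> mps_in n" using mps_in_const[of "1 :: 'a" n] by (simp add: mps_const_one)
 with f show ?thesis unfolding pfrac_def using one_neq_zero[where 'a = "'a mps"] by blast
qed

text \<open>\<open>y = 0\<close> is harmless, since division by zero gives zero. In this form
  closure under all field operations follows from closure properties of
  \<open>pseries n\<close>.\<close>

lemma pfrac_iff: "z \<in> pfrac n \<longleftrightarrow> (\<exists>x\<in>pseries n. \<exists>y\<in>pseries n. z = x / y)"
proof
 assume "z \<in> pfrac n"
 then show "\<exists>x\<in>pseries n. \<exists>y\<in>pseries n. z = x / y"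
  by (auto simp: pfrac_def pseries_def Fract_conv_to_fract)
next
 assume "\<exists>x\<in>pseries n. \<exists>y\<in>pseries n. z = x / y"
 then obtain f g where fg: "f \<in> mps_in n" "g \<in> mps_in n" "z = to_fract f / to_fract g" by (auto simp: pseries_def)
 show "z \<in> pfrac n"
 proof (cases "g = 0")
  case True
  then show ?thesis using fg pseries_pfrac[OF pseries_closed(2)] by simp
 next
  case False
  then show ?thesis using fg by (auto simp: pfrac_def Fract_conv_to_fract)
 qed
qed

lemma pfrac_closed:
 fixes y z :: "'k::field mps fract" and c :: 'k
 shows "fconst c \<in> pfrac n" "0 \<in> (pfrac n :: 'k mps fract set)" "1 \<in> (pfrac n :: 'k mps fract set)"
 "y \<in> pfrac n ==> z \<in> pfrac n ==> y + z \<in> pfrac n"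
 "y \<in> pfrac n ==> z \<in> pfrac n ==> y - z \<in> pfrac n" (is "PROP ?g1")
 "y \<in> pfrac n ==> z \<in> pfrac n ==> y * z \<in> pfrac n"
 "y \<in> pfrac n ==> - y \<in> pfrac n"
 "y \<in> pfrac n ==> inverse y \<in> pfrac n"
 "y \<in> pfrac n ==> z \<in> pfrac n ==> y / z \<in> pfrac n" (is "PROP ?g2")
 "l \<in> {1..n} ==> fvar l \<in> (pfrac n :: 'k mps fract set)" (is "PROP ?g3")
 "l \<in> {1..n} ==> hXat mu l \<in> (pfrac n :: 'k mps fract set)" (is "PROP ?g4")
proof -
 note pc = pseries_closed
 show c: "fconst c \<in> pfrac n" "0 \<in> (pfrac n :: 'k mps fract set)" "1 \<in> (pfrac n :: 'k mps fract set)"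
  "PROP ?g3" by (rule pseries_pfrac, rule pc, assumption?)+
 show add: "y \<in> pfrac n ==> z \<in> pfrac n ==> y + z \<in> pfrac n" for y z :: "'k mps fract"
 proof -
  assume "y \<in> pfrac n" "z \<in> pfrac n"
  then obtain a b c d where *: "a \<in> pseries n" "b \<in> pseries n" "c \<in> pseries n" "d \<in> pseries n"
   "y = a / b" "z = c / d" by (auto simp: pfrac_iff)
  show "y + z \<in> pfrac n"
  proof (cases "b = 0 \<or> d = 0")
   case True
   then show ?thesis using \<open>y \<in> _\<close> \<open>z \<in> _\<close> by (auto simp: *)
  next
   case False
   then have "y + z = (a * d + c * b) / (b * d)" by (simp add: * add_frac_eq)
   moreover have "a * d + c * b \<in> pseries n" "b * d \<in> pseries n" using * by (simp_all add: pc(4,6))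
   ultimately show ?thesis unfolding pfrac_iff by blast
  qed
 qed
 show mult: "y \<in> pfrac n ==> z \<in> pfrac n ==> y * z \<in> pfrac n" for y z :: "'k mps fract"
 proof -
  assume "y \<in> pfrac n" "z \<in> pfrac n"
  then obtain a b c d where *: "a \<in> pseries n" "b \<in> pseries n" "c \<in> pseries n" "d \<in> pseries n"
   "y = a / b" "z = c / d" by (auto simp: pfrac_iff)
  then have "y * z = (a * c) / (b * d)" by simp
  moreover have "a * c \<in> pseries n" "b * d \<in> pseries n" using * by (simp_all add: pc(6))
  ultimately show ?thesis unfolding pfrac_iff by blast
 qed
 show neg: "y \<in> pfrac n ==> - y \<in> pfrac n" for y :: "'k mps fract"
  using mult[OF pseries_pfrac[OF pc(7)[OF pc(3)]], of y] by simp
 show "PROP ?g1" using add[of y "- z"] neg by simp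
 show inv: "y \<in> pfrac n ==> inverse y \<in> pfrac n" for y :: "'k mps fract" unfolding pfrac_iff by (metis inverse_divide)
 show "PROP ?g2" unfolding divide_inverse by (intro mult inv)
 show "PROP ?g4" unfolding hXat_def by (intro add pseries_pfrac[OF pc(1)] c)
qed

lemma pfrac_power: "y \<in> pfrac n ==> y ^ k \<in> pfrac n" by (induction k) (auto intro: pfrac_closed)

subsection \<open>Divided differences\<close>

lemma mps_coeff_var_mult:
 "mco (mps_var l * g) t = (if lookup t l = 0 then 0 else mco g (t - single l 1))"
proof (cases "lookup t l = 0")
 case True
 have "fst p ~= single l 1" if "p \<in> msplits t" for p using that True by (cases p) (auto simp: msplits_def lookup_add)
 then show ?thesis using True by (simp add: mps_coeff_mult mps_coeff_var)
next
 case False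
 have "lookup (single l 1 + (t - single l 1)) j = lookup t j" for j
  using False by (auto simp: lookup_add lookup_minus lookup_single when_def)
 then have s: "single l 1 + (t - single l 1) = t" by (rule poly_mapping_eqI)
 have "mco (mps_var l * g) t = (\<Sum>p\<in>msplits t. if p = (single l 1, t - single l 1)
   then mco g (t - single l 1) else 0)" unfolding mps_coeff_mult
 proof (rule sum.cong[OF refl])
  fix p assume "p \<in> msplits t"
  then have p: "fst p + snd p = t" by (cases p) (simp add: msplits_def)
  then have "fst p = single l 1 ==> snd p = t - single l 1" using s by (metis add_left_imp_eq)
  then show "mco (mps_var l) (fst p) * mco g (snd p) = (if p = (single l 1, t - single l 1)
   then mco g (t - single l 1) else 0)" by (cases p) (auto simp: mps_coeff_var)
 qed
 also have "... = mco g (t - single l 1)" using s by (subst sum.delta[OF finite_msplits]) (auto simp: msplits_def)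
 finally show ?thesis using False by simp
qed

lemma mps_var_dvd:
 assumes "f \<in> mps_in n" "!!t. lookup t l = 0 ==> mco f t = 0"
 shows "\<exists>g\<in>mps_in n. f = mps_var l * g"
proof (rule bexI[of _ "Abs_mps (\<lambda>m. mco f (m + single l 1))"])
 have "t - single l 1 + single l 1 = t" if "lookup t l ~= 0" for t :: "nat \<Rightarrow>\<^sub>0 nat"
  using that by (intro poly_mapping_eqI) (auto simp: lookup_add lookup_minus lookup_single when_def)
 then show "f = mps_var l * Abs_mps (\<lambda>m. mco f (m + single l 1))"
  using assms(2) by (intro mps_eqI) (auto simp: mps_coeff_var_mult)
 show "Abs_mps (\<lambda>m. mco f (m + single l 1)) \<in> mps_in n"
  using assms(1) unfolding mps_in_def by (force simp: keys_add_nat)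
qed

text \<open>A series whose coefficients sum to zero along the directions exchanging \<open>x\<close> and \<open>y\<close> is
 divisible by \<open>x - y\<close>; the quotient is given by partial sums.\<close>

lemma mps_var_diff_dvd:
 fixes f :: "'k::comm_ring_1 mps"
 assumes "f \<in> mps_in n" and xy: "x ~= y" "x \<in> {1..n}" "y \<in> {1..n}"
  and sum0: "!!t b. lookup t x = 0 ==> lookup t y = 0 ==>
   (\<Sum>i\<le>b. mco f (t + single x i + single y (b - i))) = 0"
 shows "\<exists>g\<in>mps_in n. f = (mps_var x - mps_var y) * g"
proof -
 let ?s = "single :: nat => nat => nat \<Rightarrow>\<^sub>0 nat"
 let ?r = "\<lambda>m. m - ?s x (lookup m x) - ?s y (lookup m y)"
 \<comment> \<open>In \<open>f = (x - y) * g\<close> the coefficients satisfy f(a, b) = g(a - 1, b)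
   - g(a, b - 1), where a and b are the exponents of \<open>x\<close> and \<open>y\<close>. Solving
   along the line of constant a + b gives g(a, b) as the sum of f(a + 1 + i, b - i) over i up to
   b.\<close>
 define g where "g = Abs_mps (\<lambda>m. \<Sum>i\<le>lookup m y.
  mco f (?r m + ?s x (lookup m x + 1 + i) + ?s y (lookup m y - i)))"
 have g: "mco g (t + ?s x a + ?s y b) = (\<Sum>i\<le>b. mco f (t + ?s x (a + 1 + i) + ?s y (b - i)))"
  if t: "lookup t x = 0" "lookup t y = 0" for t a b
 proof -
  have l: "lookup (t + ?s x a + ?s y b) x = a" "lookup (t + ?s x a + ?s y b) y = b"
   using t xy(1) by (auto simp: lookup_add lookup_single)
  have "?r (t + ?s x a + ?s y b) = t" unfolding l by (rule poly_mapping_eqI) (auto simp: lookup_add lookup_minus)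
  then show ?thesis unfolding g_def mps_coeff_Abs l by simp
 qed
 have "g \<in> mps_in n" unfolding mps_in_def
 proof (intro CollectI allI impI)
  fix m assume "mco g m ~= 0"
  then obtain i where "mco f (?r m + ?s x (lookup m x + 1 + i) + ?s y (lookup m y - i)) ~= 0"
   unfolding g_def mps_coeff_Abs by (meson sum.neutral)
  then have k: "keys (?r m) \<subseteq> {1..n}" using assms(1) unfolding mps_in_def by (force simp: keys_add_nat)
  have "l \<in> keys (?r m) \<or> l = x \<or> l = y" if "l \<in> keys m" for l
   using that by (auto simp: in_keys_iff lookup_minus lookup_single when_def)
  then show "keys m \<subseteq> {1..n}" using k xy(2,3) by blast
 qed
 moreover have "f = (mps_var x - mps_var y) * g"
 proof (rule mps_eqI)
  fix m
  define a b t where "a = lookup m x" and "b = lookup m y" and "t = ?r m"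
  have t: "lookup t x = 0" "lookup t y = 0" by (auto simp: t_def lookup_minus)
  have m: "m = t + ?s x a + ?s y b"
   using xy(1) by (intro poly_mapping_eqI) (auto simp: t_def a_def b_def lookup_add lookup_minus lookup_single when_def)
  have la: "lookup m x = a" "lookup m y = b" by (simp_all add: a_def b_def)
  have mx: "m - ?s x 1 = t + ?s x (a - 1) + ?s y b" if "a ~= 0"
   unfolding m using that xy(1) t by (intro poly_mapping_eqI) (auto simp: lookup_add lookup_minus lookup_single when_def)
  have my: "m - ?s y 1 = t + ?s x a + ?s y (b - 1)" if "b ~= 0"
   unfolding m using that xy(1) t by (intro poly_mapping_eqI) (auto simp: lookup_add lookup_minus lookup_single when_def)
  have gx: "mco (mps_var x * g) m = (if a = 0 then 0 else (\<Sum>i\<le>b. mco f (t + ?s x (a + i) + ?s y (b - i))))"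
   by (auto simp: mps_coeff_var_mult la mx[unfolded One_nat_def] g[OF t])
  have gy: "mco (mps_var y * g) m = (\<Sum>i<b. mco f (t + ?s x (a + Suc i) + ?s y (b - Suc i)))"
  proof (cases "b = 0")
   case False
   then show ?thesis by (auto simp: mps_coeff_var_mult la my[unfolded One_nat_def] g[OF t] intro!: sum.cong)
  qed (simp add: mps_coeff_var_mult la)
  have split: "(\<Sum>i\<le>b. mco f (t + ?s x (a + i) + ?s y (b - i))) =
   mco f m + (\<Sum>i<b. mco f (t + ?s x (a + Suc i) + ?s y (b - Suc i)))" by (subst sum.atMost_shift) (simp add: m)
  show "mco f m = mco ((mps_var x - mps_var y) * g) m"
  proof (cases "a = 0")
   case True
   \<comment> \<open>For \<open>a = 0\<close> there is no term g(a - 1, b); here the vanishing of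
     the full sum along the line enters.\<close>
   have "mco f m + (\<Sum>i<b. mco f (t + ?s x (a + Suc i) + ?s y (b - Suc i))) = 0" using sum0[OF t, of b] split True by simp
   then show ?thesis using True by (simp only: left_diff_distrib mps_coeff_simps gx gy) (simp add: eq_neg_iff_add_eq_0)
  next
   case False
   then show ?thesis by (simp only: left_diff_distrib mps_coeff_simps gx gy split) simp
  qed
 qed
 ultimately show ?thesis by blast
qed

section \<open>Normal forms in the hyperoctahedral group\<close>

text \<open>The homogeneous Coxeter relations of type B, with the double bond between 0 and 1, each
  available in both directions. The quadratic relations are kept apart: in the two algebras the
  square of a generator is not 1 but a combination of shorter words.\<close>

inductive bmove :: "nat list => nat list => bool" where
 comm: "i + 1 < j \<or> j + 1 < i ==> bmove [i, j] [j, i]"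
| braid: "1 \<le> i ==> bmove [i, i + 1, i] [i + 1, i, i + 1]"
| braid': "1 \<le> i ==> bmove [i + 1, i, i + 1] [i, i + 1, i]"
| four: "bmove [0, 1, 0, 1] [1, 0, 1, 0]"
| four': "bmove [1, 0, 1, 0] [0, 1, 0, 1]"

inductive beq :: "nat list => nat list => bool" where
 base: "beq u u"
| step: "bmove l r ==> beq (a @ r @ b) v ==> beq (a @ l @ b) v"

lemma beq_trans: "beq u v ==> beq v w ==> beq u w" by (induction rule: beq.induct) (auto intro: beq.step)

lemma beq_append: "beq u v ==> beq (a @ u @ b) (a @ v @ b)"
proof (induction rule: beq.induct)
 case (step l r a' b' v)
 show ?case using beq.step[OF step.hyps(1), of "a @ a'" "b' @ b" "a @ v @ b"] step.IH by simp
qed (rule beq.base)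

lemma beq_Cons: "beq u v ==> beq (k # u) (k # v)" using beq_append[of u v "[k]" "[]"] by simp

lemma beq_move: "bmove l r ==> beq (a @ l @ b) (a @ r @ b)" by (rule beq.step[OF _ beq.base])

lemma bmove_length_set: "bmove l r ==> length l = length r \<and> set l = set r" by (auto elim!: bmove.cases)

lemma beq_length_set: "beq u v ==> length u = length v \<and> set u = set v"
 by (induction rule: beq.induct) (auto dest: bmove_length_set)

lemma beq_commute_word:
 "(!!j. j \<in> set w ==> k + 1 < j \<or> j + 1 < k) ==> beq (k # w) (w @ [k])"
proof (induction w)
 case (Cons j w)
 have "beq (k # j # w) (j # k # w)" using beq_move[OF bmove.comm[of k j], of "[]" w] Cons.prems by simp
 moreover have "beq (j # k # w) (j # w @ [k])" using Cons by (intro beq_Cons) auto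
 ultimately show ?case by (auto intro: beq_trans)
qed (simp add: beq.base)

text \<open>Representatives of minimal length for the cosets of the subgroup on the letters below
  \<open>m\<close> in the group on the letters up to \<open>m\<close>. The two families have
  \<open>m + 2\<close> and \<open>m\<close> members, together the index \<open>2 * (m + 1)\<close>;
  \<open>a = Suc m\<close> is the empty word, and \<open>b = 0\<close> would repeat
  \<open>a = 0\<close>.\<close>

definition nf_cosets :: "nat => nat list set" where
 "nf_cosets m = {[a..<Suc m] | a. a \<le> Suc m} \<union> {rev [1..<Suc b] @ [0..<Suc m] | b. 1 \<le> b \<and> b \<le> m}"

fun nf :: "nat => nat list set" where
 "nf 0 = {[]}"
| "nf (Suc m) = {c @ w | c w. c \<in> nf_cosets m \<and> w \<in> nf m}"

lemma upt_split: "a \<le> i ==> i \<le> b ==> [a..<b] = [a..<i] @ [i..<b]" using upt_add_eq_append[of a i "b - i"] by simp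

text \<open>The letter \<open>k\<close> commutes as far as \<open>k - 1\<close>, one braid move
  turns it into \<open>k - 1\<close> on the other side of the pair, and that letter commutes with
  the rest. \<open>2 \<le> k\<close> keeps away from the double bond.\<close>

lemma beq_up:
 assumes "a < k" "k \<le> m" "2 \<le> k"
 shows "beq (k # [a..<Suc m]) ([a..<Suc m] @ [k - 1])"
proof -
 obtain j where k: "k = Suc j" and j: "1 \<le> j" using assms(3) by (cases k) auto
 let ?L = "[a..<j]" and ?R = "[Suc (Suc j)..<Suc m]"
 have e: "[a..<Suc m] = ?L @ [j, Suc j] @ ?R" using assms k upt_split[of a j "Suc m"] by (simp add: upt_conv_Cons)
 have 1: "beq (k # ?L) (?L @ [k])" by (rule beq_commute_word) (use k in auto)
 have 2: "beq (?L @ [Suc j, j, Suc j] @ ?R) (?L @ [j, Suc j, j] @ ?R)" using beq_move[OF bmove.braid'[OF j], of ?L ?R] by simp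
 have 3: "beq (j # ?R) (?R @ [j])" by (rule beq_commute_word) auto
 have "beq (k # [a..<Suc m]) (?L @ [Suc j, j, Suc j] @ ?R)"
  using beq_append[OF 1, of "[]" "[j, Suc j] @ ?R"] unfolding e by (simp del: upt_Suc add: k)
 moreover have "beq (?L @ [j, Suc j, j] @ ?R) (?L @ [j, Suc j] @ ?R @ [j])"
  using beq_append[OF 3, of "?L @ [j, Suc j]" "[]"] by simp
 ultimately have "beq (k # [a..<Suc m]) (?L @ [j, Suc j] @ ?R @ [j])" using 2 beq_trans by blast
 then show ?thesis unfolding e by (simp add: k)
qed

text \<open>Deodhar's alternative for a minimal coset representative \<open>c\<close> and a letter
  \<open>k\<close>: the product is a representative again, or it shortens (visible as a doubled
  letter), or it stays in the coset and equals \<open>c\<close> times a letter \<open>k'\<close> of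
  the subgroup.\<close>

lemma beq_coset:
 assumes "k \<le> m" "c \<in> nf_cosets m"
 shows "(\<exists>c'\<in>nf_cosets m. beq (k # c) c') \<or> (\<exists>u a x. beq (k # c) (u @ a # a # x)) \<or>
  (\<exists>k'<m. beq (k # c) (c @ [k']))" using assms(2)[unfolded nf_cosets_def]
proof (elim UnE CollectE exE conjE)
 fix a assume c: "c = [a..<Suc m]" and a: "a \<le> Suc m"
 consider "k + 1 = a" | "k + 1 < a" | "k = a" | "a < k" "2 \<le> k" | "a = 0" "k = 1" by linarith
 then show ?thesis
 proof cases
  case 1
  then have "k # c = [k..<Suc m]" using assms(1) c by (simp add: upt_conv_Cons)
  then have "k # c \<in> nf_cosets m" using assms(1) unfolding nf_cosets_def by auto
  then show ?thesis using beq.base by blast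
 next
  case 2
  have "beq (k # c) (c @ [k])" by (rule beq_commute_word) (use 2 c in auto)
  moreover have "k < m" using 2 a by linarith
  ultimately show ?thesis by blast
 next
  case 3
  then have "k # c = [] @ k # k # [Suc k..<Suc m]" using assms(1) c by (simp add: upt_conv_Cons)
  then show ?thesis using beq.base by metis
 next
  case 4
  have "beq (k # c) (c @ [k - 1])" unfolding c by (rule beq_up) (use 4 assms in auto)
  moreover have "k - 1 < m" using 4 assms(1) by linarith
  ultimately show ?thesis by blast
 next
  case 5
  \<comment> \<open>The letter 1 in front of the full ascending word starts the second family with
    \<open>b = 1\<close>.\<close>
  have "k # c = rev [1..<Suc 1] @ [0..<Suc m]" by (simp add: 5 c)
  then have "k # c \<in> nf_cosets m" using assms(1) 5(2) unfolding nf_cosets_def by blast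
  then show ?thesis using beq.base by blast
 qed
next
 fix b assume c: "c = rev [1..<Suc b] @ [0..<Suc m]" and b: "1 \<le> b" "b \<le> m"
 consider "k = b + 1" | "k = b" | "b + 1 < k" | "1 \<le> k" "k < b" | "k = 0" by linarith
 then show ?thesis
 proof cases
  case 1
  then have "k # c = rev [1..<Suc k] @ [0..<Suc m]" "1 \<le> k" by (simp_all add: c)
  then have "k # c \<in> nf_cosets m" using assms(1) unfolding nf_cosets_def by blast
  then show ?thesis using beq.base by blast
 next
  case 2
  then have "k # c = [] @ k # k # rev [1..<k] @ [0..<Suc m]" using b by (simp add: c)
  then show ?thesis using beq.base by metis
 next
  case 3
  have 1: "beq (k # rev [1..<Suc b]) (rev [1..<Suc b] @ [k])" by (rule beq_commute_word) (use 3 in auto)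
  have 2: "beq (k # [0..<Suc m]) ([0..<Suc m] @ [k - 1])" by (rule beq_up) (use 3 assms in auto)
  have "beq (k # c) (c @ [k - 1])"
   unfolding c using beq_append[OF 1, of "[]" "[0..<Suc m]"] beq_append[OF 2, of "rev [1..<Suc b]" "[]"]
   by (auto intro: beq_trans)
  moreover have "k - 1 < m" using 3 assms(1) by linarith
  ultimately show ?thesis by blast
 next
  case 4
  \<comment> \<open>\<open>k\<close> becomes \<open>k + 1\<close> when it crosses the descending
    part, and comes back to \<open>k\<close> when it crosses the ascending part.\<close>
  let ?L = "rev [k + 2..<Suc b]" and ?R = "rev [1..<k]" and ?U = "[0..<Suc m]"
  have e: "rev [1..<Suc b] = ?L @ [k + 1, k] @ ?R" using 4 upt_split[of 1 k "Suc b"] by (simp add: upt_conv_Cons)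
  have 1: "beq (k # ?L) (?L @ [k])" by (rule beq_commute_word) auto
  have 2: "beq (?L @ [k, k + 1, k] @ ?R @ ?U) (?L @ [k + 1, k, k + 1] @ ?R @ ?U)" by (rule beq_move[OF bmove.braid[OF 4(1)]])
  have 3: "beq ((k + 1) # ?R) (?R @ [k + 1])" by (rule beq_commute_word) auto
  have 5: "beq ((k + 1) # ?U) (?U @ [k + 1 - 1])" by (rule beq_up) (use 4 b in auto)
  have s: "beq (k # c) (?L @ [k, k + 1, k] @ ?R @ ?U)"
   using beq_append[OF 1, of "[]" "[k + 1, k] @ ?R @ ?U"] unfolding c e by simp
  have t: "beq (?L @ [k + 1, k, k + 1] @ ?R @ ?U) (?L @ [k + 1, k] @ ?R @ (k + 1) # ?U)"
   using beq_append[OF 3, of "?L @ [k + 1, k]" ?U] by simp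
  have u: "beq (?L @ [k + 1, k] @ ?R @ (k + 1) # ?U) (c @ [k])"
   using beq_append[OF 5, of "?L @ [k + 1, k] @ ?R" "[]"] unfolding c e by simp
  have "beq (k # c) (c @ [k])" by (rule beq_trans[OF s beq_trans[OF 2 beq_trans[OF t u]]])
  moreover have "k < m" using 4 b by linarith
  ultimately show ?thesis by blast
 next
  case 5
  \<comment> \<open>The letter 0 reaches the middle \<open>1, 0, 1\<close> by commutations and the
    relation of the double bond passes it through unchanged. This is the only place where the
    rewriting uses that relation.\<close>
  let ?L = "rev [2..<Suc b]" and ?R = "[2..<Suc m]"
  have e: "c = ?L @ [1, 0, 1] @ ?R" unfolding c using b by (simp add: upt_conv_Cons numeral_2_eq_2)
  have 1: "beq (0 # ?L) (?L @ [0])" by (rule beq_commute_word) auto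
  have 2: "beq (?L @ [0, 1, 0, 1] @ ?R) (?L @ [1, 0, 1, 0] @ ?R)" by (rule beq_move[OF bmove.four])
  have 3: "beq (0 # ?R) (?R @ [0])" by (rule beq_commute_word) auto
  have s: "beq (k # c) (?L @ [0, 1, 0, 1] @ ?R)" using beq_append[OF 1, of "[]" "[1, 0, 1] @ ?R"] unfolding e by (simp add: 5)
  have t: "beq (?L @ [1, 0, 1, 0] @ ?R) (c @ [0])" using beq_append[OF 3, of "?L @ [1, 0, 1]" "[]"] unfolding e by simp
  have "beq (k # c) (c @ [0])" by (rule beq_trans[OF s beq_trans[OF 2 t]])
  moreover have "0 < m" using b by linarith
  ultimately show ?thesis by blast
 qed
qed

text \<open>Reduction without quadratic relations has to stop at a doubled letter, hence the second
  alternative; each user then applies its own quadratic relation.\<close>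

lemma nf_exists:
 assumes "set w \<subseteq> {..<m}"
 obtains v where "beq w v" "v \<in> nf m \<or> (\<exists>u a x. v = u @ a # a # x)"
proof -
 have "\<exists>v. beq w v \<and> (v \<in> nf m \<or> (\<exists>u a x. v = u @ a # a # x))" using assms
 proof (induction m arbitrary: w)
  case 0
  then show ?case using beq.base by auto
 next
  case (Suc m)
  note IH = Suc.IH
  show ?case using Suc.prems
  proof (induction w)
   case Nil
   have "[] \<in> nf_cosets m" by (auto simp: nf_cosets_def intro!: exI[of _ "Suc m"])
   moreover have "[] \<in> nf m" using IH[of "[]"] by (auto dest: beq_length_set)
   ultimately have "[] \<in> nf (Suc m)" by force
   then show ?case using beq.base by blast
  next
   case (Cons k w)
   then have "set w \<subseteq> {..<Suc m}" by simp
   from Cons.IH[OF this]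
   obtain v where v: "beq w v" "v \<in> nf (Suc m) \<or> (\<exists>u a x. v = u @ a # a # x)" by blast
   note kv = beq_Cons[OF v(1), of k]
   from v(2) show ?case
   proof
    assume "\<exists>u a x. v = u @ a # a # x"
    then obtain u a x where "k # v = (k # u) @ a # a # x" by auto
    then show ?thesis using kv by blast
   next
    assume "v \<in> nf (Suc m)"
    then obtain c x where cx: "v = c @ x" "c \<in> nf_cosets m" "x \<in> nf m" by auto
    have "k \<le> m" using Cons.prems by auto
    from beq_coset[OF this cx(2)] consider
     c' where "c' \<in> nf_cosets m" "beq (k # c) c'" | u a y where "beq (k # c) (u @ a # a # y)"
     | k' where "k' < m" "beq (k # c) (c @ [k'])" by blast
    then show ?thesis
    proof cases
     case 1
     then have "beq (k # v) (c' @ x)" using beq_append[of "k # c" c' "[]" x] cx(1) by simp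
     moreover have "c' @ x \<in> nf (Suc m)" using 1 cx by auto
     ultimately show ?thesis using beq_trans[OF kv] by blast
    next
     case 2
     then have "beq (k # v) (u @ a # a # (y @ x))" using beq_append[of "k # c" "u @ a # a # y" "[]" x] cx(1) by simp
     then show ?thesis using beq_trans[OF kv] by blast
    next
     case 3
     \<comment> \<open>\<open>k'\<close> now stands in front of a word in letters below
       \<open>m\<close>, so the outer induction applies to \<open>k' # x\<close>.\<close>
     then have 4: "beq (k # v) (c @ k' # x)" using beq_append[of "k # c" "c @ [k']" "[]" x] cx(1) by simp
     have "set x \<subseteq> {..<m}"
     proof -
      have "set x' \<subseteq> {..<j}" if "x' \<in> nf j" for x' j using that
       by (induction j arbitrary: x') (fastforce simp: nf_cosets_def)+
      then show ?thesis using cx(3) by blast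
     qed
     then obtain z where z: "beq (k' # x) z" "z \<in> nf m \<or> (\<exists>u a x. z = u @ a # a # x)"
      using IH[of "k' # x"] 3(1) by auto
     have 5: "beq (k # w) (c @ z)" using beq_trans[OF kv beq_trans[OF 4]] beq_append[OF z(1), of c "[]"] by simp
     from z(2) show ?thesis
     proof
      assume "z \<in> nf m"
      then have "c @ z \<in> nf (Suc m)" using cx by auto
      with 5 show ?thesis by blast
     next
      assume "\<exists>u a x. z = u @ a # a # x"
      then obtain u a x where "c @ z = (c @ u) @ a # a # x" by auto
      with 5 show ?thesis by blast
     qed
    qed
   qed
  qed
 qed
 with that show ?thesis by blast
qed

lemma nf_set: "w \<in> nf m ==> set w \<subseteq> {..<m}" by (induction m arbitrary: w) (fastforce simp: nf_cosets_def)+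

lemma finite_nf: "finite (nf m)"
proof (induction m)
 case (Suc m)
 have "nf_cosets m = (\<lambda>a. [a..<Suc m]) ` {..Suc m} \<union> (\<lambda>b. rev [1..<Suc b] @ [0..<Suc m]) ` {1..m}"
  by (auto simp: nf_cosets_def)
 then have "finite (nf_cosets m)" by simp
 moreover have "nf (Suc m) = (\<lambda>(c, w). c @ w) ` (nf_cosets m \<times> nf m)" by auto
 ultimately show ?case using Suc by simp
qed simp

section \<open>Signed permutations, which tell the normal forms apart\<close>

definition sperm :: "nat => int => int" where
 "sperm k i = (if k = 0 then (if \<bar>i\<bar> = 1 then - i else i)
  else if \<bar>i\<bar> = int k then sgn i * (int k + 1)
  else if \<bar>i\<bar> = int k + 1 then sgn i * int k else i)"

lemma sperm_sperm: "sperm k (sperm k i) = i" by (auto simp: sperm_def abs_if sgn_if split: if_splits)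

lemma foldr_sperm_inj: "foldr sperm w i = foldr sperm w j ==> i = j"
proof (induction w)
 case (Cons a w)
 then show ?case by (metis foldr_Cons comp_apply sperm_sperm)
qed simp

text \<open>The coset representatives send \<open>m + 1\<close> to \<open>2 * (m + 1)\<close>
  different values: this family yields -1 and the numbers from 1 to \<open>m + 1\<close>, the other
  one the numbers from -2 down to \<open>- (m + 1)\<close>.\<close>

lemma foldr_sperm_up: "a \<le> Suc m ==> foldr sperm [a..<Suc m] (int m + 1) = (if a = 0 then - 1 else int a)"
proof (induction a rule: inc_induct)
 case base
 then show ?case by simp
next
 case (step a)
 then have "[a..<Suc m] = a # [Suc a..<Suc m]" by (simp add: upt_conv_Cons)
 then have "foldr sperm [a..<Suc m] (int m + 1) = sperm a (int (Suc a))" using step.IH by (simp del: upt_Suc)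
 also have "sperm a (int (Suc a)) = (if a = 0 then - 1 else int a)" by (simp add: sperm_def)
 finally show ?case .
qed

lemma foldr_sperm_down: "foldr sperm (rev [1..<Suc b]) (- 1) = - (int b + 1)"
proof (induction b)
 case (Suc b)
 have "rev [1..<Suc (Suc b)] = Suc b # rev [1..<Suc b]" by simp
 then have "foldr sperm (rev [1..<Suc (Suc b)]) (- 1) = sperm (Suc b) (- (int b + 1))" using Suc.IH by (simp del: upt_Suc)
 moreover have "sperm (Suc b) (- (int b + 1)) = - (int (Suc b) + 1)" by (simp add: sperm_def)
 ultimately show ?case by simp
qed simp

text \<open>Words in the letters below \<open>m\<close> fix \<open>m + 1\<close>, so the image of
  \<open>m + 1\<close> identifies the coset representative; cancelling it leaves the case of smaller
  \<open>m\<close>.\<close>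

lemma nf_inj:
 assumes "u \<in> nf m" "v \<in> nf m" "!!i. i \<in> {1..int m} ==> foldr sperm u i = foldr sperm v i"
 shows "u = v"
 using assms
proof (induction m arbitrary: u v)
 case (Suc m)
 obtain c x where u: "u = c @ x" "c \<in> nf_cosets m" "x \<in> nf m" using Suc.prems(1) by auto
 obtain d z where v: "v = d @ z" "d \<in> nf_cosets m" "z \<in> nf m" using Suc.prems(2) by auto
 have fx: "foldr sperm w (int m + 1) = int m + 1" if "set w \<subseteq> {..<m}" for w
  using that by (induction w) (auto simp: sperm_def)
 have cd: "foldr sperm c (int m + 1) = foldr sperm d (int m + 1)"
  using Suc.prems(3)[of "int m + 1"] fx[OF nf_set[OF u(3)]] fx[OF nf_set[OF v(3)]] by (simp add: u v)
 have val: "(\<exists>a\<le>Suc m. c = [a..<Suc m] \<and> foldr sperm c (int m + 1) = (if a = 0 then - 1 else int a)) \<or>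
  (\<exists>b. 1 \<le> b \<and> c = rev [1..<Suc b] @ [0..<Suc m] \<and> foldr sperm c (int m + 1) = - (int b + 1))"
  if "c \<in> nf_cosets m" for c using that[unfolded nf_cosets_def]
 proof (elim UnE CollectE exE conjE)
  fix a assume "c = [a..<Suc m]" "a \<le> Suc m"
  then show ?thesis using foldr_sperm_up[of a m] by blast
 next
  fix b assume b: "c = rev [1..<Suc b] @ [0..<Suc m]" "1 \<le> b" "b \<le> m"
  have "foldr sperm c (int m + 1) = foldr sperm (rev [1..<Suc b]) (- 1)"
   using foldr_sperm_up[of 0 m] unfolding b(1) foldr_append comp_apply by simp
  then show ?thesis using b foldr_sperm_down by metis
 qed
 have "c = d" using val[OF u(2)] val[OF v(2)] cd by (auto simp del: upt_Suc split: if_splits)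
 moreover have "x = z"
 proof (rule Suc.IH[OF u(3) v(3)])
  fix i assume "i \<in> {1..int m}"
  then have "foldr sperm c (foldr sperm x i) = foldr sperm c (foldr sperm z i)"
   using Suc.prems(3)[of i] \<open>c = d\<close> by (simp add: u v)
  then show "foldr sperm x i = foldr sperm z i" by (rule foldr_sperm_inj)
 qed
 ultimately show ?case by (simp add: u v)
qed simp

lemma sperm_range: "k < n ==> 1 \<le> \<bar>i\<bar> \<and> \<bar>i\<bar> \<le> int n ==> 1 \<le> \<bar>sperm k i\<bar> \<and> \<bar>sperm k i\<bar> \<le> int n"
 by (auto simp: sperm_def abs_mult split: if_splits)

section \<open>Reflection systems on functions\<close>

text \<open>Dedekind's argument: the relation at \<open>mul z x\<close> minus
  \<open>\<chi> j z\<close> times the relation at \<open>x\<close> no longer contains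
  \<open>j\<close>. The arguments form just a multiplicatively closed set \<open>X\<close>, because
  the later test functions are the coefficient vectors of a completion.\<close>

lemma dedekind_independence:
 fixes \<chi> :: "'i => 'b => 'c::field"
 assumes "finite I"
  and mul: "!!x y. x \<in> X ==> y \<in> X ==> mul x y \<in> X"
  and \<chi>: "!!i x y. i \<in> I ==> x \<in> X ==> y \<in> X ==> \<chi> i (mul x y) = \<chi> i x * \<chi> i y"
  and one: "e \<in> X" "!!i. i \<in> I ==> \<chi> i e ~= 0"
  and dist: "!!i j. i \<in> I ==> j \<in> I ==> i ~= j ==> \<exists>x\<in>X. \<chi> i x ~= \<chi> j x"
  and "!!x. x \<in> X ==> (\<Sum>i\<in>I. a i * \<chi> i x) = 0"
  and "i \<in> I"
 shows "a i = 0"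
 using assms(1) \<chi> one(2) dist assms(7-)
proof (induction I arbitrary: a i rule: finite_induct)
 case (insert j I)
 have z: "a i * (\<chi> i z - \<chi> j z) = 0" if "i \<in> I" "z \<in> X" for i z
 proof (rule insert.IH[of "\<lambda>i. a i * (\<chi> i z - \<chi> j z)"])
  fix x assume x: "x \<in> X"
  have "(\<Sum>i\<in>I. a i * (\<chi> i z - \<chi> j z) * \<chi> i x) =
    (\<Sum>i\<in>insert j I. a i * \<chi> i (mul z x)) - \<chi> j z * (\<Sum>i\<in>insert j I. a i * \<chi> i x)"
   using insert.hyps insert.prems(1) x that(2) by (simp add: sum_distrib_left sum_subtractf[symmetric] algebra_simps)
  then show "(\<Sum>i\<in>I. a i * (\<chi> i z - \<chi> j z) * \<chi> i x) = 0"
   using insert.prems(4)[OF x] insert.prems(4)[OF mul[OF that(2) x]] by simp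
 qed (use insert.prems that in auto)
 have aI: "a i = 0" if i: "i \<in> I" for i
 proof -
  have "i ~= j" using i insert.hyps by blast
  then obtain x where "x \<in> X" "\<chi> i x ~= \<chi> j x" using insert.prems(3)[of i j] i by blast
  then show ?thesis using z[OF i, of x] by simp
 qed
 have "(\<Sum>i\<in>insert j I. a i * \<chi> i e) = a j * \<chi> j e" using insert.hyps aI by simp
 then have "a j * \<chi> j e = 0" using insert.prems(4)[OF one(1)] by simp
 then have "a j = 0" using insert.prems(2)[of j] by simp
 with aI insert.prems(5) show ?case by blast
qed simp

definition supp :: "'a set => ('a => 'c::zero) set" where
 "supp V = {F. \<forall>mu. mu \<notin> V --> F mu = 0}"

lemma supportedI: "(!!mu. mu \<notin> V ==> F mu = 0) ==> F \<in> supp V" by (simp add: supp_def)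

lemma supp_closed:
 fixes F G :: "'a => 'c::comm_ring_1"
 shows "F \<in> supp V ==> G \<in> supp V ==> (\<lambda>mu. F mu + G mu) \<in> supp V"
  "F \<in> supp V ==> G \<in> supp V ==> (\<lambda>mu. F mu - G mu) \<in> supp V"
  "G \<in> supp V ==> (\<lambda>mu. f mu * G mu) \<in> supp V"
  "F \<in> supp V ==> (\<lambda>mu. F mu * f mu) \<in> supp V"
  "(\<lambda>mu. 0) \<in> supp V"
  "vec V f \<in> supp V"
  "nu \<in> V ==> at_idem nu c \<in> supp V" by (auto simp: supp_def vec_def at_idem_def)

lemma supp_sum:
 "(!!i. i \<in> I ==> F i \<in> supp V) ==> (\<lambda>mu. \<Sum>i\<in>I. F i mu) \<in> supp V" by (simp add: supp_def)

locale refl_sys =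
 fixes V :: "'a set" and n :: nat and S :: "nat => ('a => 'c::field) => 'a => 'c"
  and y :: "int => 'a => 'c"
 assumes S_supp: "k < n ==> F \<in> supp V ==> S k F \<in> supp V"
  and S_add: "k < n ==> F \<in> supp V ==> G \<in> supp V ==>
   S k (\<lambda>mu. F mu + G mu) = (\<lambda>mu. S k F mu + S k G mu)"
  and S_mult: "k < n ==> F \<in> supp V ==> G \<in> supp V ==>
   S k (\<lambda>mu. F mu * G mu) = (\<lambda>mu. S k F mu * S k G mu)"
  and S_one: "k < n ==> S k (vec V (\<lambda>_. 1)) = vec V (\<lambda>_. 1)"
  and S_sq: "k < n ==> F \<in> supp V ==> S k (S k F) = F"
  and S_bmove: "bmove l r ==> set l \<subseteq> {..<n} ==> F \<in> supp V ==> foldr S l F = foldr S r F"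
  and S_y: "k < n ==> 1 \<le> \<bar>i\<bar> \<and> \<bar>i\<bar> \<le> int n ==> S k (vec V (y i)) = vec V (y (sperm k i))"
  and y_inj: "mu \<in> V ==> 1 \<le> \<bar>i\<bar> \<and> \<bar>i\<bar> \<le> int n ==> 1 \<le> \<bar>j\<bar> \<and> \<bar>j\<bar> \<le> int n ==> y i mu = y j mu ==> i = j"
begin

abbreviation "FF \<equiv> supp V :: ('a => 'c) set"
abbreviation "Sw \<equiv> foldr S"

lemma S_zero: "k < n ==> S k (\<lambda>_. 0) = (\<lambda>_. 0)"
proof -
 assume "k < n"
 then have "S k (\<lambda>mu. 0 + 0) = (\<lambda>mu. S k (\<lambda>_. 0) mu + S k (\<lambda>_. 0) mu)"
  by (intro S_add supp_closed)
 then have "S k (\<lambda>_. 0) mu + 0 = S k (\<lambda>_. 0) mu + S k (\<lambda>_. 0) mu" for mu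
  by (auto dest: fun_cong[of _ _ mu])
 then show ?thesis by (metis add_left_imp_eq)
qed

lemma S_sum:
 assumes "k < n" "!!i. i \<in> I ==> F i \<in> FF"
 shows "S k (\<lambda>mu. \<Sum>i\<in>I. F i mu) = (\<lambda>mu. \<Sum>i\<in>I. S k (F i) mu)"
 using assms(2)
proof (induction I rule: infinite_finite_induct)
 case (insert x I)
 then have "S k (\<lambda>mu. F x mu + (\<Sum>i\<in>I. F i mu)) = (\<lambda>mu. S k (F x) mu + S k (\<lambda>mu. \<Sum>i\<in>I. F i mu) mu)"
  by (intro S_add assms(1) supp_sum) auto
 with insert show ?case by simp
qed (use S_zero[OF assms(1)] in simp_all)

lemma S_eq_0: "k < n ==> F \<in> FF ==> S k F = (\<lambda>_. 0) ==> F = (\<lambda>_. 0)" by (metis S_sq S_zero)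

lemma Sw_supp: "set w \<subseteq> {..<n} ==> F \<in> FF ==> Sw w F \<in> FF" by (induction w) (auto intro: S_supp)

lemma Sw_mult: "set w \<subseteq> {..<n} ==> F \<in> FF ==> G \<in> FF ==>
 Sw w (\<lambda>mu. F mu * G mu) = (\<lambda>mu. Sw w F mu * Sw w G mu)" by (induction w) (auto simp: S_mult Sw_supp)

lemma Sw_one: "set w \<subseteq> {..<n} ==> Sw w (vec V (\<lambda>_. 1)) = vec V (\<lambda>_. 1)"
 by (induction w) (auto simp: S_one)

lemma Sw_eq_0: "set w \<subseteq> {..<n} ==> F \<in> FF ==> Sw w F = (\<lambda>_. 0) ==> F = (\<lambda>_. 0)"
 by (induction w) (auto dest: S_eq_0 intro: Sw_supp)

lemma Sw_zero: "set w \<subseteq> {..<n} ==> Sw w (\<lambda>_. 0) = (\<lambda>_. 0)" by (induction w) (auto simp: S_zero)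

lemma Sw_y: "set w \<subseteq> {..<n} ==> 1 \<le> \<bar>i\<bar> \<and> \<bar>i\<bar> \<le> int n ==>
 Sw w (vec V (y i)) = vec V (y (foldr sperm w i)) \<and> 1 \<le> \<bar>foldr sperm w i\<bar> \<and> \<bar>foldr sperm w i\<bar> \<le> int n"
proof (induction w)
 case (Cons k w)
 then have k: "k < n" by simp
 have IH: "Sw w (vec V (y i)) = vec V (y (foldr sperm w i))" "1 \<le> \<bar>foldr sperm w i\<bar> \<and> \<bar>foldr sperm w i\<bar> \<le> int n"
  using Cons by auto
 show ?case using S_y[OF k IH(2)] sperm_range[OF k IH(2)] IH(1) by simp
qed simp

lemma beq_Sw: "beq u v ==> set u \<subseteq> {..<n} ==> F \<in> FF ==> Sw u F = Sw v F"
proof (induction rule: beq.induct)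
 case (step l r a b v)
 then have "Sw l (Sw b F) = Sw r (Sw b F)" by (intro S_bmove Sw_supp) auto
 moreover have "set (a @ r @ b) \<subseteq> {..<n}" using step bmove_length_set by auto
 ultimately show ?case using step by simp
qed simp

text \<open>Here squares are 1, so a doubled letter is simply deleted. The length never grows, on
  which the filtration \<open>low\<close> relies.\<close>

lemma Sw_nf:
 assumes "set w \<subseteq> {..<n}"
 obtains v where "v \<in> nf n" "length v \<le> length w" "!!F. F \<in> FF ==> Sw w F = Sw v F"
proof -
 have "\<exists>v. v \<in> nf n \<and> length v \<le> length w \<and> (\<forall>F\<in>FF. Sw w F = Sw v F)" using assms
 proof (induction "length w" arbitrary: w rule: less_induct)
  case less
  obtain v where v: "beq w v" "v \<in> nf n \<or> (\<exists>u a x. v = u @ a # a # x)" using nf_exists[OF less.prems] by metis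
  have wv: "Sw w F = Sw v F" if "F \<in> FF" for F using beq_Sw[OF v(1) less.prems that] .
  have lv: "length w = length v" "set v \<subseteq> {..<n}" using beq_length_set[OF v(1)] less.prems by auto
  from v(2) show ?case
  proof
   assume "v \<in> nf n"
   then show ?thesis using wv lv by auto
  next
   assume "\<exists>u a x. v = u @ a # a # x"
   then obtain u a x where e: "v = u @ a # a # x" by blast
   have "set (u @ x) \<subseteq> {..<n}" "length (u @ x) < length w" using lv e by auto
   then obtain z where "z \<in> nf n" "length z \<le> length (u @ x)" "\<forall>F\<in>FF. Sw (u @ x) F = Sw z F"
    using less.hyps by blast
   moreover have "Sw v F = Sw (u @ x) F" if "F \<in> FF" for F using lv(2) that by (simp add: e S_sq Sw_supp)
   ultimately show ?thesis using wv \<open>length (u @ x) < length w\<close> by (intro exI[of _ z]) auto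
  qed
 qed
 with that show ?thesis by blast
qed

text \<open>For fixed \<open>mu\<close>, the value of \<open>Sw w g\<close> at \<open>mu\<close> is
  a character of the multiplicative set \<open>M\<close>. The functions \<open>y i\<close> separate
  these characters, as different normal forms are different signed permutations.\<close>

lemma Sw_independent:
 assumes M: "M \<subseteq> FF" "!!f g. f \<in> M ==> g \<in> M ==> (\<lambda>mu. f mu * g mu) \<in> M" "vec V (\<lambda>_. 1) \<in> M"
   "!!i. i \<in> {1..int n} ==> vec V (y i) \<in> M" and mu: "mu \<in> V"
  and 0: "!!g. g \<in> M ==> (\<Sum>w\<in>nf n. a w * Sw w g mu) = 0"
  and w: "w \<in> nf n"
 shows "a w = 0"
proof (rule dedekind_independence[where I = "nf n" and X = M and mul = "\<lambda>f g mu. f mu * g mu" and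
   \<chi> = "\<lambda>w g. Sw w g mu" and e = "vec V (\<lambda>_. 1)"])
 fix w f g assume "w \<in> nf n" "f \<in> M" "g \<in> M"
 then show "Sw w (\<lambda>mu. f mu * g mu) mu = Sw w f mu * Sw w g mu" using M(1) by (subst Sw_mult) (auto dest: nf_set)
next
 fix w assume "w \<in> nf n"
 then show "Sw w (vec V (\<lambda>_. 1)) mu ~= 0"
  using mu unfolding Sw_one[OF nf_set[OF \<open>w \<in> nf n\<close>]] by (simp add: vec_def)
next
 fix u v assume uv: "u \<in> nf n" "v \<in> nf n" "u ~= v"
 then obtain i where i: "i \<in> {1..int n}" "foldr sperm u i ~= foldr sperm v i" using nf_inj by blast
 then have "1 \<le> \<bar>i\<bar> \<and> \<bar>i\<bar> \<le> int n" by auto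
 note uy = Sw_y[OF nf_set[OF uv(1)] this] and vy = Sw_y[OF nf_set[OF uv(2)] this]
 have "Sw u (vec V (y i)) mu ~= Sw v (vec V (y i)) mu"
  using uy vy i(2) mu y_inj[OF mu, of "foldr sperm u i" "foldr sperm v i"] by (auto simp: vec_def)
 then show "\<exists>x\<in>M. Sw u x mu ~= Sw v x mu" using M(4) i(1) by blast
qed (use M 0 w finite_nf in auto)

text \<open>Combinations of the reflections for normal forms shorter than \<open>d\<close>. The
  coefficients are functions on \<open>V\<close>, so this is a length filtration of a twisted group
  ring.\<close>

definition low :: "nat => (('a => 'c) => 'a => 'c) set" where
 "low d = {L. \<exists>c. (\<forall>v. c v \<in> FF) \<and> (\<forall>v. d \<le> length v --> c v = (\<lambda>_. 0)) \<and>
  (\<forall>F\<in>FF. L F = (\<lambda>mu. \<Sum>v\<in>nf n. c v mu * Sw v F mu))}"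

lemma lowI:
 "(!!v. c v \<in> FF) ==> (!!v. d \<le> length v ==> c v = (\<lambda>_. 0)) ==>
  (!!F. F \<in> FF ==> L F = (\<lambda>mu. \<Sum>v\<in>nf n. c v mu * Sw v F mu)) ==> L \<in> low d" unfolding low_def by blast

lemma low_mono: "L \<in> low d ==> d \<le> d' ==> L \<in> low d'" unfolding low_def by (blast intro: order.trans)

lemma low_add:
 assumes "L \<in> low d" "L' \<in> low d"
 shows "(\<lambda>F mu. L F mu + L' F mu) \<in> low d"
proof -
 obtain c where c: "!!v. c v \<in> FF" "!!v. d \<le> length v ==> c v = (\<lambda>_. 0)"
  "!!F. F \<in> FF ==> L F = (\<lambda>mu. \<Sum>v\<in>nf n. c v mu * Sw v F mu)" using assms(1) unfolding low_def by blast
 obtain c' where c': "!!v. c' v \<in> FF" "!!v. d \<le> length v ==> c' v = (\<lambda>_. 0)"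
  "!!F. F \<in> FF ==> L' F = (\<lambda>mu. \<Sum>v\<in>nf n. c' v mu * Sw v F mu)" using assms(2) unfolding low_def by blast
 show ?thesis by (rule lowI[where c = "\<lambda>v mu. c v mu + c' v mu"])
   (simp_all add: c c' supp_closed distrib_right sum.distrib)
qed

lemma low_zero: "(\<lambda>F mu. 0) \<in> low d" by (rule lowI[where c = "\<lambda>_ _. 0"]) (simp_all add: supp_closed)

lemma low_sum: "(!!i. i \<in> I ==> L i \<in> low d) ==> (\<lambda>F mu. \<Sum>i\<in>I. L i F mu) \<in> low d"
 by (induction I rule: infinite_finite_induct) (simp_all add: low_zero low_add)

lemma low_scale:
 assumes "L \<in> low d"
 shows "(\<lambda>F mu. f mu * L F mu) \<in> low d"
proof -
 obtain c where c: "!!v. c v \<in> FF" "!!v. d \<le> length v ==> c v = (\<lambda>_. 0)"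
  "!!F. F \<in> FF ==> L F = (\<lambda>mu. \<Sum>v\<in>nf n. c v mu * Sw v F mu)" using assms(1) unfolding low_def by blast
 show ?thesis by (rule lowI[where c = "\<lambda>v mu. f mu * c v mu"]) (simp_all add: c supp_closed sum_distrib_left mult.assoc)
qed

lemma low_cong: "L \<in> low d ==> (!!F. F \<in> FF ==> L F = L' F) ==> L' \<in> low d" unfolding low_def by auto

lemma low_Sw:
 assumes "set w \<subseteq> {..<n}" "length w < d" "f \<in> FF"
 shows "(\<lambda>F mu. f mu * Sw w F mu) \<in> low d"
proof -
 obtain v where v: "v \<in> nf n" "length v \<le> length w" "!!F. F \<in> FF ==> Sw w F = Sw v F"
  using Sw_nf[OF assms(1)] by metis
 show ?thesis
 proof (rule lowI[where c = "\<lambda>u mu. if u = v then f mu else 0"])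
  fix F assume "F \<in> FF"
  then show "(\<lambda>mu. f mu * Sw w F mu) = (\<lambda>mu. \<Sum>u\<in>nf n. (if u = v then f mu else 0) * Sw u F mu)"
   using v(1,3) finite_nf by (auto simp: if_distrib[of "\<lambda>z. z * _"] cong: if_cong)
 qed (use assms v(2) in \<open>auto simp: supp_def fun_eq_iff\<close>)
qed

lemma low_S:
 assumes "L \<in> low d" "k < n"
 shows "(\<lambda>F. S k (L F)) \<in> low (Suc d)"
proof -
 obtain c where c: "!!v. c v \<in> FF" "!!v. d \<le> length v ==> c v = (\<lambda>_. 0)"
  "!!F. F \<in> FF ==> L F = (\<lambda>mu. \<Sum>v\<in>nf n. c v mu * Sw v F mu)" using assms(1) unfolding low_def by blast
 have "(\<lambda>F mu. \<Sum>v\<in>nf n. S k (c v) mu * Sw (k # v) F mu) \<in> low (Suc d)"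
 proof (rule low_sum)
  fix v assume v: "v \<in> nf n"
  show "(\<lambda>F mu. S k (c v) mu * Sw (k # v) F mu) \<in> low (Suc d)"
  proof (cases "d \<le> length v")
   case True
   then show ?thesis using low_zero assms(2) by (simp add: c(2) S_zero)
  next
   case False
   then show ?thesis using nf_set[OF v] assms(2) by (intro low_Sw S_supp c) auto
  qed
 qed
 then show ?thesis
 proof (rule low_cong)
  fix F assume F: "F \<in> FF"
  have s: "Sw v F \<in> FF" if "v \<in> nf n" for v using Sw_supp[OF nf_set[OF that] F] .
  show "(\<lambda>mu. \<Sum>v\<in>nf n. S k (c v) mu * Sw (k # v) F mu) = S k (L F)"
   unfolding c(3)[OF F] by (subst S_sum[OF assms(2)]) (auto simp: s c(1) S_mult assms(2) supp_closed)
 qed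
qed

end

text \<open>The shape shared by the \<open>\<tau>\<^sub>k\<close> and the \<open>T\<^sub>k\<close>:
  a multiple of the identity plus a nowhere vanishing multiple of a reflection.\<close>

locale refl_ops = refl_sys V n S y
 for V :: "'a set" and n :: nat and S :: "nat => ('a => 'c::field) => 'a => 'c" and y :: "int => 'a => 'c" +
 fixes t :: "nat => ('a => 'c) => 'a => 'c" and A B :: "nat => 'a => 'c"
 assumes t_eq: "k < n ==> F \<in> supp V ==> t k F = (\<lambda>mu. A k mu * F mu + B k mu * S k F mu)"
  and B_nz: "k < n ==> mu \<in> V ==> B k mu ~= 0"
begin

abbreviation "tw \<equiv> foldr t"

lemma t_supp: "k < n ==> F \<in> FF ==> t k F \<in> FF" by (simp add: t_eq supp_closed S_supp)

lemma tw_supp: "set w \<subseteq> {..<n} ==> F \<in> FF ==> tw w F \<in> FF" by (induction w) (auto intro: t_supp)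

text \<open>The operators \<open>tw w\<close> are triangular in the \<open>Sw w\<close> with respect to the length.\<close>

lemma tw_leading:
 assumes "set w \<subseteq> {..<n}"
 obtains b L where "b \<in> FF" "!!mu. mu \<in> V ==> b mu ~= 0" "L \<in> low (length w)"
  "!!F. F \<in> FF ==> tw w F = (\<lambda>mu. b mu * Sw w F mu + L F mu)"
proof -
 have "\<exists>b L. b \<in> FF \<and> (\<forall>mu\<in>V. b mu ~= 0) \<and> L \<in> low (length w) \<and>
  (\<forall>F\<in>FF. tw w F = (\<lambda>mu. b mu * Sw w F mu + L F mu))" using assms
 proof (induction w)
  case Nil
  show ?case
  proof (intro exI[of _ "vec V (\<lambda>_. 1)"] exI[of _ "\<lambda>F mu. 0"] conjI ballI)
   fix F assume "F \<in> FF"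
   then show "tw [] F = (\<lambda>mu. vec V (\<lambda>_. 1) mu * Sw [] F mu + 0)" by (auto simp: vec_def supp_def)
  qed (auto simp: vec_def low_zero supp_def)
 next
  case (Cons k w)
  then obtain b L where bL: "b \<in> FF" "!!mu. mu \<in> V ==> b mu ~= 0" "L \<in> low (length w)"
   "!!F. F \<in> FF ==> tw w F = (\<lambda>mu. b mu * Sw w F mu + L F mu)" by auto
  have k: "k < n" and w: "set w \<subseteq> {..<n}" using Cons.prems by auto
  define b' where "b' = (\<lambda>mu. B k mu * S k b mu)"
  define L' where "L' = (\<lambda>F mu. (\<lambda>F mu. A k mu * (\<lambda>F mu. b mu * Sw w F mu + L F mu) F mu) F mu + (\<lambda>F mu. B k mu * S k (L F) mu) F mu)"
  \<comment> \<open>\<open>b\<close> is invertible on \<open>V\<close>, and \<open>S k\<close>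
    respects products and the unit, so \<open>S k b\<close> is invertible too. As \<open>S k\<close>
    moves components, there is no pointwise argument.\<close>
  have "S k b mu ~= 0" if "mu \<in> V" for mu
  proof -
   define c where "c = (\<lambda>mu. inverse (b mu))"
   have c: "c \<in> FF" using bL(1) by (auto simp: supp_def c_def)
   have "(\<lambda>mu. b mu * c mu) = vec V (\<lambda>_. 1)" using bL(1,2) by (auto simp: vec_def supp_def c_def)
   then have "(\<lambda>mu. S k b mu * S k c mu) = vec V (\<lambda>_. 1)" using S_mult[OF k bL(1) c] S_one[OF k] by simp
   from fun_cong[OF this, of mu] that show ?thesis by (auto simp: vec_def)
  qed
  then have "\<forall>mu\<in>V. b' mu ~= 0" using B_nz[OF k] by (simp add: b'_def)
  moreover have "b' \<in> FF" unfolding b'_def by (intro supp_closed S_supp k bL)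
  moreover have "L' \<in> low (length (k # w))" unfolding L'_def
  proof (rule low_add, rule low_scale, rule low_add)
   show "(\<lambda>F mu. b mu * Sw w F mu) \<in> low (length (k # w))" by (rule low_Sw[OF w _ bL(1)]) simp
   show "L \<in> low (length (k # w))" by (rule low_mono[OF bL(3)]) simp
   have "(\<lambda>F. S k (L F)) \<in> low (length (k # w))" using low_S[OF bL(3) k] by simp
   then show "(\<lambda>F mu. B k mu * S k (L F) mu) \<in> low (length (k # w))" by (rule low_scale)
  qed
  moreover have "tw (k # w) F = (\<lambda>mu. b' mu * Sw (k # w) F mu + L' F mu)" if F: "F \<in> FF" for F
  proof -
   have sF: "Sw w F \<in> FF" by (rule Sw_supp[OF w F])
   have lF: "L F \<in> FF"
   proof -
    have "L F = (\<lambda>mu. tw w F mu - b mu * Sw w F mu)" using bL(4)[OF F] by auto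
    then show ?thesis using tw_supp[OF w F] sF by (simp add: supp_closed)
   qed
   have 2: "S k (tw w F) = (\<lambda>mu. S k b mu * S k (Sw w F) mu + S k (L F) mu)"
    unfolding bL(4)[OF F] using sF lF bL(1) by (simp add: S_add[OF k] S_mult[OF k] supp_closed)
   have "tw (k # w) F = (\<lambda>mu. A k mu * tw w F mu + B k mu * S k (tw w F) mu)" using t_eq[OF k tw_supp[OF w F]] by simp
   also have "... = (\<lambda>mu. A k mu * (b mu * Sw w F mu + L F mu) +
     B k mu * (S k b mu * S k (Sw w F) mu + S k (L F) mu))" unfolding 2 by (simp only: bL(4)[OF F])
   also have "... = (\<lambda>mu. b' mu * Sw (k # w) F mu + L' F mu)" by (simp add: L'_def b'_def algebra_simps)
   finally show ?thesis .
  qed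
  ultimately show ?case by blast
 qed
 with that show ?thesis by blast
qed

text \<open>For a longest \<open>u\<close> with \<open>m u\<close> nonzero, the reflection
  \<open>Sw u\<close> occurs in the expanded relation only as the leading term of
  \<open>tw u\<close>: any other contribution would come from a strictly longer word. Independence
  of the reflections then gives \<open>Sw u (m u) = 0\<close>.\<close>

lemma tw_independent:
 assumes M: "M \<subseteq> FF" "!!f g. f \<in> M ==> g \<in> M ==> (\<lambda>mu. f mu * g mu) \<in> M" "vec V (\<lambda>_. 1) \<in> M"
   "!!i. i \<in> {1..int n} ==> vec V (y i) \<in> M" and m: "!!w. w \<in> nf n ==> m w \<in> FF"
  and 0: "!!g mu. g \<in> M ==> mu \<in> V ==> (\<Sum>w\<in>nf n. tw w (\<lambda>mu. m w mu * g mu) mu) = 0"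
  and w: "w \<in> nf n"
 shows "m w = (\<lambda>_. 0)"
proof (rule ccontr)
 assume "m w ~= (\<lambda>_. 0)"
 let ?W = "{w \<in> nf n. m w ~= (\<lambda>_. 0)}"
 have fin: "finite ?W" using finite_nf by simp
 have ne: "?W ~= {}" using w \<open>m w ~= (\<lambda>_. 0)\<close> by blast
 have "Max (length ` ?W) \<in> length ` ?W" by (rule Max_in) (use fin ne in auto)
 then obtain u where u1: "u \<in> ?W" "Max (length ` ?W) = length u" by (rule imageE)
 have "length v \<le> length u" if "v \<in> ?W" for v unfolding u1(2)[symmetric] by (rule Max_ge) (use fin that in auto)
 note u = u1(1) this
 have un: "u \<in> nf n" using u(1) by simp
 let ?P = "\<lambda>w b c. (\<forall>mu\<in>V. b mu ~= 0) \<and> (\<forall>v. length w \<le> length v --> c v = (\<lambda>_. 0)) \<and>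
  (\<forall>F\<in>FF. tw w F = (\<lambda>mu. b mu * Sw w F mu + (\<Sum>v\<in>nf n. c v mu * Sw v F mu)))"
 have ex: "\<exists>b c. ?P w b c" if w: "w \<in> nf n" for w
 proof -
  obtain b L where bL: "!!mu. mu \<in> V ==> b mu ~= 0" "L \<in> low (length w)"
   "!!F. F \<in> FF ==> tw w F = (\<lambda>mu. b mu * Sw w F mu + L F mu)" using tw_leading[OF nf_set[OF w]] by metis
  obtain c where "!!v. length w \<le> length v ==> c v = (\<lambda>_. 0)"
   "!!F. F \<in> FF ==> L F = (\<lambda>mu. \<Sum>v\<in>nf n. c v mu * Sw v F mu)" using bL(2) unfolding low_def by blast
  with bL show ?thesis by (intro exI[of _ b] exI[of _ c]) simp
 qed
 define b c where "b = (\<lambda>w. SOME b. \<exists>c. ?P w b c)" and "c = (\<lambda>w. SOME c. ?P w (b w) c)"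
 have "?P w (b w) (c w)" if w: "w \<in> nf n" for w
 proof -
  have "\<exists>c. ?P w (b w) c" using someI_ex[OF ex[OF w]] by (simp only: b_def)
  from someI_ex[OF this] show ?thesis by (simp only: c_def)
 qed
 then have bc: "!!w mu. w \<in> nf n ==> mu \<in> V ==> b w mu ~= 0"
  "!!w v. w \<in> nf n ==> length w \<le> length v ==> c w v = (\<lambda>_. 0)"
  "!!w F. w \<in> nf n ==> F \<in> FF ==> tw w F = (\<lambda>mu. b w mu * Sw w F mu + (\<Sum>v\<in>nf n. c w v mu * Sw v F mu))"
  by blast+
 \<comment> \<open>Total coefficient of the reflection \<open>Sw v\<close> in the relation, after
   \<open>Sw v\<close> has been distributed over the product of \<open>m w\<close> and
   \<open>g\<close>.\<close>
 define a where "a = (\<lambda>mu v. b v mu * Sw v (m v) mu + (\<Sum>w\<in>nf n. c w v mu * Sw v (m w) mu))"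
 have "Sw u (m u) mu = 0" for mu
 proof (cases "mu \<in> V")
  case mu: True
  have "a mu u = 0"
  proof (rule Sw_independent[OF M mu, of "a mu"])
   fix g assume g: "g \<in> M"
   then have gF: "g \<in> FF" using M(1) by blast
   have e: "Sw v (\<lambda>mu. m w mu * g mu) mu = Sw v (m w) mu * Sw v g mu" if "v \<in> nf n" "w \<in> nf n" for v w
    using Sw_mult[OF nf_set[OF that(1)] m[OF that(2)] gF] by (simp)
   have "(\<Sum>w\<in>nf n. a mu w * Sw w g mu) = (\<Sum>w\<in>nf n. b w mu * Sw w (m w) mu * Sw w g mu) +
    (\<Sum>v\<in>nf n. \<Sum>w\<in>nf n. c w v mu * (Sw v (m w) mu * Sw v g mu))"
    by (simp add: a_def distrib_right sum.distrib sum_distrib_right mult.assoc)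
   also have "(\<Sum>v\<in>nf n. \<Sum>w\<in>nf n. c w v mu * (Sw v (m w) mu * Sw v g mu)) =
    (\<Sum>w\<in>nf n. \<Sum>v\<in>nf n. c w v mu * (Sw v (m w) mu * Sw v g mu))" by (rule sum.swap)
   also have "(\<Sum>w\<in>nf n. b w mu * Sw w (m w) mu * Sw w g mu) + ... =
    (\<Sum>w\<in>nf n. tw w (\<lambda>mu. m w mu * g mu) mu)" unfolding sum.distrib[symmetric]
   proof (rule sum.cong[OF refl])
    fix w assume w: "w \<in> nf n"
    have "(\<lambda>mu. m w mu * g mu) \<in> FF" using m[OF w] by (simp add: supp_closed)
    from bc(3)[OF w this]
    show "b w mu * Sw w (m w) mu * Sw w g mu + (\<Sum>v\<in>nf n. c w v mu * (Sw v (m w) mu * Sw v g mu)) =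
     tw w (\<lambda>mu. m w mu * g mu) mu" by (simp add: e w)
   qed
   also have "... = 0" by (rule 0[OF g mu])
   finally show "(\<Sum>w\<in>nf n. a mu w * Sw w g mu) = 0" .
  qed (use u in auto)
  moreover have "c w u mu * Sw u (m w) mu = 0" if w: "w \<in> nf n" for w
  proof (cases "m w = (\<lambda>_. 0)")
   case True
   then show ?thesis using Sw_zero[OF nf_set[OF un]] by simp
  next
   case False
   then show ?thesis using bc(2)[OF w, of u] u(2)[of w] w by simp
  qed
  ultimately have "b u mu * Sw u (m u) mu = 0" by (simp add: a_def)
  then show ?thesis using bc(1)[of u mu] u(1) mu by simp
 next
  case False
  then show ?thesis using Sw_supp[OF nf_set[OF un] m[OF un]] by (auto simp: supp_def)
 qed
 then have "m u = (\<lambda>_. 0)" using Sw_eq_0[OF nf_set[OF un] m[OF un]] by auto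
 with u(1) show False by blast
qed

end

section \<open>Presented algebras acting on functions\<close>

lemma poly_mapping_sum_single: "a = (\<Sum>w\<in>keys a. single w (lookup a w))"
proof (rule poly_mapping_eqI)
 fix v
 show "lookup a v =
   lookup (\<Sum>w\<in>keys a. single w (lookup a w)) v" by (simp add: lookup_sum lookup_single when_def in_keys_iff)
qed

abbreviation fcar :: "'g set => ('g fword \<Rightarrow>\<^sub>0 'k::field) set" where
 "fcar G \<equiv> carrier (free_algebra G)"

lemma free_algebra_simps [simp]:
 "\<one>\<^bsub>free_algebra G\<^esub> = 1" "\<zero>\<^bsub>free_algebra G\<^esub> = 0"
 "a \<otimes>\<^bsub>free_algebra G\<^esub> b = a * b" "a \<oplus>\<^bsub>free_algebra G\<^esub> b = a + b"
 by (simp_all add: free_algebra_def)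

lemma fcar_iff: "a \<in> fcar G \<longleftrightarrow> (\<forall>w \<in> keys a. set (letters w) \<subseteq> G)"
 by (simp add: free_algebra_def)

lemma letters_plus [simp]: "letters (u + v) = letters u @ letters v"
 and letters_zero [simp]: "letters 0 = []"
 by (simp_all add: plus_fword_def zero_fword_def)

lemma fcar_single: "c = 0 \<or> set (letters w) \<subseteq> G ==> single w c \<in> fcar G" by (auto simp: fcar_iff)

lemma fcar_closed:
 fixes a b :: "'g fword \<Rightarrow>\<^sub>0 'k::field"
 shows "(0 :: 'g fword \<Rightarrow>\<^sub>0 'k) \<in> fcar G" (is ?g1) "(1 :: 'g fword \<Rightarrow>\<^sub>0 'k) \<in> fcar G" (is ?g2)
 "(scal c :: 'g fword \<Rightarrow>\<^sub>0 'k) \<in> fcar G" (is ?g3) "g \<in> G ==> (gen g :: 'g fword \<Rightarrow>\<^sub>0 'k) \<in> fcar G" (is "PROP ?g4")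
 "a \<in> fcar G ==> b \<in> fcar G ==> a + b \<in> fcar G"
 "a \<in> fcar G ==> - a \<in> fcar G"
 "a \<in> fcar G ==> b \<in> fcar G ==> a - b \<in> fcar G" (is "PROP ?g5")
 "a \<in> fcar G ==> b \<in> fcar G ==> a * b \<in> fcar G" (is "PROP ?g6")
proof -
 show ?g1 ?g2
  ?g3 "PROP ?g4" by (simp_all add: scal_def gen_def fcar_single single_one[symmetric] del: single_one) (simp_all add: fcar_iff)
 show *: "a \<in> fcar G ==> b \<in> fcar G ==> a + b \<in> fcar G" for a b :: "'g fword \<Rightarrow>\<^sub>0 'k"
  using keys_add[of a b] by (auto simp: fcar_iff)
 show **: "a \<in> fcar G ==> - a \<in> fcar G" for a :: "'g fword \<Rightarrow>\<^sub>0 'k" by (simp add: fcar_iff)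
 show "PROP ?g5" using *[of a "- b"] **[of b] by simp
 show "PROP ?g6" using keys_mult[of a b] by (fastforce simp: fcar_iff)
qed

lemma fcar_sum: "(!!i. i \<in> I ==> f i \<in> fcar G) ==> sum f I \<in> fcar G"
 by (induction I rule: infinite_finite_induct) (simp_all add: fcar_closed)

lemma fcar_power: "a \<in> fcar G ==> a ^ k \<in> fcar G" by (induction k) (simp_all add: fcar_closed)

lemma fcar_mono: "G \<subseteq> H ==> a \<in> fcar G ==> a \<in> fcar H" by (auto simp: fcar_iff)

definition wordp :: "'g list => 'g fword \<Rightarrow>\<^sub>0 'k::field" where
 "wordp xs = single (Word xs) 1"

lemma wordp_simps: "wordp [] = 1" "wordp (x # xs) = gen x * wordp xs" "wordp (xs @ ys) = wordp xs * wordp ys"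
 "wordp [x] = gen x" by (simp_all add: wordp_def gen_def mult_single plus_fword_def zero_fword_def[symmetric])

lemma single_eq_scal: "single w c = scal c * wordp (letters w)" by (cases w) (simp add: scal_def wordp_def mult_single)

lemma scal_comm: "scal c * a = a * scal (c :: 'k::field)"
proof -
 have "scal c * single w d = single w d * scal c" for w d by (simp add: scal_def mult_single mult.commute)
 then have "scal c * (\<Sum>w\<in>K. single w (f w)) = (\<Sum>w\<in>K. single w (f w)) * scal c" for K f
  unfolding sum_distrib_left sum_distrib_right by (intro sum.cong refl)
 from this[of "lookup a" "keys a"] show ?thesis by (simp only: poly_mapping_sum_single[symmetric])
qed

lemma scal_simps: "scal 1 = 1" "scal 0 = 0" "scal (c + d) = scal c + scal d"
 "scal (c * d) = scal c * scal (d :: 'k::field)" "scal (- c) = - scal c" "scal (c - d) = scal c - scal d"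
 by (simp_all add: scal_def single_add mult_single single_uminus single_diff)

lemma wordp_fcar: "set xs \<subseteq> G ==> wordp xs \<in> fcar G" by (simp add: wordp_def fcar_single)

text \<open>Elements are built by multiplying with generators from the left, the side on which an
  action peels them off.\<close>

lemma fcar_induct [consumes 1, case_names zero scal add gen]:
 assumes "a \<in> fcar G"
  and zero: "P 0" and one: "!!c. P (scal c)"
  and add: "!!a b. a \<in> fcar G ==> b \<in> fcar G ==> P a ==> P b ==> P (a + b)"
  and gen: "!!g a. g \<in> G ==> a \<in> fcar G ==> P a ==> P (gen g * a)"
 shows "P (a :: 'g fword \<Rightarrow>\<^sub>0 'k::field)"
proof -
 have w: "P (wordp xs * scal c) \<and> wordp xs * scal c \<in> fcar G" if "set xs \<subseteq> G" for xs and c :: 'k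
  using that by (induction xs) (simp_all add: wordp_simps one mult.assoc fcar_closed gen)
 have s: "P (sum f I) \<and> sum f I \<in> fcar G"
  if "!!i. i \<in> I ==> P (f i) \<and> f i \<in> fcar G" for I :: "'g fword set" and f
  using that by (induction I rule: infinite_finite_induct) (auto simp: zero fcar_closed intro: add)
 have t: "P (single w (lookup a w)) \<and>
  single w (lookup a w) \<in> fcar G" if "w \<in> keys a" for w using w[of "letters w" "lookup a w"] that assms(1)
  by (simp add: single_eq_scal scal_comm fcar_iff)
 from s[of "keys a", OF t]
 have "P (\<Sum>w\<in>keys a. single w (lookup a w))" ..
 then show ?thesis by (simp only: poly_mapping_sum_single[symmetric])
qed

lemma ring_free_algebra: "ring (free_algebra G)"
proof (intro ringI abelian_groupI)
 fix x :: "'a fword \<Rightarrow>\<^sub>0 'b" assume "x \<in> fcar G"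
 then show "\<exists>y\<in>fcar G. y \<oplus>\<^bsub>free_algebra G\<^esub> x = \<zero>\<^bsub>free_algebra G\<^esub>"
  by (intro bexI[of _ "- x"]) (simp_all add: fcar_closed)
next
 show "monoid (free_algebra G :: ('a fword \<Rightarrow>\<^sub>0 'b) ring)"
  by (rule monoidI) (simp_all add: fcar_closed mult.assoc)
qed (simp_all add: fcar_closed algebra_simps)

locale presented_algebra =
 fixes G :: "'g set" and Rl :: "('g fword \<Rightarrow>\<^sub>0 'k::field) set"
 assumes rels_carrier: "Rl \<subseteq> fcar G"
begin

definition "I = genideal (free_algebra G) Rl"

abbreviation "cls \<equiv> pcls G Rl"

lemma ideal_I: "ideal I (free_algebra G)" unfolding I_def by (rule ring.genideal_ideal[OF ring_free_algebra rels_carrier])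

lemma I_rel: "r \<in> Rl ==> r \<in> I" unfolding I_def using ring.genideal_self[OF ring_free_algebra rels_carrier] by blast

lemma I_carrier: "a \<in> I ==> a \<in> fcar G" using ideal.Icarr[OF ideal_I] .

lemma I_add: "a \<in> I ==> b \<in> I ==> a + b \<in> I" using additive_subgroup.a_closed[OF ideal.axioms(1)[OF ideal_I]] by simp

lemma I_lmult: "a \<in> fcar G ==> b \<in> I ==> a * b \<in> I"
 and I_rmult: "a \<in> fcar G ==> b \<in> I ==> b * a \<in> I"
 using ideal.I_l_closed[OF ideal_I] ideal.I_r_closed[OF ideal_I] by simp_all

lemma I_zero: "0 \<in> I" using additive_subgroup.zero_closed[OF ideal.axioms(1)[OF ideal_I]] by simp

lemma I_minus: "a \<in> I ==> - a \<in> I" using I_lmult[of "- 1" a] fcar_closed(2,6) by fastforce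

lemma I_diff: "a \<in> I ==> b \<in> I ==> a - b \<in> I" using I_add[of a "- b"] I_minus[of b] by simp

lemma I_sum: "(!!i. i \<in> X ==> f i \<in> I) ==> sum f X \<in> I"
 by (induction X rule: infinite_finite_induct) (simp_all add: I_zero I_add)

lemma cls_eq: "cls a = {i + a | i. i \<in> I}" by (auto simp: pcls_def I_def[symmetric] a_r_coset_def')

lemma cls_eq_iff: "cls a = cls b \<longleftrightarrow> a - b \<in> I"
proof
 assume "cls a = cls b"
 moreover have "a \<in> cls a" unfolding cls_eq using I_zero by force
 ultimately obtain i where "i \<in> I" "a = i + b" unfolding cls_eq by blast
 then show "a - b \<in> I" by simp
next
 have *: "a - b \<in> I ==> cls a \<subseteq> cls b" for a b
 proof
  fix x assume ab: "a - b \<in> I" and "x \<in> cls a"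
  then obtain i where "i \<in> I" "x = i + a" unfolding cls_eq by blast
  then have "x = (i + (a - b)) + b" "i + (a - b) \<in> I" using ab by (simp_all add: I_add)
  then show "x \<in> cls b" unfolding cls_eq by blast
 qed
 assume "a - b \<in> I"
 moreover have "b - a \<in> I" using I_minus[OF \<open>a - b \<in> I\<close>] by simp
 ultimately show "cls a = cls b" using * by blast
qed

lemma presented_carrier: "carrier (presented G Rl) = cls ` fcar G"
 by (auto simp: presented_def FactRing_def A_RCOSETS_def' pcls_def)

lemma presented_hom: "cls \<in> ring_hom (free_algebra G) (presented G Rl)"
proof -
 have "cls = (+>\<^bsub>free_algebra G\<^esub>) I" by (rule ext) (simp add: pcls_def I_def)
 then show ?thesis using ideal.rcos_ring_hom[OF ideal_I] by (simp add: presented_def I_def)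
qed

lemma cls_simps:
 "\<one>\<^bsub>presented G Rl\<^esub> = cls 1"
 "a \<in> fcar G ==> b \<in> fcar G ==> cls a \<otimes>\<^bsub>presented G Rl\<^esub> cls b = cls (a * b)"
 "a \<in> fcar G ==> b \<in> fcar G ==> cls a \<oplus>\<^bsub>presented G Rl\<^esub> cls b = cls (a + b)"
 using ring_hom_one[OF presented_hom] ring_hom_mult[OF presented_hom] ring_hom_add[OF presented_hom] by simp_all

end

text \<open>Linearity is required on functions supported on \<open>V\<close>: elsewhere the
  reflections of series need not be homomorphisms.\<close>

locale free_action =
 fixes G :: "'g set" and V :: "'a set" and sc :: "'k::field => 'c::field"
  and \<rho> :: "'g => ('a => 'c) => 'a => 'c"
 assumes sc: "fhom sc"
  and \<rho>_supp: "g \<in> G ==> F \<in> supp V ==> \<rho> g F \<in> supp V"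
  and \<rho>_add: "g \<in> G ==> F \<in> supp V ==> F' \<in> supp V ==>
   \<rho> g (\<lambda>mu. F mu + F' mu) = (\<lambda>mu. \<rho> g F mu + \<rho> g F' mu)"
  and \<rho>_sc: "g \<in> G ==> F \<in> supp V ==> \<rho> g (\<lambda>mu. sc c * F mu) = (\<lambda>mu. sc c * \<rho> g F mu)"
begin

abbreviation "act \<equiv> free_act sc \<rho>"
abbreviation "SF \<equiv> supp V :: ('a => 'c) set"

lemma act_superset:
 assumes "finite K" "keys a \<subseteq> K"
 shows "act a F = (\<lambda>mu. \<Sum>w\<in>K. sc (lookup a w) * foldr \<rho> (letters w) F mu)"
 unfolding free_act_def
 by (intro ext sum.mono_neutral_left) (use assms in \<open>auto simp: in_keys_iff fhom_zero[OF sc]\<close>)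

lemma act_add: "act (a + b) F = (\<lambda>mu. act a F mu + act b F mu)"
proof -
 let ?K = "keys a \<union> keys b"
 have "keys (a + b) \<subseteq> ?K" by (rule keys_add)
 then show ?thesis by (simp add: act_superset[of ?K] lookup_add fhom_add[OF sc] distrib_right sum.distrib)
qed

lemma act_zero: "act 0 F = (\<lambda>_. 0)" by (simp add: free_act_def)

lemma act_single: "act (single w c) F = (\<lambda>mu. sc c * foldr \<rho> (letters w) F mu)"
 by (subst act_superset[of "{w}"]) auto

lemma act_gen: "act (gen g) F = \<rho> g F" by (simp add: gen_def act_single fhom_one[OF sc])

lemma act_scal: "act (scal c) F = (\<lambda>mu. sc c * F mu)" by (simp add: scal_def act_single)

lemma act_one: "act 1 F = F" using act_scal[of 1] by (simp add: scal_simps fhom_one[OF sc])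

lemma act_minus: "act (- a) F = (\<lambda>mu. - act a F mu)"
 using act_add[of a "- a" F] by (auto simp: act_zero fun_eq_iff eq_neg_iff_add_eq_0 add.commute)

lemma act_diff: "act (a - b) F = (\<lambda>mu. act a F mu - act b F mu)" using act_add[of a "- b" F] by (simp add: act_minus)

lemma act_sum: "act (sum f X) F = (\<lambda>mu. \<Sum>x\<in>X. act (f x) F mu)"
 by (induction X rule: infinite_finite_induct) (simp_all add: act_zero act_add)

lemma word_supp: "set xs \<subseteq> G ==> F \<in> SF ==> foldr \<rho> xs F \<in> SF" by (induction xs) (auto intro: \<rho>_supp)

lemma word_add: "set xs \<subseteq> G ==> F \<in> SF ==> F' \<in> SF ==>
 foldr \<rho> xs (\<lambda>mu. F mu + F' mu) = (\<lambda>mu. foldr \<rho> xs F mu + foldr \<rho> xs F' mu)"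
 by (induction xs) (auto simp: \<rho>_add word_supp)

lemma act_supp: "a \<in> fcar G ==> F \<in> SF ==> act a F \<in> SF" unfolding free_act_def
 by (intro supp_sum supp_closed word_supp) (auto simp: fcar_iff)

lemma act_F_add: "a \<in> fcar G ==> F \<in> SF ==> F' \<in> SF ==>
 act a (\<lambda>mu. F mu + F' mu) = (\<lambda>mu. act a F mu + act a F' mu)" unfolding free_act_def
 by (simp add: fcar_iff word_add distrib_left sum.distrib)

lemma act_gen_mult: "g \<in> G ==> a \<in> fcar G ==> F \<in> SF ==> act (gen g * a) F = \<rho> g (act a F)"
proof -
 assume g: "g \<in> G" and a: "a \<in> fcar G" and F: "F \<in> SF"
 have s: "\<rho> g (\<lambda>mu. \<Sum>w\<in>K. sc (f w) * foldr \<rho> (letters w) F mu) =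
   (\<lambda>mu. \<Sum>w\<in>K. sc (f w) * \<rho> g (foldr \<rho> (letters w) F) mu)"
  if "!!w. w \<in> K ==> set (letters w) \<subseteq> G" for K f using that
 proof (induction K rule: infinite_finite_induct)
  case (insert w K)
  have "(\<lambda>mu. sc (f w) * foldr \<rho> (letters w) F mu) \<in> SF"
   "(\<lambda>mu. \<Sum>w\<in>K. sc (f w) * foldr \<rho> (letters w) F mu) \<in> SF"
   using insert.prems by (auto intro!: supp_sum supp_closed(3) word_supp F)
  then show ?case using insert by (simp add: \<rho>_add g \<rho>_sc word_supp F)
 qed (use \<rho>_sc[OF g, of "\<lambda>_. 0" 0] in \<open>simp_all add: supp_closed fhom_zero[OF sc]\<close>)
 have "act (gen g * a) F = (\<lambda>mu. \<Sum>w\<in>keys a. sc (lookup a w) * \<rho> g (foldr \<rho> (letters w) F) mu)"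
  by (subst poly_mapping_sum_single[of a]) (simp add: sum_distrib_left act_sum gen_def mult_single act_single)
 also have "... = \<rho> g (act a F)" unfolding free_act_def using s[of "keys a" "lookup a"] a by (simp add: fcar_iff)
 finally show ?thesis .
qed

lemma act_mult:
 assumes "a \<in> fcar G" "b \<in> fcar G" "F \<in> SF"
 shows "act (a * b) F = act a (act b F)"
 using assms(1)
proof (induction rule: fcar_induct)
 case (scal c)
 have e: "act (scal c * b) F = (\<lambda>mu. \<Sum>w\<in>keys b. sc c * (sc (lookup b w) * foldr \<rho> (letters w) F mu))"
  by (subst poly_mapping_sum_single[of b])
   (simp add: sum_distrib_left act_sum scal_def mult_single act_single fhom_mult[OF sc] mult.assoc)
 show ?case unfolding act_scal e by (simp only: free_act_def sum_distrib_left)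
next
 case (gen g a)
 then show ?case using assms act_gen_mult[of g "a * b" F] act_gen_mult[of g a "act b F"]
  by (simp add: mult.assoc fcar_closed act_supp)
qed (simp_all add: distrib_right act_add act_zero)

end

locale presented_action = presented_algebra G Rl + free_action G V sc \<rho>
 for G :: "'g set" and Rl :: "('g fword \<Rightarrow>\<^sub>0 'k::field) set" and V :: "'a set" and sc :: "'k => 'c::field"
  and \<rho> :: "'g => ('a => 'c) => 'a => 'c" +
 assumes act_rel: "r \<in> Rl ==> F \<in> supp V ==> free_act sc \<rho> r F = (\<lambda>_. 0)"
begin

text \<open>The elements acting by zero form an ideal that contains the relations, hence the ideal
  generated by them.\<close>

lemma act_I: "a \<in> I ==> F \<in> SF ==> act a F = (\<lambda>_. 0)" (is "PROP ?g1")
proof -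
 let ?N = "{a \<in> fcar G. \<forall>F\<in>SF. act a F = (\<lambda>_. 0)}"
 have zero: "act a (\<lambda>_. 0) = (\<lambda>_. 0)" if "a \<in> fcar G" for a
  using act_mult[OF that fcar_closed(1), of "\<lambda>_. 0"] by (simp add: act_zero supp_closed)
 have "ideal ?N (free_algebra G)"
 proof (intro idealI ring_free_algebra)
  show "subgroup ?N (add_monoid (free_algebra G))"
  proof (rule group.subgroupI[OF abelian_group.a_group[OF ring.is_abelian_group[OF ring_free_algebra]]])
   show "?N ~= {}" using fcar_closed(1)[of G] act_zero by blast
   fix a assume a: "a \<in> ?N"
   then have "\<ominus>\<^bsub>free_algebra G\<^esub> a = - a"
    by (intro abelian_group.minus_equality[OF ring.is_abelian_group[OF ring_free_algebra]]) (simp_all add: fcar_closed)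
   then have e: "inv\<^bsub>add_monoid (free_algebra G)\<^esub> a = - a" by (simp only: a_inv_def)
   show "inv\<^bsub>add_monoid (free_algebra G)\<^esub> a \<in> ?N" unfolding e using a by (simp add: act_minus fcar_closed)
  qed (auto simp: act_add fcar_closed)
 next
  fix a x :: "'g fword \<Rightarrow>\<^sub>0 'k" assume "a \<in> ?N" "x \<in> fcar G"
  then show "x \<otimes>\<^bsub>free_algebra G\<^esub> a \<in> ?N" "a \<otimes>\<^bsub>free_algebra G\<^esub> x \<in> ?N"
   by (auto simp: fcar_closed act_mult act_supp zero)
 qed
 moreover have "Rl \<subseteq> ?N" using rels_carrier act_rel by blast
 ultimately have "I \<subseteq> ?N" unfolding I_def by (rule ring.genideal_minimal[OF ring_free_algebra])
 then show "PROP ?g1" by blast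
qed

text \<open>The representative picked by \<open>SOME\<close> differs from \<open>a\<close> by an
  element of the ideal, which acts by zero.\<close>

lemma presented_act_cls: "F \<in> SF ==> presented_act sc \<rho> (cls a) F = act a F"
proof -
 assume F: "F \<in> SF"
 have "a \<in> cls a" unfolding cls_eq using I_zero by force
 then have "(SOME b. b \<in> cls a) \<in> cls a" by (rule someI)
 then obtain i where i: "i \<in> I" "(SOME b. b \<in> cls a) = i + a" unfolding cls_eq by blast
 show ?thesis by (simp add: presented_act_def i act_add act_I[OF i(1) F])
qed

end

section \<open>Spanning by normal forms\<close>

text \<open>\<open>Gq\<close> generates the polynomial part, and \<open>tl\<close> gives the
  generators indexed by Coxeter letters. \<open>q_t\<close> is the one-step form of moving a
  polynomial to the right of a Coxeter generator, up to a polynomial error.\<close>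

locale filtered_algebra = presented_algebra G Rl
 for G :: "'g set" and Rl :: "('g fword \<Rightarrow>\<^sub>0 'k::field) set" +
 fixes Gq :: "'g set" and n :: nat and tl :: "nat => 'g"
 assumes G_eq: "G = Gq \<union> tl ` {..<n}"
  and q_t: "g \<in> Gq ==> k < n ==>
   \<exists>p\<in>fcar Gq. \<exists>p'\<in>fcar Gq. gen g * gen (tl k) - gen (tl k) * p - p' \<in> I"
begin

abbreviation "wt w \<equiv> wordp (map tl w) :: 'g fword \<Rightarrow>\<^sub>0 'k"

lemma Gq_sub: "p \<in> fcar Gq ==> p \<in> fcar G" using fcar_mono[of Gq G p] by (simp add: G_eq)

lemma wt_carrier: "set w \<subseteq> {..<n} ==> wt w \<in> fcar G" by (rule wordp_fcar) (auto simp: G_eq)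

lemma tg_carrier: "k < n ==> gen (tl k) \<in> fcar G" using fcar_closed(4)[of "tl k" G] by (auto simp: G_eq)

text \<open>The coefficients stand to the right of the words, ready to be moved across the tensor
  sign.\<close>

definition span :: "nat list set => ('g fword \<Rightarrow>\<^sub>0 'k) set" where
 "span W = {a \<in> fcar G. \<exists>p. (\<forall>w. p w \<in> fcar Gq) \<and> a - (\<Sum>w\<in>W. wt w * p w) \<in> I}"

lemma span_I: "a \<in> I ==> a \<in> span W" unfolding span_def using I_carrier fcar_closed(1)
 by (auto intro!: exI[of _ "\<lambda>_. 0"])

lemma span_add: "a \<in> span W ==> b \<in> span W ==> a + b \<in> span W"
proof -
 assume "a \<in> span W" "b \<in> span W"
 then obtain p p' where p: "!!w. p w \<in> fcar Gq" "a - (\<Sum>w\<in>W. wt w * p w) \<in> I"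
  and p': "!!w. p' w \<in> fcar Gq" "b - (\<Sum>w\<in>W. wt w * p' w) \<in> I"
  and ab: "a \<in> fcar G" "b \<in> fcar G"
  unfolding span_def by blast
 have "a + b - (\<Sum>w\<in>W. wt w * (p w + p' w)) = (a - (\<Sum>w\<in>W. wt w * p w)) + (b - (\<Sum>w\<in>W. wt w * p' w))"
  by (simp add: distrib_left sum.distrib)
 also have "... \<in> I" by (rule I_add[OF p(2) p'(2)])
 finally show ?thesis unfolding span_def using p(1) p'(1) ab
  by (auto simp: fcar_closed intro!: exI[of _ "\<lambda>w. p w + p' w"])
qed

lemma span_sum: "(!!i. i \<in> X ==> f i \<in> span W) ==> sum f X \<in> span W"
 by (induction X rule: infinite_finite_induct) (simp_all add: span_I I_zero span_add)

lemma span_cong: "b \<in> span W ==> a - b \<in> I ==> a \<in> span W" using span_add[of b W "a - b"] span_I[of "a - b" W] by simp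

lemma span_rmult: "a \<in> span W ==> q \<in> fcar Gq ==> a * q \<in> span W"
proof -
 assume "a \<in> span W" and q: "q \<in> fcar Gq"
 then obtain p where p: "!!w. p w \<in> fcar Gq" "a - (\<Sum>w\<in>W. wt w * p w) \<in> I" and a: "a \<in> fcar G"
  unfolding span_def by blast
 have "a * q - (\<Sum>w\<in>W. wt w * (p w * q)) = (a - (\<Sum>w\<in>W. wt w * p w)) * q"
  by (simp add: left_diff_distrib sum_distrib_right mult.assoc)
 also have "... \<in> I" by (rule I_rmult[OF Gq_sub[OF q] p(2)])
 finally show ?thesis unfolding span_def using p(1) a q Gq_sub[OF q]
  by (auto simp: fcar_closed intro!: exI[of _ "\<lambda>w. p w * q"])
qed

lemma span_minus: "a \<in> span W ==> - a \<in> span W" using span_rmult[of a W "- 1"] by (simp add: fcar_closed)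

lemma span_word: "finite W ==> w \<in> W ==> set w \<subseteq> {..<n} ==> wt w \<in> span W"
proof -
 assume W: "finite W" "w \<in> W" "set w \<subseteq> {..<n}"
 have "(\<Sum>v\<in>W. wt v * (if v = w then 1 else 0)) = wt w"
  using W by (simp add: if_distrib[of "\<lambda>x. _ * x"] cong: if_cong)
 then show ?thesis unfolding span_def using W wt_carrier I_zero
  by (auto intro!: exI[of _ "\<lambda>v. if v = w then 1 else 0"] simp: fcar_closed)
qed

lemma span_trans:
 assumes "!!w. w \<in> W ==> wt w \<in> span W'" "a \<in> span W"
 shows "a \<in> span W'"
proof -
 obtain p where p: "!!w. p w \<in> fcar Gq" "a - (\<Sum>w\<in>W. wt w * p w) \<in> I" using assms(2) unfolding span_def by blast
 have "(\<Sum>w\<in>W. wt w * p w) \<in> span W'" by (intro span_sum span_rmult assms p)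
 then show ?thesis using p(2) by (rule span_cong)
qed

definition filt :: "nat => ('g fword \<Rightarrow>\<^sub>0 'k) set" where
 "filt d = span {w. set w \<subseteq> {..<n} \<and> length w \<le> d}"

lemma finite_words: "finite {w. set w \<subseteq> {..<n} \<and> length w \<le> d}" by (rule finite_lists_length_le) simp

lemma filt_word: "set w \<subseteq> {..<n} ==> length w \<le> d ==> wt w \<in> filt d"
 unfolding filt_def by (rule span_word[OF finite_words]) auto

lemma filt_mono: "a \<in> filt d ==> d \<le> d' ==> a \<in> filt d'"
 unfolding filt_def[of d] filt_def[of d'] by (erule span_trans[rotated]) (auto intro: filt_word[unfolded filt_def])

text \<open>Coefficients on the right are untouched by left multiplication, so it suffices to treat
  words.\<close>

lemma filt_lift:
 assumes "a \<in> filt d" "q \<in> fcar G"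
  and "!!w. set w \<subseteq> {..<n} ==> length w \<le> d ==> q * wt w \<in> filt d'"
 shows "q * a \<in> filt d'"
proof -
 let ?W = "{w. set w \<subseteq> {..<n} \<and> length w \<le> d}"
 obtain p where p: "!!w. p w \<in> fcar Gq" "a - (\<Sum>w\<in>?W. wt w * p w) \<in> I"
  using assms(1) unfolding filt_def span_def by blast
 have "(\<Sum>w\<in>?W. q * wt w * p w) \<in> filt d'" unfolding filt_def
 proof (rule span_sum, rule span_rmult[OF _ p(1)])
  fix w assume "w \<in> ?W"
  then show "q * wt w \<in> span {w. set w \<subseteq> {..<n} \<and> length w \<le> d'}"
   using assms(3)[unfolded filt_def] by blast
 qed
 moreover have "q * a - (\<Sum>w\<in>?W. q * wt w * p w) \<in> I"
  using I_lmult[OF assms(2) p(2)] by (simp add: right_diff_distrib sum_distrib_left mult.assoc)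
 ultimately show ?thesis unfolding filt_def by (rule span_cong)
qed

lemma filt_t: "k < n ==> a \<in> filt d ==> gen (tl k) * a \<in> filt (Suc d)"
 by (rule filt_lift[of a d], assumption, rule tg_carrier, assumption)
  (use filt_word[of "k # _" "Suc d"] in \<open>auto simp: wordp_simps\<close>)

lemma filt_wt: "set u \<subseteq> {..<n} ==> a \<in> filt d ==> wt u * a \<in> filt (length u + d)"
 by (induction u) (auto simp: wordp_simps mult.assoc intro: filt_t)

text \<open>Extends \<open>q_t\<close> from the generators to all polynomials; this is what allows a
  word to be multiplied by a polynomial from the left without growing longer.\<close>

lemma q_past_t: "p \<in> fcar Gq ==> k < n ==>
 \<exists>p'\<in>fcar Gq. \<exists>p''\<in>fcar Gq. p * gen (tl k) - gen (tl k) * p' - p'' \<in> I"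
proof (induction rule: fcar_induct)
 case zero
 then show ?case using I_zero fcar_closed(1) by (intro bexI[of _ 0]) auto
next
 case (scal c)
 then show ?case using I_zero fcar_closed(1,3) by (intro bexI[of _ "scal c"] bexI[of _ 0]) (auto simp: scal_comm)
next
 case (add a b)
 then obtain a' a'' b' b'' where *: "a' \<in> fcar Gq" "a'' \<in> fcar Gq" "b' \<in> fcar Gq" "b'' \<in> fcar Gq"
  "a * gen (tl k) - gen (tl k) * a' - a'' \<in> I" "b * gen (tl k) - gen (tl k) * b' - b'' \<in> I" by blast
 then show ?case using I_add[OF *(5,6)]
  by (intro bexI[of _ "a' + b'"] bexI[of _ "a'' + b''"]) (simp_all add: fcar_closed algebra_simps)
next
 case (gen g a)
 then obtain a' a'' where a: "a' \<in> fcar Gq" "a'' \<in> fcar Gq"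
  "a * gen (tl k) - gen (tl k) * a' - a'' \<in> I" by blast
 obtain p' p'' where p: "p' \<in> fcar Gq" "p'' \<in> fcar Gq"
  "gen g * gen (tl k) - gen (tl k) * p' - p'' \<in> I" using q_t gen by blast
 have g: "gen g \<in> fcar Gq" using gen(1) by (rule fcar_closed)
 \<comment> \<open>The rule for \<open>a\<close> is multiplied by \<open>gen g\<close>, and
   \<open>gen g\<close> is then itself moved past the Coxeter generator; the two errors combine to
   \<open>p'' * a' + gen g * a''\<close>.\<close>
 have "gen g * (a * gen (tl k) - gen (tl k) * a' - a'') + (gen g * gen (tl k) - gen (tl k) * p' - p'') * a' \<in> I"
  using a p g by (intro I_add I_lmult I_rmult Gq_sub)
 also have "gen g * (a * gen (tl k) - gen (tl k) * a' - a'') + (gen g * gen (tl k) - gen (tl k) * p' - p'') * a' =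
  gen g * a * gen (tl k) - gen (tl k) * (p' * a') - (p'' * a' + gen g * a'')" by (simp add: algebra_simps)
 finally have r: "gen g * a * gen (tl k) - gen (tl k) * (p' * a') - (p'' * a' + gen g * a'') \<in> I" .
 show ?case by (rule bexI[of _ "p' * a'"], rule bexI[of _ "p'' * a' + gen g * a''"], rule r) (intro fcar_closed(5,8) a p g)+
qed

lemma filt_q_word: "p \<in> fcar Gq ==> set w \<subseteq> {..<n} ==> p * wt w \<in> filt (length w)"
proof (induction w arbitrary: p)
 case Nil
 have "1 \<in> filt 0" using filt_word[of "[]" 0] by (simp add: wordp_simps)
 then have "1 * p \<in> filt 0" unfolding filt_def using Nil(1) by (rule span_rmult)
 then show ?case by (simp add: wordp_simps)
next
 case (Cons k w)
 then have k: "k < n" and w: "set w \<subseteq> {..<n}" by auto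
 obtain p' p'' where p: "p' \<in> fcar Gq" "p'' \<in> fcar Gq" "p * gen (tl k) - gen (tl k) * p' - p'' \<in> I"
  using q_past_t[OF Cons.prems(1) k] by blast
 have "gen (tl k) * (p' * wt w) + p'' * wt w \<in> filt (Suc (length w))"
  unfolding filt_def using filt_t[OF k Cons.IH[OF p(1) w]] filt_mono[OF Cons.IH[OF p(2) w], of "Suc (length w)"]
  by (intro span_add) (simp_all add: filt_def)
 moreover have "p * wt (k # w) - (gen (tl k) * (p' * wt w) + p'' * wt w) \<in> I"
  using I_rmult[OF wt_carrier[OF w] p(3)] by (simp add: wordp_simps algebra_simps)
 ultimately show ?case unfolding filt_def using span_cong by simp
qed

lemma filt_q: "p \<in> fcar Gq ==> a \<in> filt d ==> p * a \<in> filt d"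
 by (rule filt_lift[of a d]) (auto intro: Gq_sub filt_mono[OF filt_q_word])

lemma filt_rmult_word:
 assumes "a \<in> filt d" "set v \<subseteq> {..<n}"
 shows "a * wt v \<in> filt (d + length v)"
proof -
 let ?W = "{w. set w \<subseteq> {..<n} \<and> length w \<le> d}"
 obtain p where p: "!!w. p w \<in> fcar Gq" "a - (\<Sum>w\<in>?W. wt w * p w) \<in> I"
  using assms(1) unfolding filt_def span_def by blast
 have "wt w * (p w * wt v) \<in> filt (d + length v)" if "w \<in> ?W" for w
  by (rule filt_mono[OF filt_wt[OF _ filt_q_word[OF p(1) assms(2)]]]) (use that in auto)
 then have "(\<Sum>w\<in>?W. wt w * (p w * wt v)) \<in> filt (d + length v)" unfolding filt_def by (rule span_sum)
 moreover have "a * wt v - (\<Sum>w\<in>?W. wt w * (p w * wt v)) \<in> I"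
  using I_rmult[OF wt_carrier[OF assms(2)] p(2)] by (simp add: left_diff_distrib sum_distrib_right mult.assoc)
 ultimately show ?thesis unfolding filt_def by (rule span_cong)
qed

end

text \<open>Quadratic and braid relations are asked for modulo shorter words: the square of a
  generator may leave length 1, and the braid relations of the orientifold KLR algebra have
  correction terms.\<close>

locale spanned_algebra = filtered_algebra G Rl Gq n tl
 for G :: "'g set" and Rl :: "('g fword \<Rightarrow>\<^sub>0 'k::field) set" and Gq n tl +
 assumes t_sq: "k < n ==> gen (tl k) * gen (tl k) \<in> filt 1"
  and t_bmove: "bmove l r ==> set l \<subseteq> {..<n} ==> wt l - wt r \<in> filt (length l - 1)"
begin

lemma wt_beq: "beq u v ==> set u \<subseteq> {..<n} ==> wt u - wt v \<in> filt (length u - 1)"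
proof (induction rule: beq.induct)
 case (base u)
 then show ?case unfolding filt_def by (simp add: span_I I_zero)
next
 case (step l r a b v)
 have l: "length l ~= 0" "length l = length r" "set l = set r" using step.hyps(1) by (auto elim: bmove.cases)
 have "wt (a @ r @ b) - wt v \<in> filt (length (a @ l @ b) - 1)" using step l by auto
 moreover have "wt a * (wt l - wt r) * wt b \<in> filt (length a + (length l - 1) + length b)"
  using step.prems by (intro filt_rmult_word filt_wt t_bmove step.hyps) auto
 then have "wt (a @ l @ b) - wt (a @ r @ b) \<in> filt (length (a @ l @ b) - 1)"
  using l(1) by (simp add: wordp_simps algebra_simps)
 ultimately have "(wt (a @ l @ b) - wt (a @ r @ b)) + (wt (a @ r @ b) - wt v) \<in> filt (length (a @ l @ b) - 1)"
  unfolding filt_def by (intro span_add)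
 then show ?case by simp
qed

text \<open>Induction on the length. Replacing a word by an equivalent one costs only shorter words,
  and a doubled letter makes the word itself a combination of shorter ones; what remains is a normal
  form.\<close>

lemma wt_spanned: "set w \<subseteq> {..<n} ==> wt w \<in> span (nf n)"
proof (induction "length w" arbitrary: w rule: less_induct)
 case less
 have filt: "a \<in> span (nf n)" if "a \<in> filt d" "d < length w" for a d
  by (rule span_trans[OF less.hyps that(1)[unfolded filt_def]]) (use that(2) in simp_all)
 obtain v where v: "beq w v" "v \<in> nf n \<or> (\<exists>u a x. v = u @ a # a # x)" using nf_exists[OF less.prems] by metis
 have lv: "length w = length v" "set v \<subseteq> {..<n}" using beq_length_set[OF v(1)] less.prems by auto
 have wv: "wt w - wt v \<in> span (nf n)"
 proof (cases "w = []")
  case True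
  then show ?thesis using lv(1) by (simp add: span_I I_zero)
 next
  case False
  then show ?thesis using filt[OF wt_beq[OF v(1) less.prems]] by simp
 qed
 have "wt v \<in> span (nf n)" using v(2)
 proof
  assume "v \<in> nf n"
  then show ?thesis by (intro span_word finite_nf lv)
 next
  assume "\<exists>u a x. v = u @ a # a # x"
  then obtain u a x where e: "v = u @ a # a # x" by blast
  have "wt u * (gen (tl a) * gen (tl a)) * wt x \<in> filt (length u + 1 + length x)"
   using lv(2) by (intro filt_rmult_word filt_wt t_sq) (auto simp: e)
  then have "wt v \<in> filt (length u + 1 + length x)" by (simp add: e wordp_simps mult.assoc)
  then show ?thesis by (rule filt) (simp add: lv(1) e)
 qed
 then have "wt v + (wt w - wt v) \<in> span (nf n)" using wv by (rule span_add)
 then show ?case by simp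
qed

lemma filt_spanned: "a \<in> filt d ==> a \<in> span (nf n)" unfolding filt_def by (rule span_trans) (auto intro: wt_spanned)

text \<open>Left multiplication is controlled along \<open>filt\<close>. So spanning by normal
  forms, of which there are finitely many, is converted back before the next generator is
  applied.\<close>

lemma spanned_filt: "a \<in> span (nf n) ==> \<exists>d. a \<in> filt d"
proof -
 assume a: "a \<in> span (nf n)"
 define d where "d = Max (length ` nf n)"
 have "wt w \<in> filt d" if "w \<in> nf n" for w
  by (rule filt_word[OF nf_set[OF that]]) (use finite_nf that in \<open>simp add: d_def\<close>)
 then have "a \<in> filt d" unfolding filt_def by (rule span_trans[OF _ a])
 then show ?thesis ..
qed

theorem spanned: "a \<in> fcar G ==> a \<in> span (nf n)"
proof (induction rule: fcar_induct)
 case (scal c)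
 have "wt [] * scal c \<in> span (nf n)" by (intro span_rmult wt_spanned fcar_closed) simp
 then show ?case by (simp add: wordp_simps)
next
 case (gen g a)
 then obtain d where d: "a \<in> filt d" using spanned_filt by blast
 consider "g \<in> Gq" | k where "k < n" "g = tl k" using gen(1) by (auto simp: G_eq)
 then show ?case
 proof cases
  case 1
  then show ?thesis using filt_q[OF fcar_closed(4) d] filt_spanned by blast
 next
  case 2
  then show ?thesis using filt_t[OF 2(1) d] filt_spanned by blast
 qed
qed (simp_all add: span_I I_zero span_add)

end

section \<open>Completions\<close>

text \<open>The action of a formal sum of pairs, before passing to classes;
  \<open>tensor_act\<close> evaluates it at a chosen representative.\<close>

definition tensor_lin ::
 "('r => ('a => 'c::comm_ring_1) => 'a => 'c) => ('r \<times> ('a => 'c) \<Rightarrow>\<^sub>0 int) => ('a => 'c) => 'a => 'c" where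
 "tensor_lin act z g = (\<lambda>mu. \<Sum>p \<in> keys z.
  of_int (lookup z p) * act (fst p) (\<lambda>mu. snd p mu * g mu) mu)"

lemma tensor_act_eq: "tensor_act act C = tensor_lin act (SOME z. z \<in> C)"
 by (simp add: tensor_act_def tensor_lin_def fun_eq_iff Let_def case_prod_unfold)

lemma tensor_lin_superset:
 assumes "finite K" "keys z \<subseteq> K"
 shows "tensor_lin act z g mu =
  (\<Sum>p \<in> K. of_int (lookup z p) * act (fst p) (\<lambda>mu. snd p mu * g mu) mu)"
 unfolding tensor_lin_def by (intro sum.mono_neutral_left) (use assms in \<open>auto simp: in_keys_iff\<close>)

lemma tensor_lin_zero: "tensor_lin act 0 g = (\<lambda>_. 0)" by (simp add: tensor_lin_def)

lemma tensor_lin_diff: "tensor_lin act (z - z') g = (\<lambda>mu. tensor_lin act z g mu - tensor_lin act z' g mu)"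
proof
 fix mu
 let ?K = "keys z \<union> keys z'"
 have "keys (z - z') \<subseteq> ?K" by (rule keys_diff)
 then show "tensor_lin act (z - z') g mu = tensor_lin act z g mu - tensor_lin act z' g mu"
  by (simp add: tensor_lin_superset[of ?K] lookup_minus left_diff_distrib sum_subtractf)
qed

lemma tensor_lin_minus: "tensor_lin act (- z) g = (\<lambda>mu. - tensor_lin act z g mu)"
 using tensor_lin_diff[of act 0 z g] by (simp add: tensor_lin_zero)

lemma tensor_lin_add: "tensor_lin act (z + z') g = (\<lambda>mu. tensor_lin act z g mu + tensor_lin act z' g mu)"
 using tensor_lin_diff[of act z "- z'" g] by (simp add: tensor_lin_minus)

lemma tensor_lin_frag_of: "tensor_lin act (frag_of p) g = act (fst p) (\<lambda>mu. snd p mu * g mu)"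
 by (rule ext) (subst tensor_lin_superset[of "{p}"], auto)

lemma tensor_lin_sum: "tensor_lin act (sum f X) g = (\<lambda>mu. \<Sum>x\<in>X. tensor_lin act (f x) g mu)"
 by (induction X rule: infinite_finite_induct) (simp_all add: tensor_lin_zero tensor_lin_add)

text \<open>The coefficient ring \<open>Sc\<close> is left open because the Hecke side is completed
  over power series and over fractions. \<open>P\<close> with \<open>\<alpha>\<close> and
  \<open>\<gamma>\<close> is the commutative subalgebra with its two images;
  \<open>\<alpha>_surj\<close> allows polynomial coefficients to cross the tensor sign.
  \<open>A_M\<close> says that divided differences preserve coefficients, which makes the operators
  closed under left multiplication by coefficients.\<close>

locale completed_algebra =
 spanned_algebra G Rl Gq n tl + presented_action G Rl V sc \<rho> + refl_ops V n S y "\<lambda>k. \<rho> (tl k)" A B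
 for G :: "'g set" and Rl :: "('g fword \<Rightarrow>\<^sub>0 'k::field) set" and Gq n tl and V :: "'a set"
  and sc :: "'k => 'c::field" and \<rho> :: "'g => ('a => 'c) => 'a => 'c" and S y A B +
 fixes Sc :: "'c set" and P :: "'p set" and \<alpha> :: "'p => 'g fword \<Rightarrow>\<^sub>0 'k" and \<gamma> :: "'p => 'a => 'c"
 assumes Sc: "0 \<in> Sc" "1 \<in> Sc" "!!a b. a \<in> Sc ==> b \<in> Sc ==> a + b \<in> Sc"
   "!!a b. a \<in> Sc ==> b \<in> Sc ==> a * b \<in> Sc" "!!a. a \<in> Sc ==> - a \<in> Sc" "!!c. sc c \<in> Sc"
  and \<alpha>_carrier: "p \<in> P ==> \<alpha> p \<in> fcar G"
  and \<gamma>_carrier: "p \<in> P ==> \<gamma> p \<in> carrier (coef_ring V Sc)"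
  and act_\<alpha>: "p \<in> P ==> F \<in> supp V ==> free_act sc \<rho> (\<alpha> p) F = (\<lambda>mu. \<gamma> p mu * F mu)"
  and \<alpha>_surj: "q \<in> fcar Gq ==> \<exists>p\<in>P. q - \<alpha> p \<in> I"
  and S_M: "k < n ==> m \<in> carrier (coef_ring V Sc) ==> S k m \<in> carrier (coef_ring V Sc)"
  and A_M: "k < n ==> m \<in> carrier (coef_ring V Sc) ==>
   (\<lambda>mu. A k mu * (m mu - S k m mu)) \<in> carrier (coef_ring V Sc)"
  and y_M: "i \<in> {1..int n} ==> vec V (y i) \<in> carrier (coef_ring V Sc)"
begin

abbreviation "M \<equiv> carrier (coef_ring V Sc)"
abbreviation "R \<equiv> presented G Rl"
abbreviation "pact \<equiv> presented_act sc \<rho>"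
abbreviation "lin \<equiv> tensor_lin pact"
abbreviation "TN \<equiv> tensor_null R (coef_ring V Sc) P (\<lambda>p. cls (\<alpha> p)) \<gamma>"
abbreviation "tcls \<equiv> tensor_cls R (coef_ring V Sc) P (\<lambda>p. cls (\<alpha> p)) \<gamma>"
abbreviation "TR \<equiv> tensor_ring pact R (coef_ring V Sc) P (\<lambda>p. cls (\<alpha> p)) \<gamma>"
abbreviation "FA \<equiv> free_Abelian_group (carrier R \<times> M)"
abbreviation "elt a m \<equiv> tcls (frag_of (cls a, m))"

lemma M_iff: "m \<in> M \<longleftrightarrow> (\<forall>nu\<in>V. m nu \<in> Sc) \<and> m \<in> FF"
 by (auto simp: coef_ring_def supp_def)

lemma M_FF: "m \<in> M ==> m \<in> FF" by (simp add: M_iff)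

lemma M_closed:
 "m \<in> M ==> m' \<in> M ==> (\<lambda>mu. m mu + m' mu) \<in> M"
 "m \<in> M ==> m' \<in> M ==> (\<lambda>mu. m mu * m' mu) \<in> M"
 "m \<in> M ==> (\<lambda>mu. - m mu) \<in> M"
 "(\<lambda>_. 0) \<in> M" "vec V (\<lambda>_. 1) \<in> M" "m \<in> M ==> (\<lambda>mu. sc c * m mu) \<in> M"
 by (auto simp: coef_ring_def vec_def Sc)

lemma coef_ring_simps:
 "m \<oplus>\<^bsub>coef_ring V Sc\<^esub> m' = (\<lambda>mu. m mu + m' mu)" "m \<otimes>\<^bsub>coef_ring V Sc\<^esub> m' = (\<lambda>mu. m mu * m' mu)"
 "\<one>\<^bsub>coef_ring V Sc\<^esub> = vec V (\<lambda>_. 1)" by (simp_all add: coef_ring_def)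

lemma frag_keys: "a \<in> fcar G ==> m \<in> M ==> keys (frag_of (cls a, m)) \<subseteq> carrier R \<times> M"
 by (simp add: presented_carrier)

lemma pact_cls: "F \<in> FF ==> pact (cls a) F = act a F" by (rule presented_act_cls)

lemma one_F: "g \<in> FF ==> (\<lambda>mu. vec V (\<lambda>_. 1) mu * g mu) = g" by (auto simp: vec_def supp_def)

lemma act_F_diff: "a \<in> fcar G ==> F \<in> FF ==> F' \<in> FF ==>
 act a (\<lambda>mu. F mu - F' mu) = (\<lambda>mu. act a F mu - act a F' mu)"
 using act_F_add[of a "\<lambda>mu. F mu - F' mu" F'] by (simp add: supp_closed)

lemma act_F_zero: "a \<in> fcar G ==> act a (\<lambda>_. 0) = (\<lambda>_. 0)"
 using act_F_diff[of a "\<lambda>_. 0" "\<lambda>_. 0"] by (simp add: supp_closed)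

lemma act_wt: "set w \<subseteq> {..<n} ==> F \<in> FF ==> act (wt w) F = tw w F"
proof (induction w)
 case (Cons k w)
 then have "act (gen (tl k) * wt w) F = \<rho> (tl k) (act (wt w) F)" by (intro act_gen_mult wt_carrier) (auto simp: G_eq)
 then show ?case using Cons by (simp add: wordp_simps)
qed (simp add: wordp_simps act_one)

lemma lin_supp:
 assumes "keys z \<subseteq> carrier R \<times> M" "g \<in> FF"
 shows "lin z g \<in> FF"
 unfolding tensor_lin_def
proof (intro supp_sum supp_closed(3))
 fix p assume "p \<in> keys z"
 then obtain a where "fst p = cls a" "a \<in> fcar G" using assms(1) by (force simp: presented_carrier)
 then show "pact (fst p) (\<lambda>mu. snd p mu * g mu) \<in> FF" using assms(2) by (simp add: pact_cls act_supp supp_closed)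
qed

subsection \<open>The tensor product as a group\<close>

lemma rels_sub: "tensor_rels R (coef_ring V Sc) P (\<lambda>p. cls (\<alpha> p)) \<gamma> \<subseteq> carrier FA"
proof -
 have 1: "r \<in> carrier R ==> r' \<in> carrier R ==> r \<oplus>\<^bsub>R\<^esub> r' \<in> carrier R" for r r'
  by (auto simp: presented_carrier cls_simps fcar_closed)
 have 2: "r \<in> carrier R ==> p \<in> P ==> r \<otimes>\<^bsub>R\<^esub> cls (\<alpha> p) \<in> carrier R" for r p
  by (auto simp: presented_carrier cls_simps fcar_closed \<alpha>_carrier)
 have 3: "keys (frag_of x - frag_of y - frag_of z) \<subseteq> X" if "x \<in> X" "y \<in> X" "z \<in> X" for x y z and X :: "(('g fword \<Rightarrow>\<^sub>0 'k) set \<times> ('a => 'c)) set"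
  using that keys_diff[of "frag_of x - frag_of y" "frag_of z"] keys_diff[of "frag_of x" "frag_of y"] by auto
 have 4: "keys (frag_of x - frag_of y) \<subseteq> X" if "x \<in> X" "y \<in> X" for x y and X :: "(('g fword \<Rightarrow>\<^sub>0 'k) set \<times> ('a => 'c)) set"
  using that keys_diff[of "frag_of x" "frag_of y"] by auto
 show ?thesis unfolding tensor_rels_def
  by (intro Un_least subsetI; elim CollectE exE conjE; simp only: carrier_free_Abelian_group_iff)
   ((rule 3 | rule 4); simp add: 1 2 coef_ring_simps M_closed \<gamma>_carrier)+
qed

lemma TN_subgroup: "subgroup TN FA"
 unfolding tensor_null_def by (rule group.generate_is_subgroup[OF group_free_Abelian_group rels_sub])

lemma TN_normal: "TN \<lhd> FA" by (rule comm_group.subgroup_imp_normal[OF abelian_free_Abelian_group TN_subgroup])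

lemma TN_carrier: "z \<in> TN ==> keys z \<subseteq> carrier R \<times> M" using subgroup.mem_carrier[OF TN_subgroup] by simp

lemma TN_zero: "0 \<in> TN" using subgroup.one_closed[OF TN_subgroup] by simp

lemma TN_add: "z \<in> TN ==> z' \<in> TN ==> z + z' \<in> TN" using subgroup.m_closed[OF TN_subgroup] by simp

lemma TN_minus: "z \<in> TN ==> - z \<in> TN" using subgroup.m_inv_closed[OF TN_subgroup, of z] TN_carrier[of z] by simp

lemma TN_diff: "z \<in> TN ==> z' \<in> TN ==> z - z' \<in> TN" using TN_add[of z "- z'"] TN_minus[of z'] by simp

lemma TN_sum: "(!!x. x \<in> X ==> f x \<in> TN) ==> sum f X \<in> TN"
 by (induction X rule: infinite_finite_induct) (simp_all add: TN_zero TN_add)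

lemma TN_rel1: "a \<in> fcar G ==> b \<in> fcar G ==> m \<in> M ==>
 frag_of (cls (a + b), m) - frag_of (cls a, m) - frag_of (cls b, m) \<in> TN" unfolding tensor_null_def tensor_rels_def
 by (rule generate.incl, simp only: cls_simps[symmetric]) (use presented_carrier in blast)

lemma TN_rel2: "a \<in> fcar G ==> m \<in> M ==> m' \<in> M ==>
 frag_of (cls a, \<lambda>mu. m mu + m' mu) - frag_of (cls a, m) - frag_of (cls a, m') \<in> TN"
 unfolding tensor_null_def tensor_rels_def
 by (rule generate.incl, simp only: coef_ring_simps[symmetric]) (use presented_carrier in blast)

lemma TN_rel3: "a \<in> fcar G ==> p \<in> P ==> m \<in> M ==>
 frag_of (cls (a * \<alpha> p), m) - frag_of (cls a, \<lambda>mu. \<gamma> p mu * m mu) \<in> TN"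
 unfolding tensor_null_def tensor_rels_def
 by (rule generate.incl, simp only: coef_ring_simps[symmetric] cls_simps(2)[symmetric] \<alpha>_carrier)
  (use presented_carrier in blast)

text \<open>Each of the three kinds of tensor relation acts by zero, the balancing one because
  \<open>\<alpha> p\<close> acts as multiplication by \<open>\<gamma> p\<close>. So the action
  descends to classes.\<close>

lemma lin_TN:
 assumes "z \<in> TN" and g: "g \<in> FF"
 shows "lin z g = (\<lambda>_. 0)"
proof -
 have rel: "lin z g = (\<lambda>_. 0)" if "z \<in> tensor_rels R (coef_ring V Sc) P (\<lambda>p. cls (\<alpha> p)) \<gamma>" for z
 proof -
  have f: "(\<lambda>mu. m mu * g mu) \<in> FF" for m using g by (rule supp_closed)
  from that consider
   a b m where "a \<in> fcar G" "b \<in> fcar G" "z = frag_of (cls (a + b), m) - frag_of (cls a, m) - frag_of (cls b, m)"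
  | a m m' where "a \<in> fcar G" "z = frag_of (cls a, \<lambda>mu. m mu + m' mu) - frag_of (cls a, m) - frag_of (cls a, m')"
  | a p m where "a \<in> fcar G" "p \<in> P" "z = frag_of (cls (a * \<alpha> p), m) - frag_of (cls a, \<lambda>mu. \<gamma> p mu * m mu)"
   unfolding tensor_rels_def presented_carrier
   by (elim UnE CollectE exE conjE imageE; simp only: cls_simps coef_ring_simps \<alpha>_carrier; blast)
  then show ?thesis
  proof cases
   case 1
   then show ?thesis by (simp add: tensor_lin_diff tensor_lin_frag_of pact_cls f act_add)
  next
   case 2
   then show ?thesis by (simp add: tensor_lin_diff tensor_lin_frag_of pact_cls f supp_closed(1)[OF f f]
      distrib_right act_F_add)
  next
   case 3
   then show ?thesis
    by (simp add: tensor_lin_diff tensor_lin_frag_of pact_cls f supp_closed(3)[OF f] act_mult \<alpha>_carrier act_\<alpha> mult.assoc)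
  qed
 qed
 from assms(1) show ?thesis unfolding tensor_null_def
 proof (induction rule: generate.induct)
  case (inv h)
  then have "h \<in> carrier FA" using rels_sub by blast
  then have "inv\<^bsub>FA\<^esub> h = - h" by (intro inv_free_Abelian_group) (simp only: carrier_free_Abelian_group_iff)
  then show ?case using rel[OF inv] by (simp add: tensor_lin_minus)
 qed (simp_all add: tensor_lin_zero tensor_lin_add rel)
qed

lemma tcls_eq: "tcls z = {h + z | h. h \<in> TN}" by (auto simp: tensor_cls_def r_coset_def)

lemma tcls_eqI: "z - z' \<in> TN ==> tcls z = tcls z'"
proof -
 have *: "tcls z \<subseteq> tcls z'" if "z - z' \<in> TN" for z z'
 proof
  fix x assume "x \<in> tcls z"
  then obtain h where "h \<in> TN" "x = h + z" unfolding tcls_eq by blast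
  then have "x = (h + (z - z')) + z'" "h + (z - z') \<in> TN" using that by (simp_all add: TN_add)
  then show "x \<in> tcls z'" unfolding tcls_eq by blast
 qed
 assume z: "z - z' \<in> TN"
 then have "z' - z \<in> TN" using TN_minus[OF z] by simp
 with * z show ?thesis by blast
qed

lemma TR_carrier: "carrier TR = tcls ` carrier FA"
 by (simp add: tensor_ring_def tensor_group_def carrier_FactGroup tensor_cls_def)

lemma TR_carrierE:
 assumes "C \<in> carrier TR"
 obtains z where "keys z \<subseteq> carrier R \<times> M" "C = tcls z" using assms by (auto simp: TR_carrier)

lemma tcls_carrier: "keys z \<subseteq> carrier R \<times> M ==> tcls z \<in> carrier TR" by (auto simp: TR_carrier)

lemma some_tcls: "\<exists>h\<in>TN. (SOME z. z \<in> tcls z0) = h + z0"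
proof -
 have "z0 \<in> tcls z0" unfolding tcls_eq using TN_zero by force
 then have "(SOME z. z \<in> tcls z0) \<in> tcls z0" by (rule someI)
 then show ?thesis unfolding tcls_eq by blast
qed

lemma tact_tcls: "g \<in> FF ==> tensor_act pact (tcls z) g = lin z g"
 using some_tcls[of z] by (auto simp: tensor_act_eq tensor_lin_add lin_TN)

lemma some_carrier:
 assumes "C \<in> carrier TR"
 shows "keys (SOME z. z \<in> C) \<subseteq> carrier R \<times> M"
proof -
 obtain z where z: "keys z \<subseteq> carrier R \<times> M" "C = tcls z" by (rule TR_carrierE[OF assms])
 obtain h where h: "h \<in> TN" "(SOME z. z \<in> C) = h + z" using some_tcls[of z] z(2) by blast
 show ?thesis unfolding h(2) using TN_carrier[OF h(1)] z(1) keys_add[of h z] by blast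
qed

text \<open>Spanning by normal forms writes the left factor as a sum of words times polynomials;
  each polynomial is congruent to some \<open>\<alpha> (q w)\<close> and crosses the tensor sign as
  \<open>\<gamma> (q w)\<close>.\<close>

lemma normal_form:
 assumes "keys z \<subseteq> carrier R \<times> M"
 obtains m where "!!w. m w \<in> M" "z - (\<Sum>w\<in>nf n. frag_of (cls (wt w), m w)) \<in> TN"
proof -
 have wc: "wt w \<in> fcar G" if "w \<in> nf n" for w by (rule wt_carrier[OF nf_set[OF that]])
 have zero1: "frag_of (cls 0, m) \<in> TN" if "m \<in> M" for m
  using TN_minus[OF TN_rel1[OF fcar_closed(1) fcar_closed(1) that]] by simp
 have zero2: "frag_of (cls a, \<lambda>_. 0) \<in> TN" if "a \<in> fcar G" for a
  using TN_minus[OF TN_rel2[OF that M_closed(4) M_closed(4)]] by simp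
 have csum: "frag_of (cls (\<Sum>w\<in>X. f w), m) - (\<Sum>w\<in>X. frag_of (cls (f w), m)) \<in> TN"
  if "finite X" "!!w. w \<in> X ==> f w \<in> fcar G" "m \<in> M" for X :: "nat list set" and f m using that
 proof (induction X rule: finite_induct)
  case empty
  then show ?case using zero1 by simp
 next
  case (insert x X)
  have 1: "frag_of (cls (f x + sum f X), m) - frag_of (cls (f x), m) - frag_of (cls (sum f X), m) \<in> TN"
   using insert by (intro TN_rel1 fcar_sum) auto
  have 2: "frag_of (cls (\<Sum>w\<in>X. f w), m) - (\<Sum>w\<in>X. frag_of (cls (f w), m)) \<in> TN" using insert by auto
  from TN_add[OF 1 2] show ?case using insert by (simp add: algebra_simps)
 qed
 have "\<exists>m. (\<forall>w. m w \<in> M) \<and> z - (\<Sum>w\<in>nf n. frag_of (cls (wt w), m w)) \<in> TN" using assms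
 proof (induction rule: frag_induction)
  case zero
  have "(\<Sum>w\<in>nf n. frag_of (cls (wt w), \<lambda>_. 0)) \<in> TN" by (intro TN_sum zero2 wc)
  then show ?case using TN_minus M_closed(4) by (intro exI[of _ "\<lambda>_ _. 0"]) force
 next
  case (one x)
  then obtain a m where x: "x = (cls a, m)" "a \<in> fcar G" "m \<in> M" by (auto simp: presented_carrier)
  obtain p where p: "!!w. p w \<in> fcar Gq" "a - (\<Sum>w\<in>nf n. wt w * p w) \<in> I"
   using spanned[OF x(2)] unfolding span_def by blast
  define q where "q = (\<lambda>w. SOME q. q \<in> P \<and> p w - \<alpha> q \<in> I)"
  have q: "q w \<in> P" "p w - \<alpha> (q w) \<in> I" for w
  proof -
   have "\<exists>q. q \<in> P \<and> p w - \<alpha> q \<in> I" using \<alpha>_surj[OF p(1)] by blast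
   from someI_ex[OF this] show "q w \<in> P" "p w - \<alpha> (q w) \<in> I" by (simp_all add: q_def)
  qed
  have "(\<Sum>w\<in>nf n. wt w * (p w - \<alpha> (q w))) \<in> I" by (intro I_sum I_lmult wc q)
  from I_add[OF p(2) this] have "a - (\<Sum>w\<in>nf n. wt w * \<alpha> (q w)) \<in> I"
   by (simp add: right_diff_distrib sum_subtractf)
  then have e: "cls a = cls (\<Sum>w\<in>nf n. wt w * \<alpha> (q w))" by (simp add: cls_eq_iff)
  let ?m = "\<lambda>w mu. \<gamma> (q w) mu * m mu"
  have 1: "frag_of (cls a, m) - (\<Sum>w\<in>nf n. frag_of (cls (wt w * \<alpha> (q w)), m)) \<in> TN"
   unfolding e by (intro csum finite_nf fcar_closed wc \<alpha>_carrier q x)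
  have 2: "(\<Sum>w\<in>nf n. frag_of (cls (wt w * \<alpha> (q w)), m) - frag_of (cls (wt w), ?m w)) \<in> TN"
   by (intro TN_sum TN_rel3 wc q x)
  from TN_add[OF 1 2] have "frag_of x - (\<Sum>w\<in>nf n. frag_of (cls (wt w), ?m w)) \<in> TN" by (simp add: sum_subtractf x)
  moreover have "\<forall>w. ?m w \<in> M" using M_closed(2) \<gamma>_carrier q x by blast
  ultimately show ?case by (intro exI[of _ ?m]) blast
 next
  case (diff z z')
  then obtain m m' where m: "!!w. m w \<in> M" "z - (\<Sum>w\<in>nf n. frag_of (cls (wt w), m w)) \<in> TN"
   and m': "!!w. m' w \<in> M" "z' - (\<Sum>w\<in>nf n. frag_of (cls (wt w), m' w)) \<in> TN" by blast
  let ?m = "\<lambda>w mu. m w mu + - m' w mu"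
  have "frag_of (cls (wt w), \<lambda>mu. m' w mu + ?m w mu) - frag_of (cls (wt w), m' w) - frag_of (cls (wt w), ?m w) \<in> TN"
   if "w \<in> nf n" for w by (intro TN_rel2 wc that m m' M_closed)
  then have "(\<Sum>w\<in>nf n. frag_of (cls (wt w), m w) - frag_of (cls (wt w), m' w) - frag_of (cls (wt w), ?m w)) \<in> TN"
   by (intro TN_sum) simp
  then have t: "(\<Sum>w\<in>nf n. frag_of (cls (wt w), m w)) - (\<Sum>w\<in>nf n. frag_of (cls (wt w), m' w)) -
    (\<Sum>w\<in>nf n. frag_of (cls (wt w), ?m w)) \<in> TN" unfolding sum_subtractf .
  have eq: "(z - a - (z' - a')) + (a - a' - a'') = z - z' - a''"
   for a a' a'' :: "(('g fword \<Rightarrow>\<^sub>0 'k) set \<times> ('a => 'c)) \<Rightarrow>\<^sub>0 int" by simp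
  from TN_add[OF TN_diff[OF m(2) m'(2)] t]
  have "z - z' - (\<Sum>w\<in>nf n. frag_of (cls (wt w), ?m w)) \<in> TN" by (simp only: eq)
  moreover have "\<forall>w. ?m w \<in> M" using m m' M_closed(1,3) by blast
  ultimately show ?case by (intro exI[of _ ?m]) blast
 qed
 with that show ?thesis by blast
qed

lemma lin_normal_form:
 assumes "z - (\<Sum>w\<in>nf n. frag_of (cls (wt w), m w)) \<in> TN" "g \<in> FF"
 shows "lin z g = (\<lambda>mu. \<Sum>w\<in>nf n. tw w (\<lambda>mu. m w mu * g mu) mu)"
proof -
 have "lin z g = lin (\<Sum>w\<in>nf n. frag_of (cls (wt w), m w)) g"
  using lin_TN[OF assms] by (simp add: tensor_lin_diff fun_eq_iff)
 also have "... = (\<lambda>mu. \<Sum>w\<in>nf n. tw w (\<lambda>mu. m w mu * g mu) mu)" using assms(2)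
  by (auto simp: tensor_lin_sum tensor_lin_frag_of pact_cls supp_closed act_wt nf_set intro!: ext sum.cong)
 finally show ?thesis .
qed

text \<open>Faithfulness: after reduction to normal form, triangular independence makes every
  coefficient zero. The test functions are taken from the coefficient ring, as in the definition of
  the product.\<close>

lemma lin_injective:
 assumes "keys z \<subseteq> carrier R \<times> M" "!!g. g \<in> M ==> lin z g = (\<lambda>_. 0)"
 shows "z \<in> TN"
proof -
 obtain m where m: "!!w. m w \<in> M" "z - (\<Sum>w\<in>nf n. frag_of (cls (wt w), m w)) \<in> TN"
  by (rule normal_form[OF assms(1)]) blast
 have "m w = (\<lambda>_. 0)" if w: "w \<in> nf n" for w
 proof (rule tw_independent[where M = M, OF _ _ _ _ _ _ w])
  fix g mu assume "g \<in> M" "mu \<in> V"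
  then show "(\<Sum>w\<in>nf n. tw w (\<lambda>mu. m w mu * g mu) mu) = 0"
   using fun_cong[OF lin_normal_form[OF m(2) M_FF], of g mu] assms(2) by simp
 qed (use m M_FF M_closed y_M in auto)
 moreover have "frag_of (cls (wt w), \<lambda>_. 0) \<in> TN" if "w \<in> nf n" for w
  using TN_minus[OF TN_rel2[OF wt_carrier[OF nf_set[OF that]] M_closed(4) M_closed(4)]] by simp
 ultimately have "(\<Sum>w\<in>nf n. frag_of (cls (wt w), m w)) \<in> TN" by (intro TN_sum) simp
 from TN_add[OF m(2) this] show ?thesis by simp
qed

subsection \<open>Operators\<close>

text \<open>The operators given by tensors, compared on functions supported on \<open>V\<close>.
  They are shown to be closed under composition before any product of classes is available.\<close>

definition ops :: "(('a => 'c) => 'a => 'c) set" where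
 "ops = {L. \<exists>z. keys z \<subseteq> carrier R \<times> M \<and> (\<forall>g\<in>FF. lin z g = L g)}"

lemma opsI: "keys z \<subseteq> carrier R \<times> M ==> (!!g. g \<in> FF ==> lin z g = L g) ==> L \<in> ops"
 unfolding ops_def by blast

lemma ops_supp: "L \<in> ops ==> g \<in> FF ==> L g \<in> FF"
proof -
 assume "L \<in> ops" and g: "g \<in> FF"
 then obtain z where "keys z \<subseteq> carrier R \<times> M" "lin z g = L g" unfolding ops_def by blast
 then show ?thesis using lin_supp[OF _ g, of z] by simp
qed

lemma ops_cong: "L \<in> ops ==> (!!g. g \<in> FF ==> L g = L' g) ==> L' \<in> ops" unfolding ops_def by auto

lemma ops_zero: "(\<lambda>g mu. 0) \<in> ops" by (rule opsI[of 0]) (simp_all add: tensor_lin_zero)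

lemma ops_diff: "L \<in> ops ==> L' \<in> ops ==> (\<lambda>g mu. L g mu - L' g mu) \<in> ops"
proof -
 assume "L \<in> ops" "L' \<in> ops"
 then obtain z z' where z: "keys z \<subseteq> carrier R \<times> M" "!!g. g \<in> FF ==> lin z g = L g"
  "keys z' \<subseteq> carrier R \<times> M" "!!g. g \<in> FF ==> lin z' g = L' g" unfolding ops_def by blast
 show ?thesis by (rule opsI[of "z - z'"]) (use z keys_diff[of z z'] in \<open>auto simp: tensor_lin_diff\<close>)
qed

lemma ops_add: "L \<in> ops ==> L' \<in> ops ==> (\<lambda>g mu. L g mu + L' g mu) \<in> ops"
 using ops_diff[of L "\<lambda>g mu. 0 - L' g mu"] ops_diff[OF ops_zero, of L'] by simp

lemma ops_sum: "(!!x. x \<in> X ==> L x \<in> ops) ==> (\<lambda>g mu. \<Sum>x\<in>X. L x g mu) \<in> ops"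
 by (induction X rule: infinite_finite_induct) (simp_all add: ops_zero ops_add)

lemma ops_basic: "a \<in> fcar G ==> m \<in> M ==> (\<lambda>g. act a (\<lambda>mu. m mu * g mu)) \<in> ops"
 by (rule opsI[OF frag_keys]) (simp_all add: tensor_lin_frag_of pact_cls supp_closed)

lemma ops_induct [consumes 1, case_names cong zero basic diff]:
 assumes L: "L \<in> ops"
  and cong: "!!L L'. Q L ==> (!!g. g \<in> FF ==> L g = L' g) ==> Q L'"
  and zero: "Q (\<lambda>g mu. 0)"
  and basic: "!!a m. a \<in> fcar G ==> m \<in> M ==> Q (\<lambda>g. act a (\<lambda>mu. m mu * g mu))"
  and diff: "!!L L'. L \<in> ops ==> L' \<in> ops ==> Q L ==> Q L' ==> Q (\<lambda>g mu. L g mu - L' g mu)"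
 shows "Q L"
proof -
 obtain z where z: "keys z \<subseteq> carrier R \<times> M" "!!g. g \<in> FF ==> lin z g = L g"
  using L unfolding ops_def by blast
 from z(1) have "Q (lin z) \<and> lin z \<in> ops"
 proof (induction rule: frag_induction)
  case zero
  then show ?case using assms(3) ops_zero by (simp add: tensor_lin_zero[abs_def])
 next
  case (one x)
  then obtain a m where x: "x = (cls a, m)" "a \<in> fcar G" "m \<in> M" by (auto simp: presented_carrier)
  have e: "act a (\<lambda>mu. m mu * g mu) = lin (frag_of x) g" if "g \<in> FF" for g
   using that by (simp add: x tensor_lin_frag_of pact_cls supp_closed)
  show ?case using cong[OF basic[OF x(2,3)] e] ops_cong[OF ops_basic[OF x(2,3)] e] by blast
 next
  case (diff z z')
  have e: "lin (z - z') = (\<lambda>g mu. lin z g mu - lin z' g mu)" by (rule ext) (rule tensor_lin_diff)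
  show ?case unfolding e using assms(5) diff ops_diff by blast
 qed
 then show ?thesis using cong z(2) by blast
qed

lemma ops_act: "L \<in> ops ==> a \<in> fcar G ==> (\<lambda>g. act a (L g)) \<in> ops"
proof (induction L rule: ops_induct)
 case (cong L L')
 then show ?case by (auto intro: ops_cong)
next
 case zero
 then show ?case using ops_zero by (simp add: act_F_zero)
next
 case (basic b m)
 show ?case by (rule ops_cong[OF ops_basic[of "a * b" m]])
   (use basic in \<open>simp_all add: act_mult fcar_closed supp_closed\<close>)
next
 case (diff L L')
 show ?case by (rule ops_cong[OF ops_diff[of "\<lambda>g. act a (L g)" "\<lambda>g. act a (L' g)"]])
   (use diff in \<open>simp_all add: act_F_diff ops_supp\<close>)
qed

text \<open>A coefficient crosses a Coxeter generator by the operator identity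
  \<open>m t = t (S m) + A (m - S m)\<close>, whose error is a coefficient again by
  \<open>A_M\<close>; induction along words brings all coefficients to the right.\<close>

lemma ops_mult_basic:
 assumes "a \<in> fcar G" "m \<in> M" "m' \<in> M"
 shows "(\<lambda>g mu. m mu * act a (\<lambda>mu. m' mu * g mu) mu) \<in> ops"
 using assms
proof (induction arbitrary: m rule: fcar_induct)
 case zero
 then show ?case using ops_zero by (simp add: act_zero)
next
 case (scal c)
 have "(\<lambda>g. act 1 (\<lambda>mu. (m mu * (sc c * m' mu)) * g mu)) \<in> ops"
  using scal by (intro ops_basic fcar_closed M_closed)
 then show ?case by (simp add: act_scal act_one mult.assoc)
next
 case (add a b)
 then have "(\<lambda>g mu. m mu * act a (\<lambda>mu. m' mu * g mu) mu + m mu * act b (\<lambda>mu. m' mu * g mu) mu) \<in> ops"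
  by (intro ops_add) auto
 then show ?case by (simp add: act_add distrib_left)
next
 case (gen g' a)
 define L where "L = (\<lambda>g. act a (\<lambda>mu. m' mu * g mu))"
 have IH: "(\<lambda>g mu. m mu * L g mu) \<in> ops" if "m \<in> M" for m using gen that unfolding L_def by blast
 have L: "L g \<in> FF" if "g \<in> FF" for g unfolding L_def using gen that by (intro act_supp supp_closed) auto
 have e: "act (gen g' * a) (\<lambda>mu. m' mu * g mu) = \<rho> g' (L g)" if "g \<in> FF" for g
  unfolding L_def using gen that by (intro act_gen_mult supp_closed) auto
 consider "g' \<in> Gq" | k where "k < n" "g' = tl k" using gen(1) by (auto simp: G_eq)
 then show ?case
 proof cases
  case 1
  obtain p where p: "p \<in> P" "gen g' - \<alpha> p \<in> I" using \<alpha>_surj[OF fcar_closed(4)[OF 1]] by blast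
  have \<rho>: "\<rho> g' F = (\<lambda>mu. \<gamma> p mu * F mu)" if "F \<in> FF" for F
  proof -
   have "act (gen g' - \<alpha> p) F = (\<lambda>_. 0)" by (rule act_I[OF p(2) that])
   then show ?thesis using act_\<alpha>[OF p(1) that] by (simp add: act_diff act_gen fun_eq_iff)
  qed
  show ?thesis
  proof (rule ops_cong[OF IH])
   show "(\<lambda>mu. m mu * \<gamma> p mu) \<in> M" using gen p by (intro M_closed \<gamma>_carrier) auto
   fix g assume "g \<in> FF"
   then show "(\<lambda>mu. m mu * \<gamma> p mu * L g mu) = (\<lambda>mu. m mu * act (gen g' * a) (\<lambda>mu. m' mu * g mu) mu)"
    by (simp add: e \<rho> L mult.assoc)
  qed
 next
  case (2 k)
  have Sm: "S k m \<in> M" "m \<in> M" by (rule S_M[OF 2(1)]) (use gen in auto)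
  have 1: "(\<lambda>g. act (gen (tl k)) (\<lambda>mu. S k m mu * L g mu)) \<in> ops"
   using gen Sm 2 by (intro ops_act IH tg_carrier) auto
  have 3: "(\<lambda>g mu. (A k mu * (m mu - S k m mu)) * L g mu) \<in> ops" by (rule IH[OF A_M[OF 2(1) Sm(2)]])
  show ?thesis
  proof (rule ops_cong[OF ops_add[OF 1 3]])
   fix g assume g: "g \<in> FF"
   \<comment> \<open>Starting from \<open>S k m\<close> instead of \<open>m\<close> makes the
     reflected part come out with \<open>m\<close> itself, since \<open>S k\<close> is an
     involution.\<close>
   have s: "S k (\<lambda>mu. S k m mu * L g mu) = (\<lambda>mu. m mu * S k (L g) mu)"
    using S_mult[OF 2(1) M_FF[OF Sm(1)] L[OF g]] S_sq[OF 2(1) M_FF[OF Sm(2)]] by simp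
   have "act (gen (tl k)) (\<lambda>mu. S k m mu * L g mu) =
     (\<lambda>mu. A k mu * (S k m mu * L g mu) + B k mu * (m mu * S k (L g) mu))"
    unfolding act_gen by (subst t_eq[OF 2(1)]) (simp_all add: s supp_closed L g)
   moreover have "act (gen g' * a) (\<lambda>mu. m' mu * g mu) = (\<lambda>mu. A k mu * L g mu + B k mu * S k (L g) mu)"
    using e[OF g] t_eq[OF 2(1) L[OF g]] unfolding 2(2) by simp
   ultimately show "(\<lambda>mu. act (gen (tl k)) (\<lambda>mu. S k m mu * L g mu) mu + (A k mu * (m mu - S k m mu)) * L g mu) =
    (\<lambda>mu. m mu * act (gen g' * a) (\<lambda>mu. m' mu * g mu) mu)" by (simp add: fun_eq_iff algebra_simps)
  qed
 qed
qed

lemma ops_mult: "L \<in> ops ==> m \<in> M ==> (\<lambda>g mu. m mu * L g mu) \<in> ops"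
proof (induction L rule: ops_induct)
 case (cong L L')
 then show ?case by (auto intro: ops_cong)
next
 case zero
 then show ?case using ops_zero by simp
next
 case (basic b m')
 then show ?case by (intro ops_mult_basic)
next
 case (diff L L')
 then have "(\<lambda>g mu. m mu * L g mu - m mu * L' g mu) \<in> ops" by (intro ops_diff) auto
 then show ?case by (simp add: right_diff_distrib)
qed

text \<open>The existence half for the product of classes.\<close>

lemma ops_comp: "L \<in> ops ==> L' \<in> ops ==> (\<lambda>g. L (L' g)) \<in> ops"
proof (induction L rule: ops_induct)
 case (cong L1 L2)
 then show ?case by (auto intro: ops_cong ops_supp)
next
 case (basic a m)
 then show ?case by (intro ops_act ops_mult)
next
 case (diff L1 L2)
 then show ?case by (intro ops_diff) auto
qed (simp add: ops_zero)

lemma ops_M: "m \<in> M ==> (\<lambda>g mu. m mu * g mu) \<in> ops"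
 using ops_basic[OF fcar_closed(2), of m] by (simp add: act_one)

lemma ops_id: "(\<lambda>g. g) \<in> ops" by (rule ops_cong[OF ops_M[OF M_closed(5)]]) (simp add: one_F)

lemma ops_t: "k < n ==> \<rho> (tl k) \<in> ops" by (rule ops_cong[OF ops_act[OF ops_id tg_carrier]]) (simp_all add: act_gen)

lemma ops_form:
 assumes "L \<in> ops"
 obtains m where "!!w. m w \<in> M" "!!g. g \<in> FF ==> L g = (\<lambda>mu. \<Sum>w\<in>nf n. tw w (\<lambda>mu. m w mu * g mu) mu)"
proof -
 obtain z where z: "keys z \<subseteq> carrier R \<times> M" "!!g. g \<in> FF ==> lin z g = L g"
  using assms unfolding ops_def by blast
 obtain m where m: "!!w. m w \<in> M" "z - (\<Sum>w\<in>nf n. frag_of (cls (wt w), m w)) \<in> TN"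
  by (rule normal_form[OF z(1)]) blast
 show ?thesis by (rule that[OF m(1)]) (use lin_normal_form[OF m(2)] z(2) in auto)
qed

subsection \<open>The ring structure\<close>

abbreviation "tact \<equiv> tensor_act pact"

lemma ops_obtain:
 assumes "L \<in> ops"
 obtains C where "C \<in> carrier TR" "!!g. g \<in> FF ==> tact C g = L g"
proof -
 obtain z where z: "keys z \<subseteq> carrier R \<times> M" "!!g. g \<in> FF ==> lin z g = L g"
  using assms unfolding ops_def by blast
 show ?thesis by (rule that[OF tcls_carrier[OF z(1)]]) (simp add: tact_tcls z(2))
qed

lemma tact_ops: "C \<in> carrier TR ==> tact C \<in> ops"
proof (elim TR_carrierE)
 fix z assume "keys z \<subseteq> carrier R \<times> M" "C = tcls z"
 then show "tact C \<in> ops" by (intro opsI[of z]) (simp_all add: tact_tcls)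
qed

lemma tact_inj:
 assumes "C \<in> carrier TR" "C' \<in> carrier TR" "!!g. g \<in> M ==> tact C g = tact C' g"
 shows "C = C'"
proof -
 obtain z z' where z: "keys z \<subseteq> carrier R \<times> M" "C = tcls z"
  "keys z' \<subseteq> carrier R \<times> M" "C' = tcls z'" using TR_carrierE[OF assms(1)] TR_carrierE[OF assms(2)] by metis
 have "z - z' \<in> TN"
 proof (rule lin_injective)
  show "keys (z - z') \<subseteq> carrier R \<times> M" using z keys_diff[of z z'] by blast
  show "lin (z - z') g = (\<lambda>_. 0)" if "g \<in> M" for g
   using assms(3)[OF that] M_FF[OF that] by (simp add: z tact_tcls tensor_lin_diff)
 qed
 then show ?thesis unfolding z by (rule tcls_eqI)
qed

text \<open>The definite description is met: \<open>ops_comp\<close> supplies an element with the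
  composed action, and \<open>tact_inj\<close> shows that it is the only one.\<close>

lemma TR_mult:
 assumes "C \<in> carrier TR" "C' \<in> carrier TR"
 shows "C \<otimes>\<^bsub>TR\<^esub> C' \<in> carrier TR" (is ?g1) "g \<in> FF ==> tact (C \<otimes>\<^bsub>TR\<^esub> C') g = tact C (tact C' g)" (is "PROP ?g2")
proof -
 let ?Q = "\<lambda>c. c \<in> carrier TR \<and> (\<forall>g\<in>M. tact c g = tact C (tact C' g))"
 obtain D where D: "D \<in> carrier TR" "!!g. g \<in> FF ==> tact D g = tact C (tact C' g)"
  by (rule ops_obtain[OF ops_comp[OF tact_ops[OF assms(1)] tact_ops[OF assms(2)]]]) blast
 have "C \<otimes>\<^bsub>TR\<^esub> C' = (THE c. ?Q c)" by (simp add: tensor_ring_def Let_def)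
 also have "... = D"
 proof (rule the_equality)
  show "?Q D" using D M_FF by blast
  show "c = D" if "?Q c" for c using that D M_FF by (intro tact_inj) auto
 qed
 finally show ?g1 "PROP ?g2" using D by simp_all
qed

lemma TR_add_tcls: "keys z \<subseteq> carrier R \<times> M ==> keys z' \<subseteq> carrier R \<times> M ==>
 tcls z \<oplus>\<^bsub>TR\<^esub> tcls z' = tcls (z + z')" using normal.rcos_sum[OF TN_normal, of z z']
 by (simp add: tensor_ring_def tensor_group_def Let_def tensor_cls_def)

lemma TR_add:
 assumes "C \<in> carrier TR" "C' \<in> carrier TR"
 shows "g \<in> FF ==> tact (C \<oplus>\<^bsub>TR\<^esub> C') g = (\<lambda>mu. tact C g mu + tact C' g mu)" (is "PROP ?g1")
proof -
 obtain z z' where z: "keys z \<subseteq> carrier R \<times> M" "C = tcls z"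
  "keys z' \<subseteq> carrier R \<times> M" "C' = tcls z'" using TR_carrierE[OF assms(1)] TR_carrierE[OF assms(2)] by metis
 show "PROP ?g1" unfolding z TR_add_tcls[OF z(1,3)] by (simp add: tact_tcls tensor_lin_add)
qed

lemma TR_abelian: "abelian_group TR"
proof -
 have "comm_group (FA Mod TN)" by (rule comm_group.abelian_FactGroup[OF abelian_free_Abelian_group TN_subgroup])
 moreover have "add_monoid TR = FA Mod TN" by (simp add: tensor_ring_def tensor_group_def FactGroup_def)
 ultimately show ?thesis by (simp add: abelian_group_def abelian_monoid_def abelian_group_axioms_def comm_group_def)
qed

lemma TR_one: "\<one>\<^bsub>TR\<^esub> \<in> carrier TR" "g \<in> FF ==> tact \<one>\<^bsub>TR\<^esub> g = g" (is "PROP ?g1")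
proof -
 have e: "\<one>\<^bsub>TR\<^esub> = elt 1 (vec V (\<lambda>_. 1))"
  by (simp add: tensor_ring_def Let_def cls_simps coef_ring_simps)
 show "\<one>\<^bsub>TR\<^esub> \<in> carrier TR" unfolding e by (intro tcls_carrier frag_keys fcar_closed M_closed)
 show "PROP ?g1" unfolding e by (simp add: tact_tcls tensor_lin_frag_of one_F pact_cls act_one)
qed

lemma TR_minus:
 assumes "C \<in> carrier TR" "C' \<in> carrier TR"
 shows "C \<ominus>\<^bsub>TR\<^esub> C' \<in> carrier TR" (is ?g1) "g \<in> FF ==> tact (C \<ominus>\<^bsub>TR\<^esub> C') g = (\<lambda>mu. tact C g mu - tact C' g mu)" (is "PROP ?g2")
proof -
 interpret TR: abelian_group TR by (rule TR_abelian)
 show c: ?g1 using assms by simp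
 have "(C \<ominus>\<^bsub>TR\<^esub> C') \<oplus>\<^bsub>TR\<^esub> C' = C"
  using assms by (simp add: a_minus_def TR.a_assoc TR.l_neg)
 then show "PROP ?g2" using TR_add[OF c assms(2), of g] by (simp)
qed

lemma elt_carrier: "a \<in> fcar G ==> m \<in> M ==> elt a m \<in> carrier TR" by (intro tcls_carrier frag_keys)

lemma elt_act: "g \<in> FF ==> tact (elt a m) g = act a (\<lambda>mu. m mu * g mu)"
 by (simp add: tact_tcls tensor_lin_frag_of pact_cls supp_closed)

end

section \<open>Transfer between completions\<close>

text \<open>\<open>\<Theta>\<close> is semilinear over \<open>\<phi>\<close> and turns each source
  generator into some target operator. That operator need not be a generator, which leaves room for
  units and additive coefficients between the two families.\<close>

locale ops_transfer =
 src: completed_algebra G Rl Gq n tl V sc \<rho> S y A B Sc P \<alpha> \<gamma> +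
 tgt: completed_algebra G' Rl' Gq' n tl' V sc \<rho>' S' y' A' B' Sc P' \<alpha>' \<gamma>'
 for G :: "'g set" and Rl :: "('g fword \<Rightarrow>\<^sub>0 'k::field) set" and Gq n tl and V :: "'a set"
  and sc :: "'k => 'c::field" and \<rho> S y A B and Sc :: "'c set" and P :: "'p set" and \<alpha> \<gamma>
  and G' :: "'h set" and Rl' :: "('h fword \<Rightarrow>\<^sub>0 'k) set" and Gq' tl' \<rho>' S' y' A' B'
  and P' :: "'q set" and \<alpha>' \<gamma>' +
 fixes \<Theta> \<phi> :: "('a => 'c) => 'a => 'c"
 assumes \<Theta>_supp: "g \<in> supp V ==> \<Theta> g \<in> supp V"
  and \<Theta>_add: "g \<in> supp V ==> g' \<in> supp V ==> \<Theta> (\<lambda>mu. g mu + g' mu) = (\<lambda>mu. \<Theta> g mu + \<Theta> g' mu)"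
  and \<Theta>_mult: "m \<in> carrier (coef_ring V Sc) ==> g \<in> supp V ==>
   \<Theta> (\<lambda>mu. m mu * g mu) = (\<lambda>mu. \<phi> m mu * \<Theta> g mu)"
  and \<phi>_M: "m \<in> carrier (coef_ring V Sc) ==> \<phi> m \<in> carrier (coef_ring V Sc)"
  and \<Theta>_t: "k < n ==> \<exists>L\<in>tgt.ops. \<forall>g\<in>supp V. \<Theta> (\<rho> (tl k) g) = L (\<Theta> g)"
begin

lemma \<Theta>_zero: "\<Theta> (\<lambda>_. 0) = (\<lambda>_. 0)"
proof -
 have "\<Theta> (\<lambda>mu. 0 + 0) = (\<lambda>mu. \<Theta> (\<lambda>_. 0) mu + \<Theta> (\<lambda>_. 0) mu)"
  by (intro \<Theta>_add supp_closed)
 then have "\<Theta> (\<lambda>_. 0) mu + 0 = \<Theta> (\<lambda>_. 0) mu + \<Theta> (\<lambda>_. 0) mu" for mu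
  by (auto dest: fun_cong[of _ _ mu])
 then show ?thesis by (metis add_left_imp_eq)
qed

lemma \<Theta>_sum: "(!!x. x \<in> X ==> g x \<in> supp V) ==> \<Theta> (\<lambda>mu. \<Sum>x\<in>X. g x mu) = (\<lambda>mu. \<Sum>x\<in>X. \<Theta> (g x) mu)"
 by (induction X rule: infinite_finite_induct) (simp_all add: \<Theta>_zero \<Theta>_add supp_sum)

lemma \<Theta>_tw: "set w \<subseteq> {..<n} ==> \<exists>L\<in>tgt.ops. \<forall>g\<in>supp V. \<Theta> (src.tw w g) = L (\<Theta> g)"
proof (induction w)
 case Nil
 show ?case using tgt.ops_id by auto
next
 case (Cons k w)
 obtain L where L: "L \<in> tgt.ops" "!!g. g \<in> supp V ==> \<Theta> (src.tw w g) = L (\<Theta> g)" using Cons by auto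
 have k: "k < n" using Cons.prems by simp
 obtain L' where L': "L' \<in> tgt.ops" "!!g. g \<in> supp V ==> \<Theta> (\<rho> (tl k) g) = L' (\<Theta> g)"
  using \<Theta>_t[OF k] by blast
 show ?case
 proof (intro bexI[OF _ tgt.ops_comp[OF L'(1) L(1)]] ballI)
  fix g :: "'a => 'c" assume g: "g \<in> supp V"
  have "src.tw w g \<in> supp V" using Cons.prems g by (intro src.tw_supp) auto
  then show "\<Theta> (src.tw (k # w) g) = L' (L (\<Theta> g))" using L' L(2)[OF g] by simp
 qed
qed

text \<open>A source operator is a sum over normal forms of words preceded by coefficients; words
  are transferred by \<open>\<Theta>_tw\<close>, coefficients by \<open>\<phi>\<close>.\<close>

lemma \<Theta>_ops:
 assumes "L \<in> src.ops"
 obtains L' where "L' \<in> tgt.ops" "!!g. g \<in> supp V ==> \<Theta> (L g) = L' (\<Theta> g)"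
proof -
 obtain m where m: "!!w. m w \<in> src.M"
  "!!g. g \<in> supp V ==> L g = (\<lambda>mu. \<Sum>w\<in>nf n. src.tw w (\<lambda>mu. m w mu * g mu) mu)"
  by (rule src.ops_form[OF assms]) blast
 define D where "D = (\<lambda>w. SOME L. L \<in> tgt.ops \<and> (\<forall>g\<in>supp V. \<Theta> (src.tw w g) = L (\<Theta> g)))"
 have D: "D w \<in> tgt.ops" "!!g. g \<in> supp V ==> \<Theta> (src.tw w g) = D w (\<Theta> g)" if "w \<in> nf n" for w
 proof -
  have "\<exists>L. L \<in> tgt.ops \<and> (\<forall>g\<in>supp V. \<Theta> (src.tw w g) = L (\<Theta> g))"
   using \<Theta>_tw[OF nf_set[OF that]] by blast
  from someI_ex[OF this]
  have "D w \<in> tgt.ops \<and> (\<forall>g\<in>supp V. \<Theta> (src.tw w g) = D w (\<Theta> g))" unfolding D_def .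
  then show "D w \<in> tgt.ops" "!!g. g \<in> supp V ==> \<Theta> (src.tw w g) = D w (\<Theta> g)" by blast+
 qed
 show ?thesis
 proof (rule that[of "\<lambda>g mu. \<Sum>w\<in>nf n. D w (\<lambda>mu. \<phi> (m w) mu * g mu) mu"])
  show "(\<lambda>g mu. \<Sum>w\<in>nf n. D w (\<lambda>mu. \<phi> (m w) mu * g mu) mu) \<in> tgt.ops"
  proof (rule tgt.ops_sum)
   fix w assume "w \<in> nf n"
   then show "(\<lambda>g. D w (\<lambda>mu. \<phi> (m w) mu * g mu)) \<in> tgt.ops"
    by (rule tgt.ops_comp[OF D(1) tgt.ops_M[OF \<phi>_M[OF m(1)]]])
  qed
  fix g :: "'a => 'c" assume g: "g \<in> supp V"
  have s: "(\<lambda>mu. m w mu * g mu) \<in> supp V" for w using g by (rule supp_closed)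
  have "\<Theta> (L g) = (\<lambda>mu. \<Sum>w\<in>nf n. \<Theta> (src.tw w (\<lambda>mu. m w mu * g mu)) mu)"
   unfolding m(2)[OF g] by (intro \<Theta>_sum src.tw_supp nf_set s)
  then show "\<Theta> (L g) = (\<lambda>mu. \<Sum>w\<in>nf n. D w (\<lambda>mu. \<phi> (m w) mu * \<Theta> g mu) mu)"
   using D(2)[OF _ s] \<Theta>_mult[OF m(1) g] by simp
 qed
qed

end

text \<open>The second instance, in the reverse direction, is what makes the transfer
  surjective.\<close>

locale ops_transfer_iso =
 ops_transfer G Rl Gq n tl V sc \<rho> S y A B Sc P \<alpha> \<gamma> G' Rl' Gq' tl' \<rho>' S' y' A' B' P' \<alpha>' \<gamma>' \<Theta> \<phi> +
 bwd: ops_transfer G' Rl' Gq' n tl' V sc \<rho>' S' y' A' B' Sc P' \<alpha>' \<gamma>' G Rl Gq tl \<rho> S y A B P \<alpha> \<gamma> \<Theta>' \<phi>'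
 for G :: "'g set" and Rl :: "('g fword \<Rightarrow>\<^sub>0 'k::field) set" and Gq n tl and V :: "'a set"
  and sc :: "'k => 'c::field" and \<rho> S y A B and Sc :: "'c set" and P :: "'p set" and \<alpha> \<gamma>
  and G' :: "'h set" and Rl' :: "('h fword \<Rightarrow>\<^sub>0 'k) set" and Gq' tl' \<rho>' S' y' A' B'
  and P' :: "'q set" and \<alpha>' \<gamma>' \<Theta> \<phi> \<Theta>' \<phi>' +
 assumes \<Theta>_\<Theta>': "g \<in> supp V ==> \<Theta> (\<Theta>' g) = g"
  and \<Theta>'_\<Theta>: "g \<in> supp V ==> \<Theta>' (\<Theta> g) = g"
  and \<phi>_sc: "\<phi> (vec V (\<lambda>_. sc c)) = vec V (\<lambda>_. sc c)"
begin

lemma ex_transfer: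
 assumes "C \<in> carrier src.TR"
 shows "\<exists>D. D \<in> carrier tgt.TR \<and> (\<forall>g\<in>supp V. tgt.tact D (\<Theta> g) = \<Theta> (src.tact C g))"
proof -
 obtain L where L: "L \<in> tgt.ops" "!!g. g \<in> supp V ==> \<Theta> (src.tact C g) = L (\<Theta> g)"
  by (rule \<Theta>_ops[OF src.tact_ops[OF assms]]) blast
 obtain D where D: "D \<in> carrier tgt.TR" "!!g. g \<in> supp V ==> tgt.tact D g = L g" by (rule tgt.ops_obtain[OF L(1)]) blast
 show ?thesis using D L(2) \<Theta>_supp by (intro exI[of _ D]) simp
qed

lemma ex_bwd:
 assumes "D \<in> carrier tgt.TR"
 shows "\<exists>C. C \<in> carrier src.TR \<and> (\<forall>g\<in>supp V. tgt.tact D (\<Theta> g) = \<Theta> (src.tact C g))"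
proof -
 obtain L where L: "L \<in> src.ops" "!!g. g \<in> supp V ==> \<Theta>' (tgt.tact D g) = L (\<Theta>' g)"
  by (rule bwd.\<Theta>_ops[OF tgt.tact_ops[OF assms]]) blast
 obtain C where C: "C \<in> carrier src.TR" "!!g. g \<in> supp V ==> src.tact C g = L g" by (rule src.ops_obtain[OF L(1)]) blast
 have "tgt.tact D (\<Theta> g) = \<Theta> (src.tact C g)" if g: "g \<in> supp V" for g
 proof -
  have "src.tact C g = \<Theta>' (tgt.tact D (\<Theta> g))" using C(2)[OF g] L(2)[OF \<Theta>_supp[OF g]] \<Theta>'_\<Theta>[OF g] by simp
  then show ?thesis using \<Theta>_\<Theta>' tgt.ops_supp[OF tgt.tact_ops[OF assms] \<Theta>_supp[OF g]] by simp
 qed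
 with C(1) show ?thesis by blast
qed

text \<open>The class whose action is the conjugate by \<open>\<Theta>\<close>. Faithfulness makes
  it unique, so every identity about it can be checked on operators.\<close>

definition transfer where
 "transfer C = (SOME D. D \<in> carrier tgt.TR \<and> (\<forall>g\<in>supp V. tgt.tact D (\<Theta> g) = \<Theta> (src.tact C g)))"

lemma transfer:
 assumes "C \<in> carrier src.TR"
 shows "transfer C \<in> carrier tgt.TR"
  "g \<in> supp V ==> tgt.tact (transfer C) (\<Theta> g) = \<Theta> (src.tact C g)"
 using someI_ex[OF ex_transfer[OF assms]] by (simp_all add: transfer_def)

lemma tgt_eqI:
 assumes "D \<in> carrier tgt.TR" "D' \<in> carrier tgt.TR"
  and "!!g. g \<in> supp V ==> tgt.tact D (\<Theta> g) = tgt.tact D' (\<Theta> g)"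
 shows "D = D'"
proof (rule tgt.tact_inj[OF assms(1,2)])
 fix g :: "'a => 'c" assume "g \<in> tgt.M"
 then have g: "g \<in> supp V" by (rule tgt.M_FF)
 show "tgt.tact D g = tgt.tact D' g" using assms(3)[OF bwd.\<Theta>_supp[OF g]] by (simp add: \<Theta>_\<Theta>' g)
qed

lemma transfer_elt:
 assumes "m \<in> src.M"
 shows "transfer (src.elt 1 m) = tgt.elt 1 (\<phi> m)"
proof (rule tgt_eqI)
 show "transfer (src.elt 1 m) \<in> carrier tgt.TR" "tgt.elt 1 (\<phi> m) \<in> carrier tgt.TR"
  by (intro transfer src.elt_carrier tgt.elt_carrier fcar_closed assms \<phi>_M)+
 fix g :: "'a => 'c" assume g: "g \<in> supp V"
 show "tgt.tact (transfer (src.elt 1 m)) (\<Theta> g) = tgt.tact (tgt.elt 1 (\<phi> m)) (\<Theta> g)"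
  using transfer(2)[OF src.elt_carrier[OF fcar_closed(2) assms] g]
  by (simp add: src.elt_act tgt.elt_act g \<Theta>_supp src.act_one tgt.act_one \<Theta>_mult assms)
qed

lemma transfer_iso: "transfer \<in> ring_iso src.TR tgt.TR"
proof (rule ring_iso_memI)
 fix C assume "C \<in> carrier src.TR"
 then show "transfer C \<in> carrier tgt.TR" by (rule transfer)
next
 fix C C' assume C: "C \<in> carrier src.TR" "C' \<in> carrier src.TR"
 note t = transfer[OF C(1)] transfer[OF C(2)] and mc = src.TR_mult[OF C]
 show "transfer (C \<otimes>\<^bsub>src.TR\<^esub> C') = transfer C \<otimes>\<^bsub>tgt.TR\<^esub> transfer C'"
  by (rule tgt_eqI) (simp_all add: transfer[OF mc(1)] mc tgt.TR_mult t \<Theta>_supp src.ops_supp[OF src.tact_ops] C)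
 interpret src_ab: abelian_group src.TR by (rule src.TR_abelian)
 interpret tgt_ab: abelian_group tgt.TR by (rule tgt.TR_abelian)
 have ac: "C \<oplus>\<^bsub>src.TR\<^esub> C' \<in> carrier src.TR" using C by simp
 show "transfer (C \<oplus>\<^bsub>src.TR\<^esub> C') = transfer C \<oplus>\<^bsub>tgt.TR\<^esub> transfer C'" by (rule tgt_eqI)
   (simp_all add: transfer[OF ac] src.TR_add C tgt.TR_add t \<Theta>_supp src.ops_supp[OF src.tact_ops] \<Theta>_add)
next
 show "transfer \<one>\<^bsub>src.TR\<^esub> = \<one>\<^bsub>tgt.TR\<^esub>"
  by (rule tgt_eqI) (simp_all add: transfer src.TR_one tgt.TR_one \<Theta>_supp)
next
 show "bij_betw transfer (carrier src.TR) (carrier tgt.TR)"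
 proof (rule bij_betw_imageI)
  show "inj_on transfer (carrier src.TR)"
  proof (rule inj_onI)
   fix C C' assume C: "C \<in> carrier src.TR" "C' \<in> carrier src.TR" "transfer C = transfer C'"
   show "C = C'"
   proof (rule src.tact_inj[OF C(1,2)])
    fix g :: "'a => 'c" assume "g \<in> src.M"
    then have g: "g \<in> supp V" by (rule src.M_FF)
    have "\<Theta> (src.tact C g) = \<Theta> (src.tact C' g)" using C transfer(2)[OF _ g] by metis
    then show "src.tact C g = src.tact C' g"
     using \<Theta>'_\<Theta> src.ops_supp[OF src.tact_ops[OF C(1)] g] src.ops_supp[OF src.tact_ops[OF C(2)] g] by metis
   qed
  qed
  show "transfer ` carrier src.TR = carrier tgt.TR"
  proof
   show "transfer ` carrier src.TR \<subseteq> carrier tgt.TR" using transfer(1) by blast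
   show "carrier tgt.TR \<subseteq> transfer ` carrier src.TR"
   proof
    fix D assume D: "D \<in> carrier tgt.TR"
    then obtain C where C: "C \<in> carrier src.TR"
     "\<forall>g\<in>supp V. tgt.tact D (\<Theta> g) = \<Theta> (src.tact C g)" using ex_bwd by blast
    have "D = transfer C" by (rule tgt_eqI[OF D transfer(1)[OF C(1)]]) (simp add: transfer(2) C)
    with C(1) show "D \<in> transfer ` carrier src.TR" by blast
   qed
  qed
 qed
qed

lemma transfer_scal:
 "transfer (src.elt (scal c) \<one>\<^bsub>coef_ring V Sc\<^esub>) = tgt.elt (scal c) \<one>\<^bsub>coef_ring V Sc\<^esub>"
proof (rule tgt_eqI)
 show c: "tgt.elt (scal c) \<one>\<^bsub>coef_ring V Sc\<^esub> \<in> carrier tgt.TR"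
  unfolding tgt.coef_ring_simps by (intro tgt.elt_carrier fcar_closed tgt.M_closed)
 have s: "src.elt (scal c) \<one>\<^bsub>coef_ring V Sc\<^esub> \<in> carrier src.TR"
  unfolding src.coef_ring_simps by (intro src.elt_carrier fcar_closed src.M_closed)
 then show "transfer (src.elt (scal c) \<one>\<^bsub>coef_ring V Sc\<^esub>) \<in> carrier tgt.TR" by (rule transfer)
 fix g :: "'a => 'c" assume g: "g \<in> supp V"
 have v: "(\<lambda>mu. sc c * h mu) = (\<lambda>mu. vec V (\<lambda>_. sc c) mu * h mu)" if "h \<in> supp V" for h :: "'a => 'c"
  using that by (auto simp: vec_def supp_def)
 have "vec V (\<lambda>_. sc c) \<in> src.M" using src.Sc by (auto simp: coef_ring_def vec_def)
 then have "\<Theta> (\<lambda>mu. sc c * g mu) = (\<lambda>mu. sc c * \<Theta> g mu)"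
  unfolding v[OF g] v[OF \<Theta>_supp[OF g]] using \<Theta>_mult[OF _ g] \<phi>_sc by simp
 then show "tgt.tact (transfer (src.elt (scal c) \<one>\<^bsub>coef_ring V Sc\<^esub>)) (\<Theta> g) =
   tgt.tact (tgt.elt (scal c) \<one>\<^bsub>coef_ring V Sc\<^esub>) (\<Theta> g)"
  using transfer(2)[OF s g] unfolding src.coef_ring_simps
  by (simp add: src.elt_act tgt.elt_act g \<Theta>_supp src.act_scal tgt.act_scal tgt.one_F)
qed

end

section \<open>The polynomial representation of orientifold KLR algebras\<close>

definition pev :: "'k::field mpoly => 'k mps fract" where
 "pev p = to_fract (Abs_mps (lookup p))"

lemma Abs_mps_add: "Abs_mps (lookup (p + q)) = Abs_mps (lookup p) + Abs_mps (lookup q)" by (rule mps_eqI) (simp add: lookup_add)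

lemma Abs_mps_minus: "Abs_mps (lookup (- p)) = - Abs_mps (lookup p)" by (rule mps_eqI) simp

lemma Abs_mps_zero: "Abs_mps (lookup 0) = 0" by (rule mps_eqI) simp

lemma Abs_mps_sum: "Abs_mps (lookup (sum f X)) = (\<Sum>x\<in>X. Abs_mps (lookup (f x)))"
 by (induction X rule: infinite_finite_induct) (simp_all add: zero_mps_def Abs_mps_add)

lemma Abs_mps_mult_single:
 "Abs_mps (lookup (single m c)) * Abs_mps (lookup (single m' c')) =
 Abs_mps (lookup (single (m + m') (c * c' :: 'k::comm_ring_1)))"
proof (rule mps_eqI)
 fix t
 have "mco (Abs_mps (lookup (single m c)) *
   Abs_mps (lookup (single m' c'))) t = (\<Sum>p\<in>msplits t. if p = (m, m') then c * c' else 0)"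
  unfolding mps_coeff_mult by (rule sum.cong) (auto simp: lookup_single when_def)
 also have "... = (if (m, m') \<in> msplits t then c * c' else 0)" by (rule sum.delta[OF finite_msplits])
 finally show "mco (Abs_mps (lookup (single m c)) *
   Abs_mps (lookup (single m' c'))) t =
  mco (Abs_mps (lookup (single (m + m') (c * c')))) t" by (auto simp: msplits_def lookup_single)
qed

lemma Abs_mps_mult:
 "Abs_mps (lookup (p * q)) = Abs_mps (lookup p) * Abs_mps (lookup (q :: 'k::comm_ring_1 mpoly))"
proof -
 have "Abs_mps (lookup ((\<Sum>m\<in>X. single m (f m)) * (\<Sum>m\<in>Y. single m (g m)))) =
  Abs_mps (lookup (\<Sum>m\<in>X. single m (f m))) *
  Abs_mps (lookup (\<Sum>m\<in>Y. single m (g m)))"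
  for X Y :: "(nat \<Rightarrow>\<^sub>0 nat) set" and f g :: "(nat \<Rightarrow>\<^sub>0 nat) => 'k"
  by (simp add: sum_product Abs_mps_sum Abs_mps_mult_single mult_single)
 from this[of "lookup p" "keys p" "lookup q" "keys q"]
 show ?thesis by (simp only: poly_mapping_sum_single[symmetric])
qed

lemma pev_simps:
 fixes p q :: "'k::field mpoly" and c :: 'k
 shows "pev (p + q) = pev p + pev q" "pev (- p) = - pev p" "pev (p - q) = pev p - pev q"
 "pev (p * q) = pev p * pev q" "pev (0 :: 'k mpoly) = 0" "pev (1 :: 'k mpoly) = 1" "pev (mpoly_var l :: 'k mpoly) = fvar l" "pev (p ^ k) = pev p ^ k"
 "pev (single 0 c) = fconst c"
proof -
 show a: "pev (p + q) = pev p + pev q" and m: "pev (- p) = - pev p" and t: "pev (p * q) = pev p * pev q" for p q :: "'k mpoly"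
  by (simp_all add: pev_def Abs_mps_add Abs_mps_minus Abs_mps_mult)
 show "pev (p - q) = pev p - pev q" using a[of p "- q"] m[of q] by simp
 show "pev (0 :: 'k mpoly) = 0" unfolding pev_def Abs_mps_zero by simp
 have "Abs_mps (lookup (1 :: 'k mpoly)) = 1" by (rule mps_eqI) (simp add: mps_coeff_one lookup_one when_def)
 then show o: "pev (1 :: 'k mpoly) = 1" by (simp add: pev_def)
 show "pev (p ^ k) = pev p ^ k" by (induction k) (simp_all add: o t)
 have "Abs_mps (lookup (mpoly_var l :: 'k mpoly)) = mps_var l"
  by (rule mps_eqI) (auto simp: mpoly_var_def mps_coeff_var lookup_single when_def)
 then show "pev (mpoly_var l :: 'k mpoly) = fvar l" by (simp add: pev_def fvar_def)
 have "Abs_mps (lookup (single 0 c)) = mps_const c" by (rule mps_eqI) (auto simp: mps_coeff_const lookup_single when_def)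
 then show "pev (single 0 c) = fconst c" by (simp add: pev_def fconst_def)
qed

lemma pev_single: "pev (single m c) = fconst c * (\<Prod>l\<in>keys m. fvar l ^ lookup m l)"
proof -
 have e: "mpoly_var l ^ k = single (single l k) (1 :: 'a)" for l k
  by (induction k) (simp_all add: mpoly_var_def mult_single single_add[symmetric])
 have "(\<Prod>l\<in>X. mpoly_var l ^ f l) = single (\<Sum>l\<in>X. single l (f l)) (1 :: 'a)" for X f
  by (induction X rule: infinite_finite_induct) (simp_all add: e mult_single)
 then have "single 0 c * (\<Prod>l\<in>keys m. mpoly_var l ^ lookup m l) = single m c"
  by (simp add: poly_mapping_sum_single[symmetric] mult_single)
 moreover have "pev (\<Prod>l\<in>X. mpoly_var l ^ f l) = (\<Prod>l\<in>X. fvar l ^ f l :: 'a mps fract)" for X f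
  by (induction X rule: infinite_finite_induct) (simp_all add: pev_simps)
 ultimately show ?thesis by (metis pev_simps(4,9))
qed

lemma single_Suc_0_eq: "single k (Suc 0) = single l (Suc 0) \<longleftrightarrow> k = l" by (auto dest: arg_cong[where f = keys])

lemma fvar_neq: "k ~= l ==> fvar k ~= (fvar l :: 'a::field mps fract)"
 and fvar_nz: "fvar k ~= (0 :: 'a mps fract)"
proof -
 show "k ~= l ==> fvar k ~= (fvar l :: 'a mps fract)"
 proof
  assume "k ~= l" "fvar k = (fvar l :: 'a mps fract)"
  then have "mco (mps_var k :: 'a mps) (single k 1) = mco (mps_var l) (single k 1)" by (simp add: fvar_def)
  with \<open>k ~= l\<close> show False by (simp add: mps_coeff_var single_Suc_0_eq)
 qed
 show "fvar k ~= (0 :: 'a mps fract)"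
 proof
  assume "fvar k = (0 :: 'a mps fract)"
  then have "mco (mps_var k :: 'a mps) (single k 1) = 0" by (simp add: fvar_def)
  then show False by (simp add: mps_coeff_var)
 qed
qed

lemma fvar_add_nz: "k ~= l ==> fvar k + fvar l ~= 0"
proof
 assume "k ~= l" "fvar k + fvar l = (0 :: 'a mps fract)"
 then have "to_fract (mps_var k + mps_var l) = (0 :: 'a mps fract)" by (simp add: fvar_def)
 then have e: "mps_var k + mps_var l = (0 :: 'a mps)" by (simp del: to_fract_add)
 have "mco (mps_var k + mps_var l :: 'a mps) (single k 1) = 0" unfolding e by simp
 with \<open>k ~= l\<close> show False by (simp add: mps_coeff_var single_Suc_0_eq)
qed

subsection \<open>Reflections of variables\<close>

lemma index_swap_simps:
 "index_swap 0 l = l" "1 \<le> k ==> index_swap k l = (if l = k then Suc k else if l = Suc k then k else l)"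
 by (auto simp: index_swap_def)

lemma index_swap_permutes: "k < n ==> index_swap k permutes {1..n}"
proof -
 assume "k < n"
 then have "transpose k (k + 1) permutes {1..n}" if "k ~= 0" using that by (intro permutes_swap_id) auto
 then show ?thesis by (cases "k = 0") (auto simp: index_swap_def permutes_def transpose_def)
qed

lemma klr_refl_fcoord:
 assumes "k < n"
 shows "fcoord n (klr_refl k :: 'a::field mps fract => _)"
  and "klr_refl k (fvar l :: 'a mps fract) = (if k = 0 \<and> l = 1 then - fvar 1 else fvar (index_swap k l))" (is ?g1)
proof -
 let ?\<sigma> = "\<lambda>l. if k = 0 \<and> l = 1 then - mps_var 1 else mps_var (index_swap k l) :: 'a mps"
 have *: "?\<sigma> l = mps_uni (index_swap k l) (if k = 0 \<and> l = 1 then - fps_X else fps_X)" for l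
  by (auto simp: mps_uni_X mps_uni_minus index_swap_def)
 note f = fcoordI[OF index_swap_permutes[OF assms] _ _ *]
 show "fcoord n (klr_refl k :: 'a mps fract => _)" unfolding klr_refl_def by (rule f(1)) auto
 have "fract_map (mps_subst ?\<sigma>) (fvar l) = to_fract (?\<sigma> l)" by (rule f(2)) auto
 then show ?g1 unfolding klr_refl_def by (simp add: fvar_def)
qed

lemma klr_refl_fhom: "fhom (klr_refl k)" using klr_refl_fcoord(1)[of k "Suc k"] fcoord_fhom by blast

lemma klr_refl_fvar: "klr_refl k (fvar l) = (if k = 0 \<and> l = 1 then - fvar 1 else fvar (index_swap k l))"
 using klr_refl_fcoord(2)[of k "Suc k"] by blast

lemmas klr_refl_simps = fhom_simps[OF klr_refl_fhom] klr_refl_fvar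

text \<open>Reflections are determined by their effect on variables. \<open>N\<close> exceeds all
  letters involved, so that every reflection in the two words is a coordinate change of the first
  \<open>N\<close> variables.\<close>

lemma klr_refl_word_eq:
 fixes z :: "'k::field mps fract"
 assumes "!!l. foldr klr_refl u (fvar l :: 'k mps fract) = foldr klr_refl v (fvar l)"
 shows "foldr klr_refl u z = foldr klr_refl v z"
proof -
 define N where "N = Suc (Max (insert 0 (set u \<union> set v)))"
 have w: "fcoord N (foldr klr_refl w :: 'k mps fract => _)" if "set w \<subseteq> {..<N}" for w using that
 proof (induction w)
  case Nil
  then show ?case using fcoord_id[of N] by (simp)
 next
  case (Cons k w)
  then show ?case using fcoord_comp[of N "klr_refl k" "foldr klr_refl w"] klr_refl_fcoord(1)[of k N] by (simp add: comp_def)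
 qed
 have "k < N" if "k \<in> set u \<union> set v" for k unfolding N_def less_Suc_eq_le by (rule Max_ge) (use that in auto)
 then have "set u \<subseteq> {..<N}" "set v \<subseteq> {..<N}" by auto
 then have "foldr klr_refl u = (foldr klr_refl v :: 'k mps fract => _)" by (rule fcoord_eqI[OF w w assms])
 then show ?thesis by simp
qed

lemma klr_refl_sq: "klr_refl k (klr_refl k z) = z"
proof -
 have "foldr klr_refl [k, k] z = foldr klr_refl [] z"
  by (rule klr_refl_word_eq) (auto simp: klr_refl_simps index_swap_def transpose_def)
 then show ?thesis by simp
qed

lemma klr_refl_comm: "i + 1 < j \<or> j + 1 < i ==> klr_refl i (klr_refl j z) = klr_refl j (klr_refl i z)"
proof -
 assume a: "i + 1 < j \<or> j + 1 < i"
 have "foldr klr_refl [i, j] z = foldr klr_refl [j, i] z"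
  by (rule klr_refl_word_eq) (use a in \<open>auto simp: klr_refl_simps index_swap_def transpose_def\<close>)
 then show ?thesis by simp
qed

lemma klr_refl_braid: "1 \<le> i ==> klr_refl (Suc i) (klr_refl i (klr_refl (Suc i) z)) = klr_refl i (klr_refl (Suc i) (klr_refl i z))"
proof -
 assume a: "1 \<le> i"
 have "foldr klr_refl [Suc i, i, Suc i] z = foldr klr_refl [i, Suc i, i] z"
  by (rule klr_refl_word_eq) (use a in \<open>auto simp: klr_refl_simps index_swap_def transpose_def\<close>)
 then show ?thesis by simp
qed

lemma klr_refl_four:
 "klr_refl (Suc 0) (klr_refl 0 (klr_refl (Suc 0) (klr_refl 0 z))) = klr_refl 0 (klr_refl (Suc 0) (klr_refl 0 (klr_refl (Suc 0) z)))"
proof -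
 have "foldr klr_refl [Suc 0, 0, Suc 0, 0] z = foldr klr_refl [0, Suc 0, 0, Suc 0] z"
  by (rule klr_refl_word_eq) (auto simp: klr_refl_simps index_swap_def transpose_def)
 then show ?thesis by simp
qed

subsection \<open>Divided differences of power series\<close>

lemma klr_refl_pseries: "k < n ==> z \<in> pseries n ==> klr_refl k z \<in> pseries n"
 using fcoord_pseries klr_refl_fcoord(1) by blast

text \<open>The reflected series has permuted or sign-changed coefficients. For
  \<open>k = 0\<close>, exponents without the first variable are unaffected, so the difference is
  divisible by that variable; for other \<open>k\<close> the sums along the exchanged directions
  agree, so the difference is divisible by the difference of the two variables.\<close>

lemma klr_divided_difference_any:
 assumes "k < n" "z \<in> pseries n"
 shows "(klr_refl k z - z) / (if k = 0 then fvar 1 else fvar k - fvar (Suc k)) \<in> pseries n"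
proof -
 define c :: "nat => 'a" where "c l = (if k = 0 \<and> l = 1 then - 1 else 1)" for l
 let ?u = "\<lambda>l. fps_const (c l) * fps_X" and ?\<pi> = "index_swap k"
 let ?d = "if k = 0 then mps_var 1 else mps_var k - mps_var (Suc k) :: 'a mps"
 have c: "coord n ?u ?\<pi>" using index_swap_permutes[OF assms(1)] by (simp add: coord_def c_def)
 obtain f where f: "f \<in> mps_in n" "z = to_fract f" using assms(2) by (auto simp: pseries_def)
 define f' where "f' = msub ?u ?\<pi> f"
 have m: "fps_const (- 1) * fps_X = (- fps_X :: 'a fps)" by (metis fps_const_neg fps_const_1_eq_1 mult_minus_left mult_1)
 have "klr_refl k = fract_map (msub ?u ?\<pi>)"
  unfolding klr_refl_def msub_def by (intro arg_cong[where f = fract_map] arg_cong[where f = mps_subst] ext)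
   (auto simp: c_def m mps_uni_X mps_uni_minus index_swap_def)
 then have z': "klr_refl k z = to_fract f'" by (simp add: f(2) f'_def fract_map_to_fract[OF coord_ihom[OF c]])
 have df: "f' - f \<in> mps_in n" using mps_in_add[OF coord_mps_in[OF c f(1)] mps_in_minus[OF f(1)]] by (simp add: f'_def)
 have pp: "?\<pi> (?\<pi> l) = l" for l by (simp add: index_swap_def)
 note co = mps_coeff_subst_scale[where \<pi> = ?\<pi>, OF pp, of _ _ c f, folded msub_def, folded f'_def]
 have "\<exists>g\<in>mps_in n. f' - f = ?d * g"
 proof (cases "k = 0")
  case True
  have "mco (f' - f) t = 0" if "lookup t 1 = 0" for t
  proof -
   have "c l ^ lookup t l = 1" for l using that by (auto simp: c_def)
   then show ?thesis using co[of t t] True by (simp add: index_swap_def)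
  qed
  then show ?thesis unfolding if_P[OF True] by (rule mps_var_dvd[OF df])
 next
  case False
  show ?thesis unfolding if_not_P[OF False]
  proof (rule mps_var_diff_dvd[OF df])
   fix t :: "nat \<Rightarrow>\<^sub>0 nat" and b
   assume t: "lookup t k = 0" "lookup t (Suc k) = 0"
   let ?m = "\<lambda>i j. t + single k i + single (Suc k) j"
   have "mco f' (?m i j) = mco f (?m j i) * (\<Prod>l\<in>keys (?m j i). c l ^ lookup (?m j i) l)" for i j
    by (rule co) (use t False in \<open>auto simp: lookup_add lookup_single when_def index_swap_simps\<close>)
   then have "mco f' (?m i j) = mco f (?m j i)" for i j using False by (simp add: c_def)
   moreover have "(\<Sum>i\<le>b. mco f (?m (b - i) i)) = (\<Sum>i\<le>b. mco f (?m i (b - i)))"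
    by (rule sum.reindex_bij_witness[of _ "\<lambda>i. b - i" "\<lambda>i. b - i"]) auto
   ultimately show "(\<Sum>i\<le>b. mco (f' - f) (?m i (b - i))) = 0" by (simp add: sum_subtractf)
  qed (use False assms in auto)
 qed
 then obtain g where g: "g \<in> mps_in n" "f' - f = ?d * g" by blast
 let ?D = "if k = 0 then fvar 1 else fvar k - fvar (Suc k) :: 'a mps fract"
 have "klr_refl k z - z = to_fract ?d * to_fract g"
  unfolding z' unfolding f(2) to_fract_diff[symmetric] to_fract_mult[symmetric] g(2) ..
 moreover have "to_fract ?d = ?D" by (simp add: fvar_def)
 moreover have "?D ~= 0" by (simp add: fvar_neq fvar_nz)
 ultimately have "(klr_refl k z - z) / ?D = to_fract g" by (simp only: nonzero_mult_div_cancel_left not_False_eq_True)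
 then show ?thesis using g(1) by (simp add: pseries_def)
qed

lemma klr_divided_difference:
 "1 \<le> k ==> k < n ==> z \<in> pseries n ==> (klr_refl k z - z) / (fvar k - fvar (Suc k)) \<in> pseries n" (is "PROP ?g1")
 "0 < n ==> z \<in> pseries n ==> (klr_refl 0 z - z) / fvar 1 \<in> pseries n"
proof -
 show "PROP ?g1" using klr_divided_difference_any[of k n z] by (cases "k = 0") simp_all
qed (use klr_divided_difference_any[of 0 n z] in simp)

subsection \<open>Sequences\<close>

lemma seq_swap_at:
 "1 \<le> k ==> seq_swap \<theta> k mu l = (if l = k then mu (Suc k) else if l = Suc k then mu k else mu l)"
 "seq_swap \<theta> 0 mu l = (if l = 1 then \<theta> (mu 1) else mu l)" by (auto simp: seq_swap_def)

lemma seq_swap_fix: "1 \<le> k ==> mu (Suc k) = mu k ==> seq_swap \<theta> k mu = mu"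
 "\<theta> (mu 1) = mu 1 ==> seq_swap \<theta> 0 mu = mu" by (auto simp: seq_swap_def)

locale seq_system =
 fixes \<theta> :: "'i => 'i" and n :: nat and V :: "(nat => 'i) set"
 assumes \<theta>\<theta>: "\<theta> (\<theta> i) = i"
  and finV: "finite V"
  and swapV: "nu \<in> V ==> k < n ==> seq_swap \<theta> k nu \<in> V"
begin

abbreviation "sw \<equiv> seq_swap \<theta>"

lemma sw_sq: "sw k (sw k mu) = mu" by (auto simp: seq_swap_def \<theta>\<theta>)

lemma sw_comm: "i + 1 < j \<or> j + 1 < i ==> sw i (sw j mu) = sw j (sw i mu)" by (auto simp: seq_swap_def fun_eq_iff)

lemma sw_braid: "1 \<le> i ==> sw (Suc i) (sw i (sw (Suc i) mu)) = sw i (sw (Suc i) (sw i mu))" by (auto simp: seq_swap_def)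

lemma sw_four: "sw (Suc 0) (sw 0 (sw (Suc 0) (sw 0 mu))) = sw 0 (sw (Suc 0) (sw 0 (sw (Suc 0) mu)))" by (auto simp: seq_swap_def)

lemma sw_V_iff: "k < n ==> sw k mu \<in> V \<longleftrightarrow> mu \<in> V" using swapV sw_sq by metis

end

text \<open>\<open>r mu k\<close> maps into the component at \<open>mu\<close> from the one at
  \<open>sw k mu\<close>; with this indexing by the target, composites follow a path of components
  read from the left. The KLR reflections ignore \<open>mu\<close>, the Hecke ones depend on
  it.\<close>

locale seq_refl = seq_system \<theta> n V
 for \<theta> :: "'i => 'i" and n V +
 fixes r :: "(nat => 'i) => nat => 'c::field => 'c" and y :: "int => (nat => 'i) => 'c"
 assumes r_hom: "k < n ==> mu \<in> V ==> fhom (r mu k)"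
  and r_sq: "k < n ==> mu \<in> V ==> r mu k (r (sw k mu) k z) = z"
  and r_comm: "i < n ==> j < n ==> i + 1 < j \<or> j + 1 < i ==> mu \<in> V ==>
   r mu i (r (sw i mu) j z) = r mu j (r (sw j mu) i z)" and r_braid: "1 \<le> i ==> Suc i < n ==> mu \<in> V ==>
   r mu i (r (sw i mu) (Suc i) (r (sw (Suc i) (sw i mu)) i z)) =
   r mu (Suc i) (r (sw (Suc i) mu) i (r (sw i (sw (Suc i) mu)) (Suc i) z))" and r_four: "2 \<le> n ==> mu \<in> V ==>
   r mu 0 (r (sw 0 mu) 1 (r (sw 1 (sw 0 mu)) 0 (r (sw 0 (sw 1 (sw 0 mu))) 1 z))) =
   r mu 1 (r (sw 1 mu) 0 (r (sw 0 (sw 1 mu)) 1 (r (sw 1 (sw 0 (sw 1 mu))) 0 z)))"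
  and r_y: "k < n ==> mu \<in> V ==> 1 \<le> \<bar>e\<bar> \<and> \<bar>e\<bar> \<le> int n ==> r mu k (y e (sw k mu)) = y (sperm k e) mu"
  and y_inj: "mu \<in> V ==> 1 \<le> \<bar>e\<bar> \<and> \<bar>e\<bar> \<le> int n ==> 1 \<le> \<bar>e'\<bar> \<and> \<bar>e'\<bar> \<le> int n ==> y e mu = y e' mu ==> e = e'"
begin

definition SV :: "nat => ((nat => 'i) => 'c) => (nat => 'i) => 'c" where
 "SV k F = vec V (\<lambda>mu. r mu k (F (sw k mu)))"

lemma SV_at: "mu \<in> V ==> SV k F mu = r mu k (F (sw k mu))" by (simp add: SV_def vec_def)

lemma SV_supp: "SV k F \<in> supp V" by (simp add: SV_def supp_closed)

lemma fun_V_eqI: "F \<in> supp V ==> F' \<in> supp V ==> (!!mu. mu \<in> V ==> F mu = F' mu) ==> F = F'"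
proof
 fix mu assume "F \<in> supp V" "F' \<in> supp V" "!!mu. mu \<in> V ==> F mu = F' mu"
 then show "F mu = F' mu" by (cases "mu \<in> V") (simp_all add: supp_def)
qed

lemma refl_sys: "refl_sys V n SV y"
proof
 fix k assume k: "k < n"
 note rh = r_hom[OF k]
 show "SV k F \<in> supp V" for F by (rule SV_supp)
 show "SV k (\<lambda>mu. F mu + G mu) = (\<lambda>mu. SV k F mu + SV k G mu)" for F G
  by (auto simp: SV_def vec_def fhom_add[OF rh])
 show "SV k (\<lambda>mu. F mu * G mu) = (\<lambda>mu. SV k F mu * SV k G mu)" for F G
  by (auto simp: SV_def vec_def fhom_mult[OF rh])
 show "SV k (vec V (\<lambda>_. 1)) = vec V (\<lambda>_. 1)" by (auto simp: SV_def vec_def fhom_one[OF rh] swapV[OF _ k])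
 show "SV k (SV k F) = F" if "F \<in> supp V" for F
  using that by (intro fun_V_eqI SV_supp) (auto simp: SV_at swapV[OF _ k] r_sq[OF k] sw_sq)
 show "SV k (vec V (y i)) = vec V (y (sperm k i))" if "1 \<le> \<bar>i\<bar> \<and> \<bar>i\<bar> \<le> int n" for i
  by (intro fun_V_eqI SV_supp supp_closed) (simp add: SV_at vec_def swapV[OF _ k] r_y[OF k _ that])
next
 fix l w and F :: "(nat => 'i) => 'c" assume m: "bmove l w" and l: "set l \<subseteq> {..<n}" and F: "F \<in> supp V"
 from m l F show "foldr SV l F = foldr SV w F"
 proof (induction rule: bmove.induct)
  case (comm i j)
  then show ?case by (auto intro!: fun_V_eqI SV_supp simp: SV_at swapV sw_comm[OF comm(1)] r_comm)
 next
  case (braid i)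
  then show ?case by (auto intro!: fun_V_eqI SV_supp simp: SV_at swapV sw_braid r_braid)
 next
  case (braid' i)
  then show ?case by (auto intro!: fun_V_eqI SV_supp simp: SV_at swapV sw_braid r_braid)
 next
  case four
  then have n: "2 \<le> n" "0 < n" "Suc 0 < n" by auto
  show ?case using r_four[OF n(1)] by (auto intro!: fun_V_eqI SV_supp simp: SV_at swapV sw_four n)
 next
  case four'
  then have n: "2 \<le> n" "0 < n" "Suc 0 < n" by auto
  show ?case using r_four[OF n(1)] by (auto intro!: fun_V_eqI SV_supp simp: SV_at swapV sw_four n)
 qed
qed (rule y_inj)

end

section \<open>The operators of the KLR generators on fractions of power series\<close>

lemma two_fract: "(2 :: 'k::field) ~= 0 ==> (2 :: 'k mps fract) ~= 0"
proof -
 have "fconst (2 :: 'k) = 2" using fconst_simps(3)[of "1 :: 'k" 1] by (simp add: fconst_simps(1))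
 then show "(2 :: 'k) ~= 0 ==> (2 :: 'k mps fract) ~= 0" by (metis fconst_eq_0_iff)
qed

text \<open>The braid relation of divided differences, with the six images of a function under the
  symmetric group on three letters as indeterminates: \<open>s\<close> is the function itself and
  \<open>w\<close> its image under the longest element.\<close>

lemma nil_braid_identity:
 fixes x y z :: "'f::field"
 assumes "x ~= y" "y ~= z" "x ~= z"
 shows "(((w - s21) / (x - y) - (s - s2) / (z - y)) / (x - z) - ((s12 - s1) / (x - z) - (s2 - s) / (y - z)) / (x - y)) / (y - z) =
  (((w - s12) / (y - z) - (s - s1) / (y - x)) / (x - z) - ((s21 - s2) / (x - z) - (s1 - s) / (x - y)) / (y - z)) / (x - y)"
proof -
 have e: "b / (z - y) = - (b / (y - z))" "b / (y - x) = - (b / (x - y))" for b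
  using minus_divide_right[of b "y - z"] minus_divide_right[of b "x - y"] by simp_all
 have "x - y ~= 0" "y - z ~= 0" "x - z ~= 0" using assms by simp_all
 then show ?thesis unfolding e by (simp add: divide_simps) (simp add: algebra_simps)
qed

text \<open>The analogue for the dihedral group of order 8 generated by the sign change of
  \<open>x\<close> and the exchange of \<open>x\<close> and \<open>y\<close>.\<close>

lemma nil_four_identity:
 fixes x y w :: "'f::field"
 assumes "x ~= 0" "y ~= 0" "y ~= x" "x + y ~= 0"
 shows "((((w - s101) / x + (s1 - s10) / y) / (- y - x) - ((s0 - s) / x - (s10 - s1) / y) / (y - x)) / y -
   (((s010 - s01) / y + (s - s0) / x) / (- x - y) - ((s10 - s1) / y - (s0 - s) / x) / (x - y)) / x) / (x - y) =
  ((((w - s010) / (x - y) - (s0 - s01) / (y + x)) / y + ((s1 - s) / (x - y) - (s01 - s0) / (- x - y)) / x) / (- x - y) -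
   (((s101 - s10) / (- y - x) - (s - s1) / (y - x)) / y - ((s01 - s0) / (- x - y) - (s1 - s) / (x - y)) / x) / (x - y)) / x"
proof -
 define u v where "u = x - y" and "v = x + y"
 have e: "b / (y - x) = - (b / u)" "b / (- x - y) = - (b / v)" "b / (- y - x) = - (b / v)" "b / (y + x) = b / v" "b / (x - y) = b / u" for b
  using minus_divide_right[of b "x - y"] minus_divide_right[of b "x + y"] by (simp_all add: u_def v_def)
 have "u ~= 0" "v ~= 0" using assms by (simp_all add: u_def v_def)
 then show ?thesis using assms(1,2) unfolding e by (simp add: divide_simps) (simp add: algebra_simps u_def v_def)
qed

text \<open>Variables with signs, permuted by the reflections as \<open>sperm\<close> permutes
  signed indices. That a variable differs from its negative is where 2 being nonzero enters.\<close>

definition yk :: "int => ('i, 'k::field) svec" where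
 "yk e mu = (if 0 < e then fvar (nat e) else - fvar (nat (- e)))"

lemma klr_refl_yk:
 assumes "1 \<le> \<bar>e\<bar>"
 shows "klr_refl k (yk e nu) = (yk (sperm k e) mu :: 'k::field mps fract)"
proof -
 have *: "klr_refl k (fvar (nat e)) = (yk (sperm k e) mu :: 'k mps fract)" if "0 < e" for e
  using that by (auto simp: yk_def klr_refl_fvar index_swap_def sperm_def nat_eq_iff nat_add_distrib)
 show ?thesis
 proof (cases "0 < e")
  case False
  moreover from this have "0 < - e" using assms by simp
  moreover from this have "yk (sperm k e) mu = - (yk (sperm k (- e)) mu :: 'k mps fract)"
   by (auto simp: yk_def sperm_def sgn_if add.commute)
  ultimately show ?thesis using *[of "- e"] by (simp add: yk_def fhom_minus[OF klr_refl_fhom])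
 qed (use * in \<open>simp add: yk_def\<close>)
qed

lemma yk_inj:
 fixes mu :: "nat => 'i"
 assumes two: "(2 :: 'k::field) ~= 0" and e: "1 \<le> \<bar>e\<bar>" "1 \<le> \<bar>e'\<bar>" "yk e mu = (yk e' mu :: 'k mps fract)"
 shows "e = e'"
proof -
 have n: "fvar i = (fvar j :: 'k mps fract) \<longleftrightarrow> i = j" for i j using fvar_neq by metis
 have pm: "fvar i ~= - (fvar j :: 'k mps fract)" for i j
 proof (cases "i = j")
  case True
  then show ?thesis using two_fract[OF two] fvar_nz[of j] by (simp flip: mult_2)
 qed (simp add: eq_neg_iff_add_eq_0 fvar_add_nz)
 show ?thesis using e pm pm[symmetric] by (auto simp: yk_def n split: if_splits)
qed

text \<open>\<open>a_sym\<close> says that \<open>\<theta>\<close> reverses the arrows of the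
  quiver.\<close>

locale klr_rep = seq_system \<theta> n V
 for \<theta> :: "'i => 'i" and n V +
 fixes a :: "'i => 'i => nat" and lam :: "'i => nat" and ty :: "'k::field itself"
 assumes a_sym: "a (\<theta> j) (\<theta> i) = a i j" and two: "(2 :: 'k) ~= 0"
begin

abbreviation "\<rho> \<equiv> klr_gen_act \<theta> a lam V :: 'i klr_gen => ('i, 'k) svec => ('i, 'k) svec"
abbreviation "\<tau> k \<equiv> \<rho> (KTau k)"
abbreviation (input) "FF \<equiv> supp V :: ('i, 'k) svec set"

sublocale seq_refl \<theta> n V "\<lambda>_. klr_refl :: nat => 'k mps fract => 'k mps fract" yk
proof
 show "klr_refl k (yk e (sw k mu)) = yk (sperm k e) mu" if "1 \<le> \<bar>e\<bar> \<and> \<bar>e\<bar> \<le> int n" for k e mu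
  using that by (intro klr_refl_yk) simp
 show "e = e'" if "1 \<le> \<bar>e\<bar> \<and> \<bar>e\<bar> \<le> int n" "1 \<le> \<bar>e'\<bar> \<and> \<bar>e'\<bar> \<le> int n" "yk e mu = (yk e' mu :: 'k mps fract)" for e e' and mu :: "nat => 'i"
  by (rule yk_inj[OF two, of e e' mu]) (use that in auto)
 show "klr_refl i (klr_refl (Suc i) (klr_refl i z)) = klr_refl (Suc i) (klr_refl i (klr_refl (Suc i) z))"
  if "1 \<le> i" for i and z :: "'k mps fract" by (rule klr_refl_braid[OF that, symmetric])
 show "klr_refl 0 (klr_refl 1 (klr_refl 0 (klr_refl 1 z))) = klr_refl 1 (klr_refl 0 (klr_refl 1 (klr_refl 0 z)))"
  for z :: "'k mps fract" using klr_refl_four[of z] by (simp only: One_nat_def)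
qed (rule klr_refl_fhom klr_refl_sq klr_refl_comm; assumption)+

lemma klr_P_simps: "i ~= j ==> klr_P a i j u v = (v - u) ^ a i j"
 "i ~= \<theta> i ==> klr_P0 \<theta> lam i u = (- u) ^ lam i" by (simp_all add: klr_P_def klr_P0_def)

lemma tau_out: "k < n ==> mu \<notin> V ==> \<tau> k F mu = 0"
proof -
 assume k: "k < n" and mu: "mu \<notin> V"
 have "klr_tau_comp \<theta> a lam k nu (F nu) mu = 0" if "nu \<in> V" for nu
 proof -
  have "mu ~= nu" "mu ~= sw k nu" using that mu swapV[OF that k] by auto
  then show ?thesis by (cases "k = 0") (simp_all add: klr_tau_comp_def at_idem_def)
 qed
 then show "\<tau> k F mu = 0" by (simp add: klr_gen_act.simps(3))
qed

text \<open>At a target \<open>mu\<close> only the source \<open>sw k mu\<close> contributes, also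
  for labels fixed by the reflection, where source and target coincide.\<close>

lemma tau_single:
 assumes "k < n" "mu \<in> V"
 shows "\<tau> k F mu = klr_tau_comp \<theta> a lam k (sw k mu) (F (sw k mu)) mu"
proof -
 have "(\<Sum>nu\<in>V. klr_tau_comp \<theta> a lam k nu (F nu) mu) = (\<Sum>nu\<in>{sw k mu}. klr_tau_comp \<theta> a lam k nu (F nu) mu)"
 proof (rule sum.mono_neutral_right[OF finV])
  show "{sw k mu} \<subseteq> V" using swapV[OF assms(2,1)] by simp
  show "\<forall>nu\<in>V - {sw k mu}. klr_tau_comp \<theta> a lam k nu (F nu) mu = 0"
  proof
   fix nu assume "nu \<in> V - {sw k mu}"
   then have "sw k nu ~= mu" using sw_sq by force
   moreover have "nu = sw k nu" if "if k = 0 then \<theta> (nu 1) = nu 1 else nu k = nu (k + 1)"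
    using that by (auto simp: seq_swap_def split: if_splits)
   ultimately show "klr_tau_comp \<theta> a lam k nu (F nu) mu = 0" by (auto simp: klr_tau_comp_def at_idem_def)
  qed
 qed
 then show ?thesis by (simp add: klr_gen_act.simps(3))
qed

text \<open>The definition lists images by source; here they are read at the target
  \<open>mu\<close>, so the exponents carry the labels of the source:
  \<open>\<theta> (mu 1)\<close>, and the pair \<open>mu (Suc k)\<close>,
  \<open>mu k\<close>.\<close>

lemma tau_at:
 assumes "mu \<in> V"
 shows "0 < n ==> \<tau> 0 F mu = (if \<theta> (mu 1) = mu 1 then (klr_refl 0 (F (sw 0 mu)) - F mu) / fvar 1
   else (- fvar 1) ^ lam (\<theta> (mu 1)) * klr_refl 0 (F (sw 0 mu)))" (is "PROP ?g1")
  and "1 \<le> k ==> k < n ==> \<tau> k F mu =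
   (if mu k = mu (Suc k) then (klr_refl k (F (sw k mu)) - F mu) / (fvar k - fvar (Suc k))
   else (fvar (Suc k) - fvar k) ^ a (mu (Suc k)) (mu k) * klr_refl k (F (sw k mu)))" (is "PROP ?g2")
proof -
 have s: "at_idem mu z mu = z" for z :: "'k mps fract" by (simp add: at_idem_def)
 show "PROP ?g1"
 proof (cases "\<theta> (mu 1) = mu 1")
  case True
  then have "sw 0 mu = mu" by (rule seq_swap_fix)
  then show "0 < n ==> ?thesis" using True by (simp add: tau_single[OF _ assms] klr_tau_comp_def s)
 next
  case False
  then have "\<theta> (mu 1) ~= \<theta> (\<theta> (mu 1))" by (simp add: \<theta>\<theta>)
  with False show "0 < n ==> ?thesis" by (simp add: tau_single[OF _ assms] klr_tau_comp_def s sw_sq seq_swap_at klr_P_simps)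
 qed
 show "PROP ?g2"
 proof (cases "mu k = mu (Suc k)")
  case True
  then have "1 \<le> k ==> sw k mu = mu" by (intro seq_swap_fix) auto
  then show "1 \<le> k ==> k < n ==> ?thesis" using True by (simp add: tau_single[OF _ assms] klr_tau_comp_def s)
 next
  case False
  then show "1 \<le> k ==> k < n ==> ?thesis"
   by (simp add: tau_single[OF _ assms] klr_tau_comp_def s sw_sq seq_swap_at klr_P_simps)
 qed
qed

definition Ak :: "nat => ('i, 'k) svec" where
 "Ak k mu = (if k = 0 then (if \<theta> (mu 1) = mu 1 then - 1 / fvar 1 else 0)
  else (if mu k = mu (Suc k) then - 1 / (fvar k - fvar (Suc k)) else 0))"

definition Bk :: "nat => ('i, 'k) svec" where
 "Bk k mu = (if k = 0 then (if \<theta> (mu 1) = mu 1 then 1 / fvar 1 else (- fvar 1) ^ lam (\<theta> (mu 1)))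
  else (if mu k = mu (Suc k) then 1 / (fvar k - fvar (Suc k))
   else (fvar (Suc k) - fvar k) ^ a (mu (Suc k)) (mu k)))"

lemma tau_eq: "k < n ==> F \<in> FF ==> \<tau> k F = (\<lambda>mu. Ak k mu * F mu + Bk k mu * SV k F mu)"
proof
 fix mu assume k: "k < n" and F: "F \<in> FF"
 show "\<tau> k F mu = Ak k mu * F mu + Bk k mu * SV k F mu"
 proof (cases "mu \<in> V")
  case True
  then show ?thesis using k tau_at(1)[OF True, of F] tau_at(2)[OF True, of k F]
   by (cases "k = 0") (auto simp: Ak_def Bk_def SV_at diff_divide_distrib)
 next
  case False
  then show ?thesis using tau_out[OF k False] F by (simp add: SV_def vec_def supp_def)
 qed
qed

lemma refl_ops: "refl_ops V n SV yk \<tau> Ak Bk" by (intro refl_ops.intro refl_sys refl_ops_axioms.intro tau_eq)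
  (auto simp: Bk_def fvar_nz fvar_neq)

lemma tau_supp: "k < n ==> \<tau> k F \<in> FF" using tau_out by (simp add: supp_def)

text \<open>Five cases for coincidences among three neighbouring labels. If all are equal,
  \<open>klr_Q\<close> vanishes and the identity for divided differences applies; a genuine
  correction arises only if the outer labels agree and the middle one differs.\<close>

lemma tau_braid:
 assumes k: "1 \<le> k" "Suc k < n" and mu: "mu \<in> V"
 shows "\<tau> (Suc k) (\<tau> k (\<tau> (Suc k) F)) mu - \<tau> k (\<tau> (Suc k) (\<tau> k F)) mu =
  (if mu k = mu (k + 2) then
   (klr_Q a (mu k) (mu (k + 1)) (fvar (k + 1)) (fvar k) - klr_Q a (mu k) (mu (k + 1)) (fvar (k + 1)) (fvar (k + 2))) /
   (fvar k - fvar (k + 2)) * F mu else 0)"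
proof -
 have kn: "k < n" using k by simp
 define x y z :: "'k mps fract" where "x = fvar k" and "y = fvar (Suc k)" and "z = fvar (Suc (Suc k))"
 have d: "x ~= y" "y ~= z" "x ~= z" "y ~= x" "z ~= y" "z ~= x" by (simp_all add: x_def y_def z_def fvar_neq)
 have rr: "klr_refl k x = y" "klr_refl k y = x" "klr_refl k z = z"
  "klr_refl (Suc k) x = x" "klr_refl (Suc k) y = z" "klr_refl (Suc k) z = y"
  using k by (auto simp: x_def y_def z_def klr_refl_fvar index_swap_def)
 have k2: "1 \<le> Suc k" by simp
 note rules = tau_at(2)[OF _ k(1) kn] tau_at(2)[OF _ k2 k(2)] swapV[OF _ kn] swapV[OF _ k(2)]
  seq_swap_at(1)[OF k(1)] seq_swap_at(1)[OF k2]
  fhom_simps[OF klr_refl_fhom] x_def[symmetric] y_def[symmetric] z_def[symmetric] rr mu k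
  klr_refl_braid[OF k(1)] sw_braid[OF k(1)] klr_refl_sq sw_sq klr_Q_def klr_P_def
 consider "mu k = mu (Suc k)" "mu (Suc k) = mu (Suc (Suc k))" | "mu k = mu (Suc k)" "mu (Suc k) ~= mu (Suc (Suc k))"
  | "mu k ~= mu (Suc k)" "mu (Suc k) = mu (Suc (Suc k))" | "mu k ~= mu (Suc k)" "mu k = mu (Suc (Suc k))"
  | "mu k ~= mu (Suc k)" "mu (Suc k) ~= mu (Suc (Suc k))" "mu k ~= mu (Suc (Suc k))" by metis
 then show ?thesis
 proof cases
  case 1
  then have f: "sw k mu = mu" "sw (Suc k) mu = mu" using k by (auto intro!: seq_swap_fix)
  have g: "mu (Suc k) = mu k" "mu (Suc (Suc k)) = mu k" using 1 by auto
  show ?thesis using d by (simp add: g rules nil_braid_identity)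
 next
  case 2
  then have f: "sw k mu = mu" using k by (auto intro!: seq_swap_fix)
  have f': "sw (Suc k) (sw k (sw (Suc k) mu)) = sw k (sw (Suc k) mu)" using sw_braid[OF k(1), of mu] f by simp
  show ?thesis using d 2  by (simp add: rules right_diff_distrib)
 next
  case 3
  then have f: "sw (Suc k) mu = mu" by (auto intro!: seq_swap_fix)
  have f': "sw (Suc k) (sw k mu) = sw k (sw (Suc k) (sw k mu))" using sw_braid[OF k(1), of mu] f by simp
  have g: "mu (Suc (Suc k)) = mu (Suc k)" using 3 by simp
  show ?thesis using d 3(1)  by (simp add: f'[symmetric] g rules right_diff_distrib)
 next
  case 4
  show ?thesis using d 4 by (simp add: rules) (simp add: diff_divide_distrib[symmetric] algebra_simps)?
 next
  case 5
  show ?thesis using d 5 by (simp add: rules) (simp add: diff_divide_distrib[symmetric] algebra_simps)?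
 qed
qed

lemma tau_sq:
 assumes k: "1 \<le> k" "k < n" and mu: "mu \<in> V"
 shows "\<tau> k (\<tau> k F) mu = klr_Q a (mu k) (mu (k + 1)) (fvar (k + 1)) (fvar k) * F mu"
proof -
 have d: "fvar k ~= (fvar (Suc k) :: 'k mps fract)" by (simp add: fvar_neq)
 have rr: "klr_refl k (fvar k) = fvar (Suc k)" "klr_refl k (fvar (Suc k)) = fvar k"
  using k by (auto simp: klr_refl_fvar index_swap_def)
 note rules = tau_at(2)[OF _ k] swapV[OF _ k(2)] seq_swap_at(1)[OF k(1)] fhom_simps[OF klr_refl_fhom] rr mu
  klr_refl_sq sw_sq klr_Q_def klr_P_def
 show ?thesis
 proof (cases "mu k = mu (Suc k)")
  case True
  then have f: "sw k mu = mu" using k by (intro seq_swap_fix) auto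
  have e: "(F mu - z) / (fvar (Suc k) - fvar k) = (z - F mu) / (fvar k - fvar (Suc k))" for z
   using d by (simp add: divide_simps) (simp add: algebra_simps)
  show ?thesis using True by (simp add: rules e)
 next
  case False
  then show ?thesis by (simp add: rules)
 qed
qed

lemma tau_sq_0:
 assumes n: "0 < n" and mu: "mu \<in> V"
 shows "\<tau> 0 (\<tau> 0 F) mu = klr_Q0 \<theta> lam (mu 1) (- fvar 1) * F mu"
proof -
 have rr: "klr_refl 0 (fvar (Suc 0)) = - fvar (Suc 0)" by (simp add: klr_refl_fvar)
 note rules = tau_at(1)[OF _ n] swapV[OF _ n] seq_swap_at(2) fhom_simps[OF klr_refl_fhom] rr mu
  klr_refl_sq sw_sq klr_Q0_def klr_P0_def \<theta>\<theta>
 show ?thesis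
 proof (cases "\<theta> (mu (Suc 0)) = mu (Suc 0)")
  case True
  then have f: "sw 0 mu = mu" by (intro seq_swap_fix) auto
  show ?thesis using True by (simp add: rules divide_simps)
 next
  case False
  then have "mu (Suc 0) ~= \<theta> (mu (Suc 0))" by metis
  with False show ?thesis by (simp add: rules)
 qed
qed

lemma tau_comm:
 assumes k: "k < n" "k' < n" "k + 1 < k'" and mu: "mu \<in> V"
 shows "\<tau> k (\<tau> k' F) mu = \<tau> k' (\<tau> k F) mu"
proof -
 have k': "1 \<le> k'" using k by simp
 have rr: "klr_refl k (fvar k') = fvar k'" "klr_refl k (fvar (Suc k')) = fvar (Suc k')"
  "klr_refl k' (fvar k) = fvar k" "klr_refl k' (fvar (Suc k)) = fvar (Suc k)"
  using k by (auto simp: klr_refl_fvar index_swap_def)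
 have c: "klr_refl k (klr_refl k' z) = klr_refl k' (klr_refl k z)" for z :: "'k mps fract" using k by (intro klr_refl_comm) simp
 have sc: "sw k (sw k' mu) = sw k' (sw k mu)" for mu using k by (intro sw_comm) simp
 have vs: "sw k mu \<in> V" "sw k' mu \<in> V" using mu k swapV by auto
 have fk': "mu k' = mu (Suc k') ==> sw k' nu = nu" if "nu k' = mu k'" "nu (Suc k') = mu (Suc k')" for nu
  using k' that by (intro seq_swap_fix) auto
 note rules = tau_at(2)[OF _ k' k(2)] seq_swap_at(1)[OF k'] fhom_simps[OF klr_refl_fhom] rr mu vs c sc
 show ?thesis
 proof (cases "k = 0")
  case True
  note k0 = tau_at(1)[OF _ k(1)[unfolded True]] seq_swap_at(2)
  have ne: "k' ~= Suc 0" "Suc k' ~= Suc 0" "0 < n" "Suc 0 ~= k'" "k' ~= 0" using k by auto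
  have f0: "sw 0 nu = nu" if "\<theta> (mu (Suc 0)) = mu (Suc 0)" "nu (Suc 0) = mu (Suc 0)" for nu
   using that by (intro seq_swap_fix) auto
  show ?thesis using ne unfolding True by (auto simp: rules[unfolded True] k0 algebra_simps divide_inverse)
 next
  case False
  then have k1: "1 \<le> k" by simp
  note k0 = tau_at(2)[OF _ k1 k(1)] seq_swap_at(1)[OF k1]
  have ne: "k' ~= k" "k' ~= Suc k" "Suc k' ~= k" "Suc k' ~= Suc k" using k by auto
  have f0: "sw k nu = nu" if "mu k = mu (Suc k)" "nu k = mu k" "nu (Suc k) = mu (Suc k)" for nu
   using that k1 by (intro seq_swap_fix) auto
  show ?thesis using ne[symmetric] by (auto simp: rules k0 algebra_simps divide_inverse)
 qed
qed

lemma tau_x: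
 assumes k: "1 \<le> k" "k < n" and mu: "mu \<in> V"
 shows "\<tau> k (\<lambda>mu. fvar l * F mu) mu - fvar (index_swap k l) * \<tau> k F mu =
  (if l = k \<and> mu k = mu (k + 1) then - F mu else if l = k + 1 \<and> mu k = mu (k + 1) then F mu else 0)"
proof -
 have d: "fvar k ~= (fvar (Suc k) :: 'k mps fract)" by (simp add: fvar_neq)
 have k0: "k ~= 0" using k by simp
 note rules = tau_at(2)[OF _ k] swapV[OF _ k(2)] seq_swap_at(1)[OF k(1)] fhom_simps[OF klr_refl_fhom] mu
  klr_refl_fvar index_swap_simps(2)[OF k(1)]
 show ?thesis
 proof (cases "mu k = mu (Suc k)")
  case True
  then have f: "sw k mu = mu" using k by (intro seq_swap_fix) auto
  show ?thesis using True d k0 by (auto simp: rules f diff_divide_distrib[symmetric] right_diff_distrib[symmetric])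
    (simp_all add: divide_simps algebra_simps)
 next
  case False
  then show ?thesis using k0 by (simp add: rules)
 qed
qed

lemma tau_x_0:
 assumes n: "0 < n" and mu: "mu \<in> V"
 shows "\<tau> 0 (\<lambda>mu. fvar 1 * F mu) mu + fvar 1 * \<tau> 0 F mu = (if mu 1 = \<theta> (mu 1) then - (2 * F mu) else 0)" (is ?g1)
  and "l ~= 1 ==> \<tau> 0 (\<lambda>mu. fvar l * F mu) mu = fvar l * \<tau> 0 F mu" (is "PROP ?g2")
proof -
 note rules = tau_at(1)[OF _ n] swapV[OF _ n] seq_swap_at(2) fhom_simps[OF klr_refl_fhom] mu
  klr_refl_fvar index_swap_simps(1)
 show ?g1 using fvar_nz[of "Suc 0"] by (auto simp: rules algebra_simps diff_divide_distrib)
 show "PROP ?g2" by (auto simp: rules algebra_simps)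
qed

text \<open>Written in the labels of the target \<open>mu\<close>, whereas the defining relation
  uses those of the source; hence the exchanged indices in the first case and
  \<open>\<theta> i\<close> in the second. The symmetry of \<open>a\<close> under
  \<open>\<theta>\<close> matches the exponents met along the two orders.\<close>

lemma tau_four:
 assumes n: "2 \<le> n" and mu: "mu \<in> V"
 shows "\<tau> 1 (\<tau> 0 (\<tau> 1 (\<tau> 0 F))) mu - \<tau> 0 (\<tau> 1 (\<tau> 0 (\<tau> 1 F))) mu =
  (let i = mu 1; j = mu 2; x1 = fvar 1; x2 = fvar 2 in if i ~= j \<and> j = \<theta> i then
   (klr_Q0 \<theta> lam i x2 - klr_Q0 \<theta> lam j x1) / (x1 + x2) * \<tau> 1 F mu
  else if i ~= \<theta> i \<and> j = \<theta> j then
   (klr_Q a (\<theta> i) j x2 (- x1) - klr_Q a (\<theta> i) j (- x2) (- x1)) / x2 * \<tau> 0 F mu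
  else if \<theta> i = i \<and> i ~= j \<and> j = \<theta> j then
   (klr_Q a i j x2 (- x1) - klr_Q a i j x2 x1) / (x1 * x2) * (x1 * \<tau> 0 F mu + F mu)
  else 0)"
proof -
 define x y :: "'k mps fract" where "x = fvar (Suc 0)" and "y = fvar 2"
 have n0: "0 < n" "Suc 0 < n" using n by auto
 have s2: "Suc (Suc 0) = 2" by simp
 have d: "x ~= 0" "y ~= 0" "x ~= y" "y ~= x" "x + y ~= 0" "y + x ~= 0"
  using fvar_add_nz[of "Suc 0" 2] fvar_add_nz[of 2 "Suc 0"] by (simp_all add: x_def y_def fvar_nz fvar_neq)
 have rr: "klr_refl 0 x = - x" "klr_refl 0 y = y" "klr_refl (Suc 0) x = y" "klr_refl (Suc 0) y = x"
  by (auto simp: x_def y_def klr_refl_fvar index_swap_def numeral_2_eq_2)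
 define i j where "i = mu (Suc 0)" and "j = mu 2"
 have as: "a (\<theta> i') j' = a (\<theta> j') i'" "a i' (\<theta> j') = a j' (\<theta> i')" for i' j'
  using a_sym[of i' "\<theta> j'"] a_sym[of "\<theta> i'" j'] by (simp_all add: \<theta>\<theta>)
 have one: "1 \<le> Suc 0" by simp
 note rules = tau_at(1)[OF _ n0(1), unfolded One_nat_def] tau_at(2)[OF _ one n0(2), unfolded s2]
  swapV[OF _ n0(1)] swapV[OF _ n0(2)] seq_swap_at(1)[OF one, unfolded s2] seq_swap_at(2)[unfolded One_nat_def]
  fhom_simps[OF klr_refl_fhom] x_def[symmetric] y_def[symmetric] i_def[symmetric] j_def[symmetric] rr mu
  klr_refl_four sw_four klr_refl_sq sw_sq \<theta>\<theta>
 consider "\<theta> i = i" "i = j" | "\<theta> i = i" "\<theta> j = j" "i ~= j" | "\<theta> i = i" "\<theta> j ~= j" | "\<theta> i ~= i" "\<theta> j = j"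
  | "\<theta> i ~= i" "i = j" | "\<theta> i ~= i" "j = \<theta> i" | "\<theta> i ~= i" "\<theta> j ~= j" "i ~= j" "j ~= \<theta> i" by metis
 then show ?thesis
 proof cases
  case 7
  have "\<theta> i ~= j" "\<theta> j ~= i" "i ~= \<theta> i" "j ~= \<theta> j" "\<theta> i ~= \<theta> j" using 7 \<theta>\<theta> by metis+
  then show ?thesis using 7 by (simp add: rules as add.commute[of y x])
 next
  case 1
  then have f: "sw 0 mu = mu" "sw (Suc 0) mu = mu" "j = i" by (auto intro!: seq_swap_fix simp: i_def j_def numeral_2_eq_2)
  show ?thesis using 1(1) d by (simp add: rules f nil_four_identity)
 next
  case 2
  then have f: "sw 0 mu = mu" by (auto intro!: seq_swap_fix simp: i_def)
  have f': "sw 0 (sw (Suc 0) mu) = sw (Suc 0) mu" using 2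
   by (intro seq_swap_fix) (simp add: seq_swap_at numeral_2_eq_2[symmetric] j_def)
  have "a j i = a i j" using a_sym[of i j] 2 by simp
  then show ?thesis using 2 d by (simp add: rules f f' klr_Q_def klr_P_def Let_def) (simp add: divide_inverse algebra_simps)
 next
  case 3
  then have f: "sw 0 mu = mu" by (auto intro!: seq_swap_fix simp: i_def)
  have f': "sw 0 (sw (Suc 0) (sw 0 (sw (Suc 0) mu))) = sw (Suc 0) (sw 0 (sw (Suc 0) mu))" using sw_four[of mu] f by simp
  have ne: "i ~= j" "j ~= i" "\<theta> j ~= i" "i ~= \<theta> j" "j ~= \<theta> j" using 3 \<theta>\<theta> by metis+
  have aa: "a i (\<theta> j) = a j i" "a (\<theta> j) i = a i j" using 3 a_sym[of j i] a_sym[of i j] by simp_all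
  show ?thesis using 3 d ne by (simp add: rules f f' aa Let_def) (simp add: divide_inverse algebra_simps)?
 next
  case 4
  have f: "sw 0 (sw (Suc 0) mu) = sw (Suc 0) mu" "sw 0 (sw (Suc 0) (sw 0 mu)) = sw (Suc 0) (sw 0 mu)" using 4
   by (auto intro!: seq_swap_fix simp: seq_swap_at numeral_2_eq_2[symmetric] j_def)
  have ne: "i ~= j" "j ~= i" "\<theta> i ~= j" "j ~= \<theta> i" "i ~= \<theta> i" using 4 \<theta>\<theta> by metis+
  have aa: "a j (\<theta> i) = a i j" "a (\<theta> i) j = a j i" using 4 a_sym[of i j] a_sym[of j i] by simp_all
  show ?thesis using 4 d ne by (simp add: rules f aa klr_Q_def klr_P_def Let_def) (simp add: divide_inverse algebra_simps)?
 next
  case 5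
  then have f: "sw (Suc 0) mu = mu" "j = i" by (auto intro!: seq_swap_fix simp: i_def j_def numeral_2_eq_2)
  have f': "sw (Suc 0) (sw 0 (sw (Suc 0) (sw 0 mu))) = sw 0 (sw (Suc 0) (sw 0 mu))" using sw_four[of mu] f by simp
  have ne: "i ~= \<theta> i" using 5 by metis
  show ?thesis using 5(1) d ne by (simp add: rules f f' Let_def) (simp add: divide_inverse algebra_simps)?
 next
  case 6
  have f: "sw (Suc 0) (sw 0 mu) = sw 0 mu" "sw (Suc 0) (sw 0 (sw (Suc 0) mu)) = sw 0 (sw (Suc 0) mu)" using 6
   by (auto intro!: seq_swap_fix simp: seq_swap_at numeral_2_eq_2[symmetric] i_def j_def \<theta>\<theta>)
  have "- x - y = - (x + y)" "- y - x = - (x + y)" by simp_all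
  then have e: "inverse (- x - y) = - inverse (x + y)" "inverse (- y - x) = - inverse (x + y)"
   by (simp_all only: inverse_minus_eq)
  have "i ~= \<theta> i" using 6 by metis
  then show ?thesis using 6 d by (simp add: rules f klr_Q0_def klr_P0_def Let_def) (simp add: divide_inverse algebra_simps e)
 qed
qed

end

section \<open>The action of orientifold KLR algebras\<close>

definition mpoly_in :: "nat => 'k::field mpoly set" where
 "mpoly_in n = {p. \<forall>m\<in>keys p. keys m \<subseteq> {1..n}}"

lemma mpoly_in_single: "c = 0 \<or> keys m \<subseteq> {1..n} ==> single m c \<in> mpoly_in n" by (auto simp: mpoly_in_def)

lemma mpoly_in_closed:
 fixes p q :: "'k::field mpoly"
 shows "p \<in> mpoly_in n ==> q \<in> mpoly_in n ==> p + q \<in> mpoly_in n"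
  "p \<in> mpoly_in n ==> - p \<in> mpoly_in n"
  "p \<in> mpoly_in n ==> q \<in> mpoly_in n ==> p - q \<in> mpoly_in n" (is "PROP ?g1")
  "p \<in> mpoly_in n ==> q \<in> mpoly_in n ==> p * q \<in> mpoly_in n"
  "p \<in> mpoly_in n ==> p ^ k \<in> mpoly_in n" (is "PROP ?g2")
  "l \<in> {1..n} ==> (mpoly_var l :: 'k mpoly) \<in> mpoly_in n" (is "PROP ?g3")
  "(0 :: 'k mpoly) \<in> mpoly_in n" "(1 :: 'k mpoly) \<in> mpoly_in n"
proof -
 show add: "p \<in> mpoly_in n ==> q \<in> mpoly_in n ==> p + q \<in> mpoly_in n" for p q :: "'k mpoly"
  using keys_add[of p q] by (auto simp: mpoly_in_def)
 show minus: "p \<in> mpoly_in n ==> - p \<in> mpoly_in n" for p :: "'k mpoly" by (simp add: mpoly_in_def)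
 show "PROP ?g1" using add[of p "- q"] minus[of q] by simp
 show mult: "p \<in> mpoly_in n ==> q \<in> mpoly_in n ==> p * q \<in> mpoly_in n" for p q :: "'k mpoly"
  using keys_mult[of p q] by (fastforce simp: mpoly_in_def keys_add_nat)
 show one: "(1 :: 'k mpoly) \<in> mpoly_in n" by (simp add: mpoly_in_def)
 show "PROP ?g2" by (induction k) (simp_all add: one mult)
 show "PROP ?g3" "(0 :: 'k mpoly) \<in> mpoly_in n" by (simp_all add: mpoly_var_def mpoly_in_single) (simp add: mpoly_in_def)
qed

text \<open>Congruence modulo \<open>b\<close> with cofactor in the first \<open>n\<close>
  variables. Each numerator in the relations compares one expression at congruent arguments, which
  is why the \<open>exact_div\<close> there are genuine quotients.\<close>

definition mcong :: "nat => 'k::field mpoly => 'k mpoly => 'k mpoly => bool" where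
 "mcong n b x y \<longleftrightarrow> x \<in> mpoly_in n \<and> y \<in> mpoly_in n \<and> (\<exists>c\<in>mpoly_in n. x - y = c * b)"

lemma mcong_refl: "x \<in> mpoly_in n ==> mcong n b x x" using mpoly_in_closed(7) by (auto simp: mcong_def intro!: bexI[of _ 0])

lemma mcongI: "x \<in> mpoly_in n ==> y \<in> mpoly_in n ==> c \<in> mpoly_in n ==> x - y = c * b ==> mcong n b x y"
 by (auto simp: mcong_def)

lemma mcong_mult: "mcong n b x y ==> mcong n b x' y' ==> mcong n b (x * x') (y * y')"
proof -
 assume "mcong n b x y" "mcong n b x' y'"
 then obtain c c' where c: "c \<in> mpoly_in n" "c' \<in> mpoly_in n" "x - y = c * b" "x' - y' = c' * b"
  and xy: "x \<in> mpoly_in n" "y \<in> mpoly_in n" "x' \<in> mpoly_in n" "y' \<in> mpoly_in n"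
  by (auto simp: mcong_def)
 have "x * x' - y * y' = (x - y) * x' + y * (x' - y')" by (simp add: algebra_simps)
 also have "... = (c * x' + y * c') * b" unfolding c by (simp add: algebra_simps)
 finally show ?thesis by (rule mcongI[rotated -1]) (intro mpoly_in_closed c xy)+
qed

lemma mcong_diff: "mcong n b x y ==> mcong n b x' y' ==> mcong n b (x - x') (y - y')"
proof -
 assume "mcong n b x y" "mcong n b x' y'"
 then obtain c c' where c: "c \<in> mpoly_in n" "c' \<in> mpoly_in n" "x - y = c * b" "x' - y' = c' * b"
  and xy: "x \<in> mpoly_in n" "y \<in> mpoly_in n" "x' \<in> mpoly_in n" "y' \<in> mpoly_in n"
  by (auto simp: mcong_def)
 have "(x - x') - (y - y') = (x - y) - (x' - y')" by (simp)
 also have "... = (c - c') * b" unfolding c by (simp add: algebra_simps)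
 finally show ?thesis by (rule mcongI[rotated -1]) (intro mpoly_in_closed c xy)+
qed

lemma mcong_minus: "mcong n b x y ==> mcong n b (- x) (- y)" using mcong_diff[OF mcong_refl[OF mpoly_in_closed(7)]] by fastforce

lemma mcong_power: "mcong n b x y ==> mcong n b (x ^ k) (y ^ k)"
 by (induction k) (simp_all add: mcong_refl mpoly_in_closed mcong_mult)

lemma mcong_klr:
 assumes "mcong n b u u'" "mcong n b v v'"
 shows "mcong n b (klr_Q a i j u v) (klr_Q a i j u' v')" "mcong n b (klr_Q0 \<theta> lam i u) (klr_Q0 \<theta> lam i u')"
 using assms mcong_refl[OF mpoly_in_closed(7)]
 by (auto simp: klr_Q_def klr_P_def klr_Q0_def klr_P0_def intro!: mcong_mult mcong_power mcong_diff mcong_minus)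

lemma mcong_exact_div:
 assumes "mcong n b x y" "pev b ~= 0"
 shows "exact_div (x - y) b \<in> mpoly_in n" "pev (exact_div (x - y) b) = (pev x - pev y) / pev b" (is ?g1)
proof -
 obtain c where c: "c \<in> mpoly_in n" "x - y = c * b" using assms by (auto simp: mcong_def)
 have "b ~= 0" using assms(2) by (auto simp: pev_simps)
 then have "exact_div (x - y) b = c" unfolding exact_div_def using c(2) by (intro the_equality) auto
 moreover have "pev x - pev y = pev c * pev b" using c(2) by (metis pev_simps(3,4))
 ultimately show "exact_div (x - y) b \<in> mpoly_in n" ?g1 using c assms(2) by simp_all
qed

lemma pev_klr: "pev (klr_Q a i j u v) = klr_Q a i j (pev u) (pev v)" "pev (klr_Q0 \<theta> lam i u) = klr_Q0 \<theta> lam i (pev u)"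
 by (simp_all add: klr_Q_def klr_P_def klr_Q0_def klr_P0_def pev_simps)

lemma kpoly_carrier: "p \<in> mpoly_in n ==> kpoly p \<in> fcar (KX ` {1..n})"
 unfolding kpoly_def by (intro fcar_sum fcar_single) (fastforce simp: mpoly_in_def)

context klr_rep
begin

abbreviation "gens \<equiv> klr_gens n V"
abbreviation "rels \<equiv> klr_rels \<theta> a lam n V :: ('i klr_gen fword \<Rightarrow>\<^sub>0 'k) set"

definition mixed_poly :: "(nat => 'i) => 'k mpoly" where
 "mixed_poly nu = (let i = nu 1; j = nu 2; x1 = mpoly_var 1; x2 = mpoly_var 2
   in if i ~= j \<and> j = \<theta> i then exact_div (klr_Q0 \<theta> lam j x2 - klr_Q0 \<theta> lam i x1) (x1 + x2)
    else if i ~= \<theta> i \<and> j = \<theta> j then exact_div (klr_Q a i j x2 (- x1) - klr_Q a i j (- x2) (- x1)) x2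
    else exact_div (klr_Q a i j x2 (- x1) - klr_Q a i j x2 x1) (x1 * x2))"

text \<open>Three divisibilities. Modulo \<open>x1 + x2\<close>, the variable \<open>x2\<close> is
  congruent to \<open>- x1\<close>, and \<open>klr_Q0\<close> at \<open>i\<close> and at
  \<open>\<theta> i\<close> differ by the sign of the argument; modulo \<open>x2\<close>, it is
  congruent to \<open>- x2\<close>; the one by the product \<open>x1 * x2\<close> uses that two
  fixed vertices are joined symmetrically.\<close>

lemma mixed_poly:
 assumes n: "2 \<le> n" and nu: "nu 1 ~= nu 2 \<and> nu 2 = \<theta> (nu 1) \<or> nu 2 = \<theta> (nu 2) \<and> (nu 1 ~= \<theta> (nu 1) \<or> nu 1 ~= nu 2)"
 shows "mixed_poly nu \<in> mpoly_in n" (is ?A)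
  "pev (mixed_poly nu) = (let i = nu 1; j = nu 2; x1 = fvar 1; x2 = fvar 2
   in if i ~= j \<and> j = \<theta> i then (klr_Q0 \<theta> lam j x2 - klr_Q0 \<theta> lam i x1) / (x1 + x2)
    else if i ~= \<theta> i \<and> j = \<theta> j then (klr_Q a i j x2 (- x1) - klr_Q a i j (- x2) (- x1)) / x2
    else (klr_Q a i j x2 (- x1) - klr_Q a i j x2 x1) / (x1 * x2))" (is ?B)
proof -
 define x1 x2 :: "'k mpoly" where "x1 = mpoly_var 1" and "x2 = mpoly_var 2"
 have x: "x1 \<in> mpoly_in n" "x2 \<in> mpoly_in n" using n by (simp_all add: x1_def x2_def mpoly_in_closed)
 note xs = x mpoly_in_closed(7,8) mpoly_in_closed(1)[OF x] mpoly_in_closed(3)[OF x] mpoly_in_closed(2)[OF x(1)] mpoly_in_closed(2)[OF x(2)]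
 have px: "pev x1 = fvar 1" "pev x2 = fvar 2" by (simp_all add: x1_def x2_def pev_simps)
 have nz: "pev (x1 + x2) ~= 0" "pev x2 ~= 0" "pev (x1 * x2) ~= 0"
  using fvar_add_nz[of "Suc 0" 2] by (simp_all add: pev_simps px fvar_nz)
 define i j where "i = nu 1" and "j = nu 2"
 consider "i ~= j" "j = \<theta> i" | "\<not> (i ~= j \<and> j = \<theta> i)" "i ~= \<theta> i" "j = \<theta> j"
  | "i = \<theta> i" "i ~= j" "j = \<theta> j" using nu unfolding i_def j_def by blast
 then have "?A \<and> ?B"
 proof cases
  case 1
  have e: "klr_Q0 \<theta> lam i z = klr_Q0 \<theta> lam j (- z)" for z :: "'k mpoly"
   using 1 by (simp add: klr_Q0_def \<theta>\<theta>)
  have "mcong n (x1 + x2) x2 (- x1)" by (rule mcongI[of _ _ _ 1]) (simp_all add: xs)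
  then have "mcong n (x1 + x2) (klr_Q0 \<theta> lam j x2) (klr_Q0 \<theta> lam i x1)" unfolding e by (rule mcong_klr(2)) (rule mcong_refl, rule x(1))
  from mcong_exact_div[OF this nz(1)] 1 show ?thesis
   by (simp add: mixed_poly_def i_def[symmetric, unfolded One_nat_def] j_def[symmetric] x1_def[symmetric, unfolded One_nat_def] x2_def[symmetric] Let_def pev_klr px pev_simps(1))
 next
  case 2
  have "mcong n x2 x2 (- x2)" by (rule mcongI[of _ _ _ "1 + 1"]) (simp_all add: xs mpoly_in_closed(1)[OF mpoly_in_closed(8) mpoly_in_closed(8), simplified])
  from mcong_exact_div[OF mcong_klr(1)[OF this mcong_refl[OF xs(7)]] nz(2)] 2 show ?thesis
   by (auto simp add: mixed_poly_def i_def[symmetric, unfolded One_nat_def] j_def[symmetric] x1_def[symmetric, unfolded One_nat_def] x2_def[symmetric] Let_def pev_klr px pev_simps(2))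
 next
  case 3
  have aij: "a j i = a i j" using a_sym[of i j] 3 by simp
  define N where "N = a i j"
  have Q: "klr_Q a i j u v = (- ((u - v) * (u - v))) ^ N" for u v :: "'k mpoly"
  proof -
   have "(v - u) * (u - v) = - ((u - v) * (u - v))" by (simp add: algebra_simps)
   then show ?thesis using 3 by (simp add: klr_Q_def klr_P_def aij N_def power_mult_distrib[symmetric])
  qed
  \<comment> \<open>\<open>klr_Q\<close> is a power of minus the squared difference of its
    arguments, and the two squares differ by four times \<open>x1 * x2\<close>.\<close>
  have "- ((x2 - - x1) * (x2 - - x1)) - - ((x2 - x1) * (x2 - x1)) = - (1 + 1 + (1 + 1)) * (x1 * x2)"
   by (simp add: algebra_simps)
  then have "mcong n (x1 * x2) (- ((x2 - - x1) * (x2 - - x1))) (- ((x2 - x1) * (x2 - x1)))"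
   by (rule mcongI[rotated -1]) (intro mpoly_in_closed xs)+
  then have "mcong n (x1 * x2) (klr_Q a i j x2 (- x1)) (klr_Q a i j x2 x1)" unfolding Q by (rule mcong_power)
  from mcong_exact_div[OF this nz(3)] 3 show ?thesis
   by (auto simp add: mixed_poly_def i_def[symmetric, unfolded One_nat_def] j_def[symmetric] x1_def[symmetric, unfolded One_nat_def] x2_def[symmetric] Let_def pev_klr px pev_simps(2,4))
 qed
 then show ?A ?B by simp_all
qed

lemma klr_mixed_eq: "klr_mixed \<theta> a lam nu =
 (if nu 1 ~= nu 2 \<and> nu 2 = \<theta> (nu 1) then kpoly (mixed_poly nu) * kt 1 * ke nu
 else if nu 1 ~= \<theta> (nu 1) \<and> nu 2 = \<theta> (nu 2) then kpoly (mixed_poly nu) * kt 0 * ke nu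
 else if \<theta> (nu 1) = nu 1 \<and> nu 1 ~= nu 2 \<and> nu 2 = \<theta> (nu 2) then kpoly (mixed_poly nu) * (kx 1 * kt 0 + 1) * ke nu
 else 0)" by (auto simp: klr_mixed_def mixed_poly_def Let_def)

definition braid_poly :: "nat => (nat => 'i) => 'k mpoly" where
 "braid_poly k nu = exact_div (klr_Q a (nu k) (nu (k + 1)) (mpoly_var (k + 1)) (mpoly_var k) -
     klr_Q a (nu k) (nu (k + 1)) (mpoly_var (k + 1)) (mpoly_var (k + 2))) (mpoly_var k - mpoly_var (k + 2))"

lemma braid_poly:
 assumes "1 \<le> k" "k + 1 < n"
 shows "braid_poly k nu \<in> mpoly_in n"
  "pev (braid_poly k nu) = (klr_Q a (nu k) (nu (k + 1)) (fvar (k + 1)) (fvar k) -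
   klr_Q a (nu k) (nu (k + 1)) (fvar (k + 1)) (fvar (k + 2))) / (fvar k - fvar (k + 2))" (is ?g1)
proof -
 have x: "(mpoly_var k :: 'k mpoly) \<in> mpoly_in n" "(mpoly_var (k + 1) :: 'k mpoly) \<in> mpoly_in n" "(mpoly_var (k + 2) :: 'k mpoly) \<in> mpoly_in n"
  using assms by (auto intro!: mpoly_in_closed(6))
 have nz: "pev (mpoly_var k - mpoly_var (k + 2) :: 'k mpoly) ~= 0" by (simp add: pev_simps fvar_neq)
 have "mcong n (mpoly_var k - mpoly_var (k + 2)) (mpoly_var k) (mpoly_var (k + 2) :: 'k mpoly)"
  by (rule mcongI[of _ _ _ 1]) (simp_all add: x[simplified] mpoly_in_closed)
 note * = mcong_exact_div[OF mcong_klr(1)[OF mcong_refl[OF x(2)] this] nz, of a "nu k" "nu (k + 1)"]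
 show "braid_poly k nu \<in> mpoly_in n"
  ?g1 unfolding braid_poly_def using * by (simp_all only: pev_klr pev_simps(3,7))
qed

lemma gens_closed:
 "nu \<in> V ==> ke nu \<in> fcar gens" "l \<in> {1..n} ==> kx l \<in> fcar gens" "k < n ==> kt k \<in> fcar gens"
 by (auto intro!: fcar_closed(4) simp: klr_gens_def)

lemma kpoly_gens: "p \<in> mpoly_in n ==> kpoly p \<in> fcar gens"
 by (rule fcar_mono[OF _ kpoly_carrier]) (auto simp: klr_gens_def)

lemma sq_poly:
 "1 \<le> k ==> k < n ==> klr_Q a i j (mpoly_var (k + 1)) (mpoly_var k) \<in> mpoly_in n"
 "0 < n ==> klr_Q0 \<theta> lam i (- mpoly_var 1) \<in> mpoly_in n"
 by (auto simp: klr_Q_def klr_P_def klr_Q0_def klr_P0_def intro!: mpoly_in_closed)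

lemma klr_rels_carrier: "rels \<subseteq> fcar gens"
proof
 fix r assume "r \<in> rels"
 then show "r \<in> fcar gens"
 proof cases
  case (10 nu)
  have "(klr_mixed \<theta> a lam nu :: 'i klr_gen fword \<Rightarrow>\<^sub>0 'k) \<in> fcar gens"
   unfolding klr_mixed_eq using mixed_poly(1)[OF 10(3), of nu] 10 by (auto intro!: fcar_closed(1,2,5,8) gens_closed kpoly_gens)
  with 10 show ?thesis by (auto intro!: fcar_closed(7,8) fcar_power gens_closed)
 next
  case (9 nu k)
  with braid_poly(1)[of k nu] show ?thesis unfolding braid_poly_def[symmetric]
   by (auto intro!: fcar_closed(1,7,8) gens_closed kpoly_gens)
 next
  case (11 nu k l)
  then have "index_swap k l \<in> {1..n}" by (auto simp: index_swap_def transpose_def)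
  with 11 show ?thesis by (auto intro!: fcar_closed(1,5,6,7,8) gens_closed)
 next
  case (12 nu)
  then show ?thesis unfolding mult_2 by (auto intro!: fcar_closed(1,5,6,7,8) gens_closed)
 next
  case (13 l)
  then show ?thesis by (auto intro!: fcar_closed(7,8) gens_closed)
 qed (auto intro!: fcar_closed(1,2,5,6,7,8) fcar_sum gens_closed kpoly_gens sq_poly[simplified] swapV)
qed

end

context klr_rep
begin

lemma tau_local: "k < n ==> mu \<in> V ==> F (sw k mu) = F' (sw k mu) ==> \<tau> k F mu = \<tau> k F' mu"
 by (simp add: tau_single)

lemma tau_zero: "k < n ==> \<tau> k (\<lambda>_. 0) mu = 0"
proof (cases "mu \<in> V")
 case True
 assume k: "k < n"
 then show ?thesis using tau_at(1)[OF True, of "\<lambda>_. 0"] tau_at(2)[OF True, of k "\<lambda>_. 0"]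
  by (cases "k = 0") (auto simp: fhom_zero[OF klr_refl_fhom])
qed (rule tau_out)

lemma tau_idem: "k < n ==> mu \<in> V ==> nu ~= sw k mu ==> \<tau> k (at_idem nu z) mu = 0"
 using tau_local[of k mu "at_idem nu z" "\<lambda>_. 0"] tau_zero by (auto simp: at_idem_def)

lemma klr_refl_fconst: "klr_refl k (fconst c) = fconst (c :: 'k)" by (rule fcoord_fconst[OF klr_refl_fcoord(1)[OF lessI]])

sublocale fa: free_action gens V "fconst :: 'k => 'k mps fract" \<rho>
proof
 show "fhom (fconst :: 'k => 'k mps fract)" by (rule fconst_fhom)
 fix g F F' assume g: "g \<in> gens" and F: "F \<in> FF" and F': "F' \<in> FF"
 have tau: "\<tau> k (\<lambda>mu. F mu + F' mu) mu = \<tau> k F mu + \<tau> k F' mu"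
  "\<tau> k (\<lambda>mu. fconst c * F mu) mu = fconst c * \<tau> k F mu" if k: "k < n" for k mu c
 proof -
  note fs = fhom_simps[OF klr_refl_fhom] klr_refl_fconst
  have "\<tau> k (\<lambda>mu. F mu + F' mu) mu = \<tau> k F mu + \<tau> k F' mu \<and> \<tau> k (\<lambda>mu. fconst c * F mu) mu = fconst c * \<tau> k F mu"
  proof (cases "mu \<in> V")
   case True
   show ?thesis
   proof (cases "k = 0")
    case True
    then show ?thesis using k
     by (simp add: tau_at(1)[OF \<open>mu \<in> V\<close>] fs add_divide_distrib diff_divide_distrib algebra_simps)
   next
    case False
    then have "1 \<le> k" by simp
    note at = tau_at(2)[OF \<open>mu \<in> V\<close> this k]
    show ?thesis by (simp add: at fs add_divide_distrib diff_divide_distrib algebra_simps)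
   qed
  qed (simp add: tau_out[OF k])
  then show "\<tau> k (\<lambda>mu. F mu + F' mu) mu = \<tau> k F mu + \<tau> k F' mu"
  "\<tau> k (\<lambda>mu. fconst c * F mu) mu = fconst c * \<tau> k F mu" by blast+
 qed
 show "\<rho> g F \<in> supp V" using g F tau_supp by (cases g) (auto simp: klr_gens_def at_idem_def supp_def)
 show "\<rho> g (\<lambda>mu. F mu + F' mu) = (\<lambda>mu. \<rho> g F mu + \<rho> g F' mu)"
  using g by (cases g) (auto simp: klr_gens_def at_idem_def fun_eq_iff distrib_left tau)
 show "\<rho> g (\<lambda>mu. fconst c * F mu) = (\<lambda>mu. fconst c * \<rho> g F mu)" for c
  using g by (cases g) (auto simp: klr_gens_def at_idem_def fun_eq_iff mult.left_commute tau)
qed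

lemma act_kpoly: "fa.act (kpoly p) F = (\<lambda>mu. pev p * F mu)"
proof
 fix mu
 have r: "foldr \<rho> (replicate k (KX l)) G mu = fvar l ^ k * G mu" for k l G
  by (induction k) (simp_all add: mult.assoc del: foldr_replicate)
 have w: "foldr \<rho> (concat (map (\<lambda>l. replicate (f l) (KX l)) ls)) G mu = (\<Prod>l\<leftarrow>ls. fvar l ^ f l) * G mu" for f ls G
  by (induction ls) (simp_all add: r mult.assoc del: foldr_replicate)
 have "foldr \<rho> (concat (map (\<lambda>l. replicate (lookup m l) (KX l)) (sorted_list_of_set (keys m)))) F mu =
   (\<Prod>l\<in>keys m. fvar l ^ lookup m l) * F mu" for m
  unfolding w by (subst prod.distinct_set_conv_list[symmetric]) simp_all
 then have e: "fa.act (single (Word (concat (map (\<lambda>l. replicate (lookup m l) (KX l))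
   (sorted_list_of_set (keys m))))) c) F mu = pev (single m c) * F mu" for m c by (simp add: fa.act_single pev_single)
 have "pev (sum f X) = (\<Sum>x\<in>X. pev (f x))" for f :: "(nat \<Rightarrow>\<^sub>0 nat) => 'k mpoly" and X
  by (induction X rule: infinite_finite_induct) (simp_all add: pev_simps)
 from this[of "\<lambda>m. single m (lookup p m)" "keys p"]
 have "pev p = (\<Sum>m\<in>keys p. pev (single m (lookup p m)))" by (simp only: poly_mapping_sum_single[symmetric])
 then show "fa.act (kpoly p) F mu = pev p * F mu" by (simp add: kpoly_def fa.act_sum e sum_distrib_right)
qed

text \<open>Translates from the labels of the source to those of the target. A nonzero term
  determines how the two are related; where the labels do not fit, the term is zero and both
  branches agree.\<close>

lemma mixed_swap:
 assumes "t1 ~= 0 ==> i' = j \<and> j' = i" "t0 ~= 0 ==> i' = \<theta> i \<and> j' = j" "t ~= (0 :: 'k mps fract) ==> i' = i \<and> j' = j"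
 shows "(if i ~= j \<and> j = \<theta> i then c1 i j * t1
  else if i ~= \<theta> i \<and> j = \<theta> j then c2 (\<theta> i) j * t0
  else if \<theta> i = i \<and> i ~= j \<and> j = \<theta> j then c3 i j * (x * t0 + t) else 0) =
  (if i' ~= j' \<and> j' = \<theta> i' then c1 j' i' * t1
  else if i' ~= \<theta> i' \<and> j' = \<theta> j' then c2 i' j' * t0
  else if \<theta> i' = i' \<and> i' ~= j' \<and> j' = \<theta> j' then c3 i' j' * (x * t0 + t) else 0)"
 using assms \<theta>\<theta>[of i] \<theta>\<theta>[of j] by (smt (verit) mult_zero_right add_0_right)

lemma act_klr_rels: "r \<in> rels ==> F \<in> FF ==> fa.act r F = (\<lambda>_. 0)"
proof (rule fun_V_eqI)
 assume r: "r \<in> rels" and F: "F \<in> FF"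
 show "fa.act r F \<in> FF" using r F klr_rels_carrier by (intro fa.act_supp) auto
 show "(\<lambda>_. 0) \<in> FF" by (rule supp_closed)
 fix mu assume mu: "mu \<in> V"
 have G: "at_idem nu c \<in> FF" if "nu \<in> V" for nu and c :: "'k mps fract" using that by (rule supp_closed)
 note closed = fcar_closed gens_closed kpoly_gens
 note act = fa.act_diff fa.act_add fa.act_mult fa.act_gen fa.act_one fa.act_sum fa.act_zero fa.act_minus act_kpoly
  klr_gen_act.simps(1,2) F G tau_supp
 from r show "fa.act r F mu = 0"
 proof cases
  case (1 nu nu')
  then show ?thesis by (simp add: act closed) (simp add: at_idem_def)
 next
  case 2
  have "(\<Sum>nu\<in>V. at_idem nu (F nu) mu) = F mu" using sum.delta'[OF finV, of mu F] mu by (simp add: at_idem_def)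
  then show ?thesis unfolding 2 by (simp add: act)
 next
  case (3 nu l)
  then show ?thesis by (simp add: act closed) (simp add: at_idem_def)
 next
  case (4 nu k)
  \<comment> \<open>A vector concentrated at \<open>nu\<close> has its image concentrated at
    \<open>sw k nu\<close>, which is the operator form of
    \<open>\<tau>\<^sub>k e(\<nu>) = e(s\<^sub>k \<nu>) \<tau>\<^sub>k\<close>.\<close>
  have "\<tau> k (at_idem nu (F nu)) mu = at_idem (sw k nu) (\<tau> k F (sw k nu)) mu"
  proof (cases "mu = sw k nu")
   case True
   then show ?thesis using 4 mu tau_local[of k mu "at_idem nu (F nu)" F] by (simp add: at_idem_def sw_sq)
  next
   case False
   then have "nu ~= sw k mu" using sw_sq by metis
   then show ?thesis using tau_idem[OF 4(3) mu] False by (simp add: at_idem_def)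
  qed
  then show ?thesis using 4 swapV[OF 4(2,3)] by (simp add: act closed)
 next
  case (5 l l')
  then show ?thesis by (simp add: act closed)
 next
  case (6 nu k)
  have "(klr_Q a (nu k) (nu (k + 1)) (mpoly_var (k + 1)) (mpoly_var k) :: 'k mpoly) \<in> mpoly_in n" using 6 by (intro sq_poly)
  from kpoly_gens[OF this] show ?thesis using 6 tau_sq[OF 6(3,4) mu, of "at_idem nu (F nu)"]
   by (simp add: act closed pev_klr pev_simps) (simp add: at_idem_def)
 next
  case (7 nu)
  have "(klr_Q0 \<theta> lam (nu 1) (- mpoly_var 1) :: 'k mpoly) \<in> mpoly_in n" using 7 by (intro sq_poly)
  from kpoly_gens[OF this] show ?thesis using 7 tau_sq_0[OF 7(3) mu, of "at_idem nu (F nu)"]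
   by (simp add: act closed pev_klr pev_simps) (simp add: at_idem_def)
 next
  case (8 k k')
  then show ?thesis using tau_comm[OF 8(2,3) _ mu, of F] tau_comm[OF 8(3,2) _ mu, of F] by (auto simp add: act closed)
 next
  case (9 nu k)
  then have k: "k < n" "Suc k < n" by simp_all
  show ?thesis using 9 k tau_braid[OF 9(3) k(2) mu, of "at_idem nu (F nu)"] braid_poly[OF 9(3,4), of nu]
   unfolding braid_poly_def[symmetric] by (simp add: act closed) (simp add: at_idem_def)
 next
  case (10 nu)
  define t1 t0 t where "t1 = \<tau> 1 (at_idem nu (F nu)) mu" and "t0 = \<tau> 0 (at_idem nu (F nu)) mu" and "t = at_idem nu (F nu) mu"
  have n: "0 < n" "Suc 0 < n" using 10 by auto
  have t: "t1 ~= 0 ==> nu 1 = mu 2 \<and> nu 2 = mu 1" "t0 ~= 0 ==> nu 1 = \<theta> (mu 1) \<and> nu 2 = mu 2" "t ~= 0 ==> nu 1 = mu 1 \<and> nu 2 = mu 2"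
  proof -
   assume "t1 ~= 0"
   then have "nu = sw 1 mu" using tau_idem[OF n(2) mu, of nu "F nu"] unfolding t1_def One_nat_def by blast
   then show "nu 1 = mu 2 \<and> nu 2 = mu 1" by (simp add: seq_swap_def numeral_2_eq_2)
  next
   assume "t0 ~= 0"
   then have "nu = sw 0 mu" using tau_idem[OF n(1) mu, of nu "F nu"] unfolding t0_def by blast
   then show "nu 1 = \<theta> (mu 1) \<and> nu 2 = mu 2" by (simp add: seq_swap_def)
  next
   assume "t ~= 0"
   then show "nu 1 = mu 1 \<and> nu 2 = mu 2" by (simp add: t_def at_idem_def split: if_splits)
  qed
  define c1 c2 c3 :: "'i => 'i => 'k mps fract"
   where "c1 i j = (klr_Q0 \<theta> lam i (fvar 2) - klr_Q0 \<theta> lam j (fvar 1)) / (fvar 1 + fvar 2)"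
    and "c2 i j = (klr_Q a i j (fvar 2) (- fvar 1) - klr_Q a i j (- fvar 2) (- fvar 1)) / fvar 2"
    and "c3 i j = (klr_Q a i j (fvar 2) (- fvar 1) - klr_Q a i j (fvar 2) (fvar 1)) / (fvar 1 * fvar 2)" for i j
  have "fa.act (klr_mixed \<theta> a lam nu) F mu = (if nu 1 ~= nu 2 \<and> nu 2 = \<theta> (nu 1) then c1 (nu 2) (nu 1) * t1
  else if nu 1 ~= \<theta> (nu 1) \<and> nu 2 = \<theta> (nu 2) then c2 (nu 1) (nu 2) * t0
  else if \<theta> (nu 1) = nu 1 \<and> nu 1 ~= nu 2 \<and> nu 2 = \<theta> (nu 2) then c3 (nu 1) (nu 2) * (fvar 1 * t0 + t) else 0)"
   unfolding klr_mixed_eq c1_def c2_def c3_def using mixed_poly[OF 10(3), of nu] 10 n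
   by (auto simp add: act closed t1_def t0_def t_def Let_def)
  also have "... = (if mu 1 ~= mu 2 \<and> mu 2 = \<theta> (mu 1) then c1 (mu 1) (mu 2) * t1
  else if mu 1 ~= \<theta> (mu 1) \<and> mu 2 = \<theta> (mu 2) then c2 (\<theta> (mu 1)) (mu 2) * t0
  else if \<theta> (mu 1) = mu 1 \<and> mu 1 ~= mu 2 \<and> mu 2 = \<theta> (mu 2) then c3 (mu 1) (mu 2) * (fvar 1 * t0 + t) else 0)"
   by (rule mixed_swap[OF t, symmetric]) assumption+
  also have "... = \<tau> 1 (\<tau> 0 (\<tau> 1 (\<tau> 0 (at_idem nu (F nu))))) mu - \<tau> 0 (\<tau> 1 (\<tau> 0 (\<tau> 1 (at_idem nu (F nu))))) mu"
   unfolding tau_four[OF 10(3) mu, of "at_idem nu (F nu)"] Let_def c1_def c2_def c3_def t1_def t0_def t_def ..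
  also have "... = fa.act ((kt 1 * kt 0)\<^sup>2 - (kt 0 * kt 1)\<^sup>2) (at_idem nu (F nu)) mu"
   using 10 n by (simp add: act closed power2_eq_square)
  finally show ?thesis using 10 n by (simp add: act closed fcar_power)
 next
  case (11 nu k l)
  then have "index_swap k l \<in> {1..n}" by (auto simp: index_swap_def transpose_def)
  then show ?thesis using 11 tau_x[OF 11(3,4) mu, of l "at_idem nu (F nu)"] by (simp add: act closed)
    (auto simp add: act closed at_idem_def split: if_splits)
 next
  case (12 nu)
  have two: "fa.act (2 * ke nu) F = (\<lambda>mu. 2 * at_idem nu (F nu) mu)"
   unfolding mult_2 by (simp only: fa.act_add fa.act_gen klr_gen_act.simps(1))
  have "2 * ke nu \<in> fcar gens" unfolding mult_2 using 12 by (intro closed)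
  then show ?thesis using 12 tau_x_0(1)[OF 12(3) mu, of "at_idem nu (F nu)"] by (simp add: act closed two)
    (auto simp add: act closed two at_idem_def split: if_splits)
 next
  case (13 l)
  then have "0 < n" "l ~= 1" by auto
  then show ?thesis using 13 tau_x_0(2)[OF _ mu, of l F] by (auto simp add: act closed split: if_splits)
 qed
qed

sublocale pa: presented_action gens rels V "fconst :: 'k => 'k mps fract" \<rho>
 by unfold_locales (fact klr_rels_carrier act_klr_rels)+

end

section \<open>Spanning and completion of the orientifold KLR algebra\<close>

context presented_algebra
begin

lemma I_trans: "a - b \<in> I ==> b - c \<in> I ==> a - c \<in> I" using I_add[of "a - b" "b - c"] by simp

lemma I_sym: "a - b \<in> I ==> b - a \<in> I" using I_minus[of "a - b"] by simp

lemma commutes: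
 assumes x: "x \<in> fcar G" and X: "X \<subseteq> G" and comm: "!!g. g \<in> X ==> x * gen g - gen g * x \<in> I"
 shows "a \<in> fcar X ==> x * a - a * x \<in> I"
proof (induction rule: fcar_induct)
 case (add a b)
 then show ?case using I_add[of "x * a - a * x" "x * b - b * x"] by (simp add: algebra_simps)
next
 case (gen g a)
 have a: "a \<in> fcar G" "gen g \<in> fcar G" using gen X by (auto intro: fcar_mono fcar_closed(4))
 have "(x * gen g - gen g * x) * a + gen g * (x * a - a * x) \<in> I" using a gen(1,3) by (intro I_add I_rmult I_lmult comm)
 then show ?case by (simp add: algebra_simps)
qed (simp_all add: I_zero scal_comm)

text \<open>The first letter of \<open>xs\<close> is moved to its place in \<open>ys\<close> past
  commuting letters, and the rest is induction. Polynomials are represented by sorted words, so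
  products have to be sorted anew.\<close>

lemma commuting_words:
 assumes X: "X \<subseteq> G" and comm: "!!g h. g \<in> X ==> h \<in> X ==> gen g * gen h - gen h * gen g \<in> I"
 shows "set xs \<subseteq> X ==> mset xs = mset ys ==> wordp xs - wordp ys \<in> I"
proof (induction xs arbitrary: ys)
 case Nil
 then show ?case by (simp add: I_zero)
next
 case (Cons x xs)
 have "set ys \<subseteq> X" using Cons.prems mset_eq_setD by metis
 moreover have "x \<in> set ys" using Cons.prems(2) by (metis list.set_intros(1) mset_eq_setD)
 then obtain y1 y2 where y: "ys = y1 @ x # y2" by (meson split_list)
 ultimately have c: "gen x \<in> fcar G" "wordp y1 \<in> fcar X" "wordp y2 \<in> fcar G" "x \<in> X"
  using X by (auto intro!: wordp_fcar fcar_closed(4))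
 have "mset xs = mset (y1 @ y2)" using Cons.prems(2) y by simp
 with Cons have "wordp xs - wordp (y1 @ y2) \<in> I" by simp
 then have "gen x * (wordp xs - wordp (y1 @ y2)) \<in> I" by (rule I_lmult[OF c(1)])
 moreover have "(gen x * wordp y1 - wordp y1 * gen x) * wordp y2 \<in> I"
  by (rule I_rmult[OF c(3) commutes[OF c(1) X comm[OF c(4)] c(2)]])
 ultimately have "gen x * (wordp xs - wordp (y1 @ y2)) + (gen x * wordp y1 - wordp y1 * gen x) * wordp y2 \<in> I"
  by (rule I_add)
 then show ?case by (simp add: y wordp_simps algebra_simps)
qed

end

lemma (in filtered_algebra) filt_Gq: "p \<in> fcar Gq ==> p \<in> filt d"
 using filt_q[OF _ filt_word[of "[]" d]] by (fastforce simp: wordp_simps)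

lemma (in filtered_algebra) filt_add: "a \<in> filt d ==> b \<in> filt d ==> a + b \<in> filt d"
 and filt_sum: "(!!x. x \<in> X ==> f x \<in> filt d) ==> sum f X \<in> filt d"
 and filt_cong: "b \<in> filt d ==> a - b \<in> I ==> a \<in> filt d"
 unfolding filt_def by (fact span_add, rule span_sum, blast, fact span_cong)

definition kmon :: "(nat \<Rightarrow>\<^sub>0 nat) => 'i klr_gen list" where
 "kmon m = concat (map (\<lambda>l. replicate (lookup m l) (KX l)) (sorted_list_of_set (keys m)))"

lemma kpoly_superset:
 "finite K ==> keys p \<subseteq> K ==> kpoly p = (\<Sum>m\<in>K. single (Word (kmon m)) (lookup p m))"
 unfolding kpoly_def kmon_def by (rule sum.mono_neutral_left) (auto simp: in_keys_iff)

lemma kpoly_add: "kpoly (p + q) = kpoly p + kpoly q"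
proof -
 let ?K = "keys p \<union> keys q"
 have "keys (p + q) \<subseteq> ?K" by (rule keys_add)
 then show ?thesis by (simp add: kpoly_superset[of ?K] lookup_add single_add sum.distrib)
qed

lemma kpoly_zero: "kpoly 0 = 0" by (simp add: kpoly_def)

lemma kpoly_sum: "kpoly (sum f X) = (\<Sum>x\<in>X. kpoly (f x))"
 by (induction X rule: infinite_finite_induct) (simp_all add: kpoly_zero kpoly_add)

lemma kpoly_single: "kpoly (single m c) = scal c * wordp (kmon m)"
 by (subst kpoly_superset[of "{m}"]) (simp_all add: single_eq_scal)

lemma kmon_zero: "kmon 0 = []" by (simp add: kmon_def)

lemma count_concat_replicate:
 assumes "distinct ls" "inj_on h (set ls)"
 shows "count (mset (concat (map (\<lambda>l. replicate (f l) (h l)) ls))) x = (\<Sum>l\<in>set ls. if h l = x then f l else 0)"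
 using assms by (induction ls) auto

lemma mset_kmon: "mset (KX l # kmon m) = mset (kmon (single l 1 + m))"
proof (rule multiset_eqI)
 fix x :: "'i klr_gen"
 have c: "count (mset (kmon m)) x = (case x of KX k => lookup m k | _ => 0)" for m
 proof -
  have "count (mset (kmon m)) x = (\<Sum>l\<in>keys m. if KX l = x then lookup m l else 0)"
   unfolding kmon_def by (subst count_concat_replicate) (auto simp: inj_on_def)
  also have "... = (case x of KX k => lookup m k | _ => 0)" by (cases x) (auto simp: in_keys_iff)
  finally show ?thesis .
 qed
 show "count (mset (KX l # kmon m)) x = count (mset (kmon (single l 1 + m))) x"
  unfolding mset.simps count_add_mset c by (cases x) (auto simp: lookup_add lookup_single when_def)
qed

lemma kmon_set: "set (kmon m) \<subseteq> KX ` keys m" by (fastforce simp: kmon_def)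

context klr_rep
begin

abbreviation "Gq \<equiv> KIdem ` V \<union> KX ` {1..n} :: 'i klr_gen set"

lemma Gq_gens: "Gq \<subseteq> gens" and KX_gens: "KX ` {1..n} \<subseteq> gens" by (auto simp: klr_gens_def)

lemma Gq_closed:
 "nu \<in> V ==> ke nu \<in> fcar Gq" "l \<in> {1..n} ==> kx l \<in> fcar Gq" "p \<in> mpoly_in n ==> kpoly p \<in> fcar Gq"
 by (auto intro!: fcar_closed(4)) (rule fcar_mono[OF _ kpoly_carrier], auto)

text \<open>The relations are stated after multiplication by an idempotent \<open>ke nu\<close>.
  Since the idempotents sum to 1, such local statements add up to one about \<open>b\<close>
  itself.\<close>

lemma idem_sum:
 assumes "b \<in> fcar gens" "!!nu. nu \<in> V ==> b * ke nu - c nu \<in> pa.I"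
 shows "b - (\<Sum>nu\<in>V. c nu) \<in> pa.I"
proof -
 have "b * ((\<Sum>nu\<in>V. ke nu) - 1) \<in> pa.I" by (rule pa.I_lmult[OF assms(1) pa.I_rel[OF klr_rels.intros(2)]])
 moreover have "(\<Sum>nu\<in>V. b * ke nu - c nu) \<in> pa.I" by (rule pa.I_sum) (rule assms(2))
 ultimately have "(\<Sum>nu\<in>V. b * ke nu - c nu) - b * ((\<Sum>nu\<in>V. ke nu) - 1) \<in> pa.I" by (intro pa.I_diff)
 then show ?thesis by (simp add: sum_subtractf sum_distrib_left algebra_simps)
qed

sublocale pf: filtered_algebra gens rels Gq n KTau
proof
 show "gens = Gq \<union> KTau ` {..<n}" by (simp add: klr_gens_def)
 fix g k assume g: "g \<in> Gq" and k: "k < n"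
 then consider (idem) nu where "g = KIdem nu" "nu \<in> V" | (x) l where "g = KX l" "l \<in> {1..n}" by blast
 then show "\<exists>p\<in>fcar Gq. \<exists>p'\<in>fcar Gq. gen g * gen (KTau k) - gen (KTau k) * p - p' \<in> pa.I"
 proof cases
  case idem
  then have s: "sw k nu \<in> V" using swapV k by blast
  have "kt k * ke (sw k nu) - ke nu * kt k \<in> rels" using klr_rels.intros(4)[OF s k, of \<theta> a lam] by (simp add: sw_sq)
  then have "ke nu * kt k - kt k * ke (sw k nu) - 0 \<in> pa.I" using pa.I_sym[OF pa.I_rel] by simp
  with idem s show ?thesis using Gq_closed(1) fcar_closed(1) by blast
 next
  case x
  show ?thesis
  proof (cases "k = 0")
   case False
   then have k1: "1 \<le> k" by simp
   define l' where "l' = index_swap k l"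
   have l': "l' \<in> {1..n}" "index_swap k l' = l" using x k by (auto simp: l'_def index_swap_def transpose_def)
   define c :: "(nat => 'i) => 'i klr_gen fword \<Rightarrow>\<^sub>0 'k" where "c nu = (if l' = k \<and> nu k = nu (k + 1) then - ke nu
   else if l' = k + 1 \<and> nu k = nu (k + 1) then ke nu else 0)" for nu
   have "(kt k * kx l' - kx l * kt k) - (\<Sum>nu\<in>V. c nu) \<in> pa.I"
   proof (rule idem_sum)
    show "kt k * kx l' - kx l * kt k \<in> fcar gens" using k l' x by (intro fcar_closed(7,8) gens_closed) auto
    show "(kt k * kx l' - kx l * kt k) * ke nu - c nu \<in> pa.I" if "nu \<in> V" for nu
     using klr_rels.intros(11)[OF that k1 k l'(1), of \<theta> a lam] unfolding c_def l'(2) by (rule pa.I_rel)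
   qed
   then have "- ((kt k * kx l' - kx l * kt k) - (\<Sum>nu\<in>V. c nu)) \<in> pa.I" by (rule pa.I_minus)
   then have "kx l * kt k - kt k * kx l' - (- (\<Sum>nu\<in>V. c nu)) \<in> pa.I" by (simp add: algebra_simps)
   moreover have "- (\<Sum>nu\<in>V. c nu) \<in> fcar Gq"
    unfolding c_def by (intro fcar_closed(6) fcar_sum) (auto intro!: fcar_closed(1,6) Gq_closed simp del: One_nat_def)
   ultimately show ?thesis using x l' Gq_closed(2) by blast
  next
   case k0: True
   show ?thesis
   proof (cases "l = 1")
    case True
    define c :: "(nat => 'i) => 'i klr_gen fword \<Rightarrow>\<^sub>0 'k" where "c nu = (if nu 1 = \<theta> (nu 1) then - (2 * ke nu) else 0)" for nu
    have "(kt 0 * kx 1 + kx 1 * kt 0) - (\<Sum>nu\<in>V. c nu) \<in> pa.I"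
    proof (rule idem_sum)
     show "kt 0 * kx 1 + kx 1 * kt 0 \<in> fcar gens" using k k0 by (intro fcar_closed(5,8) gens_closed) auto
     show "(kt 0 * kx 1 + kx 1 * kt 0) * ke nu - c nu \<in> pa.I" if "nu \<in> V" for nu
      using klr_rels.intros(12)[OF that, of n \<theta> a lam] k k0 unfolding c_def by (intro pa.I_rel) simp
    qed
    then have "kx l * kt k - kt k * (- kx 1) - (\<Sum>nu\<in>V. c nu) \<in> pa.I" using True k0 by (simp add: add.commute)
    moreover have "(\<Sum>nu\<in>V. c nu) \<in> fcar Gq"
     unfolding c_def mult_2 by (intro fcar_sum) (auto intro!: fcar_closed(1,6,7) Gq_closed simp del: One_nat_def)
    moreover have "- kx 1 \<in> fcar Gq" using k by (intro fcar_closed(6) Gq_closed) auto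
    ultimately show ?thesis using x by blast
   next
    case False
    with x have "l \<in> {2..n}" by auto
    from pa.I_sym[OF pa.I_rel[OF klr_rels.intros(13)[OF this]]]
    have "kx l * kt k - kt k * kx l - 0 \<in> pa.I" using k0 by simp
    then show ?thesis using x Gq_closed(2) fcar_closed(1) by blast
   qed
  qed
 qed
qed

lemma sum_Gq: "(!!nu. nu \<in> V ==> p nu \<in> mpoly_in n) ==> (\<Sum>nu\<in>V. kpoly (p nu) * ke nu) \<in> fcar Gq"
 by (intro fcar_sum fcar_closed(8) Gq_closed)

text \<open>The correction has length at most 1; 3 is the bound needed beneath a relation between
  words of length 4.\<close>

lemma mixed_filt:
 assumes "2 \<le> n" "nu \<in> V"
 shows "klr_mixed \<theta> a lam nu \<in> pf.filt 3"
proof -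
 have n: "0 < n" "Suc 0 < n" using assms by auto
 have t: "kt k * ke nu \<in> pf.filt 1" if "k < n" for k
  using pf.filt_t[OF that pf.filt_Gq[OF Gq_closed(1)[OF assms(2)], of 0]] by simp
 have "kpoly p * kt k * ke nu \<in> pf.filt 1" if "p \<in> mpoly_in n" "k < n" for p k
  using pf.filt_q[OF Gq_closed(3)[OF that(1)] t[OF that(2)]] by (simp only: mult.assoc)
 moreover have "kpoly p * (kx 1 * kt 0 + 1) * ke nu \<in> pf.filt 1" if "p \<in> mpoly_in n" for p
 proof -
  have "kx 1 * (kt 0 * ke nu) \<in> pf.filt 1" using n by (intro pf.filt_q Gq_closed t) auto
  then have "kx 1 * (kt 0 * ke nu) + ke nu \<in> pf.filt 1" by (rule pf.filt_add[OF _ pf.filt_Gq[OF Gq_closed(1)[OF assms(2)]]])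
  from pf.filt_q[OF Gq_closed(3)[OF that] this] show ?thesis by (simp add: distrib_right mult.assoc)
 qed
 moreover have "0 \<in> pf.filt 1" by (intro pf.filt_Gq fcar_closed)
 ultimately have "klr_mixed \<theta> a lam nu \<in> pf.filt 1"
  unfolding klr_mixed_eq using mixed_poly(1)[OF assms(1), of nu] n by auto
 then show ?thesis by (rule pf.filt_mono) simp
qed

sublocale ps: spanned_algebra gens rels Gq n KTau
proof
 fix k assume k: "k < n"
 show "kt k * kt k \<in> pf.filt 1"
 proof (cases "k = 0")
  case True
  define p where "p nu = klr_Q0 \<theta> lam (nu 1) (- mpoly_var 1 :: 'k mpoly)" for nu :: "nat => 'i"
  have "kt 0 * kt 0 - (\<Sum>nu\<in>V. kpoly (p nu) * ke nu) \<in> pa.I" unfolding p_def using k True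
   by (intro idem_sum fcar_closed(8) gens_closed pa.I_rel klr_rels.intros(7)) auto
  moreover have "(\<Sum>nu\<in>V. kpoly (p nu) * ke nu) \<in> pf.filt 1"
   unfolding p_def using k by (intro pf.filt_Gq sum_Gq sq_poly) auto
  ultimately show ?thesis using pf.filt_cong True by blast
 next
  case False
  then have k1: "1 \<le> k" by simp
  define p where "p nu = klr_Q a (nu k) (nu (k + 1)) (mpoly_var (k + 1)) (mpoly_var k :: 'k mpoly)" for nu
  have "kt k * kt k - (\<Sum>nu\<in>V. kpoly (p nu) * ke nu) \<in> pa.I" unfolding p_def using k k1
   by (intro idem_sum fcar_closed(8) gens_closed pa.I_rel klr_rels.intros(6)) auto
  moreover have "(\<Sum>nu\<in>V. kpoly (p nu) * ke nu) \<in> pf.filt 1"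
   unfolding p_def using k k1 by (intro pf.filt_Gq sum_Gq sq_poly)
  ultimately show ?thesis using pf.filt_cong by blast
 qed
next
 fix l r assume lr: "bmove l r" and l: "set l \<subseteq> {..<n}"
 have br: "kt (i + 1) * kt i * kt (i + 1) - kt i * kt (i + 1) * kt i \<in> pf.filt 2" if i: "1 \<le> i" "i + 1 < n" for i
 proof -
  define c where "c nu = (if nu i = nu (i + 2) then kpoly (braid_poly i nu) * ke nu else 0)" for nu
  have "(kt (i + 1) * kt i * kt (i + 1) - kt i * kt (i + 1) * kt i) - (\<Sum>nu\<in>V. c nu) \<in> pa.I"
   unfolding c_def braid_poly_def using i by (intro idem_sum fcar_closed(7,8) gens_closed pa.I_rel klr_rels.intros(9)) auto
  moreover have "(\<Sum>nu\<in>V. c nu) \<in> fcar Gq"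
   unfolding c_def by (intro fcar_sum) (auto intro!: fcar_closed(1,8) Gq_closed braid_poly i simp del: One_nat_def)
  ultimately show ?thesis using pf.filt_cong pf.filt_Gq by blast
 qed
 have fo: "(kt 1 * kt 0) ^ 2 - (kt 0 * kt 1) ^ 2 \<in> pf.filt 3" if n: "2 \<le> n"
 proof -
  have "(kt 1 * kt 0) ^ 2 - (kt 0 * kt 1) ^ 2 - (\<Sum>nu\<in>V. klr_mixed \<theta> a lam nu) \<in> pa.I"
   using n by (intro idem_sum fcar_closed(7,8) fcar_power gens_closed pa.I_rel klr_rels.intros(10)) auto
  then show ?thesis by (rule pf.filt_cong[rotated]) (intro pf.filt_sum mixed_filt n)
 qed
 have neg: "x - y \<in> pf.filt d ==> y - x \<in> pf.filt d" for x y d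
  unfolding pf.filt_def minus_diff_eq[symmetric, of y x] by (rule pf.span_minus)
 from lr l show "pf.wt l - pf.wt r \<in> pf.filt (length l - 1)"
 proof (induction rule: bmove.induct)
  case (comm i j)
  then have "kt i * kt j - kt j * kt i \<in> pa.I" by (intro pa.I_rel klr_rels.intros(8)) auto
  then show ?case by (simp add: wordp_simps pf.filt_def pf.span_I del: One_nat_def)
 next
  case (braid i)
  then have "i + 1 < n" by simp
  with neg[OF br[OF braid(1)]] show ?case by (simp add: wordp_simps mult.assoc numeral_2_eq_2)
 next
  case (braid' i)
  then have "i + 1 < n" by simp
  with br[OF braid'(1)] show ?case by (simp add: wordp_simps mult.assoc numeral_2_eq_2)
 next
  case four
  then have "2 \<le> n" by simp
  with neg[OF fo] show ?case by (simp add: wordp_simps mult.assoc power2_eq_square numeral_3_eq_3)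
 next
  case four'
  then have "2 \<le> n" by simp
  with fo show ?case by (simp add: wordp_simps mult.assoc power2_eq_square numeral_3_eq_3)
 qed
qed

text \<open>\<open>kpoly\<close> writes every monomial with increasing indices, so the new factor
  has to be sorted in, which is possible modulo the relations.\<close>

lemma kpoly_var_mult:
 assumes "l \<in> {1..n}" "p \<in> mpoly_in n"
 shows "kx l * kpoly p - kpoly (mpoly_var l * p) \<in> pa.I"
proof -
 let ?f = "\<lambda>m. single m (lookup p m)"
 have p: "p = (\<Sum>m\<in>keys p. ?f m)" by (rule poly_mapping_sum_single)
 have "kx l * kpoly (?f m) - kpoly (mpoly_var l * ?f m) \<in> pa.I" if "m \<in> keys p" for m
 proof -
  have s: "set (KX l # kmon m) \<subseteq> KX ` {1..n}" using kmon_set[of m] that assms by (fastforce simp: mpoly_in_def)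
  have "wordp (KX l # kmon m) - wordp (kmon (single l 1 + m)) \<in> pa.I"
   by (rule pa.commuting_words[OF KX_gens _ s mset_kmon]) (auto intro!: pa.I_rel klr_rels.intros(5))
  from pa.I_lmult[OF fcar_closed(3) this, of "lookup p m"]
  show ?thesis by (simp add: mpoly_var_def mult_single kpoly_single wordp_simps right_diff_distrib mult.assoc[symmetric] scal_comm[of _ "kx l"])
 qed
 then have "(\<Sum>m\<in>keys p. kx l * kpoly (?f m) - kpoly (mpoly_var l * ?f m)) \<in> pa.I" by (rule pa.I_sum)
 then have "kx l * kpoly (\<Sum>m\<in>keys p. ?f m) - kpoly (mpoly_var l * (\<Sum>m\<in>keys p. ?f m)) \<in> pa.I"
  by (simp add: kpoly_sum sum_subtractf sum_distrib_left)
 then show ?thesis by (simp only: p[symmetric])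
qed

abbreviation pol :: "((nat => 'i) => 'k mpoly) => 'i klr_gen fword \<Rightarrow>\<^sub>0 'k" where
 "pol p \<equiv> \<Sum>nu\<in>V. kpoly (p nu) * ke nu"

lemma klr_pol_iff: "p \<in> klr_pol n V \<longleftrightarrow> (\<forall>nu\<in>V. p nu \<in> mpoly_in n) \<and> (\<forall>nu. nu \<notin> V --> p nu = 0)"
 by (simp add: klr_pol_def mpoly_in_def)

text \<open>Left multiplication by a variable multiplies every component, and by an idempotent it
  keeps a single one. A scalar is spread over all components, as the idempotents sum to 1.\<close>

lemma pol_surj: "q \<in> fcar Gq ==> \<exists>p\<in>klr_pol n V. q - pol p \<in> pa.I"
proof (induction rule: fcar_induct)
 case zero
 then show ?case by (intro bexI[of _ "\<lambda>_. 0"]) (simp_all add: kpoly_zero pa.I_zero klr_pol_iff mpoly_in_closed)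
next
 case (scal c)
 let ?p = "vec V (\<lambda>_. single 0 c)"
 have "scal c * ((\<Sum>nu\<in>V. ke nu) - 1) \<in> pa.I" by (rule pa.I_lmult[OF fcar_closed(3) pa.I_rel[OF klr_rels.intros(2)]])
 moreover have "pol ?p = scal c * (\<Sum>nu\<in>V. ke nu)"
  by (simp add: vec_def kpoly_single kmon_zero wordp_simps sum_distrib_left)
 ultimately have "pol ?p - scal c \<in> pa.I" by (simp add: right_diff_distrib)
 then have "scal c - pol ?p \<in> pa.I" by (rule pa.I_sym)
 moreover have "?p \<in> klr_pol n V" by (simp add: klr_pol_iff vec_def mpoly_in_single)
 ultimately show ?case by blast
next
 case (add a b)
 then obtain p p' where p: "p \<in> klr_pol n V" "p' \<in> klr_pol n V" "a - pol p \<in> pa.I" "b - pol p' \<in> pa.I" by blast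
 have "(a - pol p) + (b - pol p') \<in> pa.I" by (rule pa.I_add[OF p(3,4)])
 then have "(a + b) - pol (\<lambda>nu. p nu + p' nu) \<in> pa.I" by (simp add: kpoly_add sum.distrib algebra_simps)
 moreover have "(\<lambda>nu. p nu + p' nu) \<in> klr_pol n V" using p(1,2) by (simp add: klr_pol_iff mpoly_in_closed)
 ultimately show ?case by (intro bexI[of _ "\<lambda>nu. p nu + p' nu"])
next
 case (gen g b)
 then obtain p where p: "p \<in> klr_pol n V" "b - pol p \<in> pa.I" by blast
 have pin: "p nu \<in> mpoly_in n" if "nu \<in> V" for nu using that p(1) by (simp add: klr_pol_iff)
 have g: "gen g \<in> fcar gens" using gen(1) Gq_gens by (intro fcar_closed(4)) blast
 have gb: "gen g * b - gen g * pol p \<in> pa.I" using pa.I_lmult[OF g p(2)] by (simp add: right_diff_distrib)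
 have "\<exists>p'\<in>klr_pol n V. gen g * pol p - pol p' \<in> pa.I"
 proof -
  from gen(1) consider (idem) mu where "g = KIdem mu" "mu \<in> V" | (x) l where "g = KX l" "l \<in> {1..n}" by blast
  then show ?thesis
  proof cases
   case x
   define p' where "p' nu = mpoly_var l * p nu" for nu
   have "(\<Sum>nu\<in>V. (kx l * kpoly (p nu) - kpoly (p' nu)) * ke nu) \<in> pa.I"
    unfolding p'_def by (intro pa.I_sum pa.I_rmult gens_closed kpoly_var_mult x pin)
   then have "kx l * pol p - pol p' \<in> pa.I" by (simp add: left_diff_distrib sum_subtractf sum_distrib_left mult.assoc)
   moreover have "p' \<in> klr_pol n V" using p(1) x by (simp add: klr_pol_iff p'_def mpoly_in_closed)
   ultimately show ?thesis using x by blast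
  next
   case idem
   define p' where "p' = at_idem mu (p mu)"
   have c: "ke mu * kpoly (p nu) - kpoly (p nu) * ke mu \<in> pa.I" if "nu \<in> V" for nu
   proof (rule pa.commutes[OF gens_closed(1)[OF idem(2)] KX_gens _ kpoly_carrier[OF pin[OF that]]])
    fix g :: "'i klr_gen" assume "g \<in> KX ` {1..n}"
    then show "ke mu * gen g - gen g * ke mu \<in> pa.I" using idem by (auto intro!: pa.I_sym[OF pa.I_rel] klr_rels.intros(3))
   qed
   have "ke mu * (kpoly (p nu) * ke nu) - kpoly (p' nu) * ke nu \<in> pa.I" if "nu \<in> V" for nu
   proof -
    have "(ke mu * kpoly (p nu) - kpoly (p nu) * ke mu) * ke nu +
      kpoly (p nu) * (ke mu * ke nu - (if mu = nu then ke mu else 0)) \<in> pa.I"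
     using idem that by (intro pa.I_add pa.I_rmult pa.I_lmult c gens_closed kpoly_gens pin pa.I_rel klr_rels.intros(1))
    then show ?thesis by (auto simp: p'_def at_idem_def kpoly_zero algebra_simps split: if_splits)
   qed
   then have "(\<Sum>nu\<in>V. ke mu * (kpoly (p nu) * ke nu) - kpoly (p' nu) * ke nu) \<in> pa.I" by (rule pa.I_sum)
   then have "ke mu * pol p - pol p' \<in> pa.I" by (simp add: sum_subtractf sum_distrib_left)
   moreover have "p' \<in> klr_pol n V" using p(1) by (simp add: klr_pol_iff p'_def at_idem_def mpoly_in_closed)
   ultimately show ?thesis using idem by blast
  qed
 qed
 then show ?case using pa.I_trans[OF gb] by blast
qed

lemma series_of_pol_pev: "series_of_pol p = (\<lambda>nu. pev (p nu))" by (simp add: series_of_pol_def pev_def)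

lemma pev_pseries: "p \<in> mpoly_in n ==> pev p \<in> pseries n"
 by (auto simp: pev_def pseries_def mps_in_def mpoly_in_def in_keys_iff intro!: imageI)

sublocale ro: refl_ops V n SV yk \<tau> Ak Bk by (rule refl_ops)

sublocale pc: completed_algebra gens rels Gq n KTau V "fconst :: 'k => 'k mps fract" \<rho> SV yk Ak Bk
 "pseries n" "klr_pol n V" pol series_of_pol
proof
 show "pol p \<in> fcar gens" if "p \<in> klr_pol n V" for p
  using that by (intro fcar_sum fcar_closed(8) gens_closed kpoly_gens) (auto simp: klr_pol_iff)
 show "series_of_pol p \<in> carrier (coef_ring V (pseries n))" if "p \<in> klr_pol n V" for p
  using that by (auto simp: coef_ring_def series_of_pol_pev klr_pol_iff pev_pseries pev_simps)
 show "fa.act (pol p) F = (\<lambda>mu. series_of_pol p mu * F mu)" if "p \<in> klr_pol n V" "F \<in> FF" for p F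
 proof (rule fun_V_eqI)
  have c: "kpoly (p nu) \<in> fcar gens" if "nu \<in> V" for nu using that \<open>p \<in> klr_pol n V\<close> by (simp add: klr_pol_iff kpoly_gens)
  show "fa.act (pol p) F \<in> FF" "(\<lambda>mu. series_of_pol p mu * F mu) \<in> FF"
   using that c by (auto intro!: fa.act_supp supp_closed(3) fcar_sum fcar_closed(8) gens_closed)
  fix mu assume mu: "mu \<in> V"
  have "fa.act (pol p) F mu = (\<Sum>nu\<in>V. pev (p nu) * at_idem nu (F nu) mu)"
   using that by (simp add: fa.act_sum fa.act_mult c gens_closed act_kpoly fa.act_gen)
  also have "... = (\<Sum>nu\<in>V. if nu = mu then pev (p nu) * F nu else 0)" by (rule sum.cong) (auto simp: at_idem_def)
  finally show "fa.act (pol p) F mu = series_of_pol p mu * F mu" using mu finV by (simp add: series_of_pol_pev)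
 qed
 show "\<exists>p\<in>klr_pol n V. q - pol p \<in> pa.I" if "q \<in> fcar Gq" for q using that by (rule pol_surj)
 fix k and m :: "('i, 'k) svec" assume k: "k < n" and m: "m \<in> carrier (coef_ring V (pseries n))"
 then have mp: "m mu \<in> pseries n" if "mu \<in> V" for mu using that by (simp add: coef_ring_def)
 have m0: "m mu = 0" if "mu \<notin> V" for mu using that m by (simp add: coef_ring_def)
 show "SV k m \<in> carrier (coef_ring V (pseries n))"
  using klr_refl_pseries[OF k mp] swapV[OF _ k] by (auto simp: coef_ring_def SV_def vec_def)
 \<comment> \<open>For a label fixed by the reflection this is a divided difference; otherwise
   \<open>Ak\<close> is zero.\<close>
 have "Ak k mu * (m mu - SV k m mu) \<in> pseries n" if mu: "mu \<in> V" for mu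
 proof (cases "k = 0")
  case True
  show ?thesis
  proof (cases "\<theta> (mu 1) = mu 1")
   case t: True
   then have "sw 0 mu = mu" by (rule seq_swap_fix)
   then have "Ak k mu * (m mu - SV k m mu) = (klr_refl 0 (m mu) - m mu) / fvar 1"
    using t True mu by (simp add: Ak_def SV_at divide_inverse algebra_simps)
   then show ?thesis using klr_divided_difference(2)[OF _ mp[OF mu]] k by simp
  qed (simp add: Ak_def True pseries_closed)
 next
  case False
  show ?thesis
  proof (cases "mu k = mu (Suc k)")
   case t: True
   then have "sw k mu = mu" using False by (intro seq_swap_fix) auto
   then have "Ak k mu * (m mu - SV k m mu) = (klr_refl k (m mu) - m mu) / (fvar k - fvar (Suc k))"
    using t False mu by (simp add: Ak_def SV_at divide_inverse algebra_simps)
   then show ?thesis using klr_divided_difference(1)[OF _ k mp[OF mu]] False by simp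
  qed (simp add: Ak_def False pseries_closed)
 qed
 then show "(\<lambda>mu. Ak k mu * (m mu - SV k m mu)) \<in> carrier (coef_ring V (pseries n))"
  by (auto simp: coef_ring_def m0 SV_def vec_def)
next
 show "vec V (yk i) \<in> carrier (coef_ring V (pseries n))" if "i \<in> {1..int n}" for i
  using that by (auto simp: coef_ring_def vec_def yk_def intro!: pseries_closed(8))
qed (simp_all add: pseries_closed)

end

section \<open>The polynomial representation of affine Hecke algebras\<close>

lemma pev_inj: "pev p = pev p' \<longleftrightarrow> p = p'"
proof
 assume "pev p = pev p'"
 then have "mco (Abs_mps (lookup p)) = mco (Abs_mps (lookup p'))" by (simp add: pev_def)
 then show "p = p'" by (simp)
qed simp

text \<open>A linear form with a nonzero coefficient is nonzero already as a polynomial. The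
  denominators of the Hecke operators are handled by this and by
  \<open>hX_mult_neq_1\<close>.\<close>

lemma lin_nz:
 fixes a b c :: "'k::field"
 assumes "k ~= l" "b ~= 0"
 shows "fconst a + fconst b * fvar k + fconst c * fvar l ~= 0"
proof
 assume "fconst a + fconst b * fvar k + fconst c * fvar l = 0"
 then have "pev (single 0 a + single 0 b * mpoly_var k + single 0 c * mpoly_var l) = pev 0" by (simp add: pev_simps)
 then have "single 0 a + single 0 b * mpoly_var k + single 0 c * mpoly_var l = (0 :: 'k mpoly)" unfolding pev_inj .
 then have "lookup (single 0 a + single 0 b * mpoly_var k + single 0 c * mpoly_var l :: 'k mpoly) (single k 1) = 0" by simp
 moreover have "0 ~= single k (Suc 0)" by (metis single_zero single_Suc_0_eq lookup_single_eq zero_neq_one One_nat_def lookup_zero)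
 ultimately show False
  using assms by (simp add: mpoly_var_def mult_single lookup_add lookup_single single_Suc_0_eq split: if_splits)
qed

lemma hX_mult_neq_1: "hXat mu k * hXat nu l ~= (1 :: 'k::field mps fract)"
proof
 assume e: "hXat mu k * hXat nu l = (1 :: 'k mps fract)"
 define b where "b = (nu l)"
 \<comment> \<open>The coefficient of the product at this exponent is 1, also when
   \<open>k = l\<close>, and the exponent has degree 2.\<close>
 let ?m = "single k (1::nat) + single l 1"
 have d: "mdeg ?m = 2" by (simp add: mdeg_add) (simp add: mdeg_def)
 have m: "?m ~= 0" "?m ~= single k 1" "?m ~= single l 1"
 proof -
  show "?m ~= 0" using d by (auto simp: mdeg_def)
  have "mdeg (single i (1::nat)) = 1" for i by (simp add: mdeg_def)
  then show "?m ~= single k 1" "?m ~= single l 1" using d by auto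
 qed
 have "pev ((single 0 (mu k) + mpoly_var k) * (single 0 (nu l) + mpoly_var l)) = pev 1" using e by (simp add: hXat_def pev_simps)
 then have "(single 0 (mu k) + mpoly_var k) * (single 0 (nu l) + mpoly_var l) = (1 :: 'k mpoly)" unfolding pev_inj .
 then have "lookup ((single 0 (mu k) + mpoly_var k) * (single 0 (nu l) + mpoly_var l) :: 'k mpoly) ?m
  = lookup 1 ?m" by simp
 then show False
  using m by (simp add: mpoly_var_def distrib_left distrib_right mult_single lookup_add lookup_single lookup_one split: if_splits)
qed

lemma hX_nz: "hXat mu k ~= (0 :: 'k::field mps fract)" using lin_nz[of k "Suc k" 1 "mu k" 0] by (simp add: hXat_def fconst_simps)

lemma hX_lin_nz: "k ~= l ==> b ~= 0 ==> fconst b * hXat mu k - fconst c * hXat mu l ~= (0 :: 'k::field mps fract)"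
proof -
 assume a: "k ~= l" "b ~= 0"
 have "fconst b * hXat mu k - fconst c * hXat mu l = fconst (b * mu k - c * mu l) + fconst b * fvar k + fconst (- c) * fvar l"
  unfolding hXat_def fhom_simps[OF fconst_fhom] by (simp add: algebra_simps)
 then show ?thesis using lin_nz[OF a, of "b * mu k - c * mu l" "- c"] by simp
qed

lemma hX_neq: "k ~= l ==> hXat mu k ~= (hXat mu l :: 'k::field mps fract)" using hX_lin_nz[of k l 1 mu 1] by (simp)

lemma hX_neq_const: "hXat mu k ~= (fconst c :: 'k::field mps fract)"
proof
 assume "hXat mu k = fconst c"
 then have "fconst (mu k - c) + fconst 1 * fvar k + fconst 0 * fvar (Suc k) = 0"
  by (simp add: hXat_def fconst_simps algebra_simps)
 then show False using lin_nz[of k "Suc k" 1 "mu k - c" 0] by simp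
qed

lemma hecke_refl_klr: "k ~= 0 ==> hecke_refl nu k = klr_refl k" by (simp add: hecke_refl_def klr_refl_def)

lemma mps_uni_inverse:
 assumes "fps_nth f 0 ~= (0 :: 'k::field)"
 shows "mps_inverse (mps_uni l f) = mps_uni l (inverse f)" (is ?g1) "inverse (to_fract (mps_uni l f)) = to_fract (mps_uni l (inverse f))" (is ?g2)
proof -
 have e: "mps_uni l f * mps_uni l (inverse f) = 1"
  using inverse_mult_eq_1'[OF assms] by (simp add: mps_uni_mult[symmetric] mps_uni_one)
 then have "mps_uni l f ~= 0" by auto
 then show ?g1 unfolding mps_inverse_def using e by (intro the_equality) (assumption, metis mult_left_cancel)
 have "to_fract (mps_uni l f) * to_fract (mps_uni l (inverse f)) = 1" by (simp only: to_fract_mult[symmetric] e) simp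
 then show ?g2 by (rule inverse_unique)
qed

text \<open>The series \<open>1 / (1 / a + x) - a\<close>, with \<open>a\<close> the first label,
  has no constant term and linear coefficient \<open>- (a ^ 2)\<close>; so inverting the first
  variable is a coordinate change.\<close>

lemma hecke_refl_0:
 assumes "0 < n" "nu (Suc 0) ~= (0 :: 'k::field)"
 shows "fcoord n (hecke_refl nu 0)"
  "hecke_refl nu 0 (fvar l) = (if l = Suc 0 then inverse (fconst (inverse (nu (Suc 0))) + fvar (Suc 0)) - fconst (nu (Suc 0)) else fvar l)" (is ?g1)
proof -
 define f where "f = fps_const (inverse (nu (Suc 0))) + fps_X"
 define u where "u = inverse f - fps_const (nu (Suc 0))"
 let ?\<sigma> = "\<lambda>l. if 0 = (0::nat) \<and> l = 1 then mps_inverse (mps_const (inverse (nu 1)) + mps_var 1) - mps_const (nu 1)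
  else mps_var (index_swap 0 l)"
 have f0: "fps_nth f 0 = inverse (nu (Suc 0))" "fps_nth f 1 = 1" by (simp_all add: f_def)
 have nz: "fps_nth f 0 ~= 0" using assms f0 by simp
 have mf: "mps_const (inverse (nu (Suc 0))) + mps_var (Suc 0) = mps_uni (Suc 0) f"
  by (simp add: f_def mps_uni_add mps_uni_const mps_uni_X)
 have s: "?\<sigma> l = mps_uni (id l) (if l = 1 then u else fps_X)" for l
  by (simp add: mf mps_uni_inverse[OF nz] u_def mps_uni_diff mps_uni_const mps_uni_X index_swap_def)
 have u0: "fps_nth u 0 = 0" using f0 by (simp add: u_def)
 have "fps_nth (g * f) 1 = fps_nth g 0 + fps_nth g 1 * inverse (nu (Suc 0))" for g using f0 by (simp)
 from this[of "inverse f"] have "fps_nth (inverse f) 0 + fps_nth (inverse f) 1 * inverse (nu (Suc 0)) = 0"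
  unfolding inverse_mult_eq_1[OF nz] by simp
 then have "fps_nth (inverse f) 1 ~= 0" using assms f0 by auto
 then have u1: "fps_nth u 1 ~= 0" by (simp add: u_def)
 have p: "id permutes {1..n}" by (rule permutes_id)
 show "fcoord n (hecke_refl nu 0)" unfolding hecke_refl_def by (rule fcoordI(1)[OF p _ _ s]) (use u0 u1 in auto)
 have v: "hecke_refl nu 0 (fvar l) = to_fract (?\<sigma> l)" unfolding hecke_refl_def
  by (rule fcoordI(2)[OF p _ _ s]) (use u0 u1 in auto)
 have "fconst (inverse (nu (Suc 0))) + fvar (Suc 0) = to_fract (mps_uni (Suc 0) f)"
  by (simp add: fconst_def fvar_def mf[symmetric])
 then have "inverse (fconst (inverse (nu (Suc 0))) + fvar (Suc 0)) = to_fract (mps_inverse (mps_uni (Suc 0) f))"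
  by (simp add: mps_uni_inverse[OF nz])
 then show ?g1 unfolding v by (simp add: mf fconst_def fvar_def index_swap_def)
qed

section \<open>The polynomial representation of the Hecke algebra in the coordinates of the KLR
  side\<close>

locale hecke_rep = seq_system "inverse :: 'k => 'k::field" n V
 for n and V :: "(nat => 'k::field) set" +
 fixes q p0 p1 :: 'k
 assumes V_nz: "nu \<in> V ==> l \<in> {1..n} ==> nu l ~= 0"
  and q_nz: "q ~= 0" and p0_nz: "p0 ~= 0" and p1_nz: "p1 ~= 0" and two: "(2 :: 'k) ~= 0"
begin

text \<open>\<open>hecke_refl\<close> is indexed by the source component, \<open>rh\<close> by the
  target, as \<open>seq_refl\<close> expects.\<close>

definition rh :: "(nat => 'k) => nat => 'k mps fract => 'k mps fract" where
 "rh mu k = hecke_refl (sw k mu) k"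

lemma rh_fcoord: "k < n ==> mu \<in> V ==> fcoord n (rh mu k)"
proof (cases "k = 0")
 case True
 assume k: "k < n" "mu \<in> V"
 then have "sw k mu (Suc 0) ~= 0" using V_nz[OF swapV[OF k(2,1)], of 1] by simp
 with k True show ?thesis unfolding rh_def by (simp add: hecke_refl_0)
next
 case False
 assume "k < n"
 with False show ?thesis by (simp add: rh_def hecke_refl_klr klr_refl_fcoord)
qed

lemma rh_fhom: "k < n ==> mu \<in> V ==> fhom (rh mu k)" using rh_fcoord fcoord_fhom by blast

lemma rh_fconst: "k < n ==> mu \<in> V ==> rh mu k (fconst c) = fconst c" using rh_fcoord fcoord_fconst by blast

lemma rh_hX: "k < n ==> mu \<in> V ==> nu = sw k mu ==> rh mu k (hXat nu l) =
 (if k = 0 then (if l = Suc 0 then inverse (hXat mu (Suc 0)) else hXat mu l)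
 else hXat mu (if l = k then Suc k else if l = Suc k then k else l))"
proof (cases "k = 0")
 case True
 assume k: "k < n" "mu \<in> V" "nu = sw k mu"
 then have nz: "sw k mu (Suc 0) ~= 0" using V_nz[OF swapV[OF k(2,1)], of 1] by simp
 have n: "0 < n" using k by simp
 show ?thesis using k True nz unfolding hXat_def fhom_add[OF rh_fhom[OF k(1,2)]] rh_fconst[OF k(1,2)] unfolding rh_def
  by (simp add: hecke_refl_0(2)[of n] seq_swap_def)
next
 case False
 assume k: "k < n" "mu \<in> V" "nu = sw k mu"
 show ?thesis using k False unfolding hXat_def fhom_add[OF rh_fhom[OF k(1,2)]] rh_fconst[OF k(1,2)] unfolding rh_def
  by (auto simp: hecke_refl_klr klr_refl_fvar index_swap_def seq_swap_def)
qed

text \<open>The change of variables relating the two algebras.\<close>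

definition cc :: "(nat => 'k) => 'k mps fract => 'k mps fract" where
 "cc mu = fract_map (mps_subst (\<lambda>l. mps_uni (id l) (if l \<in> {1..n} then
  fps_const (mu l) * inverse (fps_const (mu l) + fps_X) - (fps_const (mu l) + fps_X) * fps_const (inverse (mu l)) else fps_X)))"

text \<open>For \<open>l\<close> in \<open>{1..n}\<close> the image of the variable has no constant
  term and linear coefficient \<open>- 2 / mu l\<close>, nonzero because 2 is; so the substitution
  is invertible.\<close>

lemma cc:
 assumes "mu \<in> V"
 shows "fcoord n (cc mu)"
  "cc mu (fvar l) = (if l \<in> {1..n} then fconst (mu l) / hXat mu l - hXat mu l / fconst (mu l) else fvar l)" (is ?g1)
proof -
 define f where "f l = fps_const (mu l) + fps_X" for l
 define u where "u l = (if l \<in> {1..n} then fps_const (mu l) * inverse (f l) - f l * fps_const (inverse (mu l)) else fps_X)" for l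
 have cc: "cc mu = fract_map (mps_subst (\<lambda>l. mps_uni (id l) (u l)))" unfolding cc_def u_def f_def ..
 have f0: "fps_nth (f l) 0 = mu l" "fps_nth (f l) 1 = 1" for l by (simp_all add: f_def)
 have nz: "mu l ~= 0" if "l \<in> {1..n}" for l using V_nz[OF assms that] .
 have u0: "fps_nth (u l) 0 = 0" for l by (simp add: u_def f0)
 have u1: "fps_nth (u l) 1 ~= 0" for l
 proof (cases "l \<in> {1..n}")
  case True
  have z: "fps_nth (f l) 0 ~= 0" using nz[OF True] f0 by simp
  have "fps_nth (g * f l) 1 = fps_nth g 0 + fps_nth g 1 * mu l" for g using f0[of l] by (simp)
  from this[of "inverse (f l)"] have "fps_nth (inverse (f l)) 0 + fps_nth (inverse (f l)) 1 * mu l = 0"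
   unfolding inverse_mult_eq_1[OF z] by simp
  then have "fps_nth (inverse (f l)) 1 * mu l = - inverse (mu l)" using f0 by (simp add: add_eq_0_iff2)
  moreover have "fps_nth (u l) 1 = mu l * fps_nth (inverse (f l)) 1 - inverse (mu l)" using True f0 by (simp add: u_def)
  ultimately have "fps_nth (u l) 1 = - (2 * inverse (mu l))" by (simp add: mult.commute)
  then show ?thesis using nz[OF True] two by simp
 next
  case False
  then have "u l = fps_X" unfolding u_def by (rule if_not_P)
  then show ?thesis by simp
 qed
 have p: "id permutes {1..n}" by (rule permutes_id)
 show "fcoord n (cc mu)" unfolding cc by (rule fcoordI(1)[OF p u0 u1 refl])
 have v: "cc mu (fvar l) = to_fract (mps_uni (id l) (u l))" unfolding cc by (rule fcoordI(2)[OF p u0 u1 refl])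
 show ?g1
 proof (cases "l \<in> {1..n}")
  case True
  have z: "fps_nth (f l) 0 ~= 0" using nz[OF True] f0 by simp
  have h: "hXat mu l = to_fract (mps_uni l (f l))" by (simp add: hXat_def fconst_def fvar_def f_def mps_uni_add mps_uni_const mps_uni_X)
  have "fconst (mu l) / hXat mu l = to_fract (mps_uni l (fps_const (mu l) * inverse (f l)))"
   unfolding divide_inverse h mps_uni_inverse(2)[OF z] by (simp add: fconst_def mps_uni_mult mps_uni_const)
  moreover have "hXat mu l / fconst (mu l) = to_fract (mps_uni l (f l * fps_const (inverse (mu l))))"
   unfolding divide_inverse fconst_inverse[symmetric] h by (simp add: fconst_def mps_uni_mult mps_uni_const)
  ultimately show ?thesis using True unfolding v by (simp add: u_def mps_uni_diff)
 next
  case False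
  then have "u l = fps_X" unfolding u_def by (rule if_not_P)
  then show ?thesis unfolding v if_not_P[OF False] by (simp add: mps_uni_X fvar_def)
 qed
qed

text \<open>Checked on variables. For \<open>k = 0\<close> both \<open>X\<^sub>1\<close> and its
  label are inverted, so the coordinate changes sign; for other \<open>k\<close> variables and
  labels are exchanged together. Hence KLR reflections correspond to Hecke reflections.\<close>

lemma rh_cc: "k < n ==> mu \<in> V ==> rh mu k (cc (sw k mu) z) = cc mu (klr_refl k z)"
proof -
 assume k: "k < n" and mu: "mu \<in> V"
 have s: "sw k mu \<in> V" using swapV[OF mu k] .
 have "(\<lambda>z. rh mu k (cc (sw k mu) z)) = (\<lambda>z. cc mu (klr_refl k z))"
 proof (rule fcoord_eqI)
  show "fcoord n (\<lambda>z. rh mu k (cc (sw k mu) z))" by (rule fcoord_comp[OF rh_fcoord[OF k mu] cc(1)[OF s]])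
  show "fcoord n (\<lambda>z. cc mu (klr_refl k z))" by (rule fcoord_comp[OF cc(1)[OF mu] klr_refl_fcoord(1)[OF k]])
  have nh: "rh mu k (fvar l) = fvar l" if "l \<notin> {1..n}" for l
  proof -
   have l: "l ~= k \<or> k = 0" "l ~= Suc k" "l ~= Suc 0" using that k by auto
   have "sw k mu l = mu l" using l by (auto simp: seq_swap_def)
   then have "rh mu k (fvar l + fconst (mu l)) = fvar l + fconst (mu l)"
    using rh_hX[OF k mu refl, of l] l unfolding hXat_def by (auto simp: add.commute)
   then show ?thesis by (simp add: fhom_add[OF rh_fhom[OF k mu]] rh_fconst[OF k mu])
  qed
  have at: "sw k mu l = (if k = 0 then if l = Suc 0 then inverse (mu l) else mu l
    else if l = k then mu (Suc k) else if l = Suc k then mu k else mu l)" for l by (simp add: seq_swap_def)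
  note fs = fhom_simps[OF rh_fhom[OF k mu]] rh_fconst[OF k mu] rh_hX[OF k mu refl] fhom_simps[OF fcoord_fhom[OF cc(1)[OF mu]]] cc(2)[OF mu] cc(2)[OF s]
  show "rh mu k (cc (sw k mu) (fvar l)) = cc mu (klr_refl k (fvar l))" for l
  proof (cases "k = 0")
   case True
   then show ?thesis using k nh[of l, unfolded True]
    by (auto simp: klr_refl_fvar fs[unfolded True] index_swap_simps at[unfolded True] fconst_inverse divide_inverse)
  next
   case False
   then show ?thesis using k nh[of l] by (auto simp: klr_refl_fvar fs index_swap_simps at)
  qed
 qed
 then show ?thesis by meson
qed

definition yh :: "int => ('k, 'k) svec" where "yh e mu = cc mu (yk e mu)"

text \<open>\<open>cc mu\<close> is onto, so every argument can be written as an image under it; the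
  Coxeter relations of \<open>rh\<close> are then those of the KLR reflections, moved through
  \<open>rh_cc\<close>.\<close>

sublocale sr: seq_refl inverse n V rh yh
proof
 have ex: "\<exists>w. z = cc mu w" if "mu \<in> V" for mu z using fcoord_inverse[OF cc(1)[OF that]] by metis
 show "rh mu k (rh (sw k mu) k z) = z" if k: "k < n" and mu: "mu \<in> V" for k mu z
  using ex[OF mu, of z] rh_cc[OF k swapV[OF mu k]] rh_cc[OF k mu] by (auto simp: sw_sq klr_refl_sq)
 show "rh mu i (rh (sw i mu) j z) = rh mu j (rh (sw j mu) i z)"
  if i: "i < n" "j < n" "i + 1 < j \<or> j + 1 < i" and mu: "mu \<in> V" for i j mu z
 proof -
  have r: "rh mu i (rh (sw i mu) j (cc (sw j (sw i mu)) w)) = cc mu (klr_refl i (klr_refl j w))"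
   if "i < n" "j < n" for i j w using that mu by (simp add: rh_cc swapV)
  obtain w where "z = cc (sw j (sw i mu)) w" using ex swapV i mu by metis
  then show ?thesis using r[of i j w] r[of j i w] i by (simp add: sw_comm[OF i(3)] klr_refl_comm[OF i(3)])
 qed
 show "rh mu i (rh (sw i mu) (Suc i) (rh (sw (Suc i) (sw i mu)) i z)) =
   rh mu (Suc i) (rh (sw (Suc i) mu) i (rh (sw i (sw (Suc i) mu)) (Suc i) z))"
  if i: "1 \<le> i" "Suc i < n" and mu: "mu \<in> V" for i mu z
 proof -
  have r: "rh mu i (rh (sw i mu) j (rh (sw j (sw i mu)) i (cc (sw i (sw j (sw i mu))) w))) =
   cc mu (klr_refl i (klr_refl j (klr_refl i w)))" if "i < n" "j < n" for i j w using that mu by (simp add: rh_cc swapV)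
  have i': "i < n" using i by simp
  obtain w where "z = cc (sw i (sw (Suc i) (sw i mu))) w" using ex swapV i(2) i' mu by metis
  then show ?thesis using r[OF i' i(2), of w] r[OF i(2) i', of w] by (simp only: sw_braid[OF i(1)] klr_refl_braid[OF i(1)])
 qed
 show "rh mu 0 (rh (sw 0 mu) 1 (rh (sw 1 (sw 0 mu)) 0 (rh (sw 0 (sw 1 (sw 0 mu))) 1 z))) =
   rh mu 1 (rh (sw 1 mu) 0 (rh (sw 0 (sw 1 mu)) 1 (rh (sw 1 (sw 0 (sw 1 mu))) 0 z)))"
  if n: "2 \<le> n" and mu: "mu \<in> V" for mu z
 proof -
  have r: "rh mu i (rh (sw i mu) j (rh (sw j (sw i mu)) i (rh (sw i (sw j (sw i mu))) j (cc (sw j (sw i (sw j (sw i mu)))) w)))) =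
   cc mu (klr_refl i (klr_refl j (klr_refl i (klr_refl j w))))" if "i < n" "j < n" for i j w
   using that mu by (simp add: rh_cc swapV)
  have n': "0 < n" "Suc 0 < n" using n by auto
  obtain w where "z = cc (sw (Suc 0) (sw 0 (sw (Suc 0) (sw 0 mu)))) w" using ex swapV n' mu by metis
  then show ?thesis using r[OF n', of w] r[OF n'(2,1), of w] by (simp only: sw_four klr_refl_four One_nat_def)
 qed
 show "rh mu k (yh e (sw k mu)) = yh (sperm k e) mu"
  if k: "k < n" and mu: "mu \<in> V" and e: "1 \<le> \<bar>e\<bar> \<and> \<bar>e\<bar> \<le> int n" for k e mu
  unfolding yh_def rh_cc[OF k mu] using e by (simp add: klr_refl_yk[where mu = mu])
 show "e = e'" if "mu \<in> V" and e: "1 \<le> \<bar>e\<bar> \<and> \<bar>e\<bar> \<le> int n" "1 \<le> \<bar>e'\<bar> \<and> \<bar>e'\<bar> \<le> int n" "yh e mu = yh e' mu" for e e' mu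
  using e yk_inj[OF two, of e e' mu] by (simp add: yh_def fhom_eq_iff[OF fcoord_fhom[OF cc(1)[OF that(1)]]])
qed (fact rh_fhom)

end

text \<open>With \<open>c = q - 1 / q\<close>, the operators are \<open>T\<^sub>k = g + (q - g) s\<^sub>k\<close> for \<open>g = c y / (y - x)\<close> and
 \<open>T\<^sub>0 = a + (p\<^sub>0 - a) s\<^sub>0\<close> for \<open>a = x (\<alpha> x - \<beta>) / (x\<^sup>2 - 1)\<close>. Each of the two braid relations
 comes down to one rational identity between the \<open>g\<close> and \<open>a\<close>.\<close>

definition hg :: "'f::field => 'f => 'f => 'f" where "hg c x y = c * y / (y - x)"

definition ha :: "'f::field => 'f => 'f => 'f" where "ha \<alpha> \<beta> x = x * (\<alpha> * x - \<beta>) / (x\<^sup>2 - 1)"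

lemma hg_swap: "x ~= y ==> hg c y x = c - hg c x y" by (simp add: hg_def divide_simps) (simp add: algebra_simps)

lemma hg_inverse_swap: "x ~= 0 ==> y ~= 0 ==> hg c (inverse y) x = hg c (inverse x) y"
 by (cases "x * y = 1") (simp_all add: hg_def divide_simps, simp_all add: algebra_simps)

lemma hg_inverse:
 assumes "x ~= 0" "y ~= 0"
 shows "x ~= y ==> hg c (inverse x) (inverse y) = c - hg c x y"
  and "x * y ~= 1 ==> hg c x (inverse y) = c - hg c (inverse x) y"
 using assms by (simp_all add: hg_def divide_simps) (simp_all add: algebra_simps)

lemma ha_inverse:
 assumes "x ~= 0" "x\<^sup>2 ~= 1"
 shows "ha \<alpha> \<beta> (inverse x) = \<alpha> - ha \<alpha> \<beta> x"
proof -
 have "1 - x\<^sup>2 ~= 0" "x\<^sup>2 - 1 ~= 0" using assms by auto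
 moreover have "ha \<alpha> \<beta> (inverse x) = (\<alpha> - \<beta> * x) / (1 - x\<^sup>2)"
 proof -
  have num: "inverse x * (\<alpha> * inverse x - \<beta>) = (\<alpha> - \<beta> * x) / x\<^sup>2" and den: "(inverse x)\<^sup>2 - 1 = (1 - x\<^sup>2) / x\<^sup>2"
   using assms(1) by (simp_all add: field_simps power2_eq_square)
  show ?thesis unfolding ha_def num den using assms(1) by simp
 qed
 ultimately show ?thesis using assms(1) unfolding ha_def by (simp add: divide_simps) (simp add: algebra_simps power2_eq_square)
qed

lemma hg_three:
 assumes "x ~= y" "y ~= z" "x ~= z"
 shows "hg c x y * hg c y z + c * hg c x z = hg c x z * (hg c x y + hg c y z)"
proof -
 have "y - x ~= 0" "z - y ~= 0" "z - x ~= 0" using assms by auto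
 then show ?thesis unfolding hg_def by (simp add: divide_simps) (simp add: algebra_simps)
qed

lemma hg_ha:
 fixes x y c \<alpha> \<beta> :: "'f::field"
 assumes "x ~= 0" "y ~= 0" "x ~= y" "x * y ~= 1" "x\<^sup>2 ~= 1" "y\<^sup>2 ~= 1"
 defines "g \<equiv> hg c x y" and "h \<equiv> hg c (inverse x) y" and "a1 \<equiv> ha \<alpha> \<beta> x" and "a2 \<equiv> ha \<alpha> \<beta> y"
 shows "a1 * g + h * \<alpha> + a2 * c = h * a1 + a2 * h + g * a2"
proof -
 have d: "y - x ~= 0" "x * y - 1 ~= 0" "x\<^sup>2 - 1 ~= 0" "y\<^sup>2 - 1 ~= 0" using assms by auto
 have "y - inverse x = (x * y - 1) / x" using assms(1) by (simp add: field_simps)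
 then have h: "h = c * (x * y) / (x * y - 1)" by (simp add: h_def hg_def)
 show ?thesis using d
  unfolding h g_def hg_def a1_def a2_def ha_def by (simp add: divide_simps) (simp add: algebra_simps power2_eq_square)
qed

text \<open>Both sides are threefold products expanded on the six images of a function. Their
  difference is the assumed relation between the \<open>g\<close> times a linear factor in
  \<open>w\<close>, \<open>w1\<close> and \<open>w2\<close>.\<close>

lemma hecke_braid_identity:
 fixes g12 g23 g13 c q :: "'f::field"
 assumes "g12 * g23 + c * g13 = g13 * (g12 + g23)"
 defines "f12 \<equiv> q - g12" and "f23 \<equiv> q - g23" and "f13 \<equiv> q - g13"
 shows "g12 * (g23 * (g12 * w + f12 * w1) + f23 * (g13 * w2 + f13 * w21)) +
   f12 * (g13 * ((c - g12) * w1 + (q - (c - g12)) * w) + f13 * (g23 * w12 + f23 * w121)) =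
  g23 * (g12 * (g23 * w + f23 * w2) + f12 * (g13 * w1 + f13 * w12)) +
   f23 * (g13 * ((c - g23) * w2 + (q - (c - g23)) * w) + f13 * (g12 * w21 + f12 * w121))" (is "?L = ?R")
proof -
 have "?L - ?R = ((g12 - g23) * w + f12 * w1 - f23 * w2) * (g12 * g23 + c * g13 - g13 * (g12 + g23))"
  unfolding assms(2-) by (simp add: algebra_simps)
 then show ?thesis using assms(1) by simp
qed

text \<open>The eight images of a function occur as indeterminates, and primes mark the coefficients
  at reflected arguments. The difference of both sides is a multiple of the assumed
  relation.\<close>

lemma hecke_four_identity:
 fixes g h a1 a2 c \<alpha> q p :: "'f::field"
 assumes "a1 * g + h * \<alpha> + a2 * c = h * a1 + a2 * h + g * a2"
 defines "f \<equiv> q - g" and "H \<equiv> q - h" and "e1 \<equiv> p - a1" and "e2 \<equiv> p - a2"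
  and "g' \<equiv> c - g" and "h' \<equiv> c - h" and "a1' \<equiv> \<alpha> - a1" and "a2' \<equiv> \<alpha> - a2"
 defines "f' \<equiv> q - g'" and "H' \<equiv> q - h'" and "e1' \<equiv> p - a1'" and "e2' \<equiv> p - a2'"
 shows "a1 * (g * (a1 * (g * w + f * w1) + e1 * (h * w0 + H * w01)) + f * (a2 * (g' * w1 + f' * w) + e2 * (h * w10 + H * w101))) +
   e1 * (h * (a1' * (h * w0 + H * w01) + e1' * (g * w + f * w1)) + H * (a2 * (h' * w01 + H' * w0) + e2 * (g * w010 + f * v))) =
  g * (a1 * (g * (a1 * w + e1 * w0) + f * (a2 * w1 + e2 * w10)) + e1 * (h * (a1' * w0 + e1' * w) + H * (a2 * w01 + e2 * w010))) +
   f * (a2 * (g' * (a2 * w1 + e2 * w10) + f' * (a1 * w + e1 * w0)) + e2 * (h * (a2' * w10 + e2' * w1) + H * (a1 * w101 + e1 * v)))"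
  (is "?L = ?R")
proof -
 have "?L - ?R = (a1 * g + h * \<alpha> + a2 * c - (h * a1 + a2 * h + g * a2)) *
   (e1 * H * w01 - f * e2 * w10 + e1 * (h - g) * w0 + f * (a1 - a2) * w1)" unfolding assms(2-) by (simp add: algebra_simps)
 then show ?thesis using assms(1) by simp
qed

context hecke_rep
begin

abbreviation "\<rho> \<equiv> hecke_gen_act q p0 p1"
abbreviation "T k \<equiv> \<rho> (HT k)"

definition cq :: "'k mps fract" where "cq = fconst (q - inverse q)"

definition ca :: "'k mps fract" where "ca = fconst (p0 - inverse p1)"

definition cb :: "'k mps fract" where "cb = fconst (p0 * inverse p1 - 1)"

definition hq :: "nat => 'k mps fract" where "hq k = (if k = 0 then fconst p0 else fconst q)"

definition hc :: "nat => 'k mps fract" where "hc k = (if k = 0 then ca else cq)"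

definition Ah :: "nat => ('k, 'k) svec" where
 "Ah k mu = (if k = 0 then ha ca cb (hXat mu 1) else hg cq (hXat mu k) (hXat mu (Suc k)))"

definition Bh :: "nat => ('k, 'k) svec" where
 "Bh k mu = hq k - Ah k mu"

lemma hX_sq_neq_1: "(hXat mu k)\<^sup>2 ~= (1 :: 'k mps fract)" using hX_mult_neq_1[of mu k mu k] by (simp add: power2_eq_square)

lemma Bh_eq:
 "Bh 0 mu = fconst (inverse p1) * ((hXat mu 1 + fconst p0) * (hXat mu 1 - fconst p1)) / (hXat mu 1 ^ 2 - 1)" (is ?g1)
 "k ~= 0 ==> Bh k mu = (fconst q * hXat mu k - fconst (inverse q) * hXat mu (Suc k)) / (hXat mu k - hXat mu (Suc k))"
proof -
 note fc = fhom_simps[OF fconst_fhom]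
 have p': "fconst p1 * fconst (inverse p1) = (1 :: 'k mps fract)" using p1_nz by (simp add: fc(2)[symmetric] fc(3))
 then have p: "fconst p1 * (fconst (inverse p1) * z) = z" for z :: "'k mps fract" by (simp)
 have d: "hXat mu 1 ^ 2 - 1 ~= 0" using hX_sq_neq_1 by simp
 have "Bh 0 mu * (hXat mu 1 ^ 2 - 1) = fconst p0 * (hXat mu 1 ^ 2 - 1) - hXat mu 1 * (ca * hXat mu 1 - cb)"
  using d by (simp add: Bh_def hq_def Ah_def ha_def left_diff_distrib)
 also have "... = fconst (inverse p1) * ((hXat mu 1 + fconst p0) * (hXat mu 1 - fconst p1))"
  unfolding ca_def cb_def fc(2,3,6) by (simp add: algebra_simps power2_eq_square p')
 finally show ?g1 using d by (metis nonzero_eq_divide_eq)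
 assume k: "k ~= 0"
 have d: "hXat mu k - hXat mu (Suc k) ~= 0" "hXat mu (Suc k) - hXat mu k ~= 0" using hX_neq[of k "Suc k" mu] by auto
 have "hg cq (hXat mu k) (hXat mu (Suc k)) = - (cq * hXat mu (Suc k) / (hXat mu k - hXat mu (Suc k)))"
  unfolding hg_def by (metis minus_diff_eq minus_divide_right)
 then have "Bh k mu * (hXat mu k - hXat mu (Suc k)) = fconst q * (hXat mu k - hXat mu (Suc k)) + cq * hXat mu (Suc k)"
  using d k by (simp add: Bh_def hq_def Ah_def distrib_right)
 also have "... = fconst q * hXat mu k - fconst (inverse q) * hXat mu (Suc k)"
  unfolding cq_def fc(6) by (simp add: algebra_simps)
 finally show "Bh k mu = (fconst q * hXat mu k - fconst (inverse q) * hXat mu (Suc k)) / (hXat mu k - hXat mu (Suc k))"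
  using d by (metis nonzero_eq_divide_eq)
qed

lemma Bh_nz: "Bh k mu ~= 0"
proof (cases "k = 0")
 case True
 have "hXat mu 1 + fconst p0 ~= 0" using hX_neq_const[of mu 1 "- p0"] by (simp add: fhom_minus[OF fconst_fhom] add_eq_0_iff2)
 then show ?thesis using True hX_neq_const[of mu 1 p1] hX_sq_neq_1[of mu 1] p1_nz by (simp add: Bh_eq fconst_eq_0_iff)
next
 case False
 then show ?thesis using hX_lin_nz[of k "Suc k" q mu "inverse q"] hX_neq[of k "Suc k" mu] q_nz by (simp add: Bh_eq)
qed

lemma T_at: "T k F mu = Ah k mu * F mu + Bh k mu * rh mu k (F (sw k mu))"
proof (cases "k = 0")
 case True
 have "T k F mu = fconst p0 * F mu + Bh 0 mu * (rh mu 0 (F (sw 0 mu)) - F mu)"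
  by (simp add: hecke_gen_act.simps(3) True Bh_eq hecke_refl_vec_def rh_def Let_def)
 then show ?thesis by (simp add: True Bh_def hq_def algebra_simps)
next
 case False
 have "T k F mu = fconst q * F mu + Bh k mu * (rh mu k (F (sw k mu)) - F mu)"
  using False by (simp add: hecke_gen_act.simps(3) Bh_eq hecke_refl_vec_def rh_def Let_def)
 then show ?thesis using False by (simp add: Bh_def hq_def algebra_simps)
qed

lemma rh_coef:
 assumes "k < n" "mu \<in> V"
 shows "rh mu k (hg (fconst c) u v) = hg (fconst c) (rh mu k u) (rh mu k v)"
  "rh mu k (ha (fconst c) (fconst c') u) = ha (fconst c) (fconst c') (rh mu k u)"
 using assms by (simp_all add: hg_def ha_def fhom_simps[OF rh_fhom] rh_fconst)

text \<open>\<open>Ah\<close> and its reflection add up to \<open>hc k\<close>, the coefficient of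
  the linear term in the quadratic relation; \<open>T_sq\<close> rests on this.\<close>

lemma rh_Ah: "k < n ==> mu \<in> V ==> rh mu k (Ah k (sw k mu)) = hc k - Ah k mu"
proof (cases "k = 0")
 case True
 assume "k < n" "mu \<in> V"
 with True show ?thesis by (simp add: Ah_def hc_def ca_def cb_def rh_coef rh_hX ha_inverse hX_nz hX_sq_neq_1)
next
 case False
 assume "k < n" "mu \<in> V"
 with False show ?thesis using hg_swap[of "hXat mu k" "hXat mu (Suc k)" cq]
  by (simp add: Ah_def hc_def cq_def rh_coef rh_hX hX_neq)
qed

lemma rh_hq: "k < n ==> mu \<in> V ==> rh mu k (hq j) = hq j" by (simp add: hq_def rh_fconst)

text \<open>The constant term of the quadratic relation, whose roots are \<open>q\<close> and
  \<open>- 1 / q\<close>, or \<open>p0\<close> and \<open>- 1 / p1\<close> for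
  \<open>k = 0\<close>.\<close>

lemma hq_hc: "hq k * (hq k - hc k) = (if k = 0 then fconst (p0 * inverse p1) else 1)"
proof -
 have "hq k * (hq k - hc k) = fconst (if k = 0 then p0 * inverse p1 else q * inverse q)"
  by (simp add: hq_def hc_def ca_def cq_def fhom_simps(6,2)[OF fconst_fhom, symmetric])
 then show ?thesis using q_nz by (simp add: fconst_simps)
qed

lemma T_sq:
 assumes k: "k < n" and mu: "mu \<in> V"
 shows "T k (T k F) mu = hc k * T k F mu + (if k = 0 then fconst (p0 * inverse p1) else 1) * F mu"
proof -
 have "T k (T k F) mu = hc k * T k F mu + hq k * (hq k - hc k) * F mu"
  using k mu by (simp add: T_at Bh_def fhom_simps[OF rh_fhom] rh_Ah rh_hq sr.r_sq sw_sq algebra_simps)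
 then show ?thesis by (simp only: hq_hc)
qed

lemma T_braid:
 assumes k: "1 \<le> k" "Suc k < n" and mu: "mu \<in> V"
 shows "T k (T (Suc k) (T k F)) mu = T (Suc k) (T k (T (Suc k) F)) mu"
proof -
 have kn: "k < n" "k ~= 0" "k ~= Suc k" "Suc k ~= k" "Suc (Suc k) ~= k" "k ~= Suc (Suc k)" "Suc (Suc k) ~= Suc k" "Suc k ~= Suc (Suc k)" "Suc k ~= 0"
  using k by auto
 define x y z where "x = hXat mu k" and "y = hXat mu (Suc k)" and "z = hXat mu (Suc (Suc k))"
 have d: "x ~= y" "y ~= z" "x ~= z" by (simp_all add: x_def y_def z_def hX_neq)
 have V: "sw k nu \<in> V" "sw (Suc k) nu \<in> V" if "nu \<in> V" for nu using that swapV k by auto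
 note r = rh_hX[OF kn(1) _ refl] rh_hX[OF k(2) _ refl]
 note at = T_at[of k, unfolded Bh_def hq_def Ah_def if_not_P[OF kn(2)]] T_at[of "Suc k", unfolded Bh_def hq_def Ah_def if_not_P[OF kn(9)]]
 have g: "hg cq y x = cq - hg cq x y" "hg cq z y = cq - hg cq y z" by (rule hg_swap[OF d(1)], rule hg_swap[OF d(2)])
 note rules = at fhom_simps[OF rh_fhom[OF kn(1)]] fhom_simps[OF rh_fhom[OF k(2)]] rh_fconst[OF kn(1)] rh_fconst[OF k(2)]
  rh_coef(1)[OF kn(1)] rh_coef(1)[OF k(2)] r sr.r_sq[OF kn(1)] sr.r_sq[OF k(2)] sw_sq V mu kn if_True if_False refl
  sw_braid[OF k(1)] sr.r_braid[OF k] cq_def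
 show ?thesis unfolding cq_def[symmetric]
  apply (simp only: rules)
  apply (simp only: cq_def[symmetric] x_def[symmetric] y_def[symmetric] z_def[symmetric] g)
  apply (rule hecke_braid_identity[OF hg_three[OF d]])
  done
qed

lemma T_four:
 assumes n: "2 \<le> n" and mu: "mu \<in> V"
 shows "T 0 (T 1 (T 0 (T 1 F))) mu = T 1 (T 0 (T 1 (T 0 F))) mu"
proof -
 have kn: "0 < n" "Suc 0 < n" "Suc 0 ~= 0" "Suc (Suc 0) ~= 0" "Suc (Suc 0) ~= Suc 0" "Suc 0 ~= Suc (Suc 0)" using n by auto
 define x y where "x = hXat mu (Suc 0)" and "y = hXat mu (Suc (Suc 0))"
 have d: "x ~= 0" "y ~= 0" "x ~= y" "x * y ~= 1" "x\<^sup>2 ~= 1" "y\<^sup>2 ~= 1"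
  by (simp_all add: x_def y_def hX_neq hX_nz hX_mult_neq_1 hX_sq_neq_1)
 have V: "sw 0 nu \<in> V" "sw (Suc 0) nu \<in> V" if "nu \<in> V" for nu using that swapV kn by auto
 note r = rh_hX[OF kn(1) _ refl] rh_hX[OF kn(2) _ refl]
 note at = T_at[of 0, unfolded Bh_def hq_def Ah_def if_P[OF refl] One_nat_def]
  T_at[of "Suc 0", unfolded Bh_def hq_def Ah_def if_not_P[OF kn(3)]]
 have g: "hg cq y x = cq - hg cq x y" "hg cq (inverse y) x = hg cq (inverse x) y"
  "hg cq (inverse x) (inverse y) = cq - hg cq x y" "hg cq (inverse y) (inverse x) = hg cq x y"
  "hg cq x (inverse y) = cq - hg cq (inverse x) y" "hg cq y (inverse x) = cq - hg cq (inverse x) y"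
  "ha ca cb (inverse x) = ca - ha ca cb x" "ha ca cb (inverse y) = ca - ha ca cb y"
  using hg_inverse[OF d(1,2), of cq] hg_inverse[OF d(2,1), of cq] d hg_swap[OF d(3), of cq]
   hg_inverse_swap[OF d(1,2), of cq] ha_inverse[OF d(1,5), of ca cb] ha_inverse[OF d(2,6), of ca cb]
  by (auto simp: mult.commute[of y x])
 note rules = at fhom_simps[OF rh_fhom[OF kn(1)]] fhom_simps[OF rh_fhom[OF kn(2)]] rh_fconst[OF kn(1)] rh_fconst[OF kn(2)]
  rh_coef[OF kn(1)] rh_coef[OF kn(2)] r sr.r_sq[OF kn(1)] sr.r_sq[OF kn(2)] sw_sq V mu kn if_True if_False refl
  sw_four[symmetric] sr.r_four[OF n, unfolded One_nat_def] cq_def ca_def cb_def inverse_inverse_eq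
 show ?thesis unfolding One_nat_def
  apply (simp only: rules)
  apply (simp only: cq_def[symmetric] ca_def[symmetric] cb_def[symmetric] x_def[symmetric] y_def[symmetric] g)
  apply (rule hecke_four_identity[OF hg_ha[OF d]])
  done
qed

lemma T_comm:
 assumes k: "k < n" "k' < n" "k + 1 < k'" and mu: "mu \<in> V"
 shows "T k (T k' F) mu = T k' (T k F) mu"
proof -
 have a: "rh mu k (Ah k' (sw k mu)) = Ah k' mu" using k mu by (cases "k = 0") (auto simp: Ah_def cq_def rh_coef rh_hX)
 have a': "rh mu k' (Ah k (sw k' mu)) = Ah k mu"
  using k mu by (cases "k = 0") (auto simp: Ah_def cq_def ca_def cb_def rh_coef rh_hX)
 have s: "sw k' (sw k mu) = sw k (sw k' mu)" using k by (intro sw_comm) simp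
 have r: "rh mu k' (rh (sw k' mu) k z) = rh mu k (rh (sw k mu) k' z)" for z using k mu by (intro sr.r_comm) auto
 show ?thesis unfolding T_at[of k] T_at[of k'] Bh_def fhom_simps[OF rh_fhom[OF k(1) mu]] fhom_simps[OF rh_fhom[OF k(2) mu]]
   rh_hq[OF k(1) mu] rh_hq[OF k(2) mu] a a' s r by (simp add: algebra_simps)
qed

text \<open>The reflected part of the composite has coefficient containing the factor
  \<open>A * x + y * (cq - A)\<close>, which is zero by the defining equation of
  \<open>A\<close>.\<close>

lemma T_X_T:
 assumes k: "1 \<le> k" "k < n" and mu: "mu \<in> V"
 shows "T k (\<lambda>mu. hXat mu k * T k F mu) mu = hXat mu (k + 1) * F mu"
proof -
 define A x y where "A = Ah k mu" and "x = hXat mu k" and "y = hXat mu (Suc k)"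
 have k0: "k ~= 0" using k by simp
 have d: "y - x ~= 0" using hX_neq[of "Suc k" k mu] by (simp add: x_def y_def)
 have h: "hq k = fconst q" "hc k = cq" using k by (simp_all add: hq_def hc_def)
 have qc: "fconst q * (fconst q - cq) = 1" using hq_hc[of k] h k0 by simp
 have A: "A * (y - x) = cq * y" using d k0 by (simp add: A_def Ah_def hg_def x_def y_def)
 have "T k (\<lambda>mu. hXat mu k * T k F mu) mu = (A * x * A + (fconst q - A) * y * (fconst q - (cq - A))) * F mu +
   (fconst q - A) * (A * x + y * (cq - A)) * rh mu k (F (sw k mu))"
  using k mu by (simp add: T_at Bh_def fhom_simps[OF rh_fhom] rh_Ah sr.r_sq sw_sq h rh_hX rh_fconst A_def[symmetric] x_def[symmetric] y_def[symmetric] algebra_simps)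
 also have "A * x + y * (cq - A) = 0" using A by (simp add: algebra_simps)
 also have "A * x * A + (fconst q - A) * y * (fconst q - (cq - A)) =
   y * (fconst q * (fconst q - cq)) - A * (A * (y - x) - cq * y)" by (simp add: algebra_simps)
 finally show ?thesis unfolding qc A by (simp add: y_def)
qed

text \<open>Unlike in \<open>T_X_T\<close> the reflected part survives: the corresponding factor is
  \<open>cb\<close>, which accounts for the extra multiple of \<open>T 0\<close> in the
  relation.\<close>

lemma T_Xinv_T:
 assumes n: "0 < n" and mu: "mu \<in> V"
 shows "T 0 (\<lambda>mu. inverse (hXat mu 1) * T 0 F mu) mu =
  fconst (p0 * inverse p1) * (hXat mu 1 * F mu) + fconst (p0 * inverse p1 - 1) * T 0 F mu"
proof -
 define A x where "A = Ah 0 mu" and "x = hXat mu (Suc 0)"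
 have x: "x ~= 0" "x\<^sup>2 - 1 ~= 0" by (simp_all add: x_def hX_nz hX_sq_neq_1)
 have h: "hq 0 = fconst p0" "hc 0 = ca" by (simp_all add: hq_def hc_def)
 have qc: "fconst p0 * (fconst p0 - ca) = fconst (p0 * inverse p1)" using hq_hc[of 0] h by simp
 have A: "A * (x\<^sup>2 - 1) = x * (ca * x - cb)" using x by (simp add: A_def Ah_def ha_def x_def)
 have "x * (A * inverse x + x * (ca - A)) = A * (x * inverse x) + x\<^sup>2 * (ca - A)"
  by (simp only: algebra_simps power2_eq_square)
 also have "... = x\<^sup>2 * ca - A * (x\<^sup>2 - 1)" using x(1) by (simp add: algebra_simps)
 also have "... = x * cb" unfolding A by (simp add: algebra_simps power2_eq_square)
 finally have b: "A * inverse x + x * (ca - A) = cb" using x(1) by simp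
 have "T 0 (\<lambda>mu. inverse (hXat mu 1) * T 0 F mu) mu =
   (A * inverse x * A + (fconst p0 - A) * x * (fconst p0 - (ca - A))) * F mu +
   (fconst p0 - A) * (A * inverse x + x * (ca - A)) * rh mu 0 (F (sw 0 mu))"
  using n mu by (simp add: T_at Bh_def fhom_simps[OF rh_fhom] rh_Ah sr.r_sq sw_sq h rh_hX rh_fconst A_def[symmetric] x_def[symmetric] algebra_simps)
 also have "A * inverse x * A + (fconst p0 - A) * x * (fconst p0 - (ca - A)) =
   x * (fconst p0 * (fconst p0 - ca)) + A * (A * inverse x + x * (ca - A))" by (simp add: algebra_simps)
 finally show ?thesis unfolding b qc by (simp add: T_at[of 0] Bh_def h A_def x_def cb_def[symmetric] algebra_simps)
qed

lemma T_X:
 assumes "k < n" "l ~= k" "l ~= k + 1" "mu \<in> V"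
 shows "T k (\<lambda>mu. hXat mu l * F mu) mu = hXat mu l * T k F mu"
 using assms by (auto simp add: T_at fhom_simps[OF rh_fhom] rh_hX algebra_simps)

end

text \<open>Outside \<open>V\<close> a reflection need not be a homomorphism, but zero must still go
  to zero for the Hecke operators to preserve supports.\<close>

lemma fract_map_zero: "h 0 = 0 ==> fract_map h 0 = 0"
proof -
 assume h: "h 0 = 0"
 define ab :: "'a \<times> 'a" where "ab = (SOME (a, b). b ~= 0 \<and> 0 = Fract a b)"
 have "(case (0 :: 'a, 1 :: 'a) of (a, b) => b ~= 0 \<and> 0 = Fract a b)" by (simp add: Zero_fract_def)
 then have "case ab of (a, b) => b ~= 0 \<and> 0 = Fract a b" unfolding ab_def by (rule someI)
 then have "fst ab = 0" by (auto simp: Zero_fract_def eq_fract)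
 then show ?thesis unfolding fract_map_def ab_def[symmetric] by (simp add: h case_prod_unfold) (metis eq_fract(3) Zero_fract_def)
qed

lemma (in presented_algebra) inverse_commutes:
 assumes "a \<in> fcar G" "b \<in> fcar G" "b' \<in> fcar G" "a * b - b * a \<in> I" "b * b' - 1 \<in> I" "b' * b - 1 \<in> I"
 shows "a * b' - b' * a \<in> I"
proof -
 have "(b' * b - 1) * (a * b') \<in> I" "b' * ((a * b - b * a) * b') \<in> I" "(b' * a) * (b * b' - 1) \<in> I"
  by (rule I_rmult I_lmult; (rule assms I_rmult fcar_closed)+)+
 then have "(b' * a) * (b * b' - 1) - (b' * b - 1) * (a * b') - b' * ((a * b - b * a) * b') \<in> I" by (intro I_diff)
 then show ?thesis by (simp add: algebra_simps)
qed

section \<open>Relations and spanning for the affine Hecke algebra\<close>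

context hecke_rep
begin

abbreviation "gens \<equiv> hecke_gens n"
abbreviation "rels \<equiv> hecke_rels q p0 p1 n"

lemma T_zero: "mu \<notin> V ==> k < n ==> F \<in> supp V ==> T k F mu = 0"
proof -
 assume "mu \<notin> V" "k < n" "F \<in> supp V"
 then have "F mu = 0" "F (sw k mu) = 0" by (simp_all add: supp_def sw_V_iff)
 then show ?thesis by (simp add: T_at rh_def hecke_refl_def fract_map_zero)
qed

sublocale fa: free_action gens V "fconst :: 'k => 'k mps fract" \<rho>
proof
 show "fhom (fconst :: 'k => 'k mps fract)" by (rule fconst_fhom)
 fix g and F F' :: "('k, 'k) svec" assume g: "g \<in> gens" and F: "F \<in> supp V" and F': "F' \<in> supp V"
 have s: "(\<lambda>mu. F mu + F' mu) \<in> supp V" "(\<lambda>mu. fconst c * F mu) \<in> supp V" for c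
  using F F' by (auto intro: supp_closed)
 have T: "T k (\<lambda>mu. F mu + F' mu) = (\<lambda>mu. T k F mu + T k F' mu)" "T k (\<lambda>mu. fconst c * F mu) = (\<lambda>mu. fconst c * T k F mu)"
  "T k F \<in> supp V" if k: "k < n" for k c
 proof -
  have "T k (\<lambda>mu. F mu + F' mu) mu = T k F mu + T k F' mu \<and> T k (\<lambda>mu. fconst c * F mu) mu = fconst c * T k F mu" for mu
  proof (cases "mu \<in> V")
   case True
   then show ?thesis using k by (simp add: T_at fhom_simps[OF rh_fhom] rh_fconst algebra_simps)
  qed (simp add: T_zero k F F' s)
  then show "T k (\<lambda>mu. F mu + F' mu) = (\<lambda>mu. T k F mu + T k F' mu)" "T k (\<lambda>mu. fconst c * F mu) = (\<lambda>mu. fconst c * T k F mu)"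
   by (auto)
  show "T k F \<in> supp V" using k F by (simp add: supportedI T_zero)
 qed
 show "\<rho> g F \<in> supp V" using g F T(3) by (cases g) (auto simp: hecke_gens_def supp_def)
 show "\<rho> g (\<lambda>mu. F mu + F' mu) = (\<lambda>mu. \<rho> g F mu + \<rho> g F' mu)"
  using g T(1) by (cases g) (auto simp: hecke_gens_def fun_eq_iff distrib_left)
 show "\<rho> g (\<lambda>mu. fconst c * F mu) = (\<lambda>mu. fconst c * \<rho> g F mu)" for c
  using g T(2) by (cases g) (auto simp: hecke_gens_def fun_eq_iff mult.left_commute)
qed

lemma gens_closed:
 "l \<in> {1..n} ==> hX l \<in> fcar gens" "l \<in> {1..n} ==> hXinv l \<in> fcar gens" "k < n ==> hT k \<in> fcar gens"
 by (auto intro!: fcar_closed(4) simp: hecke_gens_def)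

lemma hecke_rels_carrier: "rels \<subseteq> fcar gens"
proof
 fix r assume "r \<in> rels"
 then show "r \<in> fcar gens" by cases (auto intro!: fcar_closed(2,3,5,7,8) fcar_power gens_closed simp del: One_nat_def)
qed

lemma act_hecke_rels: "r \<in> rels ==> F \<in> supp V ==> fa.act r F = (\<lambda>_. 0)"
proof (rule sr.fun_V_eqI)
 assume r: "r \<in> rels" and F: "F \<in> supp V"
 show "fa.act r F \<in> supp V" using r F hecke_rels_carrier by (intro fa.act_supp) auto
 show "(\<lambda>_. 0) \<in> supp V" by (rule supp_closed)
 fix mu assume mu: "mu \<in> V"
 have TF: "T k G \<in> supp V" if "k < n" "G \<in> supp V" for k G using that by (simp add: supportedI T_zero)
 note act = fa.act_diff fa.act_add fa.act_mult fa.act_gen fa.act_one fa.act_scal fcar_closed gens_closed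
  hecke_gen_act.simps(1,2) F TF supp_closed(3)
 from r show "fa.act r F mu = 0"
 proof cases
  case (1 k)
  then have k: "k < n" "k ~= 0" by auto
  have "(hT k - scal q) * (hT k + scal (inverse q)) = hT k * hT k - scal (q - inverse q) * hT k - 1"
   using q_nz by (simp add: algebra_simps scal_comm[of _ "hT k"] scal_simps(4)[symmetric] scal_simps)
  with 1 k show ?thesis using T_sq[OF k(1) mu, of F] by (simp add: act hc_def cq_def)
 next
  case 2
  have "(hT 0 - scal p0) * (hT 0 + scal (inverse p1)) = hT 0 * hT 0 - scal (p0 - inverse p1) * hT 0 - scal (p0 * inverse p1)"
   by (simp add: algebra_simps scal_comm[of _ "hT 0"] scal_simps)
  with 2 show ?thesis using T_sq[OF 2(2) mu, of F] by (simp add: act hc_def ca_def)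
 next
  case (3 k)
  then show ?thesis using T_braid[OF _ _ mu, of k F] by (simp add: act)
 next
  case 4
  then have "0 < n" "Suc 0 < n" by auto
  with 4 show ?thesis using T_four[OF 4(2) mu, of F] by (simp add: act power2_eq_square)
 next
  case (5 k k')
  then show ?thesis using T_comm[OF 5(2,3) _ mu, of F] T_comm[OF 5(3,2) _ mu, of F] by (auto simp add: act)
 next
  case (6 l l')
  then show ?thesis by (simp add: act)
 next
  case (7 l)
  then show ?thesis by (simp add: act hX_nz)
 next
  case (8 l)
  then show ?thesis by (simp add: act hX_nz)
 next
  case (9 k)
  then show ?thesis using T_X_T[OF 9(2,3) mu, of F] by (simp add: act)
 next
  case 10
  then show ?thesis using T_Xinv_T[OF 10(2) mu, of F] by (simp add: act)
 next
  case (11 k l)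
  then show ?thesis using T_X[OF 11(2) _ _ mu, of l F] by (simp add: act)
 qed
qed

sublocale pa: presented_action gens rels V "fconst :: 'k => 'k mps fract" \<rho>
 by unfold_locales (fact hecke_rels_carrier act_hecke_rels)+

abbreviation "Gq \<equiv> HX ` {1..n} \<union> HXinv ` {1..n}"

lemma Gq_closed: "l \<in> {1..n} ==> hX l \<in> fcar Gq" "l \<in> {1..n} ==> hXinv l \<in> fcar Gq"
 by (auto intro!: fcar_closed(4))

lemma quadratic_I:
 assumes "k < n"
 shows "hT k * hT k - scal (if k = 0 then p0 - inverse p1 else q - inverse q) * hT k -
  scal (if k = 0 then p0 * inverse p1 else 1) \<in> pa.I"
proof (cases "k = 0")
 case True
 have "(hT 0 - scal p0) * (hT 0 + scal (inverse p1)) \<in> pa.I" using assms True by (intro pa.I_rel hecke_rels.intros) simp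
 moreover have "(hT 0 - scal p0) * (hT 0 + scal (inverse p1)) = hT 0 * hT 0 - scal (p0 - inverse p1) * hT 0 - scal (p0 * inverse p1)"
  by (simp add: algebra_simps scal_comm[of _ "hT 0"] scal_simps)
 ultimately show ?thesis using True by simp
next
 case False
 have "(hT k - scal q) * (hT k + scal (inverse q)) \<in> pa.I" using assms False by (intro pa.I_rel hecke_rels.intros) simp_all
 moreover have "(hT k - scal q) * (hT k + scal (inverse q)) = hT k * hT k - scal (q - inverse q) * hT k - scal 1"
  using q_nz by (simp add: algebra_simps scal_comm[of _ "hT k"] scal_simps(4)[symmetric] scal_simps)
 ultimately show ?thesis using False by simp
qed

text \<open>The rule \<open>hX l * t = t * hX l' + z\<close> is multiplied by \<open>hXinv l\<close>
  on the left and by \<open>hXinv l'\<close> on the right.\<close>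

lemma past_inverse:
 assumes l: "l \<in> {1..n}" "l' \<in> {1..n}" "t \<in> fcar gens" "z \<in> fcar gens" "hX l * t - t * hX l' - z \<in> pa.I"
 shows "hXinv l * t - t * hXinv l' + hXinv l * z * hXinv l' \<in> pa.I"
proof -
 have i: "hX l' * hXinv l' - 1 \<in> pa.I" "hXinv l * hX l - 1 \<in> pa.I"
  using l by (auto intro!: pa.I_rel hecke_rels.intros simp del: One_nat_def)
 have c: "hXinv l * t \<in> fcar gens" "t * hXinv l' \<in> fcar gens" "hXinv l \<in> fcar gens" "hXinv l' \<in> fcar gens"
  using l by (auto intro!: fcar_closed(8) gens_closed simp del: One_nat_def)
 have "(hXinv l * hX l - 1) * (t * hXinv l') - (hXinv l * t) * (hX l' * hXinv l' - 1) - hXinv l * (hX l * t - t * hX l' - z) * hXinv l' \<in> pa.I"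
  by (rule pa.I_diff[OF pa.I_diff[OF pa.I_rmult[OF c(2) i(2)] pa.I_lmult[OF c(1) i(1)]] pa.I_rmult[OF c(4) pa.I_lmult[OF c(3) l(5)]]])
 then show ?thesis by (simp add: algebra_simps)
qed

end

text \<open>The word that \<open>hecke_of_laurent\<close> attaches to an exponent; for a given index
  at most one of \<open>HX\<close> and \<open>HXinv\<close> occurs.\<close>

definition hmon :: "(nat \<Rightarrow>\<^sub>0 int) => hecke_gen list" where
 "hmon m = concat (map (\<lambda>l. replicate (nat (lookup m l)) (HX l) @
  replicate (nat (- lookup m l)) (HXinv l)) (sorted_list_of_set (keys m)))"

definition hpol :: "((nat \<Rightarrow>\<^sub>0 int) \<Rightarrow>\<^sub>0 'k::field) => hecke_gen fword \<Rightarrow>\<^sub>0 'k" where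
 "hpol p = (\<Sum>m\<in>keys p. single (Word (hmon m)) (lookup p m))"

lemma hpol_superset:
 "finite K ==> keys p \<subseteq> K ==> hpol p = (\<Sum>m\<in>K. single (Word (hmon m)) (lookup p m))"
 unfolding hpol_def by (rule sum.mono_neutral_left) (auto simp: in_keys_iff)

lemma hpol_add: "hpol (p + q) = hpol p + hpol q"
proof -
 let ?K = "keys p \<union> keys q"
 have "keys (p + q) \<subseteq> ?K" by (rule keys_add)
 then show ?thesis by (simp add: hpol_superset[of ?K] lookup_add single_add sum.distrib)
qed

lemma hpol_zero: "hpol 0 = 0" by (simp add: hpol_def)

lemma hpol_sum: "hpol (sum f X) = (\<Sum>x\<in>X. hpol (f x))"
 by (induction X rule: infinite_finite_induct) (simp_all add: hpol_zero hpol_add)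

lemma hpol_single: "hpol (single m c) = scal c * wordp (hmon m)" by (subst hpol_superset[of "{m}"]) (simp_all add: single_eq_scal)

lemma hmon_zero: "hmon 0 = []" by (simp add: hmon_def)

lemma count_hmon:
 "count (mset (hmon m)) x = (case x of HX l => nat (lookup m l) | HXinv l => nat (- lookup m l) | HT _ => 0)"
proof -
 have cnt: "count (mset (concat (map F ls))) x = (\<Sum>l\<in>set ls. count (mset (F l)) x)" if "distinct ls"
  for ls and F :: "nat => hecke_gen list"
  using that by (induction ls) auto
 have "count (mset (hmon m)) x = (\<Sum>l\<in>keys m. (if HX l = x then nat (lookup m l) else 0) +
   (if HXinv l = x then nat (- lookup m l) else 0))" unfolding hmon_def by (subst cnt) (auto intro!: sum.cong)
 also have "... = (case x of HX l => nat (lookup m l) | HXinv l => nat (- lookup m l) | HT _ => 0)"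
  by (cases x) (auto simp: sum.distrib in_keys_iff)
 finally show ?thesis .
qed

text \<open>Multiplying by \<open>X\<^sub>l\<close> lengthens the word if the exponent of
  \<open>l\<close> is nonnegative and cancels an inverse if it is negative; hence two cases for each
  of the two generators.\<close>

lemma mset_hmon:
 "0 \<le> lookup m l ==> mset (HX l # hmon m) = mset (hmon (single l 1 + m))"
 "lookup m l < 0 ==> mset (hmon m) = mset (HXinv l # hmon (single l 1 + m))"
 "lookup m l \<le> 0 ==> mset (HXinv l # hmon m) = mset (hmon (single l (- 1) + m))"
 "0 < lookup m l ==> mset (hmon m) = mset (HX l # hmon (single l (- 1) + m))"
 by (rule multiset_eqI; unfold mset.simps count_add_mset count_hmon;
   auto simp: lookup_add lookup_single when_def split: hecke_gen.split)+

lemma hmon_set: "set (hmon m) \<subseteq> HX ` keys m \<union> HXinv ` keys m" by (fastforce simp: hmon_def)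

context hecke_rep
begin

lemma Gq_gens: "Gq \<subseteq> gens" by (auto simp: hecke_gens_def)

text \<open>The Bernstein relations, obtained from \<open>T x T = y\<close>, with \<open>y\<close>
  the next variable, and the quadratic relation. The case \<open>k = 0\<close>, \<open>l = 1\<close>
  is separate, since there the variable passes into its inverse.\<close>

lemma X_past_T:
 assumes k: "k < n" and l: "l \<in> {1..n}" and kl: "k = 0 ==> l ~= 1"
 shows "\<exists>l'\<in>{1..n}. \<exists>z\<in>fcar Gq. hX l * hT k - hT k * hX l' - z \<in> pa.I"
proof -
 define c :: "hecke_gen fword \<Rightarrow>\<^sub>0 'k" where "c = scal (q - inverse q)"
 have c: "c \<in> fcar Gq" "c \<in> fcar gens" "c * a = a * c" for a by (simp_all add: c_def fcar_closed scal_comm)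
 have c': "c * (a * b) = a * (c * b)" for a b by (metis mult.assoc c(3))
 define T :: "hecke_gen fword \<Rightarrow>\<^sub>0 'k" where "T = hT k"
 consider "l ~= k" "l ~= k + 1" | "l = k" "1 \<le> k" | "l = k + 1" "1 \<le> k"
  using kl l by (cases "k = 0"; cases "l = k"; cases "l = k + 1") auto
 then show ?thesis
 proof cases
  case 1
  have "hX l * hT k - hT k * hX l - 0 \<in> pa.I" using pa.I_sym[OF pa.I_rel[OF hecke_rels.intros(11)[OF k l 1]]] by simp
  then show ?thesis using l fcar_closed(1) by blast
 next
  case 2
  define x y :: "hecke_gen fword \<Rightarrow>\<^sub>0 'k" where "x = hX k" and "y = hX (k + 1)"
  have m: "T \<in> fcar gens" "x \<in> fcar gens" "y \<in> fcar gens" using k 2 by (auto simp: T_def x_def y_def intro!: gens_closed simp del: One_nat_def)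
  have Q: "T * T - c * T - 1 \<in> pa.I" using quadratic_I[OF k] 2 by (simp add: T_def c_def scal_simps)
  have r: "T * x * T - y \<in> pa.I" unfolding T_def x_def y_def using k 2 by (intro pa.I_rel hecke_rels.intros(9))
  have "T * (T * x * T - y) - (T * T - c * T - 1) * (x * T) - c * (T * x * T - y) \<in> pa.I"
   by (intro pa.I_diff[OF pa.I_diff[OF pa.I_lmult[OF m(1) r] pa.I_rmult[OF fcar_closed(8)[OF m(2,1)] Q]] pa.I_lmult[OF c(2) r]])
  \<comment> \<open>Multiplying \<open>T x T = y\<close> by \<open>T\<close> and replacing
    \<open>T T\<close> by \<open>c T + 1\<close> gives \<open>x T = T y - c y\<close>.\<close>
  moreover have "T * (T * x * T - y) - (T * T - c * T - 1) * (x * T) - c * (T * x * T - y) = x * T - T * y - (- (c * y))"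
   by (simp add: algebra_simps)
  ultimately have "hX l * hT k - hT k * hX (k + 1) - (- (c * y)) \<in> pa.I" using 2 by (simp only: T_def x_def y_def)
  moreover have "- (c * y) \<in> fcar Gq" using k c by (auto simp: y_def intro!: fcar_closed(6,8) Gq_closed simp del: One_nat_def)
  moreover have "k + 1 \<in> {1..n}" using k by simp
  ultimately show ?thesis by blast
 next
  case 3
  define x y :: "hecke_gen fword \<Rightarrow>\<^sub>0 'k" where "x = hX k" and "y = hX (k + 1)"
  have m: "T \<in> fcar gens" "x \<in> fcar gens" "y \<in> fcar gens" using k 3 by (auto simp: T_def x_def y_def intro!: gens_closed simp del: One_nat_def)
  have Q: "T * T - c * T - 1 \<in> pa.I" using quadratic_I[OF k] 3 by (simp add: T_def c_def scal_simps)
  have r: "T * x * T - y \<in> pa.I" unfolding T_def x_def y_def using k 3 by (intro pa.I_rel hecke_rels.intros(9))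
  have "(T * x) * (T * T - c * T - 1) + c * (T * x * T - y) - (T * x * T - y) * T \<in> pa.I"
   by (intro pa.I_diff[OF pa.I_add[OF pa.I_lmult[OF fcar_closed(8)[OF m(1,2)] Q] pa.I_lmult[OF c(2) r]] pa.I_rmult[OF m(1) r]])
  moreover have "(T * x) * (T * T - c * T - 1) + c * (T * x * T - y) - (T * x * T - y) * T = y * T - T * x - c * y"
   by (simp add: algebra_simps c')
  ultimately have "hX l * hT k - hT k * hX k - c * y \<in> pa.I" using 3 by (simp only: T_def x_def y_def)
  moreover have "c * y \<in> fcar Gq" using k c by (auto simp: y_def intro!: fcar_closed(6,8) Gq_closed simp del: One_nat_def)
  moreover have "k \<in> {1..n}" using k 3 by simp
  ultimately show ?thesis by blast
 qed
qed

text \<open>The first rule follows from the relation for \<open>hT 0 * hXinv 1 * hT 0\<close> by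
  multiplying with \<open>hT 0\<close>, applying the quadratic relation and cancelling the
  invertible scalar \<open>p0 / p1\<close>. Multiplying it by \<open>hX 1\<close> on the left and by
  \<open>hXinv 1\<close> on the right gives the second.\<close>

lemma X_past_T0:
 assumes n: "0 < n"
 defines "\<alpha> \<equiv> scal (p0 - inverse p1)" and "\<beta> \<equiv> scal (p0 * inverse p1 - 1)"
 shows "hXinv 1 * hT 0 - hT 0 * hX 1 - (\<beta> - \<alpha> * hX 1) \<in> pa.I" (is ?g1)
  "hX 1 * hT 0 - hT 0 * hXinv 1 - (\<alpha> * hX 1 - \<beta>) \<in> pa.I" (is ?g2)
proof -
 define \<gamma> \<gamma>' :: "hecke_gen fword \<Rightarrow>\<^sub>0 'k" where "\<gamma> = scal (p0 * inverse p1)" and "\<gamma>' = scal (inverse (p0 * inverse p1))"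
 define T x x' :: "hecke_gen fword \<Rightarrow>\<^sub>0 'k" where "T = hT 0" and "x = hX 1" and "x' = hXinv 1"
 have m: "T \<in> fcar gens" "x \<in> fcar gens" "x' \<in> fcar gens" "\<alpha> \<in> fcar gens" "\<beta> \<in> fcar gens" "\<gamma>' \<in> fcar gens"
  using n by (auto simp: T_def x_def x'_def \<alpha>_def \<beta>_def \<gamma>'_def fcar_closed intro!: gens_closed simp del: One_nat_def)
 have c: "\<alpha> * a = a * \<alpha>" "\<beta> * a = a * \<beta>" "\<gamma> * a = a * \<gamma>" for a by (simp_all add: \<alpha>_def \<beta>_def \<gamma>_def scal_comm)
 have c': "\<alpha> * (a * b) = a * (\<alpha> * b)" "\<beta> * (a * b) = a * (\<beta> * b)" "\<gamma> * (a * b) = a * (\<gamma> * b)" for a b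
  by (metis mult.assoc c(1), metis mult.assoc c(2), metis mult.assoc c(3))
 have Q: "T * T - \<alpha> * T - \<gamma> \<in> pa.I" using quadratic_I[OF n] by (simp add: T_def \<alpha>_def \<gamma>_def)
 have r: "T * x' * T - (\<gamma> * x + \<beta> * T) \<in> pa.I"
  unfolding T_def x_def x'_def \<beta>_def \<gamma>_def using n by (intro pa.I_rel hecke_rels.intros(10))
 have xx: "x * x' - 1 \<in> pa.I" using n unfolding x_def x'_def by (intro pa.I_rel hecke_rels.intros(7)) auto
 let ?w = "x' * T - T * x - (\<beta> - \<alpha> * x)"
 have "(T * T - \<alpha> * T - \<gamma>) * (x' * T) \<in> pa.I" "T * (T * x' * T - (\<gamma> * x + \<beta> * T)) \<in> pa.I"
  "\<alpha> * (T * x' * T - (\<gamma> * x + \<beta> * T)) \<in> pa.I" "\<beta> * (T * T - \<alpha> * T - \<gamma>) \<in> pa.I"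
  using m Q r by (auto intro: pa.I_lmult pa.I_rmult fcar_closed(8))
 then have "T * (T * x' * T - (\<gamma> * x + \<beta> * T)) - (T * T - \<alpha> * T - \<gamma>) * (x' * T) -
   \<alpha> * (T * x' * T - (\<gamma> * x + \<beta> * T)) + \<beta> * (T * T - \<alpha> * T - \<gamma>) \<in> pa.I"
  by (intro pa.I_add[OF pa.I_diff[OF pa.I_diff]])
 moreover have "T * (T * x' * T - (\<gamma> * x + \<beta> * T)) - (T * T - \<alpha> * T - \<gamma>) * (x' * T) -
   \<alpha> * (T * x' * T - (\<gamma> * x + \<beta> * T)) + \<beta> * (T * T - \<alpha> * T - \<gamma>) = \<gamma> * ?w"
 proof -
  have "\<alpha> * (\<beta> * T) = \<beta> * (\<alpha> * T)" "\<alpha> * (\<gamma> * x) = \<gamma> * (\<alpha> * x)" "\<beta> * \<gamma> = \<gamma> * \<beta>" "T * (\<beta> * T) = \<beta> * (T * T)" "T * (\<gamma> * x) = \<gamma> * (T * x)"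
   by (rule c'(1), rule c'(1), rule c(2), rule c'(2)[symmetric], rule c'(3)[symmetric])
  then show ?thesis by (simp add: algebra_simps)
 qed
 ultimately have "\<gamma>' * (\<gamma> * ?w) \<in> pa.I" using pa.I_lmult[OF m(6)] by metis
 moreover have "\<gamma>' * \<gamma> = 1"
 proof -
  have "p0 * inverse p1 ~= 0" using p0_nz p1_nz by simp
  then show ?thesis unfolding \<gamma>_def \<gamma>'_def scal_simps(4)[symmetric] by (subst field_class.field_inverse) (simp_all add: scal_simps(1))
 qed
 ultimately have w: "?w \<in> pa.I" by (simp only: mult.assoc[symmetric] mult_1_left)
 then show ?g1 by (simp only: T_def x_def x'_def)
 have "(x * x' - 1) * (T * x') \<in> pa.I" "x * T * (x * x' - 1) \<in> pa.I" "\<alpha> * x * (x * x' - 1) \<in> pa.I" "\<beta> * (x * x' - 1) \<in> pa.I" "x * ?w * x' \<in> pa.I"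
  using m xx w by (auto intro: pa.I_lmult pa.I_rmult fcar_closed(8))
 then have "(x * x' - 1) * (T * x') - x * T * (x * x' - 1) + \<alpha> * x * (x * x' - 1) - \<beta> * (x * x' - 1) - x * ?w * x' \<in> pa.I"
  by (intro pa.I_diff[OF pa.I_diff[OF pa.I_add[OF pa.I_diff]]])
 moreover have "(x * x' - 1) * (T * x') - x * T * (x * x' - 1) + \<alpha> * x * (x * x' - 1) - \<beta> * (x * x' - 1) - x * ?w * x' =
  x * T - T * x' - (\<alpha> * x - \<beta>)"
 proof -
  have "x * (\<beta> * x') = \<beta> * (x * x')" "x * (\<alpha> * (x * x')) = \<alpha> * (x * (x * x'))" by (rule c'(2)[symmetric], rule c'(1)[symmetric])
  then show ?thesis by (simp add: algebra_simps)
 qed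
 ultimately show ?g2 by (simp only: T_def x_def x'_def)
qed

sublocale pf: filtered_algebra gens rels Gq n HT
proof
 show "gens = Gq \<union> HT ` {..<n}" by (auto simp: hecke_gens_def)
 fix g k assume g: "g \<in> Gq" and k: "k < n"
 then consider (x) l where "g = HX l" "l \<in> {1..n}" | (y) l where "g = HXinv l" "l \<in> {1..n}" by blast
 then show "\<exists>p\<in>fcar Gq. \<exists>p'\<in>fcar Gq. gen g * gen (HT k) - gen (HT k) * p - p' \<in> pa.I"
 proof cases
  case (x l)
  show ?thesis
  proof (cases "k = 0 \<and> l = 1")
   case True
   then have "hX l * hT k - hT k * hXinv 1 - (scal (p0 - inverse p1) * hX 1 - scal (p0 * inverse p1 - 1)) \<in> pa.I"
    using X_past_T0(2) k by simp
   moreover have "scal (p0 - inverse p1) * hX 1 - scal (p0 * inverse p1 - 1) \<in> fcar Gq" "hXinv 1 \<in> fcar Gq"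
    using k by (auto intro!: fcar_closed(3,7,8) Gq_closed simp del: One_nat_def)
   ultimately show ?thesis using x by blast
  next
   case False
   with X_past_T[OF k x(2)] show ?thesis using x Gq_closed by blast
  qed
 next
  case (y l)
  show ?thesis
  proof (cases "k = 0 \<and> l = 1")
   case True
   then have "hXinv l * hT k - hT k * hX 1 - (scal (p0 * inverse p1 - 1) - scal (p0 - inverse p1) * hX 1) \<in> pa.I"
    using X_past_T0(1) k by simp
   moreover have "scal (p0 * inverse p1 - 1) - scal (p0 - inverse p1) * hX 1 \<in> fcar Gq" "hX 1 \<in> fcar Gq"
    using k by (auto intro!: fcar_closed(3,7,8) Gq_closed simp del: One_nat_def)
   ultimately show ?thesis using y by blast
  next
   case False
   with X_past_T[OF k y(2)] obtain l' z where z: "l' \<in> {1..n}" "z \<in> fcar Gq" "hX l * hT k - hT k * hX l' - z \<in> pa.I" by blast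
   have "hXinv l * hT k - hT k * hXinv l' + hXinv l * z * hXinv l' \<in> pa.I"
    by (rule past_inverse[OF y(2) z(1) gens_closed(3)[OF k] fcar_mono[OF Gq_gens z(2)] z(3)])
   then have "hXinv l * hT k - hT k * hXinv l' - (- (hXinv l * z * hXinv l')) \<in> pa.I" by simp
   moreover have "- (hXinv l * z * hXinv l') \<in> fcar Gq" using y z by (intro fcar_closed(6,8) Gq_closed)
   ultimately show ?thesis using y z Gq_closed by blast
  qed
 qed
qed

sublocale ps: spanned_algebra gens rels Gq n HT
proof
 fix k assume k: "k < n"
 let ?c = "scal (if k = 0 then p0 - inverse p1 else q - inverse q)" and ?d = "scal (if k = 0 then p0 * inverse p1 else 1)"
 have "hT k * hT k - (?c * hT k + ?d) \<in> pa.I" using quadratic_I[OF k] by (simp add: algebra_simps)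
 moreover have "?c * hT k + ?d \<in> pf.filt 1"
 proof (rule pf.filt_add[OF pf.filt_q[OF fcar_closed(3)] pf.filt_Gq[OF fcar_closed(3)]])
  show "hT k \<in> pf.filt 1" using pf.filt_word[of "[k]" 1] k by (simp add: wordp_simps)
 qed
 ultimately show "hT k * hT k \<in> pf.filt 1" using pf.filt_cong by blast
next
 fix l r assume lr: "bmove l r" and l: "set l \<subseteq> {..<n}"
 from lr l have "pf.wt l - pf.wt r \<in> pa.I"
 proof (induction rule: bmove.induct)
  case (comm i j)
  then have "hT i * hT j - hT j * hT i \<in> pa.I" by (intro pa.I_rel hecke_rels.intros(5)) auto
  then show ?case by (simp add: wordp_simps)
 next
  case (braid i)
  then have "hT i * hT (i + 1) * hT i - hT (i + 1) * hT i * hT (i + 1) \<in> pa.I" by (intro pa.I_rel hecke_rels.intros(3)) auto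
  then show ?case by (simp add: wordp_simps mult.assoc)
 next
  case (braid' i)
  then have "hT i * hT (i + 1) * hT i - hT (i + 1) * hT i * hT (i + 1) \<in> pa.I" by (intro pa.I_rel hecke_rels.intros(3)) auto
  from pa.I_sym[OF this] show ?case by (simp add: wordp_simps mult.assoc)
 next
  case four
  then have "(hT 0 * hT 1) ^ 2 - (hT 1 * hT 0) ^ 2 \<in> pa.I" by (intro pa.I_rel hecke_rels.intros(4)) auto
  then show ?case by (simp add: wordp_simps mult.assoc power2_eq_square)
 next
  case four'
  then have "(hT 0 * hT 1) ^ 2 - (hT 1 * hT 0) ^ 2 \<in> pa.I" by (intro pa.I_rel hecke_rels.intros(4)) auto
  from pa.I_sym[OF this] show ?case by (simp add: wordp_simps mult.assoc power2_eq_square)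
 qed
 then show "pf.wt l - pf.wt r \<in> pf.filt (length l - 1)" unfolding pf.filt_def by (rule pf.span_I)
qed

lemma X_commute:
 assumes "g \<in> Gq" "h \<in> Gq"
 shows "gen g * gen h - gen h * gen g \<in> pa.I"
proof -
 have XX: "hX l * hX l' - hX l' * hX l \<in> pa.I" if "l \<in> {1..n}" "l' \<in> {1..n}" for l l'
  using that by (intro pa.I_rel hecke_rels.intros)
 have i: "hX l * hXinv l - 1 \<in> pa.I" "hXinv l * hX l - 1 \<in> pa.I" if "l \<in> {1..n}" for l
  using that by (auto intro!: pa.I_rel hecke_rels.intros simp del: One_nat_def)
 have XY: "hX l * hXinv l' - hXinv l' * hX l \<in> pa.I" if l: "l \<in> {1..n}" "l' \<in> {1..n}" for l l'
  by (rule pa.inverse_commutes[OF gens_closed(1)[OF l(1)] gens_closed(1)[OF l(2)] gens_closed(2)[OF l(2)] XX[OF l] i[OF l(2)]])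
 have YY: "hXinv l * hXinv l' - hXinv l' * hXinv l \<in> pa.I" if l: "l \<in> {1..n}" "l' \<in> {1..n}" for l l'
  by (rule pa.inverse_commutes[OF gens_closed(2)[OF l(1)] gens_closed(1)[OF l(2)] gens_closed(2)[OF l(2)] pa.I_sym[OF XY[OF l(2,1)]] i[OF l(2)]])
 from assms show ?thesis using XX XY YY pa.I_sym[OF XY] by blast
qed

text \<open>If the exponent of \<open>l\<close> has the opposite sign, the word is first written
  with the inverse generator in front, which then cancels.\<close>

lemma hmon_mult:
 assumes l: "l \<in> {1..n}" and m: "keys m \<subseteq> {1..n}"
 shows "hX l * wordp (hmon m) - wordp (hmon (single l 1 + m)) \<in> pa.I" (is ?g1)
  "hXinv l * wordp (hmon m) - wordp (hmon (single l (- 1) + m)) \<in> pa.I" (is ?g2)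
proof -
 note comm = pa.commuting_words[OF Gq_gens X_commute]
 have s: "set (hmon m) \<subseteq> Gq" using hmon_set[of m] m by blast
 have g: "HX l \<in> Gq" "HXinv l \<in> Gq" using l by auto
 have mk: "keys (single l z + m) \<subseteq> {1..n}" for z
  using keys_add[of "single l z" m] l m by (auto split: if_splits simp del: One_nat_def)
 then have w: "wordp (hmon (single l z + m)) \<in> fcar gens" for z
  using hmon_set[of "single l z + m"] Gq_gens by (intro wordp_fcar) blast
 have i: "hX l * hXinv l - 1 \<in> pa.I" "hXinv l * hX l - 1 \<in> pa.I"
  using l by (auto intro!: pa.I_rel hecke_rels.intros simp del: One_nat_def)
 show ?g1
 proof (cases "0 \<le> lookup m l")
  case True
  show ?thesis using comm[OF _ _ _ mset_hmon(1)[OF True]] g s by (simp add: wordp_simps)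
 next
  case False
  then have "wordp (hmon m) - hXinv l * wordp (hmon (single l 1 + m)) \<in> pa.I"
   using comm[OF _ _ s mset_hmon(2)] by (simp add: wordp_simps)
  from pa.I_add[OF pa.I_lmult[OF gens_closed(1)[OF l] this] pa.I_rmult[OF w[of 1] i(1)]]
  show ?thesis by (simp add: algebra_simps)
 qed
 show ?g2
 proof (cases "lookup m l \<le> 0")
  case True
  show ?thesis using comm[OF _ _ _ mset_hmon(3)[OF True]] g s by (simp add: wordp_simps)
 next
  case False
  then have "wordp (hmon m) - hX l * wordp (hmon (single l (- 1) + m)) \<in> pa.I"
   using comm[OF _ _ s mset_hmon(4)] by (simp add: wordp_simps)
  from pa.I_add[OF pa.I_lmult[OF gens_closed(2)[OF l] this] pa.I_rmult[OF w[of "- 1"] i(2)]]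
  show ?thesis by (simp add: algebra_simps)
 qed
qed

end

section \<open>Completions of the Hecke algebra over power series and over fractions\<close>

context hecke_rep
begin

lemma laurent_closed: "p \<in> laurent n ==> p' \<in> laurent n ==> p + p' \<in> laurent n"
 using keys_add[of p p'] by (auto simp: laurent_def simp del: One_nat_def)

lemma laurent_sum: "(!!x. x \<in> X ==> f x \<in> laurent n) ==> sum f X \<in> laurent n"
 by (induction X rule: infinite_finite_induct) (simp_all add: laurent_closed, simp_all add: laurent_def)

lemma laurent_single: "c = 0 \<or> keys m \<subseteq> {1..n} ==> single m c \<in> laurent n" by (auto simp: laurent_def)

lemma hpol_carrier: "p \<in> laurent n ==> hpol p \<in> fcar gens"
proof -
 assume "p \<in> laurent n"
 then have "set (hmon m) \<subseteq> gens" if "m \<in> keys p" for m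
  using that hmon_set[of m] unfolding laurent_def hecke_gens_def by blast
 then show ?thesis unfolding hpol_def by (intro fcar_sum fcar_single) simp
qed

lemma hpol_surj: "b \<in> fcar Gq ==> \<exists>p\<in>laurent n. b - hpol p \<in> pa.I"
proof (induction rule: fcar_induct)
 case zero
 then show ?case by (intro bexI[of _ 0]) (simp_all add: hpol_zero pa.I_zero laurent_def)
next
 case (scal c)
 then show ?case by (intro bexI[of _ "single 0 c"]) (simp_all add: hpol_single hmon_zero wordp_simps pa.I_zero laurent_single)
next
 case (add a b)
 then obtain p p' where p: "p \<in> laurent n" "p' \<in> laurent n" "a - hpol p \<in> pa.I" "b - hpol p' \<in> pa.I" by blast
 have "(a - hpol p) + (b - hpol p') \<in> pa.I" by (rule pa.I_add[OF p(3,4)])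
 then have "(a + b) - hpol (p + p') \<in> pa.I" by (simp add: hpol_add algebra_simps)
 then show ?case using laurent_closed[OF p(1,2)] by blast
next
 case (gen g b)
 then obtain p where p: "p \<in> laurent n" "b - hpol p \<in> pa.I" by blast
 obtain l z where g: "l \<in> {1..n}" "!!m. keys m \<subseteq> {1..n} ==>
   gen g * wordp (hmon m) - wordp (hmon (single l z + m)) \<in> pa.I" "(gen g :: hecke_gen fword \<Rightarrow>\<^sub>0 'k) \<in> fcar gens"
  using gen(1) hmon_mult gens_closed(1,2) by blast
 let ?p' = "\<Sum>m\<in>keys p. single (single l z + m) (lookup p m)"
 have m: "keys m \<subseteq> {1..n}" if "m \<in> keys p" for m using that p(1) by (simp add: laurent_def)
 have "gen g * hpol (single m c) - hpol (single (single l z + m) c) \<in> pa.I" if "m \<in> keys p" for m c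
  using pa.I_lmult[OF fcar_closed(3) g(2)[OF m[OF that]], of c]
  by (simp add: hpol_single right_diff_distrib mult.assoc[symmetric] scal_comm[of _ "gen g"])
 then have "(\<Sum>m\<in>keys p. gen g * hpol (single m (lookup p m)) -
   hpol (single (single l z + m) (lookup p m))) \<in> pa.I" by (rule pa.I_sum)
 then have "gen g * hpol (\<Sum>m\<in>keys p. single m (lookup p m)) - hpol ?p' \<in> pa.I"
  by (simp add: hpol_sum sum_subtractf sum_distrib_left)
 then have "gen g * hpol p - hpol ?p' \<in> pa.I" by (simp only: poly_mapping_sum_single[symmetric])
 moreover have "gen g * b - gen g * hpol p \<in> pa.I" using pa.I_lmult[OF g(3) p(2)] by (simp add: right_diff_distrib)
 moreover have "?p' \<in> laurent n"
 proof (intro laurent_sum laurent_single disjI2)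
  show "keys (single l z + m) \<subseteq> {1..n}" if "m \<in> keys p" for m
   using keys_add[of "single l z" m] g(1) m[OF that] by (auto split: if_splits simp del: One_nat_def)
 qed
 ultimately show ?case using pa.I_trans by blast
qed

lemma act_hpol: "fa.act (hpol p) F mu = (\<Sum>m\<in>keys p. fconst (lookup p m) *
  (\<Prod>l\<in>keys m. hXat mu l powi lookup m l)) * F mu"
proof -
 have r: "foldr \<rho> (replicate k (HX l)) G mu = hXat mu l ^ k * G mu"
  "foldr \<rho> (replicate k (HXinv l)) G mu = inverse (hXat mu l) ^ k * G mu" for k l G
  by (induction k) (simp_all add: mult.assoc del: foldr_replicate)
 have rr: "foldr \<rho> (replicate (nat z) (HX l) @ replicate (nat (- z)) (HXinv l)) G mu = hXat mu l powi z * G mu" for z l G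
  unfolding foldr_append comp_def r by (auto simp: power_int_def)
 have w: "foldr \<rho> (concat (map (\<lambda>l. replicate (nat (f l)) (HX l) @ replicate (nat (- f l)) (HXinv l)) ls)) G mu =
   (\<Prod>l\<leftarrow>ls. hXat mu l powi f l) * G mu" for f ls G
 proof (induction ls)
  case (Cons l ls)
  show ?case unfolding list.map concat.simps foldr_append[of _ "_ @ _"] comp_def rr Cons.IH by (simp)
 qed simp
 have "foldr \<rho> (hmon m) F mu = (\<Prod>l\<in>keys m. hXat mu l powi lookup m l) * F mu" for m
  unfolding hmon_def w by (subst prod.distinct_set_conv_list[symmetric]) simp_all
 then show ?thesis by (simp add: hpol_def fa.act_sum fa.act_single sum_distrib_right mult.assoc)
qed

lemma refl_ops: "refl_ops V n sr.SV yh T Ah Bh"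
proof (intro refl_ops.intro sr.refl_sys refl_ops_axioms.intro ext)
 fix k and F :: "('k, 'k) svec" and mu assume k: "k < n" and F: "F \<in> supp V"
 show "T k F mu = Ah k mu * F mu + Bh k mu * sr.SV k F mu"
 proof (cases "mu \<in> V")
  case False
  then show ?thesis using T_zero[OF False k F] F by (simp add: sr.SV_def vec_def supp_def)
 qed (simp add: T_at sr.SV_at)
qed (rule Bh_nz)

sublocale ro: refl_ops V n sr.SV yh T Ah Bh by (rule refl_ops)

text \<open>Parametric in \<open>Sc\<close>: the condition on \<open>Ah\<close> needs divided
  differences over power series and is immediate over fractions.\<close>

lemma completed:
 assumes Sc: "0 \<in> Sc" "1 \<in> Sc" "!!a b. a \<in> Sc ==> b \<in> Sc ==> a + b \<in> Sc"
   "!!a b. a \<in> Sc ==> b \<in> Sc ==> a * b \<in> Sc" "!!a. a \<in> Sc ==> - a \<in> Sc" "!!c. fconst c \<in> Sc"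
  and X: "!!mu l. mu \<in> V ==> l \<in> {1..n} ==> hXat mu l \<in> Sc" "!!mu l. mu \<in> V ==> l \<in> {1..n} ==> inverse (hXat mu l) \<in> Sc"
  and S: "!!k mu z. k < n ==> mu \<in> V ==> z \<in> Sc ==> rh mu k z \<in> Sc"
  and A: "!!k mu m. k < n ==> m \<in> carrier (coef_ring V Sc) ==> mu \<in> V ==> Ah k mu * (m mu - rh mu k (m (sw k mu))) \<in> Sc"
 shows "completed_algebra gens rels Gq n HT V fconst \<rho> sr.SV yh Ah Bh Sc (laurent n) hpol (series_of_laurent V)"
proof
 have Sc_pow: "a ^ k \<in> Sc" if "a \<in> Sc" for a k using that by (induction k) (simp_all add: Sc)
 have Sc_prod: "prod f X \<in> Sc" if "!!x. x \<in> X ==> f x \<in> Sc" for f :: "nat => 'k mps fract" and X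
  using that by (induction X rule: infinite_finite_induct) (simp_all add: Sc)
 have Sc_sum: "sum f X \<in> Sc" if "!!x. x \<in> X ==> f x \<in> Sc" for f :: "(nat \<Rightarrow>\<^sub>0 int) => 'k mps fract" and X
  using that by (induction X rule: infinite_finite_induct) (simp_all add: Sc)
 have Xp: "hXat mu l powi z \<in> Sc" if "mu \<in> V" "l \<in> {1..n}" for mu l z
  using Sc_pow X[OF that] by (simp add: power_int_def)
 show "hpol p \<in> fcar gens" if "p \<in> laurent n" for p using that by (rule hpol_carrier)
 show "series_of_laurent V p \<in> carrier (coef_ring V Sc)" if "p \<in> laurent n" for p
 proof -
  have "(\<Sum>m\<in>keys p. fconst (lookup p m) *
    (\<Prod>l\<in>keys m. hXat mu l powi lookup m l)) \<in> Sc" if "mu \<in> V" for mu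
   using that \<open>p \<in> laurent n\<close> unfolding laurent_def by (intro Sc_sum Sc_prod Sc Xp) blast+
  then show ?thesis by (simp add: coef_ring_def series_of_laurent_def vec_def)
 qed
 show "fa.act (hpol p) F = (\<lambda>mu. series_of_laurent V p mu * F mu)" if "p \<in> laurent n" "F \<in> supp V" for p F
  using that by (auto simp: act_hpol series_of_laurent_def vec_def supp_def)
 show "\<exists>p\<in>laurent n. b - hpol p \<in> pa.I" if "b \<in> fcar Gq" for b using that by (rule hpol_surj)
 fix k and m :: "('k, 'k) svec" assume k: "k < n" and m: "m \<in> carrier (coef_ring V Sc)"
 then have mp: "m mu \<in> Sc" if "mu \<in> V" for mu using that by (simp add: coef_ring_def)
 have m0: "m mu = 0" if "mu \<notin> V" for mu using that m by (simp add: coef_ring_def)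
 show "sr.SV k m \<in> carrier (coef_ring V Sc)" using S[OF k _ mp] swapV[OF _ k] by (auto simp: coef_ring_def sr.SV_def vec_def)
 show "(\<lambda>mu. Ah k mu * (m mu - sr.SV k m mu)) \<in> carrier (coef_ring V Sc)"
  using A[OF k m] by (auto simp: coef_ring_def m0 sr.SV_def vec_def)
next
 show "vec V (yh i) \<in> carrier (coef_ring V Sc)" if "i \<in> {1..int n}" for i
 proof -
  have l: "nat i \<in> {1..n}" using that by auto
  have d: "a - b \<in> Sc" if "a \<in> Sc" "b \<in> Sc" for a b using Sc(3)[OF that(1) Sc(5)[OF that(2)]] by simp
  have "yh i mu \<in> Sc" if "mu \<in> V" for mu
  proof -
   have "yh i mu = fconst (mu (nat i)) * inverse (hXat mu (nat i)) - hXat mu (nat i) * fconst (inverse (mu (nat i)))"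
    using \<open>i \<in> _\<close> l unfolding yh_def yk_def by (simp add: cc(2)[OF that] divide_inverse fconst_inverse)
   then show ?thesis by (simp only:) (intro d Sc X that l)
  qed
  then show ?thesis by (simp add: coef_ring_def vec_def)
 qed
qed (fact Sc)+

text \<open>At a self-inverse label the coordinate \<open>cc mu (fvar 1)\<close> is a unit times
  \<open>X\<^sub>1\<^sup>2 - 1\<close>, so this is the divided difference by
  \<open>x\<^sub>1\<close>, carried over by \<open>cc\<close>.\<close>

lemma rh_divided_difference:
 assumes n: "0 < n" and mu: "mu \<in> V" "inverse (mu 1) = mu 1" and z: "z \<in> pseries n"
 shows "(z - rh mu 0 z) / (hXat mu 1 ^ 2 - 1) \<in> pseries n"
proof -
 have l1: "(1::nat) \<in> {1..n}" using n by simp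
 have s: "sw 0 mu = mu" using mu(2) by (rule seq_swap_fix)
 have m0: "mu 1 ~= 0" using V_nz[OF mu(1) l1] .
 have m1: "mu 1 * mu 1 = 1" using mu(2) m0 by (metis field_class.field_inverse)
 obtain G where G: "fcoord n G" "!!z. G (cc mu z) = z" "!!z. cc mu (G z) = z"
  by (rule fcoord_inverse[OF cc(1)[OF mu(1)]]) (rule that)
 define w where "w = (klr_refl 0 (G z) - G z) / fvar 1"
 have w: "w \<in> pseries n" unfolding w_def by (rule klr_divided_difference(2)[OF n fcoord_pseries[OF G(1) z]])
 have "G z - klr_refl 0 (G z) = - (fvar 1 * w)" by (simp add: w_def fvar_nz)
 moreover have "z - rh mu 0 z = cc mu (G z - klr_refl 0 (G z))"
  using rh_cc[OF n mu(1), of "G z"] by (simp add: s G fhom_diff[OF fcoord_fhom[OF cc(1)[OF mu(1)]]])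
 ultimately have e: "z - rh mu 0 z = - (cc mu (fvar 1) * cc mu w)"
  by (simp only: fhom_minus[OF fcoord_fhom[OF cc(1)[OF mu(1)]]] fhom_mult[OF fcoord_fhom[OF cc(1)[OF mu(1)]]])
 define X c where "X = hXat mu 1" and "c = fconst (mu 1)"
 have X: "X ~= 0" "X ^ 2 - 1 ~= 0" unfolding X_def by (simp_all add: hX_nz hX_sq_neq_1)
 have c: "c * c = 1" "c ~= 0" unfolding c_def fhom_mult[OF fconst_fhom, symmetric] m1 fconst_eq_0_iff
  by (rule fconst_simps(1), rule m0)
 have "cc mu (fvar 1) = c / X - X / c" using l1 by (simp add: cc(2)[OF mu(1)] X_def c_def)
 also have "... = - (X ^ 2 - 1) / (c * X)" using X c by (simp add: divide_simps) (simp add: algebra_simps power2_eq_square)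
 finally have u: "cc mu (fvar 1) = - (X ^ 2 - 1) / (c * X)" .
 have "- (- D / (c * X) * v) / D = v * inverse X * inverse c" if "D ~= 0" for D v using that by (simp add: divide_inverse)
 from this[OF X(2)] have "(z - rh mu 0 z) / (X ^ 2 - 1) = cc mu w * inverse X * inverse c" unfolding e u .
 moreover have "inverse X \<in> pseries n" "inverse c \<in> pseries n"
  using has_ct_inverse(1)[OF has_ct_hXat[OF l1]] m0 unfolding X_def c_def fconst_inverse[symmetric] pseries_iff
  by (blast intro: has_ct_fconst)+
 ultimately show ?thesis unfolding X_def by (simp add: pseries_closed fcoord_pseries[OF cc(1)[OF mu(1)] w])
qed

text \<open>Unless the reflection fixes the labels, the denominator of \<open>Ah\<close> has nonzero
  constant term and is a unit; in the fixed case the difference over the denominator is a divided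
  difference up to units.\<close>

lemma Ah_integral:
 assumes k: "k < n" and m: "m \<in> carrier (coef_ring V (pseries n))" and mu: "mu \<in> V"
 shows "Ah k mu * (m mu - rh mu k (m (sw k mu))) \<in> pseries n"
proof -
 have mp: "m mu \<in> pseries n" "m (sw k mu) \<in> pseries n" using m mu swapV[OF mu k] by (auto simp: coef_ring_def)
 then have d: "m mu - rh mu k (m (sw k mu)) \<in> pseries n" by (intro pseries_closed(5) fcoord_pseries[OF rh_fcoord[OF k mu]])
 have unit: "a / b * z \<in> pseries n" if "a \<in> pseries n" "has_ct n b c" "c ~= 0" "z \<in> pseries n" for a b c z
  using that by (metis pseries_iff has_ct_divide pseries_closed(6))
 show ?thesis
 proof (cases "k = 0")
  case True
  have n: "0 < n" using k by simp
  have l1: "(1::nat) \<in> {1..n}" using n by simp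
  have X: "hXat mu 1 \<in> pseries n" using has_ct_hXat[OF l1] pseries_iff by blast
  have a: "hXat mu 1 * (ca * hXat mu 1 - cb) \<in> pseries n" unfolding ca_def cb_def by (intro pseries_closed X)
  show ?thesis
  proof (cases "inverse (mu 1) = mu 1")
   case i: True
   then have s: "sw 0 mu = mu" by (rule seq_swap_fix)
   have "Ah k mu * (m mu - rh mu k (m (sw k mu))) = hXat mu 1 * (ca * hXat mu 1 - cb) * ((m mu - rh mu 0 (m mu)) / (hXat mu 1 ^ 2 - 1))"
    by (simp add: Ah_def ha_def True s)
   also have "... \<in> pseries n" by (rule pseries_closed(6)[OF a rh_divided_difference[OF n mu i mp(1)]])
   finally show ?thesis .
  next
   case False
   have "mu 1 ^ 2 ~= 1" using False by (metis inverse_unique power2_eq_square)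
   then have "mu 1 ^ 2 - 1 ~= 0" by simp
   then show ?thesis unfolding Ah_def ha_def if_P[OF True] using unit[OF a has_ct_diff[OF has_ct_power[OF has_ct_hXat[OF l1]] has_ct_1]] d by blast
  qed
 next
  case False
  have l: "k \<in> {1..n}" "Suc k \<in> {1..n}" using k False by auto
  have y: "cq * hXat mu (Suc k) \<in> pseries n" unfolding cq_def using has_ct_hXat[OF l(2)] pseries_iff by (blast intro: pseries_closed)
  show ?thesis
  proof (cases "mu k = mu (Suc k)")
   case i: True
   then have s: "sw k mu = mu" using False by (intro seq_swap_fix) auto
   have r: "rh mu k z = klr_refl k z" for z using False by (simp add: rh_def hecke_refl_klr)
   define d where "d = fvar k - (fvar (Suc k) :: 'k mps fract)"
   have e: "hXat mu (Suc k) - hXat mu k = - d" by (simp add: hXat_def i d_def)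
   have "Ah k mu * (m mu - rh mu k (m (sw k mu))) = cq * hXat mu (Suc k) * ((klr_refl k (m mu) - m mu) / (fvar k - fvar (Suc k)))"
    unfolding Ah_def hg_def if_not_P[OF False] s r e d_def[symmetric] by (simp add: divide_inverse algebra_simps)
   also have "... \<in> pseries n" using False k by (intro pseries_closed(6)[OF y] klr_divided_difference mp) auto
   finally show ?thesis .
  next
   case i: False
   then have "mu (Suc k) - mu k ~= 0" by simp
   then show ?thesis unfolding Ah_def hg_def if_not_P[OF False]
    using unit[OF y has_ct_diff[OF has_ct_hXat[OF l(2)] has_ct_hXat[OF l(1)]]] d by blast
  qed
 qed
qed

lemma hX_pseries:
 assumes "mu \<in> V" "l \<in> {1..n}"
 shows "hXat mu l \<in> pseries n" "inverse (hXat mu l) \<in> pseries n"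
 using has_ct_hXat[OF assms(2), of mu] has_ct_inverse(1)[OF has_ct_hXat[OF assms(2), of mu] V_nz[OF assms]] pseries_iff by blast+

sublocale hs: completed_algebra gens rels Gq n HT V fconst \<rho> sr.SV yh Ah Bh "pseries n" "laurent n" hpol "series_of_laurent V"
 by (rule completed) (simp_all add: pseries_closed hX_pseries fcoord_pseries[OF rh_fcoord] Ah_integral)

lemma Ah_pfrac: "k < n ==> mu \<in> V ==> Ah k mu \<in> pfrac n"
proof -
 assume k: "k < n" and mu: "mu \<in> V"
 have X: "hXat mu l \<in> pfrac n" if "l \<in> {1..n}" for l using hX_pseries[OF mu that] by (intro pseries_pfrac)
 have c: "fconst c \<in> pfrac n" for c by (intro pseries_pfrac pseries_closed)
 show ?thesis
 proof (cases "k = 0")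
  case True
  have "(1::nat) \<in> {1..n}" using k by simp
  then show ?thesis unfolding Ah_def ha_def if_P[OF True] ca_def cb_def by (intro pfrac_closed pfrac_power c X)
 next
  case False
  then have "k \<in> {1..n}" "Suc k \<in> {1..n}" using k by auto
  then show ?thesis unfolding Ah_def hg_def if_not_P[OF False] cq_def by (intro pfrac_closed c X)
 qed
qed

sublocale hf: completed_algebra gens rels Gq n HT V fconst \<rho> sr.SV yh Ah Bh "pfrac n" "laurent n" hpol "series_of_laurent V"
proof (rule completed)
 show "Ah k mu * (m mu - rh mu k (m (sw k mu))) \<in> pfrac n"
  if "k < n" "m \<in> carrier (coef_ring V (pfrac n))" "mu \<in> V" for k mu m using that swapV[OF that(3,1)]
  by (intro pfrac_closed Ah_pfrac fcoord_pfrac[OF rh_fcoord]) (auto simp: coef_ring_def)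
 show "hXat mu l \<in> pfrac n" "inverse (hXat mu l) \<in> pfrac n" if "mu \<in> V" "l \<in> {1..n}" for mu l
  using hX_pseries[OF that] by (auto intro: pseries_pfrac)
qed (simp_all add: pfrac_closed fcoord_pfrac[OF rh_fcoord])

end

section \<open>The comparison\<close>

context klr_rep
begin

text \<open>A rescaling after which the intertwiner going into the component at \<open>mu\<close> carries the factor
 \<open>(x\<^sub>k - x\<^sub>k\<^sub>+\<^sub>1)\<close> for an arrow from \<open>mu\<^sub>k\<close> to \<open>mu\<^sub>k\<^sub>+\<^sub>1\<close>, instead of \<open>(x\<^sub>k\<^sub>+\<^sub>1 - x\<^sub>k)\<close> for an arrow
 from \<open>mu\<^sub>k\<^sub>+\<^sub>1\<close> to \<open>mu\<^sub>k\<close>; similarly for \<open>k = 0\<close>.\<close>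

definition gfac :: "(nat => 'i) => nat => nat => 'k mps fract" where
 "gfac mu i j = (fvar i - fvar j) ^ a (mu i) (mu j) * (- fvar i - fvar j) ^ a (\<theta> (mu j)) (mu i)"

definition gpairs :: "(nat \<times> nat) set" where "gpairs = {(i, j). 1 \<le> i \<and> i < j \<and> j \<le> n}"

definition gauge :: "('i, 'k) svec" where
 "gauge mu = (\<Prod>(i, j)\<in>gpairs. gfac mu i j) * (\<Prod>i\<in>{1..n}. fvar i ^ lam (mu i))"

lemma finite_gpairs: "finite gpairs" by (rule finite_subset[of _ "{1..n} \<times> {1..n}"]) (auto simp: gpairs_def)

lemma gauge_nz: "gauge mu ~= 0"
proof -
 have "- fvar i - fvar j ~= (0 :: 'k mps fract)" if "i ~= j" for i j
 proof -
  have "- fvar i - fvar j = - (fvar i + fvar j :: 'k mps fract)" by simp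
  then show ?thesis using fvar_add_nz[OF that] by (simp only: neg_equal_0_iff_equal not_False_eq_True)
 qed
 then have "gfac mu i j ~= 0" if "(i, j) \<in> gpairs" for i j using that by (auto simp: gpairs_def gfac_def fvar_neq)
 then show ?thesis using finite_gpairs by (auto simp: gauge_def fvar_nz)
qed

text \<open>Exchanging \<open>k\<close> and \<open>Suc k\<close> permutes the ordered pairs of
  positions, except that the pair \<open>(k, Suc k)\<close> gets reversed. There the second factor
  of \<open>gfac\<close> is symmetric by \<open>a_sym\<close>, and the first one yields the two
  powers in the claim.\<close>

lemma gauge_swap:
 assumes k: "1 \<le> k" "k < n"
 shows "klr_refl k (gauge (sw k mu)) * (fvar k - fvar (Suc k)) ^ a (mu k) (mu (Suc k)) =
  gauge mu * (fvar (Suc k) - fvar k) ^ a (mu (Suc k)) (mu k)"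
proof -
 let ?s = "index_swap k" and ?p = "(k, Suc k)"
 have s: "?s i = (if i = k then Suc k else if i = Suc k then k else i)" for i by (rule index_swap_simps(2)[OF k(1)])
 have ss: "?s (?s i) = i" for i by (simp add: s)
 have at: "sw k mu i = mu (?s i)" for i using k by (auto simp: seq_swap_def s)
 have k0: "k ~= 0" using k by simp
 have f: "klr_refl k (gfac (sw k mu) i j) = gfac mu (?s i) (?s j)" for i j using k0 by (simp add: gfac_def klr_refl_simps at)
 have p: "?p \<in> gpairs" using k by (simp add: gpairs_def)
 have "klr_refl k (\<Prod>(i, j)\<in>gpairs. gfac (sw k mu) i j) = (\<Prod>(i, j)\<in>gpairs. gfac mu (?s i) (?s j))"
  by (simp add: fhom_prod[OF klr_refl_fhom] case_prod_unfold f)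
 also have "... = gfac mu (?s k) (?s (Suc k)) * (\<Prod>(i, j)\<in>gpairs - {?p}. gfac mu (?s i) (?s j))"
  using prod.remove[OF finite_gpairs p, of "\<lambda>(i, j). gfac mu (?s i) (?s j)"] by simp
 also have "(\<Prod>(i, j)\<in>gpairs - {?p}. gfac mu (?s i) (?s j)) = (\<Prod>(i, j)\<in>gpairs - {?p}. gfac mu i j)"
  by (rule prod.reindex_bij_witness[where i = "\<lambda>(i, j). (?s i, ?s j)" and j = "\<lambda>(i, j). (?s i, ?s j)"])
   (use k in \<open>auto simp: gpairs_def ss s split: if_splits\<close>)
 finally have 1: "klr_refl k (\<Prod>(i, j)\<in>gpairs. gfac (sw k mu) i j) =
   gfac mu (Suc k) k * (\<Prod>(i, j)\<in>gpairs - {?p}. gfac mu i j)" by (simp add: s)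
 have 2: "(\<Prod>(i, j)\<in>gpairs. gfac mu i j) = gfac mu k (Suc k) * (\<Prod>(i, j)\<in>gpairs - {?p}. gfac mu i j)"
  using prod.remove[OF finite_gpairs p, of "\<lambda>(i, j). gfac mu i j"] by simp
 have "klr_refl k (\<Prod>i\<in>{1..n}. fvar i ^ lam (sw k mu i)) = (\<Prod>i\<in>{1..n}. fvar (?s i) ^ lam (mu (?s i)))"
  using k0 by (simp add: fhom_prod[OF klr_refl_fhom] fhom_power[OF klr_refl_fhom] klr_refl_fvar at)
 also have "... = (\<Prod>i\<in>{1..n}. fvar i ^ lam (mu i))"
  by (rule prod.reindex_bij_witness[where i = ?s and j = ?s]) (use k in \<open>auto simp: ss s\<close>)
 finally have 3: "klr_refl k (\<Prod>i\<in>{1..n}. fvar i ^ lam (sw k mu i)) = (\<Prod>i\<in>{1..n}. fvar i ^ lam (mu i))" .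
 have "a (\<theta> (mu k)) (mu (Suc k)) = a (\<theta> (mu (Suc k))) (mu k)"
  using a_sym[of "mu (Suc k)" "\<theta> (mu k)"] by (simp add: \<theta>\<theta>)
 moreover have "- fvar (Suc k) - fvar k = (- fvar k - fvar (Suc k) :: 'k mps fract)" by simp
 ultimately show ?thesis unfolding gauge_def fhom_mult[OF klr_refl_fhom] 1 2 3 gfac_def by (simp only: mult_ac)
qed

text \<open>The sign change of the first variable exchanges the two factors of \<open>gfac\<close>
  at the pairs \<open>(1, j)\<close>, by \<open>a_sym\<close>; this is why \<open>gfac\<close> has
  the second one. Only the framing factor of position 1 changes.\<close>

lemma gauge_swap_0:
 assumes n: "0 < n"
 shows "klr_refl 0 (gauge (sw 0 mu)) * fvar 1 ^ lam (mu 1) = gauge mu * (- fvar 1) ^ lam (\<theta> (mu 1))"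
proof -
 have as: "a (\<theta> (mu (Suc 0))) (mu j) = a (\<theta> (mu j)) (mu (Suc 0))" for j
  using a_sym[of "mu j" "\<theta> (mu (Suc 0))"] by (simp add: \<theta>\<theta>)
 have f: "klr_refl 0 (gfac (sw 0 mu) i j) = gfac mu i j" if "(i, j) \<in> gpairs" for i j
 proof (cases "i = 1")
  case True
  then show ?thesis using that by (simp add: gpairs_def gfac_def klr_refl_simps index_swap_simps seq_swap_def as a_sym)
 next
  case False
  then show ?thesis using that by (simp add: gpairs_def gfac_def klr_refl_simps index_swap_simps seq_swap_def)
 qed
 have 1: "klr_refl 0 (\<Prod>(i, j)\<in>gpairs. gfac (sw 0 mu) i j) = (\<Prod>(i, j)\<in>gpairs. gfac mu i j)"
  unfolding fhom_prod[OF klr_refl_fhom] by (rule prod.cong[OF refl]) (use f in auto)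
 have n1: "1 \<in> {1..n}" using n by simp
 have r: "(\<Prod>i\<in>{1..n} - {1}. klr_refl 0 (fvar i ^ lam (sw 0 mu i))) = (\<Prod>i\<in>{1..n} - {1}. fvar i ^ lam (mu i))"
  by (rule prod.cong[OF refl]) (auto simp: klr_refl_fvar fhom_power[OF klr_refl_fhom] index_swap_simps seq_swap_def)
 have 2: "klr_refl 0 (\<Prod>i\<in>{1..n}. fvar i ^ lam (sw 0 mu i)) = (- fvar 1) ^ lam (\<theta> (mu 1)) * (\<Prod>i\<in>{1..n} - {1}. fvar i ^ lam (mu i))"
  unfolding fhom_prod[OF klr_refl_fhom] prod.remove[OF finite_atLeastAtMost n1, of "\<lambda>i. klr_refl 0 (fvar i ^ lam (sw 0 mu i))"] r
  by (simp add: klr_refl_fvar fhom_power[OF klr_refl_fhom] seq_swap_def)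
 have 3: "(\<Prod>i\<in>{1..n}. fvar i ^ lam (mu i)) = fvar 1 ^ lam (mu 1) * (\<Prod>i\<in>{1..n} - {1}. fvar i ^ lam (mu i))"
  by (rule prod.remove[OF finite_atLeastAtMost n1])
 show ?thesis unfolding gauge_def fhom_mult[OF klr_refl_fhom] 1 2 3 by (simp only: mult_ac)
qed

end

section \<open>Conjugating the KLR operators into Hecke operators\<close>

locale hecke_klr =
 K: klr_rep inverse n V "arrows q" "framing p0 p1" "TYPE('k)" + H: hecke_rep n V q p0 p1
 for n and V :: "(nat => 'k::field) set" and q p0 p1 :: 'k +
 assumes q_sq: "q ^ 2 ~= 1" and p_neq: "p0 ~= 1" "p0 ~= - 1" "p1 ~= 1" "p1 ~= - 1"
begin

abbreviation "cc \<equiv> H.cc"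
abbreviation "gauge \<equiv> K.gauge :: ('k, 'k) svec"

definition cu :: "nat => ('k, 'k) svec" where
 "cu k mu = (if k = 0 then cc mu (fvar 1) else cc mu (fvar k) - cc mu (fvar (Suc k)))"

definition fixd :: "nat => (nat => 'k) => bool" where
 "fixd k mu \<longleftrightarrow> (if k = 0 then mu 1 = inverse (mu 1) else mu k = mu (k + 1))"

definition ex :: "nat => (nat => 'k) => nat" where
 "ex k mu = (if k = 0 then framing p0 p1 (mu 1) else arrows q (mu k) (mu (k + 1)))"

definition Ck :: "nat => ('k, 'k) svec" where
 "Ck k mu = (if fixd k mu then - inverse (cu k mu) else 0)"

definition Dk :: "nat => ('k, 'k) svec" where
 "Dk k mu = (if fixd k mu then inverse (cu k mu) else cu k mu ^ ex k mu)"

text \<open>The conjugate of \<open>\<tau>\<^sub>k\<close> by \<open>Theta\<close>, written out on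
  the Hecke side. In the unfixed case the exponent belongs to an arrow from \<open>mu k\<close> to
  \<open>mu (k + 1)\<close>, or is the framing of \<open>mu 1\<close>.\<close>

definition tk :: "nat => ('k, 'k) svec => ('k, 'k) svec" where
 "tk k G = vec V (\<lambda>mu. Ck k mu * G mu + Dk k mu * H.rh mu k (G (K.sw k mu)))"

definition Theta :: "('k, 'k) svec => ('k, 'k) svec" where
 "Theta F = vec V (\<lambda>mu. cc mu (gauge mu * F mu))"

lemma cc_fhom: "mu \<in> V ==> fhom (cc mu)" using H.cc(1) fcoord_fhom by blast

lemma arrows_refl: "mu \<in> V ==> l \<in> {1..n} ==> arrows q (mu l) (mu l) = 0"
 using H.V_nz[of mu l] q_sq by (auto simp: arrows_def)

text \<open>A self-inverse value is 1, -1, or 0 (the inverse of 0 being 0), none of which is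
  \<open>p1\<close> or \<open>- p0\<close>; so the framing vanishes at fixed vertices.\<close>

lemma framing_fixed: "i = inverse i ==> framing p0 p1 i = 0"
proof -
 assume i: "i = inverse i"
 have "i = 0 \<or> i = 1 \<or> i = - 1"
 proof (cases "i = 0")
  case False
  then have "i * i = 1" using i by (metis field_class.field_inverse mult.commute)
  then have "i\<^sup>2 = 1" by (simp add: power2_eq_square)
  then show ?thesis by (simp add: power2_eq_1_iff)
 qed simp
 then show ?thesis using p_neq H.p0_nz H.p1_nz by (auto simp: framing_def equation_minus_iff[of _ p0])
qed

text \<open>At fixed labels the exponents in the gauge rules vanish, so the gauge is invariant and
  the divided difference is carried over. Otherwise these rules replace the factor of the polynomial
  representation by the one in \<open>Dk\<close>.\<close>

lemma Theta_tau:
 assumes k: "k < n" and F: "F \<in> supp V"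
 shows "Theta (K.\<rho> (KTau k) F) = tk k (Theta F)"
proof (rule K.fun_V_eqI)
 show "Theta (K.\<rho> (KTau k) F) \<in> supp V" "tk k (Theta F) \<in> supp V" by (simp_all add: Theta_def tk_def supp_closed)
 fix mu assume mu: "mu \<in> V"
 note cs = fhom_simps[OF cc_fhom[OF mu]]
 have s: "K.sw k mu \<in> V" using K.swapV[OF mu k] .
 define g' where "g' = klr_refl k (gauge (K.sw k mu))"
 define Fs where "Fs = klr_refl k (F (K.sw k mu))"
 have r: "H.rh mu k (Theta F (K.sw k mu)) = cc mu (g' * Fs)"
  using H.rh_cc[OF k mu] s by (simp add: Theta_def vec_def fhom_mult[OF klr_refl_fhom] g'_def Fs_def)
 show "Theta (K.\<rho> (KTau k) F) mu = tk k (Theta F) mu"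
 proof (cases "k = 0")
  case True
  have n: "0 < n" using k by simp
  note g = K.gauge_swap_0[OF n, of mu, folded True, folded g'_def]
  note t = K.tau_at(1)[OF mu n, of F, folded True, folded Fs_def]
  show ?thesis
  proof (cases "mu 1 = inverse (mu 1)")
   case fx: True
   then have ge: "g' = gauge mu" using g framing_fixed[OF fx] by simp
   then have "Theta (K.\<rho> (KTau k) F) mu = cc mu (g' * ((Fs - F mu) / fvar 1))"
    using mu t fx by (simp add: Theta_def vec_def)
   also have "... = inverse (cu k mu) * (cc mu (g' * Fs) - cc mu (gauge mu * F mu))"
    using True ge by (simp add: cs cu_def divide_inverse algebra_simps)
   also have "... = tk k (Theta F) mu" using mu fx True r
    by (simp add: tk_def vec_def Ck_def Dk_def fixd_def algebra_simps) (simp add: Theta_def vec_def mult.commute)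
   finally show ?thesis .
  next
   case False
   then have nf: "inverse (mu 1) ~= mu 1" by metis
   have "Theta (K.\<rho> (KTau k) F) mu = cc mu (gauge mu * ((- fvar 1) ^ framing p0 p1 (inverse (mu 1)) * Fs))"
    using mu t nf by (simp add: Theta_def vec_def)
   also have "... = cc mu ((gauge mu * (- fvar 1) ^ framing p0 p1 (inverse (mu 1))) * Fs)" by (simp only: mult.assoc)
   also have "... = cc mu ((g' * fvar 1 ^ framing p0 p1 (mu 1)) * Fs)" unfolding g ..
   also have "... = cu k mu ^ ex k mu * cc mu (g' * Fs)" using True by (simp add: cs cu_def ex_def)
   also have "... = tk k (Theta F) mu" using mu False True r[unfolded True] by (simp add: tk_def vec_def Ck_def Dk_def fixd_def)
   finally show ?thesis .
  qed
 next
  case False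
  then have k1: "1 \<le> k" by simp
  note g = K.gauge_swap[OF k1 k, of mu, folded g'_def]
  note t = K.tau_at(2)[OF mu k1 k, of F, folded Fs_def]
  show ?thesis
  proof (cases "mu k = mu (k + 1)")
   case fx: True
   then have "g' = gauge mu" using g arrows_refl[OF mu, of k] k k1 by simp
   then have "Theta (K.\<rho> (KTau k) F) mu = cc mu (g' * ((Fs - F mu) / (fvar k - fvar (Suc k))))"
    using mu t fx by (simp add: Theta_def vec_def)
   also have "... = inverse (cu k mu) * (cc mu (g' * Fs) - cc mu (gauge mu * F mu))"
    using False \<open>g' = gauge mu\<close> by (simp add: cs cu_def divide_inverse algebra_simps)
   also have "... = tk k (Theta F) mu" using mu fx False r
    by (simp add: tk_def vec_def Ck_def Dk_def fixd_def algebra_simps) (simp add: Theta_def vec_def mult.commute)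
   finally show ?thesis .
  next
   case nf: False
   then have "Theta (K.\<rho> (KTau k) F) mu = cc mu (gauge mu * ((fvar (Suc k) - fvar k) ^ arrows q (mu (Suc k)) (mu k) * Fs))"
    using mu t by (simp add: Theta_def vec_def)
   also have "... = cc mu ((gauge mu * (fvar (Suc k) - fvar k) ^ arrows q (mu (Suc k)) (mu k)) * Fs)" by (simp only: mult.assoc)
   also have "... = cc mu ((g' * (fvar k - fvar (Suc k)) ^ arrows q (mu k) (mu (Suc k))) * Fs)" unfolding g ..
   also have "... = cu k mu ^ ex k mu * cc mu (g' * Fs)" using False by (simp add: cs cu_def ex_def)
   also have "... = tk k (Theta F) mu" using mu nf False by (simp add: tk_def vec_def Ck_def Dk_def fixd_def r)
   finally show ?thesis .
  qed
 qed
qed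

definition unit :: "'k mps fract => bool" where
 "unit z \<longleftrightarrow> (\<exists>c. has_ct n z c \<and> c ~= 0)"

lemma unit_closed:
 "has_ct n z c ==> c ~= 0 ==> unit z" "unit y ==> unit z ==> unit (y * z)" "unit z ==> unit (inverse z)"
 "unit y ==> unit z ==> unit (y / z)" "unit z ==> unit (- z)" unfolding unit_def
 by (blast, metis has_ct_mult mult_eq_0_iff, metis has_ct_inverse(1) nonzero_imp_inverse_nonzero,
   metis has_ct_divide divide_eq_0_iff, metis has_ct_minus neg_equal_0_iff_equal)

lemma unit_pseries: "unit z ==> z \<in> pseries n" by (auto simp: unit_def pseries_iff)

lemma unit_const: "c ~= 0 ==> unit (fconst c)" using has_ct_fconst unit_closed(1) by blast

lemma unit_X: "mu \<in> V ==> l \<in> {1..n} ==> unit (hXat mu l)" using has_ct_hXat H.V_nz unit_closed(1) by blast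

text \<open>\<open>al\<close> and \<open>be\<close> solve \<open>Ck + Dk S = al T + be\<close> for
  \<open>T = Ah + Bh S\<close>.\<close>

definition al :: "nat => ('k, 'k) svec" where "al k mu = Dk k mu / H.Bh k mu"

definition be :: "nat => ('k, 'k) svec" where "be k mu = Ck k mu - al k mu * H.Ah k mu"

lemma cc_x: "mu \<in> V ==> l \<in> {1..n} ==> cc mu (fvar l) = fconst (mu l) / hXat mu l - hXat mu l / fconst (mu l)"
 by (simp only: H.cc(2) if_True)

text \<open>\<open>cc mu (fvar l)\<close> is \<open>X - mu l\<close> times
  \<open>- (X + mu l) / (X * mu l)\<close>, and the latter is a unit as \<open>2 * mu l\<close> is
  nonzero. So the coordinate cancels the linear factor just when that factor is not a unit
  itself.\<close>

lemma unit_linear: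
 assumes mu: "mu \<in> V" and l: "l \<in> {1..n}"
 shows "unit (cc mu (fvar l) ^ of_bool (mu l = c) / (hXat mu l - fconst c))"
proof (cases "mu l = c")
 case False
 then have "mu l - c ~= 0" by simp
 then have "unit (hXat mu l - fconst c)" using has_ct_diff[OF has_ct_hXat[OF l] has_ct_fconst] unit_closed(1) by blast
 then have "unit (1 / (hXat mu l - fconst c))" using unit_closed(4)[OF unit_closed(1)[OF has_ct_1]] by simp
 then show ?thesis using False by simp
next
 case True
 define X m where "X = hXat mu l" and "m = fconst (mu l)"
 have nz: "X ~= 0" "m ~= 0" "X - m ~= 0" using H.V_nz[OF mu l] hX_neq_const[of mu l "mu l"]
  by (simp_all add: X_def m_def hX_nz fconst_eq_0_iff)
 have "mu l + mu l ~= 0" using H.V_nz[OF mu l] H.two by (metis mult_2 mult_eq_0_iff)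
 then have "unit (X + m)" unfolding X_def m_def using has_ct_add[OF has_ct_hXat[OF l] has_ct_fconst] unit_closed(1) by blast
 then have "unit (- ((X + m) / (X * m)))" unfolding X_def m_def by (intro unit_closed(2,4,5) unit_X unit_const H.V_nz mu l)
 moreover have "(m / X - X / m) / (X - m) = - ((X + m) / (X * m))" using nz by (simp add: divide_simps) (simp add: algebra_simps)
 ultimately show ?thesis using True by (simp add: cc_x[OF mu l] X_def m_def)
qed

lemma q_simps: "q ~= 0" "q - inverse q ~= 0"
proof -
 show "q ~= 0" by (rule H.q_nz)
 then have "q * (q - inverse q) = q\<^sup>2 - 1" by (simp add: algebra_simps power2_eq_square)
 then show "q - inverse q ~= 0" using q_sq by auto
qed

lemma Ah_pseries:
 assumes k: "k < n" and mu: "mu \<in> V" and f: "\<not> fixd k mu"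
 shows "H.Ah k mu \<in> pseries n"
proof (cases "k = 0")
 case True
 have l: "1 \<in> {1..n}" using k by simp
 have "mu 1 ^ 2 ~= 1" using f True by (metis fixd_def inverse_unique power2_eq_square)
 then have "mu 1 ^ 2 - 1 ~= 0" by simp
 then have "has_ct n (H.Ah k mu) (mu 1 * ((p0 - inverse p1) * mu 1 - (p0 * inverse p1 - 1)) / (mu 1 ^ 2 - 1))"
  unfolding H.Ah_def ha_def if_P[OF True] H.ca_def H.cb_def
  by (intro has_ct_divide has_ct_mult has_ct_diff has_ct_power has_ct_1 has_ct_fconst has_ct_hXat l)
 then show ?thesis using pseries_iff by blast
next
 case False
 have l: "k \<in> {1..n}" "Suc k \<in> {1..n}" using k False by auto
 have "mu (Suc k) - mu k ~= 0" using f False by (simp add: fixd_def)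
 then have "has_ct n (H.Ah k mu) ((q - inverse q) * mu (Suc k) / (mu (Suc k) - mu k))"
  unfolding H.Ah_def hg_def if_not_P[OF False] H.cq_def
  by (intro has_ct_divide has_ct_mult has_ct_diff has_ct_fconst has_ct_hXat l)
 then show ?thesis using pseries_iff by blast
qed

lemma unit_Bh_num:
 assumes k: "k < n" "k ~= 0" and mu: "mu \<in> V" and "mu (Suc k) ~= q\<^sup>2 * mu k"
 shows "unit (fconst q * hXat mu k - fconst (inverse q) * hXat mu (Suc k))"
proof (rule unit_closed(1))
 have l: "k \<in> {1..n}" "Suc k \<in> {1..n}" using k by auto
 show "has_ct n (fconst q * hXat mu k - fconst (inverse q) * hXat mu (Suc k)) (q * mu k - inverse q * mu (Suc k))"
  by (intro has_ct_diff has_ct_mult has_ct_fconst has_ct_hXat l)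
 have "q * (q * mu k - inverse q * mu (Suc k)) = q\<^sup>2 * mu k - mu (Suc k)"
  using q_simps by (simp add: algebra_simps power2_eq_square)
 then show "q * mu k - inverse q * mu (Suc k) ~= 0" using assms(4) by auto
qed

text \<open>\<open>cu\<close> cancels the pole of \<open>Bh\<close>. The remaining numerator is a
  unit: for \<open>k = 0\<close> because the label is 1 or -1 while \<open>p0\<close> and
  \<open>p1\<close> are neither, for other \<open>k\<close> because \<open>q ^ 2\<close> is not
  1.\<close>

lemma al_unit_fixed:
 assumes k: "k < n" and mu: "mu \<in> V" and f: "fixd k mu"
 shows "unit (cu k mu * H.Bh k mu)"
proof (cases "k = 0")
 case True
 have l: "1 \<in> {1..n}" using k by simp
 define X m P0 P1 where "X = hXat mu 1" and "m = fconst (mu 1)" and "P0 = fconst p0" and "P1 = fconst p1"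
 have m0: "mu 1 ~= 0" by (rule H.V_nz[OF mu l])
 have "mu 1 * mu 1 = 1" using f True m0 by (metis fixd_def field_class.field_inverse)
 then have m1: "mu 1 = 1 \<or> mu 1 = - 1" by (metis power2_eq_square power2_eq_1_iff)
 have mm: "m * m = 1" unfolding m_def fhom_mult[OF fconst_fhom, symmetric] \<open>mu 1 * mu 1 = 1\<close> by (rule fconst_simps(1))
 have nz: "X ~= 0" "X ^ 2 - 1 ~= 0" "m ~= 0" using mm by (auto simp: X_def hX_nz H.hX_sq_neq_1)
 have "mu 1 + p0 ~= 0" "mu 1 - p1 ~= 0" using m1 p_neq by (auto simp: add_eq_0_iff)
 then have u: "unit (X + P0)" "unit (X - P1)" unfolding X_def P0_def P1_def
  using has_ct_add[OF has_ct_hXat[OF l] has_ct_fconst] has_ct_diff[OF has_ct_hXat[OF l] has_ct_fconst] unit_closed(1) by blast+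
 have "cu k mu = m / X - X / m" using True cc_x[OF mu l] by (simp add: cu_def X_def m_def)
 also have "... = - (X ^ 2 - 1) / (m * X)" using nz mm by (simp add: divide_simps) (simp add: algebra_simps power2_eq_square)
 finally have c: "cu k mu = - (X ^ 2 - 1) / (m * X)" .
 have b: "H.Bh k mu = fconst (inverse p1) * ((X + P0) * (X - P1)) / (X ^ 2 - 1)"
  using True by (simp add: H.Bh_eq X_def P0_def P1_def)
 have "- D / (m * X) * (i * y / D) = - (i * y / (m * X))" if "D ~= 0" for D i y using that by simp
 from this[OF nz(2)] have "cu k mu * H.Bh k mu = - (fconst (inverse p1) * ((X + P0) * (X - P1)) / (m * X))" unfolding c b .
 also have "unit ..." unfolding m_def
  using H.p1_nz unit_X[OF mu l, folded X_def] by (intro unit_closed(2,4,5) u unit_const m0) auto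
 finally show ?thesis .
next
 case False
 have l: "k \<in> {1..n}" "Suc k \<in> {1..n}" using k False by auto
 have f': "mu (Suc k) = mu k" using f False by (simp add: fixd_def)
 define X Y m N where "X = hXat mu k" and "Y = hXat mu (Suc k)" and "m = fconst (mu k)"
  and "N = fconst q * hXat mu k - fconst (inverse q) * hXat mu (Suc k)"
 have m0: "mu k ~= 0" by (rule H.V_nz[OF mu l(1)])
 have nz: "X ~= 0" "Y ~= 0" "m ~= 0" "X - Y ~= 0" using m0 hX_neq[of k "Suc k" mu] by (auto simp: X_def Y_def m_def hX_nz fconst_eq_0_iff)
 have c: "cu k mu = - ((X - Y) * (m * m + X * Y) / (m * (X * Y)))"
 proof -
  have "cu k mu = m / X - X / m - (m / Y - Y / m)"
   unfolding cu_def if_not_P[OF False] cc_x[OF mu l(1)] cc_x[OF mu l(2)] f' X_def Y_def m_def ..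
  then show ?thesis using nz by (simp add: divide_simps) (simp add: algebra_simps)
 qed
 have b: "H.Bh k mu = N / (X - Y)" using False by (simp add: H.Bh_eq X_def Y_def N_def)
 have "mu k * mu k + mu k * mu (Suc k) = 2 * (mu k * mu k)" unfolding f' by simp
 then have "mu k * mu k + mu k * mu (Suc k) ~= 0" using m0 H.two by simp
 then have u: "unit (m * m + X * Y)" unfolding m_def X_def Y_def
  by (rule unit_closed(1)[rotated]) (intro has_ct_add has_ct_mult has_ct_fconst has_ct_hXat l)
 have "q\<^sup>2 * mu k ~= mu k" using m0 q_sq by simp
 then have N: "unit N" unfolding N_def using f' by (intro unit_Bh_num[OF k False mu]) simp
 have "- (D * i / j) * (y / D) = - (i * y / j)" if "D ~= 0" for D i y j :: "'k mps fract" using that by simp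
 from this[OF nz(4)] have "cu k mu * H.Bh k mu = - ((m * m + X * Y) * N / (m * (X * Y)))" unfolding c b .
 also have "unit ..." using unit_X[OF mu l(1), folded X_def] unit_X[OF mu l(2), folded Y_def] unit_const[OF m0, folded m_def]
  by (intro unit_closed(2,4,5) u N)
 finally show ?thesis .
qed

text \<open>Away from fixed labels the zeros of \<open>Dk\<close> and \<open>Bh\<close> have to
  match. For \<open>k = 0\<close>, the two linear factors in the numerator of \<open>Bh\<close>
  correspond to the two summands of the framing; for other \<open>k\<close> the numerator has zero
  constant term exactly along an arrow, where \<open>cu\<close> enters to the first power.\<close>

lemma al_unit:
 assumes k: "k < n" and mu: "mu \<in> V"
 shows "unit (al k mu)"
proof (cases "fixd k mu")
 case True
 then have "al k mu = inverse (cu k mu * H.Bh k mu)" by (simp add: al_def Dk_def divide_inverse)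
 then show ?thesis using unit_closed(3)[OF al_unit_fixed[OF k mu True]] by simp
next
 case nf: False
 show ?thesis
 proof (cases "k = 0")
  case True
  have l: "1 \<in> {1..n}" using k by simp
  define X u where "X = hXat mu 1" and "u = cc mu (fvar 1)"
  have "mu 1 ^ 2 ~= 1" using nf True by (metis fixd_def inverse_unique power2_eq_square)
  then have "mu 1 ^ 2 - 1 ~= 0" by simp
  then have sq: "unit (X ^ 2 - 1)" unfolding X_def
   by (rule unit_closed(1)[rotated]) (intro has_ct_diff has_ct_power has_ct_1 has_ct_hXat l)
  have P: "X + fconst p0 = X - fconst (- p0)" by (simp add: fhom_minus[OF fconst_fhom])
  have "al k mu = u ^ (of_bool (mu 1 = p1) + of_bool (mu 1 = - p0)) / (fconst (inverse p1) * ((X + fconst p0) * (X - fconst p1)) / (X ^ 2 - 1))"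
   unfolding al_def using nf True by (simp add: Dk_def cu_def ex_def framing_def H.Bh_eq X_def u_def)
  also have "... = (u ^ of_bool (mu 1 = p1) / (X - fconst p1)) * (u ^ of_bool (mu 1 = - p0) / (X - fconst (- p0))) * (X ^ 2 - 1) * inverse (fconst (inverse p1))"
   unfolding P power_add by (simp add: divide_inverse)
  also have "unit ..." unfolding X_def u_def
   by (intro unit_closed(2,3) unit_linear[OF mu l] sq[unfolded X_def] unit_const) (simp add: H.p1_nz)
  finally show ?thesis .
 next
  case False
  have l: "k \<in> {1..n}" "Suc k \<in> {1..n}" using k False by auto
  define X Y x y N where "X = hXat mu k" and "Y = hXat mu (Suc k)" and "x = fconst (mu k)" and "y = fconst (mu (Suc k))"
   and "N = fconst q * hXat mu k - fconst (inverse q) * hXat mu (Suc k)"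
  have m0: "mu k ~= 0" "mu (Suc k) ~= 0" using H.V_nz[OF mu] l by auto
  have "mu k - mu (Suc k) ~= 0" using nf False by (simp add: fixd_def)
  then have XY: "unit (X - Y)" unfolding X_def Y_def by (rule unit_closed(1)[rotated]) (intro has_ct_diff has_ct_hXat l)
  have al: "al k mu = cu k mu ^ of_bool (mu (Suc k) = q\<^sup>2 * mu k) / (N / (X - Y))"
   using nf False by (simp add: al_def Dk_def ex_def arrows_def H.Bh_eq X_def Y_def N_def)
  show ?thesis
  proof (cases "mu (Suc k) = q\<^sup>2 * mu k")
   case nq: False
   have "unit ((X - Y) / N)" unfolding N_def by (intro unit_closed(4) XY unit_Bh_num[OF k False mu nq])
   then show ?thesis using nq by (simp add: al)
  next
   case arr: True
   have nz: "X ~= 0" "Y ~= 0" "x ~= 0" "y ~= 0" "N ~= 0" using m0 hX_lin_nz[of k "Suc k" q mu "inverse q"] q_simps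
    by (auto simp: X_def Y_def x_def y_def N_def hX_nz fconst_eq_0_iff)
   have y: "y = fconst q * fconst q * x" unfolding y_def x_def arr fhom_mult[OF fconst_fhom] power2_eq_square ..
   have "fconst q * fconst (inverse q) = (1 :: 'k mps fract)"
    using q_simps by (simp add: fhom_mult[OF fconst_fhom, symmetric] fconst_simps)
   then have qN: "fconst q * N = fconst q * fconst q * X - Y" unfolding N_def X_def Y_def by (simp add: right_diff_distrib)
   \<comment> \<open>Since \<open>y\<close> is \<open>q ^ 2\<close> times \<open>x\<close>, the
     second factor is \<open>- q * N / X\<close>, so \<open>N\<close> cancels in \<open>al\<close>;
     the first factor has constant term twice \<open>mu k / mu (Suc k)\<close> and is a
     unit.\<close>
   have "cu k mu = (X / y + x / Y) * (Y / X - y / x)"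
   proof -
    have "cu k mu = x / X - X / x - (y / Y - Y / y)"
     unfolding cu_def if_not_P[OF False] cc_x[OF mu l(1)] cc_x[OF mu l(2)] X_def Y_def x_def y_def ..
    then show ?thesis using nz by (simp add: divide_simps) (simp add: algebra_simps)
   qed
   also have "Y / X - y / x = - (fconst q * N) / X" unfolding qN y using nz by (simp add: divide_simps)
   finally have c: "cu k mu = (X / y + x / Y) * (- (fconst q * N) / X)" .
   have "al k mu = - ((X / y + x / Y) * fconst q * (X - Y) / X)" unfolding al using arr nz by (simp add: c)
   moreover have "mu k / mu (Suc k) + mu k / mu (Suc k) ~= 0" using m0 H.two by (simp)
   then have "unit (X / y + x / Y)" unfolding X_def x_def Y_def y_def
    by (rule unit_closed(1)[rotated]) (intro has_ct_add has_ct_divide has_ct_fconst has_ct_hXat l m0)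
   ultimately show ?thesis
    using XY unit_X[OF mu l(1), folded X_def] unit_const[OF q_simps(1)] by (auto intro!: unit_closed(2,4,5))
  qed
 qed
qed

text \<open>At fixed labels both terms have poles. As \<open>Ck = - Dk\<close> there,
  \<open>be\<close> equals \<open>- al * (Bh + Ah)\<close>, and \<open>Bh + Ah\<close> is the
  constant \<open>hq k\<close>.\<close>

lemma be_pseries:
 assumes k: "k < n" and mu: "mu \<in> V"
 shows "be k mu \<in> pseries n"
proof (cases "fixd k mu")
 case True
 have "al k mu * H.Bh k mu = inverse (cu k mu)" using True by (simp add: al_def Dk_def H.Bh_nz)
 then have "be k mu = - (al k mu * (H.Bh k mu + H.Ah k mu))" using True by (simp add: be_def Ck_def distrib_left)
 also have "H.Bh k mu + H.Ah k mu = H.hq k" by (simp add: H.Bh_def)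
 finally show ?thesis using unit_pseries[OF al_unit[OF k mu]] by (auto simp: H.hq_def intro!: pseries_closed)
next
 case False
 then show ?thesis using unit_pseries[OF al_unit[OF k mu]] Ah_pseries[OF k mu False]
  by (auto simp: be_def Ck_def intro!: pseries_closed)
qed

definition dd :: "(nat => 'k) => 'k mps fract => 'k mps fract" where
 "dd mu = (SOME G. fcoord n G \<and> (\<forall>z. G (cc mu z) = z) \<and> (\<forall>z. cc mu (G z) = z))"

lemma dd:
 assumes "mu \<in> V"
 shows "fcoord n (dd mu)" "dd mu (cc mu z) = z" "cc mu (dd mu z) = z"
proof -
 have "\<exists>G. fcoord n G \<and> (\<forall>z. G (cc mu z) = z) \<and> (\<forall>z. cc mu (G z) = z)"
  using fcoord_inverse[OF H.cc(1)[OF assms]] by metis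
 then have "fcoord n (dd mu) \<and> (\<forall>z. dd mu (cc mu z) = z) \<and> (\<forall>z. cc mu (dd mu z) = z)"
  unfolding dd_def by (rule someI_ex)
 then show "fcoord n (dd mu)" "dd mu (cc mu z) = z" "cc mu (dd mu z) = z" by blast+
qed

lemma dd_fhom: "mu \<in> V ==> fhom (dd mu)" using dd(1) fcoord_fhom by blast

definition Theta' :: "('k, 'k) svec => ('k, 'k) svec" where
 "Theta' F = vec V (\<lambda>mu. inverse (gauge mu) * dd mu (F mu))"

definition phi :: "('k, 'k) svec => ('k, 'k) svec" where
 "phi m = vec V (\<lambda>mu. cc mu (m mu))"

definition phi' :: "('k, 'k) svec => ('k, 'k) svec" where
 "phi' m = vec V (\<lambda>mu. dd mu (m mu))"

abbreviation "MM \<equiv> carrier (coef_ring V (pseries n)) :: ('k, 'k) svec set"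

lemma MM_iff: "m \<in> MM \<longleftrightarrow> (\<forall>nu\<in>V. m nu \<in> pseries n) \<and> m \<in> supp V"
 by (auto simp: coef_ring_def supp_def)

lemma vec_MM: "(!!mu. mu \<in> V ==> f mu \<in> pseries n) ==> vec V f \<in> MM"
 by (simp add: MM_iff supp_closed) (simp add: vec_def)

lemma phi_MM: "m \<in> MM ==> phi m \<in> MM" "m \<in> MM ==> phi' m \<in> MM" unfolding phi_def phi'_def
 by (rule vec_MM, rule fcoord_pseries[OF H.cc(1)], assumption, simp add: MM_iff,
   rule vec_MM, rule fcoord_pseries[OF dd(1)], assumption, simp add: MM_iff)

lemma tk_eq:
 assumes "k < n" "G \<in> supp V"
 shows "tk k G = (\<lambda>mu. vec V (al k) mu * H.\<rho> (HT k) G mu + vec V (be k) mu * G mu)"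
proof
 fix mu
 show "tk k G mu = vec V (al k) mu * H.\<rho> (HT k) G mu + vec V (be k) mu * G mu"
 proof (cases "mu \<in> V")
  case True
  have D: "al k mu * H.Bh k mu = Dk k mu" by (simp add: al_def H.Bh_nz)
  have "al k mu * H.\<rho> (HT k) G mu + be k mu * G mu = Ck k mu * G mu + (al k mu * H.Bh k mu) * H.rh mu k (G (K.sw k mu))"
   unfolding H.T_at be_def by (simp add: algebra_simps)
  then have "al k mu * H.\<rho> (HT k) G mu + be k mu * G mu = Ck k mu * G mu + Dk k mu * H.rh mu k (G (K.sw k mu))"
   unfolding D .
  then show ?thesis by (simp add: tk_def vec_def)
 qed (simp add: tk_def vec_def)
qed

lemma Theta_props:
 "Theta g \<in> supp V" "Theta' g \<in> supp V"
 "Theta (\<lambda>mu. g mu + g' mu) = (\<lambda>mu. Theta g mu + Theta g' mu)" (is ?g1)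
 "Theta' (\<lambda>mu. g mu + g' mu) = (\<lambda>mu. Theta' g mu + Theta' g' mu)" (is ?g2)
 "Theta (\<lambda>mu. m mu * g mu) = (\<lambda>mu. phi m mu * Theta g mu)" (is ?g3)
 "Theta' (\<lambda>mu. m mu * g mu) = (\<lambda>mu. phi' m mu * Theta' g mu)" (is ?g4)
 "g \<in> supp V ==> Theta (Theta' g) = g" (is "PROP ?g5") "g \<in> supp V ==> Theta' (Theta g) = g" (is "PROP ?g6")
proof -
 note defs = Theta_def Theta'_def phi_def phi'_def vec_def supp_def fun_eq_iff
 note hs = fhom_add[OF cc_fhom] fhom_mult[OF cc_fhom] fhom_add[OF dd_fhom] fhom_mult[OF dd_fhom] distrib_left mult.left_commute
 show "Theta g \<in> supp V" "Theta' g \<in> supp V" by (simp_all add: defs)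
 show ?g1
  ?g2
  ?g3
  ?g4 by (simp_all add: defs hs)
 have gi: "gauge mu * (inverse (gauge mu) * z) = z" "inverse (gauge mu) * (gauge mu * z) = z" for mu z
  using K.gauge_nz by (simp_all)
 show "PROP ?g5" "PROP ?g6" by (auto simp: defs dd gi)
qed

text \<open>Forward, \<open>\<tau>\<^sub>k\<close> becomes \<open>al T + be\<close>; backward, this
  is solved for \<open>T\<close>, which is possible over power series because \<open>al\<close> is a
  unit.\<close>

sublocale X: ops_transfer_iso K.gens K.rels K.Gq n KTau V fconst K.\<rho> K.SV yk K.Ak K.Bk "pseries n" "klr_pol n V" K.pol series_of_pol
 H.gens H.rels H.Gq HT H.\<rho> H.sr.SV H.yh H.Ah H.Bh "laurent n" hpol "series_of_laurent V" Theta phi Theta' phi'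
proof
 fix k assume k: "k < n"
 have m: "vec V (al k) \<in> MM" "vec V (be k) \<in> MM" "vec V (\<lambda>mu. inverse (al k mu)) \<in> MM"
  "vec V (\<lambda>mu. - (inverse (al k mu) * be k mu)) \<in> MM"
  using unit_pseries[OF al_unit[OF k]] unit_pseries[OF unit_closed(3)[OF al_unit[OF k]]] be_pseries[OF k]
  by (auto intro!: vec_MM pseries_closed)
 show "\<exists>L\<in>H.hs.ops. \<forall>g\<in>supp V. Theta (K.\<rho> (KTau k) g) = L (Theta g)"
  by (rule bexI[OF _ H.hs.ops_add[OF H.hs.ops_mult[OF H.hs.ops_t[OF k] m(1)] H.hs.ops_M[OF m(2)]]])
   (simp add: Theta_tau[OF k] tk_eq[OF k] Theta_props(1))
 have al: "al k mu ~= 0" if "mu \<in> V" for mu using al_unit[OF k that] has_ct_inverse(2) unfolding unit_def by blast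
 have "Theta' (H.\<rho> (HT k) g) = (\<lambda>mu. phi' (vec V (\<lambda>mu. inverse (al k mu))) mu * K.\<rho> (KTau k) (Theta' g) mu +
   phi' (vec V (\<lambda>mu. - (inverse (al k mu) * be k mu))) mu * Theta' g mu)" (is "?l = ?r") if g: "g \<in> supp V" for g
 proof -
  define F where "F = Theta' g"
  have F: "F \<in> supp V" "Theta F = g" using g by (simp_all add: F_def Theta_props)
  have tF: "K.\<rho> (KTau k) F \<in> supp V" by (rule K.tau_supp[OF k])
  have "tk k g = (\<lambda>mu. vec V (al k) mu * H.\<rho> (HT k) g mu + vec V (be k) mu * g mu)" by (rule tk_eq[OF k g])
  then have e: "tk k g mu = al k mu * H.\<rho> (HT k) g mu + be k mu * g mu" if "mu \<in> V" for mu
   using that by (simp add: vec_def)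
  have "H.\<rho> (HT k) g mu = vec V (\<lambda>mu. inverse (al k mu)) mu * Theta (K.\<rho> (KTau k) F) mu +
    vec V (\<lambda>mu. - (inverse (al k mu) * be k mu)) mu * g mu" for mu
  proof (cases "mu \<in> V")
   case True
   then show ?thesis using al[OF True] by (simp add: Theta_tau[OF k F(1)] F(2) e vec_def distrib_left)
  next
   case False
   then show ?thesis using H.T_zero[OF False k g] by (simp add: vec_def)
  qed
  then have "H.\<rho> (HT k) g = (\<lambda>mu. vec V (\<lambda>mu. inverse (al k mu)) mu * Theta (K.\<rho> (KTau k) F) mu +
    vec V (\<lambda>mu. - (inverse (al k mu) * be k mu)) mu * g mu)" by (rule ext)
  then show ?thesis by (simp only: Theta_props(4,6) Theta_props(8)[OF tF[unfolded F_def]] F_def)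
 qed
 then show "\<exists>L\<in>K.pc.ops. \<forall>g\<in>supp V. Theta' (H.\<rho> (HT k) g) = L (Theta' g)"
  by (intro bexI[OF _ K.pc.ops_add[OF K.pc.ops_mult[OF K.pc.ops_t[OF k] phi_MM(2)[OF m(3)]] K.pc.ops_M[OF phi_MM(2)[OF m(4)]]]] ballI)
next
 show "phi (vec V (\<lambda>_. fconst c)) = vec V (\<lambda>_. fconst c)" for c
  by (auto simp: phi_def vec_def fcoord_fconst[OF H.cc(1)])
qed (simp_all only: Theta_props phi_MM)

lemma phi_inverse: "m \<in> MM ==> phi' (phi m) = m" "m \<in> MM ==> phi (phi' m) = m"
 by (auto simp: phi_def phi'_def vec_def dd MM_iff supp_def)

lemma phi_iso: "alg_iso (\<lambda>c. vec V (\<lambda>_. fconst c)) (coef_ring V (pseries n)) (\<lambda>c. vec V (\<lambda>_. fconst c)) (coef_ring V (pseries n)) phi"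
 unfolding alg_iso_def
proof (intro conjI allI)
 show "phi \<in> ring_iso (coef_ring V (pseries n)) (coef_ring V (pseries n))"
 proof (rule ring_iso_memI)
  show "bij_betw phi MM MM" by (rule bij_betw_byWitness[where f' = phi']) (auto simp: phi_inverse phi_MM)
 qed (auto simp: phi_MM H.hs.coef_ring_simps, auto simp: phi_def vec_def fun_eq_iff fhom_simps[OF cc_fhom])
qed (rule X.\<phi>_sc)

lemma phi_idem: "nu \<in> V ==> phi (at_idem nu z) = at_idem nu (cc nu z)"
 by (rule ext) (auto simp: phi_def vec_def at_idem_def fhom_zero[OF cc_fhom])

text \<open>Recognises the algebras and elements of the theorem as instances of the abstract
  completion, so that everything proved about operators applies to them.\<close>

lemma hat_simps:
 "klr_hat inverse (arrows q) (framing p0 p1) n V = K.pc.TR" (is ?g1)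
 "klr_elt inverse (arrows q) (framing p0 p1) n V r f = K.pc.elt r f" (is ?g2)
 "hecke_hat (pseries n) q p0 p1 n V = H.hs.TR" "hecke_elt (pseries n) q p0 p1 n V h f = H.hs.elt h f" (is ?g3)
 "hecke_hat (pfrac n) q p0 p1 n V = H.hf.TR" "hecke_elt (pfrac n) q p0 p1 n V h f = H.hf.elt h f" (is ?g4)
 "hecke_incl q p0 p1 n V C = H.hf.tcls (SOME z. z \<in> C)" (is ?g5)
 "hecke_fun q p0 p1 n V g = H.hf.elt 1 (vec V g)" (is ?g6)
proof -
 have k: "klr_of_pol inverse (arrows q) (framing p0 p1) n V = (\<lambda>p. pcls K.gens K.rels (K.pol p))"
  by (rule ext) (simp add: klr_of_pol_def klr_cls_def)
 have h: "hecke_of_laurent q p0 p1 n = (\<lambda>p. pcls H.gens H.rels (hpol p))"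
  by (rule ext) (simp add: hecke_of_laurent_def hecke_cls_def hpol_def hmon_def)
 show ?g1
  ?g2 by (simp_all add: klr_hat_def klr_elt_def k klr_alg_def klr_cls_def)
 show "hecke_hat (pseries n) q p0 p1 n V = H.hs.TR" ?g3
  "hecke_hat (pfrac n) q p0 p1 n V = H.hf.TR" ?g4
  ?g5
  ?g6
  by (simp_all add: hecke_hat_def hecke_elt_def hecke_tensor_cls_def hecke_alg_def hecke_cls_def h hecke_incl_def hecke_fun_def)
qed

section \<open>Intertwiners and the images of the generators\<close>

lemma fun_K:
 assumes "!!mu. mu \<in> V ==> f mu \<in> pfrac n"
 shows "H.hf.elt 1 (vec V f) \<in> carrier H.hf.TR"
  "g \<in> supp V ==> H.hf.tact (H.hf.elt 1 (vec V f)) g = (\<lambda>mu. vec V f mu * g mu)" (is "PROP ?g1")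
proof -
 have "vec V f \<in> H.hf.M" using assms by (auto simp: coef_ring_def vec_def)
 then show "H.hf.elt 1 (vec V f) \<in> carrier H.hf.TR" by (intro H.hf.elt_carrier fcar_closed)
 show "PROP ?g1" by (simp add: H.hf.elt_act H.fa.act_one)
qed

lemma hX_pfrac: "mu \<in> V ==> l \<in> {1..n} ==> hXat mu l \<in> pfrac n" by (rule pfrac_closed)

text \<open>The operator \<open>T - hq\<close> equals \<open>Bh (S - 1)\<close>, and the coefficient
  in the intertwiner is the inverse of \<open>Bh\<close>; so the intertwiner acts as the bare
  reflection.\<close>

lemma Phi:
 assumes k: "k < n"
 shows "hecke_Phi q p0 p1 n V k \<in> carrier H.hf.TR" (is ?g1)
  "g \<in> supp V ==> H.hf.tact (hecke_Phi q p0 p1 n V k) g = H.sr.SV k g"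
proof -
 define b where "b mu = inverse (H.Bh k mu)" for mu
 define T where "T = H.hf.elt (hT k) \<one>\<^bsub>coef_ring V (pfrac n)\<^esub>"
 define c where "c = H.hf.elt 1 (vec V (\<lambda>_. H.hq k))"
 define B where "B = H.hf.elt 1 (vec V b)"
 have Phi: "hecke_Phi q p0 p1 n V k = \<one>\<^bsub>H.hf.TR\<^esub> \<oplus>\<^bsub>H.hf.TR\<^esub> B \<otimes>\<^bsub>H.hf.TR\<^esub> (T \<ominus>\<^bsub>H.hf.TR\<^esub> c)"
 proof (cases "k = 0")
  case True
  have "fconst p1 * ((hXat mu 1 ^ 2 - 1) / ((hXat mu 1 + fconst p0) * (hXat mu 1 - fconst p1))) = b mu" for mu
   by (simp add: b_def True H.Bh_eq fconst_inverse divide_inverse)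
  then show ?thesis using True by (simp add: hecke_Phi_def Let_def hat_simps B_def T_def c_def H.hq_def)
 next
  case False
  have "(hXat mu k - hXat mu (k + 1)) / (fconst q * hXat mu k - fconst (inverse q) * hXat mu (k + 1)) = b mu" for mu
   using False by (simp add: b_def H.Bh_eq)
  then show ?thesis using False by (simp add: hecke_Phi_def Let_def hat_simps B_def T_def c_def H.hq_def)
 qed
 have hq: "H.hq k \<in> pfrac n" by (simp add: H.hq_def pfrac_closed)
 have b: "b mu \<in> pfrac n" if "mu \<in> V" for mu unfolding b_def H.Bh_def by (intro pfrac_closed hq H.Ah_pfrac k that)
 have T: "T \<in> carrier H.hf.TR" "H.hf.tact T g = H.\<rho> (HT k) g" if "g \<in> supp V" for g
  unfolding T_def H.hf.coef_ring_simps
  using that k by (simp_all add: H.hf.elt_carrier H.gens_closed H.hf.M_closed H.hf.elt_act H.hf.one_F H.fa.act_gen)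
 have c: "c \<in> carrier H.hf.TR" "!!g. g \<in> supp V ==> H.hf.tact c g = (\<lambda>mu. vec V (\<lambda>_. H.hq k) mu * g mu)"
  unfolding c_def by (rule fun_K, rule hq, rule fun_K, rule hq)
 have B: "B \<in> carrier H.hf.TR" "!!g. g \<in> supp V ==> H.hf.tact B g = (\<lambda>mu. vec V b mu * g mu)"
  unfolding B_def by (rule fun_K, rule b, assumption, rule fun_K, rule b)
 have T1: "T \<in> carrier H.hf.TR" by (rule T(1)[OF supp_closed(5)])
 note Tc = H.hf.TR_minus[OF T1 c(1)]
 note BT = H.hf.TR_mult[OF B(1) Tc(1)]
 interpret ab: abelian_group H.hf.TR by (rule H.hf.TR_abelian)
 show ?g1 unfolding Phi using BT(1) H.hf.TR_one(1) by simp
 show "H.hf.tact (hecke_Phi q p0 p1 n V k) g = H.sr.SV k g" if g: "g \<in> supp V"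
 proof (rule H.sr.fun_V_eqI)
  have Tg: "(\<lambda>mu. H.\<rho> (HT k) g mu - vec V (\<lambda>_. H.hq k) mu * g mu) \<in> supp V"
   by (rule supp_closed(2)[OF H.fa.\<rho>_supp supp_closed(3)]) (use k g in \<open>auto simp: hecke_gens_def\<close>)
  have "H.hf.tact (hecke_Phi q p0 p1 n V k) g = (\<lambda>mu. g mu + vec V b mu * (H.\<rho> (HT k) g mu - vec V (\<lambda>_. H.hq k) mu * g mu))"
   unfolding Phi H.hf.TR_add[OF H.hf.TR_one(1) BT(1) g] H.hf.TR_one(2)[OF g] BT(2)[OF g] Tc(2)[OF g] T(2)[OF g] c(2)[OF g] B(2)[OF Tg] ..
  then have e: "H.hf.tact (hecke_Phi q p0 p1 n V k) g mu = g mu + b mu * (H.\<rho> (HT k) g mu - H.hq k * g mu)" if "mu \<in> V" for mu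
   using that by (simp add: vec_def)
  show "H.hf.tact (hecke_Phi q p0 p1 n V k) g \<in> supp V"
   using H.hf.ops_supp[OF H.hf.tact_ops g] \<open>hecke_Phi q p0 p1 n V k \<in> carrier H.hf.TR\<close> by blast
  show "H.sr.SV k g \<in> supp V" by (rule H.sr.SV_supp)
  fix mu assume mu: "mu \<in> V"
  have d: "H.\<rho> (HT k) g mu - H.hq k * g mu = H.Bh k mu * (H.sr.SV k g mu - g mu)"
   unfolding H.T_at H.sr.SV_at[OF mu] H.Bh_def by (simp add: algebra_simps)
  have "inverse (H.Bh k mu) * (H.Bh k mu * z) = z" for z by (simp add: H.Bh_nz)
  note bi = this
  show "H.hf.tact (hecke_Phi q p0 p1 n V k) g mu = H.sr.SV k g mu" unfolding e[OF mu] d b_def bi by simp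
 qed
qed

abbreviation "tau_image k nu \<equiv> hecke_incl q p0 p1 n V (X.transfer (K.pc.elt (ke nu * kt k) \<one>\<^bsub>coef_ring V (pseries n)\<^esub>))"

text \<open>A class over power series and its inclusion have the same action, as both evaluate the
  same representative, and the completion over fractions is faithful. The idempotent
  \<open>ke nu\<close> in front leaves only the component at \<open>nu\<close>.\<close>

lemma incl_eqI:
 assumes k: "k < n" and nu: "nu \<in> V" and D: "D \<in> carrier H.hf.TR"
  and act: "!!g. g \<in> supp V ==> H.hf.tact D g = at_idem nu (tk k g nu)"
 shows "tau_image k nu = D"
proof -
 define E where "E = K.pc.elt (ke nu * kt k) \<one>\<^bsub>coef_ring V (pseries n)\<^esub>"
 have gk: "ke nu * kt k \<in> fcar K.gens" using k nu by (intro fcar_closed(8) K.gens_closed)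
 have E: "E \<in> carrier K.pc.TR" unfolding E_def K.pc.coef_ring_simps by (intro K.pc.elt_carrier gk K.pc.M_closed)
 define C where "C = X.transfer E"
 have C: "C \<in> carrier H.hs.TR" unfolding C_def by (rule X.transfer(1)[OF E])
 have s: "keys (SOME z. z \<in> C) \<subseteq> carrier H.hs.R \<times> H.hf.M"
  using H.hs.some_carrier[OF C] pseries_pfrac by (fastforce simp: coef_ring_def)
 have inc: "hecke_incl q p0 p1 n V C \<in> carrier H.hf.TR" unfolding hat_simps by (rule H.hf.tcls_carrier[OF s])
 have ia: "H.hf.tact (hecke_incl q p0 p1 n V C) g = H.hs.tact C g" if "g \<in> supp V" for g
  by (simp only: hat_simps H.hf.tact_tcls[OF that] tensor_act_eq[of _ C])
 have "hecke_incl q p0 p1 n V C = D"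
 proof (rule H.hf.tact_inj[OF inc D])
  fix g assume "g \<in> H.hf.M"
  then have g: "g \<in> supp V" by (rule H.hf.M_FF)
  define F where "F = Theta' g"
  have F: "F \<in> supp V" "Theta F = g" using g by (simp_all add: F_def Theta_props)
  have "K.pc.tact E F = at_idem nu (K.\<rho> (KTau k) F nu)"
   using F k nu by (simp add: E_def K.pc.elt_act K.pc.coef_ring_simps K.pc.one_F K.fa.act_mult K.gens_closed K.fa.act_gen)
  then have "H.hs.tact C g = Theta (at_idem nu (K.\<rho> (KTau k) F nu))"
   using X.transfer(2)[OF E F(1)] by (simp only: C_def F(2))
  also have "... = at_idem nu (Theta (K.\<rho> (KTau k) F) nu)"
   using nu by (intro ext) (auto simp: Theta_def at_idem_def vec_def fhom_zero[OF cc_fhom])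
  also have "... = at_idem nu (tk k g nu)" unfolding Theta_tau[OF k F(1)] F(2) ..
  finally show "H.hf.tact (hecke_incl q p0 p1 n V C) g = H.hf.tact D g" by (simp only: ia[OF g] act[OF g])
 qed
 then show ?thesis by (simp only: C_def E_def)
qed

text \<open>The idempotent on the left retains the component at \<open>nu\<close>, so the value
  \<open>f nu\<close> alone decides. This is why the stated coefficient functions may contain both
  \<open>nu\<close> and their argument.\<close>

lemma coef_Phi:
 assumes k: "k < n" and nu: "nu \<in> V" and f: "!!mu. mu \<in> V ==> f mu \<in> pfrac n"
 defines "K \<equiv> H.hf.TR" and "\<Phi> \<equiv> hecke_Phi q p0 p1 n V k" and "e \<equiv> H.hf.elt 1 (vec V (at_idem nu 1))" and "F \<equiv> H.hf.elt 1 (vec V f)"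
 shows "fixd k nu ==> f nu = inverse (cu k nu) ==>
   tau_image k nu = e \<otimes>\<^bsub>K\<^esub> (F \<otimes>\<^bsub>K\<^esub> (\<Phi> \<ominus>\<^bsub>K\<^esub> \<one>\<^bsub>K\<^esub>))"
  and "\<not> fixd k nu ==> f nu = cu k nu ^ ex k nu ==>
   tau_image k nu = e \<otimes>\<^bsub>K\<^esub> (F \<otimes>\<^bsub>K\<^esub> \<Phi>)"
  and "\<not> fixd k nu ==> ex k nu = 0 ==>
   tau_image k nu = e \<otimes>\<^bsub>K\<^esub> \<Phi>"
proof -
 have at: "at_idem nu 1 mu \<in> pfrac n" for mu by (simp add: at_idem_def pfrac_closed)
 have e: "e \<in> carrier K" "g \<in> supp V ==> H.hf.tact e g = (\<lambda>mu. vec V (at_idem nu 1) mu * g mu)" for g :: "('k, 'k) svec"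
  unfolding e_def K_def by (rule fun_K, rule at, rule fun_K, rule at)
 have F: "F \<in> carrier K" "g \<in> supp V ==> H.hf.tact F g = (\<lambda>mu. vec V f mu * g mu)" for g :: "('k, 'k) svec"
  unfolding F_def K_def by (rule fun_K, rule f, assumption, rule fun_K, rule f)
 note Ph = Phi[OF k, folded K_def \<Phi>_def]
 note one = H.hf.TR_one[folded K_def] and mult = H.hf.TR_mult[folded K_def] and ts = H.hf.ops_supp[OF H.hf.tact_ops, folded K_def]
 note P1 = H.hf.TR_minus[folded K_def, OF Ph(1) one(1)]
 note FP1 = mult(1)[OF F(1) P1(1)] and FP = mult(1)[OF F(1) Ph(1)]
 have ed: "H.hf.tact (e \<otimes>\<^bsub>K\<^esub> D) g = at_idem nu (H.hf.tact D g nu)" if D: "D \<in> carrier K" and g: "g \<in> supp V" for D g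
  unfolding mult(2)[OF e(1) D g] e(2)[OF ts[OF D g]] by (rule ext) (use nu in \<open>simp add: at_idem_def vec_def\<close>)
 have Fd: "H.hf.tact (F \<otimes>\<^bsub>K\<^esub> D) g nu = f nu * H.hf.tact D g nu" if D: "D \<in> carrier K" and g: "g \<in> supp V" for D g
  unfolding mult(2)[OF F(1) D g] F(2)[OF ts[OF D g]] using nu by (simp add: vec_def)
 note tk = tk_def vec_def Ck_def Dk_def H.sr.SV_at[OF nu]
 note ieq = incl_eqI[OF k nu, folded K_def, OF mult(1)[OF e(1)]]
 show "tau_image k nu = e \<otimes>\<^bsub>K\<^esub> (F \<otimes>\<^bsub>K\<^esub> (\<Phi> \<ominus>\<^bsub>K\<^esub> \<one>\<^bsub>K\<^esub>))" if "fixd k nu" "f nu = inverse (cu k nu)"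
  by (rule ieq[OF FP1]) (use that nu in \<open>simp add: ed[OF FP1] Fd[OF P1(1)] P1(2) Ph(2) one(2) tk algebra_simps\<close>)
 show "tau_image k nu = e \<otimes>\<^bsub>K\<^esub> (F \<otimes>\<^bsub>K\<^esub> \<Phi>)" if "\<not> fixd k nu" "f nu = cu k nu ^ ex k nu"
  by (rule ieq[OF FP]) (use that nu in \<open>simp add: ed[OF FP] Fd[OF Ph(1)] Ph(2) tk\<close>)
 show "tau_image k nu = e \<otimes>\<^bsub>K\<^esub> \<Phi>" if "\<not> fixd k nu" "ex k nu = 0"
  by (rule ieq[OF Ph(1)]) (use that nu in \<open>simp add: ed[OF Ph(1)] Ph(2) tk\<close>)
qed

text \<open>Brings the difference of two coordinates into the factored shape of the theorem. At a
  self-inverse label \<open>fconst (nu 1)\<close> equals its own inverse, which gives the third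
  form.\<close>

lemma cu_simps:
 assumes nu: "nu \<in> V" and k: "k < n"
 shows "1 \<le> k ==> cu k nu = (hXat nu k / fconst (nu (k + 1)) + fconst (nu k) / hXat nu (k + 1)) *
   (hXat nu (k + 1) / hXat nu k - fconst (nu (k + 1)) / fconst (nu k))"
  and "k = 0 ==> cu 0 nu = fconst (nu 1) / hXat nu 1 - hXat nu 1 / fconst (nu 1)"
  and "k = 0 ==> fixd 0 nu ==> inverse (cu 0 nu) = fconst (nu 1) * inverse (inverse (hXat nu 1) - hXat nu 1)"
proof -
 show "cu k nu = (hXat nu k / fconst (nu (k + 1)) + fconst (nu k) / hXat nu (k + 1)) *
   (hXat nu (k + 1) / hXat nu k - fconst (nu (k + 1)) / fconst (nu k))" if "1 \<le> k"
 proof -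
  have l: "k \<in> {1..n}" "k + 1 \<in> {1..n}" and k0: "k ~= 0" using that k by auto
  define X Y x y where "X = hXat nu k" and "Y = hXat nu (k + 1)" and "x = fconst (nu k)" and "y = fconst (nu (k + 1))"
  have nz: "X ~= 0" "Y ~= 0" "x ~= 0" "y ~= 0" unfolding X_def Y_def x_def y_def fconst_eq_0_iff
   by (rule hX_nz, rule hX_nz, rule H.V_nz[OF nu l(1)], rule H.V_nz[OF nu l(2)])
  have "cu k nu = x / X - X / x - (y / Y - Y / y)"
   unfolding cu_def if_not_P[OF k0] Suc_eq_plus1 cc_x[OF nu l(1)] cc_x[OF nu l(2)] X_def Y_def x_def y_def ..
  also have "... = (X / y + x / Y) * (Y / X - y / x)" using nz by (simp add: divide_simps) (simp add: algebra_simps)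
  finally show ?thesis unfolding X_def Y_def x_def y_def .
 qed
 show c0: "cu 0 nu = fconst (nu 1) / hXat nu 1 - hXat nu 1 / fconst (nu 1)" if "k = 0"
  using cc_x[OF nu, of 1] k by (simp add: cu_def)
 show "inverse (cu 0 nu) = fconst (nu 1) * inverse (inverse (hXat nu 1) - hXat nu 1)" if "k = 0" "fixd 0 nu"
 proof -
  have "fconst (nu 1) = inverse (fconst (nu 1) :: 'k mps fract)" using that by (simp add: fixd_def flip: fconst_inverse)
  then have i: "z / fconst (nu 1) = z * fconst (nu 1)" for z :: "'k mps fract" by (simp add: divide_inverse)
  have "cu 0 nu = (inverse (hXat nu 1) - hXat nu 1) * fconst (nu 1)"
   unfolding c0[OF that(1)] i by (simp add: divide_inverse algebra_simps)
  then have "inverse (cu 0 nu) = inverse (inverse (hXat nu 1) - hXat nu 1) * inverse (fconst (nu 1))" by simp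
  then show ?thesis using \<open>fconst (nu 1) = inverse (fconst (nu 1))\<close> by (metis mult.commute)
 qed
qed

lemma cu_fixed:
 assumes nu: "nu \<in> V" and k: "1 \<le> k" "k < n" and fx: "nu k = nu (k + 1)"
 shows "inverse (hXat nu k / fconst (nu (k + 1)) + fconst (nu k) / hXat nu (k + 1)) * inverse (hXat nu (k + 1) / hXat nu k - 1) = inverse (cu k nu)"
proof -
 have "nu (k + 1) ~= 0" using H.V_nz[OF nu, of "k + 1"] k by simp
 then have "fconst (nu (k + 1)) / fconst (nu k) = (1 :: 'k mps fract)" by (simp add: fx fconst_eq_0_iff)
 then show ?thesis unfolding cu_simps(1)[OF nu k(2,1)] by simp
qed

lemma transfer_tau:
 assumes nu: "nu \<in> V" and k: "1 \<le> k" "k < n"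
 shows "tau_image k nu =
  H.hf.elt 1 (vec V (at_idem nu 1)) \<otimes>\<^bsub>H.hf.TR\<^esub> (if nu k = nu (k + 1) then
   H.hf.elt 1 (vec V (\<lambda>mu. inverse (hXat mu k / fconst (nu (k + 1)) + fconst (nu k) / hXat mu (k + 1)) *
       inverse (hXat mu (k + 1) / hXat mu k - 1)))
   \<otimes>\<^bsub>H.hf.TR\<^esub> (hecke_Phi q p0 p1 n V k \<ominus>\<^bsub>H.hf.TR\<^esub> \<one>\<^bsub>H.hf.TR\<^esub>)
  else if nu (k + 1) = q ^ 2 * nu k then
   H.hf.elt 1 (vec V (\<lambda>mu. (hXat mu k / fconst (nu (k + 1)) + fconst (nu k) / hXat mu (k + 1)) *
       (hXat mu (k + 1) / hXat mu k - fconst (nu (k + 1)) / fconst (nu k))))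
   \<otimes>\<^bsub>H.hf.TR\<^esub> hecke_Phi q p0 p1 n V k
  else hecke_Phi q p0 p1 n V k)" (is "_ = _ \<otimes>\<^bsub>_\<^esub> (if _ then H.hf.elt 1 (vec V ?f) \<otimes>\<^bsub>_\<^esub> _ else if _ then H.hf.elt 1 (vec V ?g) \<otimes>\<^bsub>_\<^esub> _ else _)")
proof -
 have l: "k \<in> {1..n}" "k + 1 \<in> {1..n}" using k by auto
 have X: "hXat mu k \<in> pfrac n" "hXat mu (k + 1) \<in> pfrac n" if "mu \<in> V" for mu
  using hX_pfrac[OF that l(1)] hX_pfrac[OF that l(2)] .
 have f: "?f mu \<in> pfrac n" "?g mu \<in> pfrac n" if "mu \<in> V" for mu by (intro pfrac_closed X that)+
 have fx: "fixd k nu \<longleftrightarrow> nu k = nu (k + 1)" using k by (simp add: fixd_def)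
 have ex: "ex k nu = of_bool (nu (k + 1) = q ^ 2 * nu k)" using k by (simp add: ex_def arrows_def)
 consider "nu k = nu (k + 1)" | "nu k ~= nu (k + 1)" "nu (k + 1) = q ^ 2 * nu k" | "nu k ~= nu (k + 1)" "nu (k + 1) ~= q ^ 2 * nu k"
  by blast
 then show ?thesis
 proof cases
  case 1
  show ?thesis unfolding if_P[OF 1] by (rule coef_Phi(1)[OF k(2) nu f(1)]) (simp_all only: fx 1 cu_fixed[OF nu k 1, unfolded 1])
 next
  case 2
  have g: "?g nu = cu k nu ^ ex k nu" unfolding ex cu_simps(1)[OF nu k(2,1)] using 2 by simp
  have nf: "\<not> fixd k nu" using 2 fx by blast
  show ?thesis unfolding if_not_P[OF 2(1)] if_P[OF 2(2)] by (rule coef_Phi(2)[where f = ?g, OF k(2) nu _ nf g], rule f(2))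
 next
  case 3
  show ?thesis unfolding if_not_P[OF 3(1)] if_not_P[OF 3(2)]
   by (rule coef_Phi(3)[OF k(2) nu f(1)]) (simp_all only: fx ex 3 not_False_eq_True of_bool_eq)
 qed
qed

lemma transfer_tau_0:
 assumes nu: "nu \<in> V" and n: "0 < n"
 shows "tau_image 0 nu =
  H.hf.elt 1 (vec V (at_idem nu 1)) \<otimes>\<^bsub>H.hf.TR\<^esub> (if nu 1 = inverse (nu 1) then
   H.hf.elt 1 (vec V (\<lambda>mu. fconst (nu 1) * inverse (inverse (hXat mu 1) - hXat mu 1)))
   \<otimes>\<^bsub>H.hf.TR\<^esub> (hecke_Phi q p0 p1 n V 0 \<ominus>\<^bsub>H.hf.TR\<^esub> \<one>\<^bsub>H.hf.TR\<^esub>)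
  else
   H.hf.elt 1 (vec V (\<lambda>mu. (fconst (nu 1) / hXat mu 1 - hXat mu 1 / fconst (nu 1)) ^ framing p0 p1 (nu 1)))
   \<otimes>\<^bsub>H.hf.TR\<^esub> hecke_Phi q p0 p1 n V 0)" (is "_ = _ \<otimes>\<^bsub>_\<^esub> (if _ then H.hf.elt 1 (vec V ?f) \<otimes>\<^bsub>_\<^esub> _ else H.hf.elt 1 (vec V ?g) \<otimes>\<^bsub>_\<^esub> _)")
proof -
 have l: "1 \<in> {1..n}" using n by simp
 have X: "hXat mu 1 \<in> pfrac n" if "mu \<in> V" for mu using that l by (rule hX_pfrac)
 have f: "?f mu \<in> pfrac n" "?g mu \<in> pfrac n" if "mu \<in> V" for mu
  by (intro pfrac_closed X that, intro pfrac_power pfrac_closed X that)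
 have fx: "fixd 0 nu \<longleftrightarrow> nu 1 = inverse (nu 1)" by (simp add: fixd_def)
 show ?thesis
 proof (cases "nu 1 = inverse (nu 1)")
  case True
  show ?thesis unfolding if_P[OF True]
   by (rule coef_Phi(1)[OF n nu f(1)]) (simp_all only: fx True[symmetric] cu_simps(3)[OF nu n refl])
 next
  case False
  have g: "?g nu = cu 0 nu ^ ex 0 nu" unfolding cu_simps(2)[OF nu n refl] by (simp add: ex_def)
  have nf: "\<not> fixd 0 nu" using False fx by blast
  show ?thesis unfolding if_not_P[OF False] by (rule coef_Phi(2)[where f = ?g, OF n nu _ nf g], rule f(2))
 qed
qed

lemma phi_at:
 "nu \<in> V ==> phi (at_idem nu 1) = at_idem nu 1"
 "nu \<in> V ==> k \<in> {1..n} ==> phi (at_idem nu (fvar k)) = at_idem nu (fconst (nu k) / hXat nu k - hXat nu k / fconst (nu k))"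
 by (simp_all add: phi_idem fhom_one[OF cc_fhom] cc_x del: One_nat_def)

lemma completion_iso: "alg_iso (\<lambda>c. K.pc.elt (scal c) \<one>\<^bsub>coef_ring V (pseries n)\<^esub>) K.pc.TR
  (\<lambda>c. H.hs.elt (scal c) \<one>\<^bsub>coef_ring V (pseries n)\<^esub>) H.hs.TR X.transfer"
 unfolding alg_iso_def using X.transfer_iso X.transfer_scal by blast

end

section \<open>From the hypotheses of the theorem to the setting of the comparison\<close>

lemma theta_seqs_system:
 fixes \<theta> :: "'i => 'i"
 assumes \<theta>\<theta>: "!!i. \<theta> (\<theta> i) = i" and J: "!!i. i \<in> J ==> \<theta> i \<in> J"
 shows "seq_system \<theta> n (theta_seqs \<theta> J n \<beta>)"
proof
 let ?s = "\<lambda>nu k. single (nu k) 1 + single (\<theta> (nu k)) (1 :: nat)"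
 \<comment> \<open>The entries of such a sequence lie in the finite support of
   \<open>\<beta>\<close>, although the vertex set may be infinite.\<close>
 show "finite (theta_seqs \<theta> J n \<beta>)"
 proof (rule finite_subset[OF _ finite_PiE])
  show "theta_seqs \<theta> J n \<beta> \<subseteq> {1..n} \<rightarrow>\<^sub>E keys \<beta>"
  proof
   fix nu assume nu: "nu \<in> theta_seqs \<theta> J n \<beta>"
   have "nu k \<in> keys \<beta>" if k: "k \<in> {1..n}" for k
   proof -
    have "lookup \<beta> (nu k) = (\<Sum>l\<in>{1..n}. lookup (?s nu l) (nu k))"
     using nu by (auto simp: theta_seqs_def lookup_sum simp del: One_nat_def)
    moreover have "0 < lookup (?s nu k) (nu k)" by (simp add: lookup_add)
    ultimately have "0 < lookup \<beta> (nu k)" using member_le_sum[OF k, of "\<lambda>l. lookup (?s nu l) (nu k)"] by simp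
    then show ?thesis by (simp add: in_keys_iff)
   qed
   then show "nu \<in> {1..n} \<rightarrow>\<^sub>E keys \<beta>" using nu by (auto simp: theta_seqs_def)
  qed
 qed simp_all
 fix nu k assume nu: "nu \<in> theta_seqs \<theta> J n \<beta>" and k: "k < n"
 have c: "seq_swap \<theta> k nu \<in> {1..n} \<rightarrow>\<^sub>E J"
  using nu k J by (auto simp: theta_seqs_def seq_swap_def PiE_iff extensional_def)
 have "(\<Sum>l\<in>{1..n}. ?s (seq_swap \<theta> k nu) l) = (\<Sum>l\<in>{1..n}. ?s nu l)"
 proof (cases "k = 0")
  case True
  then show ?thesis by (intro sum.cong refl) (simp add: seq_swap_def \<theta>\<theta> add.commute)
 next
  case False
  show ?thesis by (rule sum.reindex_bij_witness[where i = "transpose k (k + 1)" and j = "transpose k (k + 1)"])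
    (use False k in \<open>auto simp: seq_swap_def transpose_def\<close>)
 qed
 with nu c show "seq_swap \<theta> k nu \<in> theta_seqs \<theta> J n \<beta>" by (simp add: theta_seqs_def)
qed (rule \<theta>\<theta>)

lemma vertices_nz: "q ~= 0 ==> \<xi> ~= 0 ==> i \<in> vertices q \<xi> ==> i ~= 0" by (auto simp: vertices_def)

lemma vertices_inverse:
 assumes "i \<in> vertices q \<xi>"
 shows "inverse i \<in> vertices q \<xi>"
proof -
 obtain k where "i = \<xi> * q powi (2 * k) \<or> i = inverse \<xi> * q powi (2 * k)" using assms by (auto simp: vertices_def)
 moreover have "inverse (q powi (2 * k)) = q powi (2 * (- k))" by (simp add: power_int_minus)
 ultimately have "inverse i = inverse \<xi> * q powi (2 * (- k)) \<or> inverse i = \<xi> * q powi (2 * (- k))" by auto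
 then show ?thesis unfolding vertices_def by blast
qed

lemma arrows_inverse:
 assumes "q ~= 0"
 shows "arrows q (inverse j) (inverse i) = arrows q i j"
proof -
 have "inverse i = q ^ 2 * inverse j \<longleftrightarrow> j = q ^ 2 * i"
  using assms by (cases "i = 0"; cases "j = 0") (auto simp: field_simps)
 then show ?thesis by (simp add: arrows_def)
qed

lemma mult_order_ge_3:
 assumes "3 \<le> mult_order q"
 shows "q ^ 2 ~= 1"
proof
 assume q: "q ^ 2 = 1"
 then have "\<exists>m>0. q ^ m = 1" by (intro exI[of _ 2]) simp
 moreover have "(LEAST m. 0 < m \<and> q ^ m = 1) \<le> 2" by (rule Least_le) (simp add: q)
 ultimately show False using assms by (simp add: mult_order_def)
qed

text \<open>The image of the complex number 1/2 inverts 2. If \<open>q\<close> were 0, then for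
  infinite order the map \<open>h\<close> would not be injective, and a finite order is excluded
  since positive powers of 0 are 0.\<close>

lemma ground_field_props:
 assumes "ground_field (q :: 'k::field)"
 shows "q ~= 0" "(2 :: 'k) ~= 0"
proof -
 from assms obtain h :: "complex poly => 'k" where h: "h 1 = 1" "!!a b. h (a + b) = h a + h b" "!!a b. h (a * b) = h a * h b"
  "h [:0, 1:] = q" "mult_order q = \<infinity> ==> inj h" unfolding ground_field_def by (metis (full_types))
 have h0: "h 0 = 0" using h(2)[of 0 0] by (simp only: add_0_left add_cancel_right_right)
 have "1 = h ([:1/2:] * (1 + 1))" using h(1) by (simp add: one_pCons)
 also have "... = h [:1/2:] * 2" unfolding h(2,3) h(1) by simp
 finally show "(2 :: 'k) ~= 0" by auto
 show "q ~= 0"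
 proof
  assume q: "q = 0"
  show False
  proof (cases "mult_order q = \<infinity>")
   case True
   from h(5)[OF this] have "[:0, 1:] = (0 :: complex poly)" using h(4) h0 q by (metis injD)
   then show False by simp
  next
   case False
   then show False using q by (auto simp: mult_order_def power_0_left split: if_splits)
  qed
 qed
qed

theorem theorem8p2p1:
  fixes q p0 p1 \<xi> :: "'k::field" and \<beta> :: "'k \<Rightarrow>\<^sub>0 nat" and n :: nat
  assumes "ground_field q" and "3 \<le> mult_order q"
    and "p0 \<noteq> 0" and "p1 \<noteq> 0" and "\<xi> \<noteq> 0"
    and "p0 \<noteq> 1" and "p0 \<noteq> - 1" and "p1 \<noteq> 1" and "p1 \<noteq> - 1"
    and "Poly_Mapping.keys \<beta> \<subseteq> vertices q \<xi>"
    and "\<And>i. Poly_Mapping.lookup \<beta> (inverse i) = Poly_Mapping.lookup \<beta> i"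
    and "\<And>i. i \<in> vertices q \<xi> \<Longrightarrow> inverse i = i \<Longrightarrow> even (Poly_Mapping.lookup \<beta> i)"
    and "theta_norm \<beta> = n"
  shows
    "let V = theta_seqs inverse (vertices q \<xi>) n \<beta>;
         M = coef_ring V (pseries n);
         R = klr_hat inverse (arrows q) (framing p0 p1) n V;
         r = klr_elt inverse (arrows q) (framing p0 p1) n V;
         H = hecke_hat (pseries n) q p0 p1 n V;
         h = hecke_elt (pseries n) q p0 p1 n V;
         K = hecke_hat (pfrac n) q p0 p1 n V;
         f = hecke_fun q p0 p1 n V;
         e = (\<lambda>\<nu>. f (at_idem \<nu> 1));
         \<Phi> = hecke_Phi q p0 p1 n V
     in \<exists>\<phi>.
          alg_iso (\<lambda>c. vec V (\<lambda>_. fconst c)) M (\<lambda>c. vec V (\<lambda>_. fconst c)) M \<phi> \<and>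
          (\<forall>\<nu> \<in> V. \<phi> (at_idem \<nu> 1) = at_idem \<nu> 1) \<and>
          (\<forall>\<nu> \<in> V. \<forall>k \<in> {1..n}.
             \<phi> (at_idem \<nu> (fvar k)) =
             at_idem \<nu> (fconst (\<nu> k) / hXat \<nu> k - hXat \<nu> k / fconst (\<nu> k))) \<and>
          (\<exists>\<Psi>.
             alg_iso (\<lambda>c. r (scal c) \<one>\<^bsub>M\<^esub>) R (\<lambda>c. h (scal c) \<one>\<^bsub>M\<^esub>) H \<Psi> \<and>
             (\<forall>g \<in> carrier M. \<Psi> (r 1 g) = h 1 (\<phi> g)) \<and>
             (\<forall>\<nu> \<in> V. \<forall>k. 1 \<le> k \<and> k < n \<longrightarrow>
                hecke_incl q p0 p1 n V (\<Psi> (r (ke \<nu> * kt k) \<one>\<^bsub>M\<^esub>)) =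
                e \<nu> \<otimes>\<^bsub>K\<^esub>
                (if \<nu> k = \<nu> (k + 1) then
                   f (\<lambda>\<mu>. inverse (hXat \<mu> k / fconst (\<nu> (k + 1)) + fconst (\<nu> k) / hXat \<mu> (k + 1)) *
                          inverse (hXat \<mu> (k + 1) / hXat \<mu> k - 1))
                   \<otimes>\<^bsub>K\<^esub> (\<Phi> k \<ominus>\<^bsub>K\<^esub> \<one>\<^bsub>K\<^esub>)
                 else if \<nu> (k + 1) = q ^ 2 * \<nu> k then
                   f (\<lambda>\<mu>. (hXat \<mu> k / fconst (\<nu> (k + 1)) + fconst (\<nu> k) / hXat \<mu> (k + 1)) *
                          (hXat \<mu> (k + 1) / hXat \<mu> k - fconst (\<nu> (k + 1)) / fconst (\<nu> k)))
                   \<otimes>\<^bsub>K\<^esub> \<Phi> k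
                 else \<Phi> k)) \<and>
             (0 < n \<longrightarrow> (\<forall>\<nu> \<in> V.
                hecke_incl q p0 p1 n V (\<Psi> (r (ke \<nu> * kt 0) \<one>\<^bsub>M\<^esub>)) =
                e \<nu> \<otimes>\<^bsub>K\<^esub>
                (if \<nu> 1 = inverse (\<nu> 1) then
                   f (\<lambda>\<mu>. fconst (\<nu> 1) * inverse (inverse (hXat \<mu> 1) - hXat \<mu> 1))
                   \<otimes>\<^bsub>K\<^esub> (\<Phi> 0 \<ominus>\<^bsub>K\<^esub> \<one>\<^bsub>K\<^esub>)
                 else
                   f (\<lambda>\<mu>. (fconst (\<nu> 1) / hXat \<mu> 1 - hXat \<mu> 1 / fconst (\<nu> 1)) ^ framing p0 p1 (\<nu> 1))
                   \<otimes>\<^bsub>K\<^esub> \<Phi> 0))))"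
proof -
 have q: "q ~= 0" "(2 :: 'k) ~= 0" using ground_field_props[OF assms(1)] .
 interpret seq_system inverse n "theta_seqs inverse (vertices q \<xi>) n \<beta>"
  by (intro theta_seqs_system inverse_inverse_eq vertices_inverse)
 \<comment> \<open>\<open>q ^ 2\<close> differs from 1 by the bound on the order; labels are nonzero
   because they are vertices, and inversion reverses arrows.\<close>
 interpret hecke_klr n "theta_seqs inverse (vertices q \<xi>) n \<beta>" q p0 p1
  using q mult_order_ge_3[OF assms(2)] assms(3,4,6-9) vertices_nz[OF q(1) assms(5)]
  by unfold_locales (auto simp: arrows_inverse theta_seqs_def PiE_iff)
 show ?thesis unfolding Let_def hat_simps(1-6,8) by (intro exI[of _ phi] exI[of _ X.transfer] conjI ballI allI impI)
   (rule phi_iso | rule completion_iso | (rule phi_at(1) X.transfer_elt, assumption) | (rule phi_at(2), assumption, assumption) |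
    (erule conjE, rule transfer_tau, assumption, assumption, assumption) | (rule transfer_tau_0, assumption, assumption))+
qed

end
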